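(* Let $\mathcal{Z}=\{\boldsymbol\zeta_1,\dots,\boldsymbol\zeta_p\}\subseteq\boldsymbol\theta(\Omega)$ be a set of $p$ distinct points and let $w_1,\dots,w_p\in\mathbb{D}$. Define scalars $c_1,\dots,c_p$ by $$\begin{bmatrix} c_1 \\ \vdots \\ c_p \end{bmatrix}=\begin{bmatrix}\mathbb{S}_{\boldsymbol\theta(\Omega)}(\boldsymbol\zeta_i,\boldsymbol\zeta_j)\end{bmatrix}_{p\times p}^{-1}\begin{bmatrix} w_1 \\ \vdots \\ w_p \end{bmatrix},$$ and set $\psi_{\mathcal{Z},\mathcal{W}}=\sum_{i=1}^pc_i\,\mathbb{S}_{\boldsymbol\theta(\Omega)}(\cdot,\boldsymbol\zeta_i)$, $\mathcal{Q}_{\mathcal{Z}}=\mathrm{span}\{\mathbb{S}_{\boldsymbol\theta(\Omega)}(\cdot,\boldsymbol\zeta_i):i=1,\dots,p\}$, and $\mathcal{M}_{\mathcal{Q}_{\mathcal{Z}}}=\mathcal{Q}_{\mathcal{Z}}^{conj}\dotplus\mathcal{M}_{\boldsymbol\theta(\Omega)}\dotplus H^2_0(\partial\boldsymbol\theta(\Omega))$. Then there exists $\varphi\in\mathcal{S}(\boldsymbol\theta(\Omega))$ satisfying $\varphi(\boldsymbol\zeta_i)=w_i$ for all $i=1,\dots,p$ if and only if the functional $$X_{\mathcal{Q}_{\mathcal{Z}}}:\left(\mathcal{M}_{\mathcal{Q}_{\mathcal{Z}}},\|\cdot\|_{L^1(\partial\boldsymbol\theta(\Omega))}\right)\to\mathbb{C},\qquad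 X_{\mathcal{Q}_{\mathcal{Z}}}f=\int_{\partial\boldsymbol\theta(\Omega)}\psi_{\mathcal{Z},\mathcal{W}}f\,d\mu_{\boldsymbol\theta},\quad f\in\mathcal{M}_{\mathcal{Q}_{\mathcal{Z}}},$$ is contractive, i.e. $|X_{\mathcal{Q}_{\mathcal{Z}}}f|\le\|f\|_{L^1(\partial\boldsymbol\theta(\Omega))}$ for all $f\in\mathcal{M}_{\mathcal{Q}_{\mathcal{Z}}}$.
   Context: **Domains.** $\Omega\subseteq\mathbb{C}^d$ is a bounded symmetric domain in its standard realization (circled, convex, containing $0$). $G$ is a finite complex reflection group, i.e. a finite group of linear maps of $\mathbb{C}^d$ generated by complex reflections (finite order linear maps $\sigma$ with $\operatorname{rank}(I_d-\sigma)=1$), and $\Omega$ is $G$-invariant. The ring of $G$-invariant polynomials is generated by $d$ algebraically independent homogeneous polynomials; fix such $\theta_1,\dots,\theta_d$ with $k_j=\deg\theta_j$ and put $\boldsymbol\theta=(\theta_1,\dots,\theta_d):\Omega\to\boldsymbol\theta(\Omega)$, a proper holomorphic map onto the bounded domain $\boldsymbol\theta(\Omega)$. $J_{\boldsymbol\theta}$ is its complex Jacobian determinant. Shilov boundaries are denoted $\partial\Omega$ and $\partial\boldsymbol\theta(\Omega)$; one has $\partial\boldsymbol\theta(\Omega)=\boldsymbol\theta(\partial\Omega)$. $\mathbb{D}$ is the open unit disc. **Hardy spaces.** $\mu$ is the normalized measure on $\partial\Omega$ invariant under $\mathbb{K}=\{\phi\in\mathrm{Aut}(\Omega):\phi(0)=0\}$.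 $H^2(\Omega)$ is the space of holomorphic $f$ on $\Omega$ with $\|f\|^2_{H^2(\Omega)}=\sup_{0<r<1}\int_{\partial\Omega}|f(rz)|^2d\mu(z)<\infty$. Each $f\in H^2(\Omega)$ has a radial boundary value $f^*(z)=\lim_{r\to1^-}f(rz)$ ($\mu$-a.e.), $f^*\in L^2(\partial\Omega)$; $H^2(\partial\Omega)=\{f^*:f\in H^2(\Omega)\}$. Let $c_{\boldsymbol\theta}=\|J_{\boldsymbol\theta}\|_{H^2(\Omega)}$. $H^2(\boldsymbol\theta(\Omega))$ is the Hilbert space of holomorphic $f$ on $\boldsymbol\theta(\Omega)$ with $J_{\boldsymbol\theta}(f\circ\boldsymbol\theta)\in H^2(\Omega)$, with norm $\|f\|=c_{\boldsymbol\theta}^{-1}\|J_{\boldsymbol\theta}(f\circ\boldsymbol\theta)\|_{H^2(\Omega)}$. It is a reproducing kernel Hilbert space; $\mathbb{S}_{\boldsymbol\theta(\Omega)}$ denotes its reproducing kernel: $\langle f,\mathbb{S}_{\boldsymbol\theta(\Omega)}(\cdot,\boldsymbol\zeta)\rangle=f(\boldsymbol\zeta)$. $\mu_{\boldsymbol\theta}$ is the probability measure on $\partial\boldsymbol\theta(\Omega)$ given by $\int f\,d\mu_{\boldsymbol\theta}=c_{\boldsymbol\theta}^{-2}\int_{\partial\Omega}(f\circ\boldsymbol\theta)|J_{\boldsymbol\theta}|^2d\mu$, and $L^p(\partial\boldsymbol\theta(\Omega))=L^p(\mu_{\boldsymbol\theta})$. $H^2(\partial\boldsymbol\theta(\Omega))=\{f\in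 L^2(\partial\boldsymbol\theta(\Omega)):J_{\boldsymbol\theta}(f\circ\boldsymbol\theta)\in H^2(\partial\Omega)\}$, a closed subspace. The boundary map $f\mapsto\tilde f^*$, $\tilde f^*(\boldsymbol\zeta)=\lim_{r\to1^-}f(r^{k_1}\zeta_1,\dots,r^{k_d}\zeta_d)$ ($\mu_{\boldsymbol\theta}$-a.e.), is an isometry of $H^2(\boldsymbol\theta(\Omega))$ onto $H^2(\partial\boldsymbol\theta(\Omega))$, and functions are identified with their boundary values. $\mathcal{S}(\boldsymbol\theta(\Omega))$ is the set of holomorphic functions on $\boldsymbol\theta(\Omega)$ bounded by $1$ in modulus (closed unit ball of $H^\infty(\boldsymbol\theta(\Omega))$). **Subspaces.** For $\mathcal{E}\subseteq L^2(\partial\boldsymbol\theta(\Omega))$ put $\mathcal{E}^{conj}=\{\bar f:f\in\mathcal{E}\}$. $H^2_0(\partial\boldsymbol\theta(\Omega))=\{f\in H^2(\partial\boldsymbol\theta(\Omega)):\langle f,1\rangle=0\}$; $\mathcal{M}_{\boldsymbol\theta(\Omega)}=L^2(\partial\boldsymbol\theta(\Omega))\ominus\big(H^2(\partial\boldsymbol\theta(\Omega))+H^2(\partial\boldsymbol\theta(\Omega))^{conj}\big)$; $\dotplus$ is the algebraic direct sum, taken inside $L^1(\partial\boldsymbol\theta(\Omega))$. *)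

theory Defs
  imports "HOL-Probability.Probability_Measure" "HOL-Algebra.Generated_Groups"
begin

section \<open>Holomorphic functions of several variables\<close>

text \<open>As for \<^const>\<open>holomorphic_on\<close>, only the values on \<open>U\<close> matter; on an open \<open>U\<close> this is
  complex (Frechet) differentiability at every point.\<close>

definition holo :: "(complex^'n \<Rightarrow> complex) \<Rightarrow> (complex^'n) set \<Rightarrow> bool" where
  "holo f U \<longleftrightarrow> (\<forall>z\<in>U. \<exists>f'. (f has_derivative f') (at z within U) \<and>
                           (\<forall>c v. f' (c *s v) = c * f' v))"

definition holo_map :: "(complex^'n \<Rightarrow> complex^'m) \<Rightarrow> (complex^'n) set \<Rightarrow> bool" where
  "holo_map \<phi> U \<longleftrightarrow> (\<forall>i. holo (\<lambda>z. \<phi> z $ i) U)"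

definition automorphism :: "(complex^'n) set \<Rightarrow> (complex^'n \<Rightarrow> complex^'n) \<Rightarrow> bool" where
  "automorphism \<Omega> \<phi> \<longleftrightarrow> bij_betw \<phi> \<Omega> \<Omega> \<and> holo_map \<phi> \<Omega> \<and> holo_map (inv_into \<Omega> \<phi>) \<Omega>"

definition complex_jacobian :: "(complex^'n \<Rightarrow> complex^'n) \<Rightarrow> complex^'n \<Rightarrow> complex" where
  "complex_jacobian \<theta> z = det (matrix (frechet_derivative \<theta> (at z)) :: complex^'n^'n)"


section \<open>Bounded symmetric domains and Shilov boundaries\<close>

definition bounded_symmetric_domain :: "(complex^'n) set \<Rightarrow> bool" where
  "bounded_symmetric_domain \<Omega> \<longleftrightarrow> open \<Omega> \<and> connected \<Omega> \<and> bounded \<Omega> \<and> \<Omega> \<noteq> {} \<and>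
     (\<forall>a\<in>\<Omega>. \<exists>s. automorphism \<Omega> s \<and> (\<forall>z\<in>\<Omega>. s (s z) = z) \<and> s a = a \<and>
               (\<exists>e>0. \<forall>z\<in>\<Omega> \<inter> ball a e. s z = z \<longrightarrow> z = a))"

definition standard_realization :: "(complex^'n) set \<Rightarrow> bool" where
  "standard_realization \<Omega> \<longleftrightarrow> 0 \<in> \<Omega> \<and> convex \<Omega> \<and>
     (\<forall>c z. norm c = 1 \<longrightarrow> z \<in> \<Omega> \<longrightarrow> c *s z \<in> \<Omega>)"

definition disc_algebra :: "(complex^'n) set \<Rightarrow> (complex^'n \<Rightarrow> complex) set" where
  "disc_algebra U = {f. continuous_on (closure U) f \<and> holo f U}"

text \<open>The smallest closed set on which every element of the algebra attains its maximum modulus.\<close>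

definition shilov_boundary :: "(complex^'n) set \<Rightarrow> (complex^'n) set" where
  "shilov_boundary U = \<Inter>{K. closed K \<and> K \<subseteq> closure U \<and>
     (\<forall>f\<in>disc_algebra U. \<forall>z\<in>closure U. \<exists>w\<in>K. norm (f z) \<le> norm (f w))}"


section \<open>Complex reflection groups and basic invariants\<close>

text \<open>Matrix powers are iterates of \<open>(**)\<close>: the power operation on \<^typ>\<open>complex^'n^'n\<close> is not the matrix
  power.\<close>

definition complex_reflection :: "complex^'n^'n \<Rightarrow> bool" where
  "complex_reflection \<sigma> \<longleftrightarrow>
     (\<exists>m>0. (((**) \<sigma>) ^^ m) (mat 1) = mat 1) \<and> rank (mat 1 - \<sigma>) = 1"

definition GL :: "(complex^'n^'n) monoid" where
  "GL = \<lparr>carrier = {A. invertible A}, monoid.mult = (**), one = mat 1\<rparr>"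

definition finite_reflection_group :: "(complex^'n^'n) set \<Rightarrow> bool" where
  "finite_reflection_group G \<longleftrightarrow>
     finite G \<and> (\<exists>R. (\<forall>\<sigma>\<in>R. complex_reflection \<sigma>) \<and> G = generate GL R)"

text \<open>Polynomials in \<open>d = CARD('n)\<close> variables, identified with the polynomial functions on
  \<^typ>\<open>complex^'n\<close>; \<open>\<alpha>\<close> ranges over multi-indices.\<close>

definition monomial_sum :: "('n \<Rightarrow> nat) set \<Rightarrow> (('n \<Rightarrow> nat) \<Rightarrow> complex) \<Rightarrow> complex^'n \<Rightarrow> complex" where
  "monomial_sum A a z = (\<Sum>\<alpha>\<in>A. a \<alpha> * (\<Prod>i\<in>UNIV. (z $ i) ^ \<alpha> i))"

definition polynomial_fun :: "(complex^'n \<Rightarrow> complex) \<Rightarrow> bool" where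
  "polynomial_fun p \<longleftrightarrow> (\<exists>A a. finite A \<and> p = monomial_sum A a)"

definition homogeneous_polynomial :: "nat \<Rightarrow> (complex^'n \<Rightarrow> complex) \<Rightarrow> bool" where
  "homogeneous_polynomial k p \<longleftrightarrow>
     (\<exists>A a. finite A \<and> (\<forall>\<alpha>\<in>A. (\<Sum>i\<in>UNIV. \<alpha> i) = k) \<and> p = monomial_sum A a)"

definition invariant_polynomials :: "(complex^'n^'n) set \<Rightarrow> (complex^'n \<Rightarrow> complex) set" where
  "invariant_polynomials G = {p. polynomial_fun p \<and> (\<forall>g\<in>G. \<forall>z. p (g *v z) = p z)}"

definition basic_invariants ::
    "(complex^'n^'n) set \<Rightarrow> (complex^'n \<Rightarrow> complex^'n) \<Rightarrow> ('n \<Rightarrow> nat) \<Rightarrow> bool" where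
  "basic_invariants G \<theta> k \<longleftrightarrow>
     (\<forall>j. homogeneous_polynomial (k j) (\<lambda>z. \<theta> z $ j)) \<and>
     (\<forall>p. polynomial_fun p \<longrightarrow> (\<forall>z. p (\<theta> z) = 0) \<longrightarrow> p = (\<lambda>_. 0)) \<and>
     invariant_polynomials G = {\<lambda>z. p (\<theta> z) | p. polynomial_fun p}"


section \<open>Hardy spaces\<close>

text \<open>The normalized measure on the Shilov boundary invariant under the automorphisms fixing \<open>0\<close>.
  Such automorphisms act on the Shilov boundary through their continuous extension to the closure.\<close>

definition invariant_boundary_measure :: "(complex^'n) set \<Rightarrow> (complex^'n) measure \<Rightarrow> bool" where
  "invariant_boundary_measure \<Omega> \<mu> \<longleftrightarrow> prob_space \<mu> \<and>
     sets \<mu> = sets (restrict_space borel (shilov_boundary \<Omega>)) \<and>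
     (\<forall>\<phi>. automorphism \<Omega> \<phi> \<longrightarrow> \<phi> 0 = 0 \<longrightarrow> continuous_on (closure \<Omega>) \<phi> \<longrightarrow>
        (\<forall>A\<in>sets \<mu>. emeasure \<mu> (\<phi> -` A \<inter> shilov_boundary \<Omega>) = emeasure \<mu> A))"

definition hardy_sup :: "(complex^'n) measure \<Rightarrow> (complex^'n \<Rightarrow> complex) \<Rightarrow> ennreal" where
  "hardy_sup \<mu> f = (SUP r\<in>{0<..<1::real}. \<integral>\<^sup>+ z. ennreal ((norm (f (r *\<^sub>R z)))\<^sup>2) \<partial>\<mu>)"

definition H2 :: "(complex^'n) set \<Rightarrow> (complex^'n) measure \<Rightarrow> (complex^'n \<Rightarrow> complex) set" where
  "H2 \<Omega> \<mu> = {f. holo f \<Omega> \<and> hardy_sup \<mu> f < \<infinity>}"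

definition H2_norm :: "(complex^'n) measure \<Rightarrow> (complex^'n \<Rightarrow> complex) \<Rightarrow> real" where
  "H2_norm \<mu> f = sqrt (enn2real (hardy_sup \<mu> f))"

text \<open>Boundary functions are handled through representatives: membership below is invariant under
  changes on null sets.\<close>

definition H2_boundary ::
    "(complex^'n) set \<Rightarrow> (complex^'n) measure \<Rightarrow> (complex^'n \<Rightarrow> complex) set" where
  "H2_boundary \<Omega> \<mu> =
     {g. \<exists>f\<in>H2 \<Omega> \<mu>. AE z in \<mu>. ((\<lambda>r::real. f (r *\<^sub>R z)) \<longlongrightarrow> g z) (at_left 1)}"

definition lift_J :: "(complex^'n \<Rightarrow> complex^'n) \<Rightarrow> (complex^'n \<Rightarrow> complex) \<Rightarrow> complex^'n \<Rightarrow> complex" where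
  "lift_J \<theta> f = (\<lambda>z. complex_jacobian \<theta> z * f (\<theta> z))"

definition c_theta :: "(complex^'n \<Rightarrow> complex^'n) \<Rightarrow> (complex^'n) measure \<Rightarrow> real" where
  "c_theta \<theta> \<mu> = H2_norm \<mu> (complex_jacobian \<theta>)"

definition H2_theta ::
    "(complex^'n) set \<Rightarrow> (complex^'n \<Rightarrow> complex^'n) \<Rightarrow> (complex^'n) measure \<Rightarrow> (complex^'n \<Rightarrow> complex) set" where
  "H2_theta \<Omega> \<theta> \<mu> = {f. holo f (\<theta> ` \<Omega>) \<and> lift_J \<theta> f \<in> H2 \<Omega> \<mu>}"

definition H2_theta_norm ::
    "(complex^'n \<Rightarrow> complex^'n) \<Rightarrow> (complex^'n) measure \<Rightarrow> (complex^'n \<Rightarrow> complex) \<Rightarrow> real" where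
  "H2_theta_norm \<theta> \<mu> f = H2_norm \<mu> (lift_J \<theta> f) / c_theta \<theta> \<mu>"

text \<open>The inner product, linear in the first argument, that induces the norm (polarization).\<close>

definition H2_theta_inner ::
    "(complex^'n \<Rightarrow> complex^'n) \<Rightarrow> (complex^'n) measure \<Rightarrow>
     (complex^'n \<Rightarrow> complex) \<Rightarrow> (complex^'n \<Rightarrow> complex) \<Rightarrow> complex" where
  "H2_theta_inner \<theta> \<mu> f g =
     (\<Sum>m<4. \<i> ^ m * of_real ((H2_theta_norm \<theta> \<mu> (\<lambda>z. f z + \<i> ^ m * g z))\<^sup>2)) / 4"

definition reproducing_kernel ::
    "'a set \<Rightarrow> ('a \<Rightarrow> complex) set \<Rightarrow> (('a \<Rightarrow> complex) \<Rightarrow> ('a \<Rightarrow> complex) \<Rightarrow> complex) \<Rightarrow>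
     ('a \<Rightarrow> 'a \<Rightarrow> complex) \<Rightarrow> bool" where
  "reproducing_kernel X H ip S \<longleftrightarrow>
     (\<forall>w\<in>X. (\<lambda>z. S z w) \<in> H \<and> (\<forall>f\<in>H. ip f (\<lambda>z. S z w) = f w))"

text \<open>The defining change of variables is imposed on nonnegative Borel functions, which determines
  the measure and yields the formula for all integrable functions.\<close>

definition theta_boundary_measure ::
    "(complex^'n) set \<Rightarrow> (complex^'n \<Rightarrow> complex^'n) \<Rightarrow> (complex^'n) measure \<Rightarrow> (complex^'n) measure \<Rightarrow> bool" where
  "theta_boundary_measure \<Omega> \<theta> \<mu> \<mu>\<theta> \<longleftrightarrow> prob_space \<mu>\<theta> \<and>
     sets \<mu>\<theta> = sets (restrict_space borel (shilov_boundary (\<theta> ` \<Omega>))) \<and>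
     (\<forall>f :: complex^'n \<Rightarrow> ennreal. f \<in> borel_measurable borel \<longrightarrow>
        (\<integral>\<^sup>+ \<zeta>. f \<zeta> \<partial>\<mu>\<theta>) =
        (\<integral>\<^sup>+ z. f (\<theta> z) * ennreal ((norm (complex_jacobian \<theta> z))\<^sup>2) \<partial>\<mu>) / ennreal ((c_theta \<theta> \<mu>)\<^sup>2))"

definition L2 :: "'a measure \<Rightarrow> ('a \<Rightarrow> complex) set" where
  "L2 M = {f \<in> borel_measurable M. integrable M (\<lambda>x. (norm (f x))\<^sup>2)}"

definition L2_inner :: "'a measure \<Rightarrow> ('a \<Rightarrow> complex) \<Rightarrow> ('a \<Rightarrow> complex) \<Rightarrow> complex" where
  "L2_inner M f g = (\<integral>x. f x * cnj (g x) \<partial>M)"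

definition L1_norm :: "'a measure \<Rightarrow> ('a \<Rightarrow> complex) \<Rightarrow> real" where
  "L1_norm M f = (\<integral>x. norm (f x) \<partial>M)"

definition H2_theta_boundary ::
    "(complex^'n) set \<Rightarrow> (complex^'n \<Rightarrow> complex^'n) \<Rightarrow> (complex^'n) measure \<Rightarrow> (complex^'n) measure \<Rightarrow>
     (complex^'n \<Rightarrow> complex) set" where
  "H2_theta_boundary \<Omega> \<theta> \<mu> \<mu>\<theta> = {f \<in> L2 \<mu>\<theta>. lift_J \<theta> f \<in> H2_boundary \<Omega> \<mu>}"

definition weighted_dilation :: "('n \<Rightarrow> nat) \<Rightarrow> real \<Rightarrow> complex^'n \<Rightarrow> complex^'n" where
  "weighted_dilation k r \<zeta> = (\<chi> j. of_real (r ^ k j) * \<zeta> $ j)"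

text \<open>\<^const>\<open>Lim\<close> has an unspecified value where the limit does not exist; this only concerns
  a null set.\<close>

definition boundary_value ::
    "('n \<Rightarrow> nat) \<Rightarrow> (complex^'n \<Rightarrow> complex) \<Rightarrow> complex^'n \<Rightarrow> complex" where
  "boundary_value k f \<zeta> = Lim (at_left 1) (\<lambda>r. f (weighted_dilation k r \<zeta>))"

text \<open>The representatives of the boundary functions of the members of a set of functions on the
  image domain.\<close>

definition boundary_functions ::
    "('n \<Rightarrow> nat) \<Rightarrow> (complex^'n) measure \<Rightarrow> (complex^'n \<Rightarrow> complex) set \<Rightarrow> (complex^'n \<Rightarrow> complex) set" where
  "boundary_functions k \<mu>\<theta> Q = {g \<in> L2 \<mu>\<theta>. \<exists>q\<in>Q. AE \<zeta> in \<mu>\<theta>.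
     ((\<lambda>r. q (weighted_dilation k r \<zeta>)) \<longlongrightarrow> g \<zeta>) (at_left 1)}"

definition schur_class :: "(complex^'n) set \<Rightarrow> (complex^'n \<Rightarrow> complex) set" where
  "schur_class U = {f. holo f U \<and> (\<forall>z\<in>U. norm (f z) \<le> 1)}"


section \<open>The subspaces\<close>

definition conj_set :: "('a \<Rightarrow> complex) set \<Rightarrow> ('a \<Rightarrow> complex) set" where
  "conj_set E = {\<lambda>x. cnj (f x) | f. f \<in> E}"

definition H2_theta_boundary_0 ::
    "(complex^'n) set \<Rightarrow> (complex^'n \<Rightarrow> complex^'n) \<Rightarrow> (complex^'n) measure \<Rightarrow> (complex^'n) measure \<Rightarrow>
     (complex^'n \<Rightarrow> complex) set" where
  "H2_theta_boundary_0 \<Omega> \<theta> \<mu> \<mu>\<theta> =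
     {f \<in> H2_theta_boundary \<Omega> \<theta> \<mu> \<mu>\<theta>. L2_inner \<mu>\<theta> f (\<lambda>_. 1) = 0}"

definition M_theta ::
    "(complex^'n) set \<Rightarrow> (complex^'n \<Rightarrow> complex^'n) \<Rightarrow> (complex^'n) measure \<Rightarrow> (complex^'n) measure \<Rightarrow>
     (complex^'n \<Rightarrow> complex) set" where
  "M_theta \<Omega> \<theta> \<mu> \<mu>\<theta> = {m \<in> L2 \<mu>\<theta>.
     \<forall>f\<in>H2_theta_boundary \<Omega> \<theta> \<mu> \<mu>\<theta>. \<forall>g\<in>conj_set (H2_theta_boundary \<Omega> \<theta> \<mu> \<mu>\<theta>).
       L2_inner \<mu>\<theta> m (\<lambda>x. f x + g x) = 0}"

definition kernel_span :: "('a \<Rightarrow> 'a \<Rightarrow> complex) \<Rightarrow> ('p::finite \<Rightarrow> 'a) \<Rightarrow> ('a \<Rightarrow> complex) set" where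
  "kernel_span S \<zeta> = {\<lambda>z. \<Sum>i\<in>UNIV. a i * S z (\<zeta> i) | a. True}"

text \<open>The three summands are pairwise orthogonal in \<open>L\<^sup>2\<close>, so the sum is direct (modulo null
  functions); as a set, the direct sum is the set of all sums.\<close>

definition M_Q ::
    "(complex^'n) set \<Rightarrow> (complex^'n \<Rightarrow> complex^'n) \<Rightarrow> ('n \<Rightarrow> nat) \<Rightarrow>
     (complex^'n) measure \<Rightarrow> (complex^'n) measure \<Rightarrow> (complex^'n \<Rightarrow> complex) set \<Rightarrow>
     (complex^'n \<Rightarrow> complex) set" where
  "M_Q \<Omega> \<theta> k \<mu> \<mu>\<theta> Q = {\<lambda>x. q x + m x + h x | q m h.
     q \<in> conj_set (boundary_functions k \<mu>\<theta> Q) \<and> m \<in> M_theta \<Omega> \<theta> \<mu> \<mu>\<theta> \<and>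
     h \<in> H2_theta_boundary_0 \<Omega> \<theta> \<mu> \<mu>\<theta>}"

definition X_functional ::
    "('n \<Rightarrow> nat) \<Rightarrow> (complex^'n) measure \<Rightarrow> (complex^'n \<Rightarrow> complex) \<Rightarrow> (complex^'n \<Rightarrow> complex) \<Rightarrow> complex" where
  "X_functional k \<mu>\<theta> \<psi> f = (\<integral>\<zeta>. boundary_value k \<psi> \<zeta> * f \<zeta> \<partial>\<mu>\<theta>)"

end

theory Submission
  imports Defs "HOL-Complex_Analysis.Complex_Analysis" "HOL-Computational_Algebra.Fundamental_Theorem_Algebra"
begin

text \<open>
  Polynomials are dense in the boundary Hardy space: a lift \<open>J (f \<circ> \<theta>)\<close> is approximated by polynomials, which after
  averaging over the group are relative invariants and hence divisible by \<open>J\<close>. So boundary Hardy functions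
  integrate multiplicatively, and the kernel functions, which extend continuously to the closure because dilations
  are self-adjoint, evaluate \<open>L\<^sup>2\<close> limits of polynomials.

  If \<open>\<phi>\<close> interpolates, then on the three summands \<open>\<psi>\<close> acts by integration like a polynomial of sup norm at most
  \<open>1 + e\<close> that is close to \<open>\<phi>\<close> at the nodes, and \<open>e\<close> tends to \<open>0\<close>. Conversely, a contractive functional is
  integration against some \<open>\<phi>\<close> with \<open>\<bar>\<phi>\<bar> \<le> 1\<close> almost everywhere. Annihilation of \<open>M_theta\<close> and of the polynomials
  vanishing at \<open>0\<close> makes \<open>\<phi>\<close> an \<open>L\<^sup>2\<close> limit of polynomials. Point evaluations are multiplicative on the powers
  of \<open>\<phi>\<close>, so its values at interior points are bounded by \<open>1\<close>; they form a holomorphic function, the sum of the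
  limits of the homogeneous parts.
\<close>

text \<open>The map \<theta> branches where \<open>J\<close> vanishes, and this shapes the proof.
  Divisibility by \<open>J\<close> has to hold with multiplicity, so it is tested on lines in a
  direction \<open>v\<close> with \<open>J v \<noteq> 0\<close>: averaging over the group a map that
  is invariant under the stabiliser of a point compares the order of \<open>J\<close> at that point
  with the order of a relative invariant. Holomorphy on the image cannot be read off from local
  inverses of \<theta> either. Instead homogeneous parts are shown to be invariant polynomials,
  hence polynomials in \<theta>, and their series is summed on the image, where openness of \<theta>
  supplies the neighbourhoods. The other obstacle is that boundary functions are mere L2 classes.
  Polynomials stand in for them: their mean value property makes integration multiplicative, and
  kernel functions, being continuous up to the boundary, can be paired with any L2 limit. In one
  direction a combination of kernels may be exchanged for an interpolant because the pairing sees
  only the values at the nodes; in the other, testing on the conjugated kernels returns exactly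
  these values.\<close>

no_notation fps_nth (infixl \<open>$\<close> 75)

section \<open>Polynomial functions\<close>

lemma polynomial_fun_monomial: "polynomial_fun (\<lambda>z. c * (\<Prod>i\<in>UNIV. (z $ i) ^ \<alpha> i))"
proof -
  have "(\<lambda>z. c * (\<Prod>i\<in>UNIV. (z $ i) ^ \<alpha> i)) = monomial_sum {\<alpha>} (\<lambda>_. c)"
    by (simp add: monomial_sum_def fun_eq_iff)
  thus ?thesis unfolding polynomial_fun_def by blast
qed

lemma polynomial_fun_const [simp, intro]: "polynomial_fun (\<lambda>_. c)"
  using polynomial_fun_monomial[of c "\<lambda>_. 0"] by simp

lemma polynomial_fun_coord [simp, intro]:
  fixes j :: "'n::finite"
  shows "polynomial_fun (\<lambda>z. z $ j)"
proof -
  have "(\<Prod>i\<in>UNIV. (z $ i) ^ (if i = j then 1 else 0)) = z $ j" for z :: "complex^'n"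
    by (subst prod.mono_neutral_cong_right[of UNIV "{j}"]) auto
  thus ?thesis using polynomial_fun_monomial[of 1 "\<lambda>i. if i = j then 1 else 0"] by simp
qed

lemma polynomial_fun_add [intro]:
  assumes "polynomial_fun p" "polynomial_fun q" shows "polynomial_fun (\<lambda>z. p z + q z)"
proof -
  obtain A a B b where *: "finite A" "p = monomial_sum A a" "finite B" "q = monomial_sum B b"
    using assms unfolding polynomial_fun_def by blast
  let ?c = "\<lambda>\<alpha>. (if \<alpha> \<in> A then a \<alpha> else 0) + (if \<alpha> \<in> B then b \<alpha> else 0)"
  have "p z + q z = monomial_sum (A \<union> B) ?c z" for z
  proof -
    have "p z = (\<Sum>\<alpha>\<in>A \<union> B. (if \<alpha> \<in> A then a \<alpha> else 0) * (\<Prod>i\<in>UNIV. (z $ i) ^ \<alpha> i))"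
      unfolding * monomial_sum_def by (rule sum.mono_neutral_cong_left) (use * in auto)
    moreover have "q z = (\<Sum>\<alpha>\<in>A \<union> B. (if \<alpha> \<in> B then b \<alpha> else 0) * (\<Prod>i\<in>UNIV. (z $ i) ^ \<alpha> i))"
      unfolding * monomial_sum_def by (rule sum.mono_neutral_cong_left) (use * in auto)
    ultimately show ?thesis
      by (simp add: monomial_sum_def sum.distrib distrib_right)
  qed
  hence "(\<lambda>z. p z + q z) = monomial_sum (A \<union> B) ?c" by blast
  moreover have "finite (A \<union> B)" using *(1,3) by simp
  ultimately show ?thesis unfolding polynomial_fun_def by blast
qed

lemma polynomial_fun_sum [intro]:
  "(\<And>x. x \<in> X \<Longrightarrow> polynomial_fun (p x)) \<Longrightarrow> polynomial_fun (\<lambda>z. \<Sum>x\<in>X. p x z)"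
  by (induction X rule: infinite_finite_induct) auto

lemma polynomial_fun_mult [intro]:
  assumes "polynomial_fun p" "polynomial_fun q" shows "polynomial_fun (\<lambda>z. p z * q z)"
proof -
  obtain A a B b where *: "finite A" "p = monomial_sum A a" "finite B" "q = monomial_sum B b"
    using assms unfolding polynomial_fun_def by blast
  have "p z * q z = (\<Sum>\<alpha>\<in>A. \<Sum>\<beta>\<in>B. (a \<alpha> * b \<beta>) * (\<Prod>i\<in>UNIV. (z $ i) ^ (\<alpha> i + \<beta> i)))" for z
    unfolding * monomial_sum_def
    by (simp add: sum_product power_add prod.distrib mult_ac)
  moreover have "polynomial_fun (\<lambda>z. (\<Sum>\<alpha>\<in>A. \<Sum>\<beta>\<in>B. (a \<alpha> * b \<beta>) * (\<Prod>i\<in>UNIV. (z $ i) ^ (\<alpha> i + \<beta> i))))"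
    by (intro polynomial_fun_sum polynomial_fun_monomial)
  ultimately show ?thesis by simp
qed

lemma polynomial_fun_minus [intro]: "polynomial_fun p \<Longrightarrow> polynomial_fun (\<lambda>z. - p z)"
  using polynomial_fun_mult[OF polynomial_fun_const[of "-1"], of p] by simp

lemma polynomial_fun_diff [intro]:
  "polynomial_fun p \<Longrightarrow> polynomial_fun q \<Longrightarrow> polynomial_fun (\<lambda>z. p z - q z)"
  using polynomial_fun_add[OF _ polynomial_fun_minus, of p q] by simp

lemma polynomial_fun_prod [intro]:
  "(\<And>x. x \<in> X \<Longrightarrow> polynomial_fun (p x)) \<Longrightarrow> polynomial_fun (\<lambda>z. \<Prod>x\<in>X. p x z)"
  by (induction X rule: infinite_finite_induct) auto

lemma polynomial_fun_power [intro]: "polynomial_fun p \<Longrightarrow> polynomial_fun (\<lambda>z. p z ^ m)"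
  by (induction m) auto

text \<open>Frees later arguments from multi-indices: composition, differentiation and restriction
  to lines need only be checked on constants and coordinates and carried through sums and
  products.\<close>

lemma polynomial_fun_induct [consumes 1, case_names const coord add mult]:
  assumes p: "polynomial_fun p"
    and const: "\<And>c. P (\<lambda>_. c)" and coord: "\<And>i. P (\<lambda>z. z $ i)"
    and add: "\<And>p q. polynomial_fun p \<Longrightarrow> polynomial_fun q \<Longrightarrow> P p \<Longrightarrow> P q \<Longrightarrow> P (\<lambda>z. p z + q z)"
    and mult: "\<And>p q. polynomial_fun p \<Longrightarrow> polynomial_fun q \<Longrightarrow> P p \<Longrightarrow> P q \<Longrightarrow> P (\<lambda>z. p z * q z)"
  shows "P p"
proof -
  obtain A a where *: "finite A" "p = monomial_sum A a"
    using p unfolding polynomial_fun_def by blast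
  have pow: "P (\<lambda>z. (z $ i) ^ m)" for i m
    by (induction m) (use mult[OF polynomial_fun_coord polynomial_fun_power[OF polynomial_fun_coord]] const[of 1] coord in auto)
  have pr: "P (\<lambda>z. \<Prod>i\<in>X. (z $ i) ^ \<alpha> i)" for X \<alpha>
  proof (induction X rule: infinite_finite_induct)
    case (insert x F)
    have "P (\<lambda>z. (z $ x) ^ \<alpha> x * (\<Prod>i\<in>F. (z $ i) ^ \<alpha> i))"
      by (intro mult pow insert polynomial_fun_power polynomial_fun_prod polynomial_fun_coord)
    with insert show ?case by simp
  qed (use const[of 1] in auto)
  have "P (\<lambda>z. \<Sum>\<alpha>\<in>A. a \<alpha> * (\<Prod>i\<in>UNIV. (z $ i) ^ \<alpha> i))"
    using \<open>finite A\<close>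
  proof (induction A rule: finite_induct)
    case (insert x F)
    have "P (\<lambda>z. a x * (\<Prod>i\<in>UNIV. (z $ i) ^ x i) + (\<Sum>\<alpha>\<in>F. a \<alpha> * (\<Prod>i\<in>UNIV. (z $ i) ^ \<alpha> i)))"
      by (intro add mult pr const insert polynomial_fun_sum polynomial_fun_mult polynomial_fun_power
          polynomial_fun_prod polynomial_fun_coord polynomial_fun_const)
    with insert show ?case by simp
  qed (use const[of 0] in auto)
  moreover have "p = (\<lambda>z. \<Sum>\<alpha>\<in>A. a \<alpha> * (\<Prod>i\<in>UNIV. (z $ i) ^ \<alpha> i))"
    using * by (simp add: monomial_sum_def fun_eq_iff)
  ultimately show ?thesis by simp
qed

lemma polynomial_fun_compose:
  assumes "polynomial_fun p" "\<And>i. polynomial_fun (\<lambda>z. q z $ i)"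
  shows "polynomial_fun (\<lambda>z. p (q z))"
  using assms by (induction p rule: polynomial_fun_induct) auto

lemma polynomial_fun_matrix_vector [intro]: "polynomial_fun (\<lambda>z. (A *v z) $ i)"
  by (simp add: matrix_vector_mult_def) (intro polynomial_fun_sum polynomial_fun_mult polynomial_fun_const polynomial_fun_coord)

lemma polynomial_fun_linear_compose:
  "polynomial_fun p \<Longrightarrow> polynomial_fun (\<lambda>z. p (A *v z))"
  by (rule polynomial_fun_compose) auto

lemma homogeneous_polynomial_imp_polynomial_fun: "homogeneous_polynomial m p \<Longrightarrow> polynomial_fun p"
  unfolding homogeneous_polynomial_def polynomial_fun_def by blast

lemma homogeneous_polynomial_scale:
  assumes "homogeneous_polynomial m p" shows "p (c *s z) = c ^ m * p z"
proof -
  obtain A a where *: "finite A" "\<And>\<alpha>. \<alpha> \<in> A \<Longrightarrow> (\<Sum>i\<in>UNIV. \<alpha> i) = m" "p = monomial_sum A a"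
    using assms unfolding homogeneous_polynomial_def by blast
  have "p (c *s z) = (\<Sum>\<alpha>\<in>A. a \<alpha> * (c ^ (\<Sum>i\<in>UNIV. \<alpha> i) * (\<Prod>i\<in>UNIV. (z $ i) ^ \<alpha> i)))"
    unfolding * monomial_sum_def by (simp add: power_mult_distrib prod.distrib power_sum)
  also have "\<dots> = (\<Sum>\<alpha>\<in>A. c ^ m * (a \<alpha> * (\<Prod>i\<in>UNIV. (z $ i) ^ \<alpha> i)))"
    using * by (intro sum.cong) auto
  finally show ?thesis by (simp add: * monomial_sum_def sum_distrib_left)
qed

lemma polynomial_fun_has_derivative:
  fixes p :: "complex^'n \<Rightarrow> complex"
  assumes "polynomial_fun p"
  shows "\<exists>p'. (\<forall>i. polynomial_fun (p' i)) \<and>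
           (\<forall>z. (p has_derivative (\<lambda>h. \<Sum>i\<in>UNIV. p' i z * h $ i)) (at z))"
  using assms
proof (induction p rule: polynomial_fun_induct)
  case (const c)
  show ?case by (intro exI[of _ "\<lambda>_ _. 0"]) auto
next
  case (coord j)
  have "((\<lambda>z::complex^'n. z $ j) has_derivative (\<lambda>h. \<Sum>i\<in>UNIV. (if i = j then 1 else 0) * h $ i)) (at z)" for z
  proof -
    have "(\<lambda>h::complex^'n. \<Sum>i\<in>UNIV. (if i = j then 1 else 0) * h $ i) = (\<lambda>h. h $ j)"
    proof
      fix h :: "complex^'n"
      show "(\<Sum>i\<in>UNIV. (if i = j then 1 else 0) * h $ i) = h $ j"
        by (subst sum.mono_neutral_cong_right[of UNIV "{j}"]) auto
    qed
    thus ?thesis using bounded_linear_imp_has_derivative[OF bounded_linear_vec_nth] by simp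
  qed
  thus ?case by (intro exI[of _ "\<lambda>i _. if i = j then 1 else 0"]) auto
next
  case (add p q)
  then obtain p' q' where *: "\<And>i. polynomial_fun (p' i)" "\<And>i. polynomial_fun (q' i)"
    "\<And>z. (p has_derivative (\<lambda>h. \<Sum>i\<in>UNIV. p' i z * h $ i)) (at z)"
    "\<And>z. (q has_derivative (\<lambda>h. \<Sum>i\<in>UNIV. q' i z * h $ i)) (at z)" by blast
  show ?case
  proof (intro exI[of _ "\<lambda>i z. p' i z + q' i z"] conjI allI)
    fix z show "((\<lambda>z. p z + q z) has_derivative (\<lambda>h. \<Sum>i\<in>UNIV. (p' i z + q' i z) * h $ i)) (at z)"
      by (rule has_derivative_eq_rhs[OF has_derivative_add[OF *(3,4)]]) (simp add: sum.distrib distrib_right fun_eq_iff)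
  qed (use * in auto)
next
  case (mult p q)
  then obtain p' q' where *: "\<And>i. polynomial_fun (p' i)" "\<And>i. polynomial_fun (q' i)"
    "\<And>z. (p has_derivative (\<lambda>h. \<Sum>i\<in>UNIV. p' i z * h $ i)) (at z)"
    "\<And>z. (q has_derivative (\<lambda>h. \<Sum>i\<in>UNIV. q' i z * h $ i)) (at z)" by blast
  show ?case
  proof (intro exI[of _ "\<lambda>i z. p z * q' i z + p' i z * q z"] conjI allI)
    fix z show "((\<lambda>z. p z * q z) has_derivative (\<lambda>h. \<Sum>i\<in>UNIV. (p z * q' i z + p' i z * q z) * h $ i)) (at z)"
      by (rule has_derivative_eq_rhs[OF has_derivative_mult[OF *(3,4)]])
        (simp add: fun_eq_iff sum_distrib_left sum_distrib_right sum.distrib[symmetric] algebra_simps)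
  qed (intro polynomial_fun_add polynomial_fun_mult * mult.hyps)
qed

lemma polynomial_fun_continuous_on [continuous_intros]:
  assumes "polynomial_fun p" shows "continuous_on X p"
proof -
  obtain p' where "\<And>z. (p has_derivative (\<lambda>h. \<Sum>i\<in>UNIV. p' i z * h $ i)) (at z)"
    using polynomial_fun_has_derivative[OF assms] by blast
  hence "isCont p z" for z by (rule has_derivative_continuous)
  thus ?thesis by (simp add: continuous_at_imp_continuous_on)
qed

lemma polynomial_fun_holo: assumes "polynomial_fun p" shows "holo p U"
proof -
  obtain p' where p': "\<And>z. (p has_derivative (\<lambda>h. \<Sum>i\<in>UNIV. p' i z * h $ i)) (at z)"
    using polynomial_fun_has_derivative[OF assms] by blast
  show ?thesis unfolding holo_def
  proof (intro ballI exI conjI allI)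
    fix z assume "z \<in> U"
    show "(p has_derivative (\<lambda>h. \<Sum>i\<in>UNIV. p' i z * h $ i)) (at z within U)"
      using p' by (rule has_derivative_at_withinI)
  qed (simp add: sum_distrib_left mult_ac)
qed

text \<open>The degree bound is uniform in the base point and the coefficients depend polynomially
  on it. This allows Euclidean division and termwise integration on all parallel lines at
  once.\<close>

lemma polynomial_fun_along_line:
  fixes p :: "complex^'n \<Rightarrow> complex"
  assumes "polynomial_fun p"
  shows "\<exists>q m. (\<forall>i. polynomial_fun (\<lambda>z. coeff (q z) i)) \<and> (\<forall>z. degree (q z) \<le> m) \<and>
           (\<forall>z t. p (z + t *s v) = poly (q z) t)"
  using assms
proof (induction p rule: polynomial_fun_induct)
  case (const c)
  show ?case by (intro exI[of _ "\<lambda>_. [:c:]"] exI[of _ 0]) auto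
next
  case (coord j)
  have "polynomial_fun (\<lambda>z::complex^'n. coeff [:z $ j, v $ j:] i)" for i
    by (cases i; cases "i - 1") auto
  thus ?case by (intro exI[of _ "\<lambda>z. [:z $ j, v $ j:]"] exI[of _ 1]) auto
next
  case (add p q)
  then obtain p' q' m n where *: "\<And>i. polynomial_fun (\<lambda>z. coeff (p' z) i)" "\<And>i. polynomial_fun (\<lambda>z. coeff (q' z) i)"
    "\<And>z. degree (p' z) \<le> m" "\<And>z. degree (q' z) \<le> n"
    "\<And>z t. p (z + t *s v) = poly (p' z) t" "\<And>z t. q (z + t *s v) = poly (q' z) t" by metis
  show ?case
  proof (intro exI[of _ "\<lambda>z. p' z + q' z"] exI[of _ "max m n"] conjI allI)
    show "degree (p' z + q' z) \<le> max m n" for z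
      by (meson *(3,4) degree_add_le le_max_iff_disj)
  qed (use * in auto)
next
  case (mult p q)
  then obtain p' q' m n where *: "\<And>i. polynomial_fun (\<lambda>z. coeff (p' z) i)" "\<And>i. polynomial_fun (\<lambda>z. coeff (q' z) i)"
    "\<And>z. degree (p' z) \<le> m" "\<And>z. degree (q' z) \<le> n"
    "\<And>z t. p (z + t *s v) = poly (p' z) t" "\<And>z t. q (z + t *s v) = poly (q' z) t" by metis
  show ?case
  proof (intro exI[of _ "\<lambda>z. p' z * q' z"] exI[of _ "m + n"] conjI allI)
    show "degree (p' z * q' z) \<le> m + n" for z
      by (meson *(3,4) degree_mult_le add_mono order.trans)
    show "polynomial_fun (\<lambda>z. coeff (p' z * q' z) i)" for i
      unfolding coeff_mult by (intro polynomial_fun_sum polynomial_fun_mult *)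
  qed (use * in auto)
qed

lemma polynomial_fun_line_poly:
  assumes "polynomial_fun p" obtains q where "\<And>t. p (z + t *s v) = poly q t"
  using polynomial_fun_along_line[OF assms, of v] by metis

lemma continuous_on_vector_smult [continuous_intros]:
  fixes f :: "'a::topological_space \<Rightarrow> complex" and g :: "'a \<Rightarrow> complex^'n"
  assumes "continuous_on X f" "continuous_on X g" shows "continuous_on X (\<lambda>x. f x *s g x)"
  unfolding vector_scalar_mult_def
  by (intro continuous_on_vec_lambda continuous_on_mult continuous_on_component assms)

lemma poly_eq_0_on_ball:
  fixes q :: "complex poly"
  assumes "e > 0" "\<And>t. norm t < e \<Longrightarrow> poly q t = 0" shows "q = 0"
proof (rule ccontr)
  assume "q \<noteq> 0"
  hence "finite {t. poly q t = 0}" by (rule poly_roots_finite)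
  moreover have "ball 0 e \<subseteq> {t. poly q t = 0}" using assms by auto
  ultimately have "finite (ball (0::complex) e)" by (rule finite_subset[rotated])
  thus False using uncountable_ball[OF assms(1), of "0::complex"] countable_finite by blast
qed

text \<open>On the complex line from a point of \<open>U\<close> through \<open>z\<close> the
  restriction vanishes near parameter 0, hence is the zero polynomial; parameter 1 is
  \<open>z\<close>.\<close>

lemma polynomial_fun_zero_on_open:
  fixes p :: "complex^'n \<Rightarrow> complex"
  assumes "polynomial_fun p" "open U" "U \<noteq> {}" "\<And>z. z \<in> U \<Longrightarrow> p z = 0"
  shows "p z = 0"
proof -
  obtain a where a: "a \<in> U" using assms by blast
  obtain q where q: "\<And>t. p (a + t *s (z - a)) = poly q t"
    using polynomial_fun_line_poly[OF assms(1)] by blast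
  have "continuous_on UNIV (\<lambda>t. a + t *s (z - a))"
    by (intro continuous_intros)
  hence "open ((\<lambda>t. a + t *s (z - a)) -` U)" using \<open>open U\<close> open_vimage by blast
  moreover have "0 \<in> (\<lambda>t. a + t *s (z - a)) -` U" using a by simp
  ultimately obtain e where e: "e > 0" "ball 0 e \<subseteq> (\<lambda>t. a + t *s (z - a)) -` U"
    using openE by blast
  have "q = 0"
    by (rule poly_eq_0_on_ball[OF e(1)]) (use e q assms(4) in \<open>force simp flip: q\<close>)
  thus ?thesis using q[of 1] by simp
qed

lemma polynomial_fun_dense_nonzero:
  fixes p :: "complex^'n \<Rightarrow> complex"
  assumes "polynomial_fun p" "p a \<noteq> 0"
  shows "closure {z. p z \<noteq> 0} = UNIV"
proof -
  have "interior {z. p z = 0} = {}"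
    using polynomial_fun_zero_on_open[OF assms(1), of "interior {z. p z = 0}"] assms(2) interior_subset
    by (metis (mono_tags, lifting) mem_Collect_eq open_interior subsetD)
  moreover have "{z. p z \<noteq> 0} = - {z. p z = 0}" by auto
  ultimately show ?thesis by (simp add: closure_complement)
qed

lemma continuous_eq_on_dense:
  fixes f g :: "'a::topological_space \<Rightarrow> 'b::t2_space"
  assumes "closure D = UNIV" "continuous_on UNIV f" "continuous_on UNIV g" "\<And>z. z \<in> D \<Longrightarrow> f z = g z"
  shows "f z = g z"
proof -
  have "closed {z. f z = g z}" using assms(2,3) by (rule closed_Collect_eq)
  hence "closure D \<subseteq> {z. f z = g z}" using assms(4) by (intro closure_minimal) auto
  thus ?thesis using assms(1) by auto
qed

text \<open>Interpolation on the grid \<open>{0..n}\<^sup>d\<close> shows that a function which is a polynomial of degree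
  at most \<open>n\<close> in each variable separately is a polynomial.\<close>

definition lagrange_basis :: "nat \<Rightarrow> nat \<Rightarrow> complex \<Rightarrow> complex" where
  "lagrange_basis n a x = (\<Prod>b\<in>{..n} - {a}. (x - of_nat b) / (of_nat a - of_nat b))"

lemma polynomial_fun_lagrange_basis [intro]:
  "polynomial_fun p \<Longrightarrow> polynomial_fun (\<lambda>z. lagrange_basis n a (p z))"
  unfolding lagrange_basis_def divide_inverse by (intro polynomial_fun_prod polynomial_fun_mult polynomial_fun_diff polynomial_fun_const)

lemma lagrange_basis_interpolation:
  fixes q :: "complex poly"
  assumes "degree q \<le> n"
  shows "poly q x = (\<Sum>a\<le>n. poly q (of_nat a) * lagrange_basis n a x)"
proof -
  define L where "L a = (\<Prod>b\<in>{..n} - {a}. smult (1 / (of_nat a - of_nat b)) [:- of_nat b, 1::complex:])" for a :: nat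
  have L: "poly (L a) x = lagrange_basis n a x" for a x
    unfolding L_def lagrange_basis_def poly_prod by (intro prod.cong) (auto simp: diff_divide_distrib)
  define r where "r = (\<Sum>a\<le>n. smult (poly q (of_nat a)) (L a))"
  have degL: "degree (L a) \<le> n" if "a \<le> n" for a
  proof -
    have "degree (L a) \<le> (\<Sum>b\<in>{..n} - {a}. degree (smult (1 / (of_nat a - of_nat b)) [:- of_nat b, 1::complex:]))"
      unfolding L_def by (rule order.trans[OF degree_prod_sum_le]) (auto simp: o_def)
    also have "\<dots> \<le> (\<Sum>b\<in>{..n} - {a}. 1)" by (intro sum_mono) (auto intro: order.trans[OF degree_smult_le])
    also have "\<dots> = n" using that by simp
    finally show ?thesis .
  qed
  have Lval: "lagrange_basis n a (of_nat b) = (if a = b then 1 else 0)" if "a \<le> n" "b \<le> n" for a b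
    using that unfolding lagrange_basis_def by (auto intro!: prod.neutral prod_zero)
  have "degree (q - r) \<le> n"
    unfolding r_def by (intro degree_diff_le assms degree_sum_le) (auto simp: degL)
  moreover have "poly (q - r) (of_nat b) = 0" if "b \<le> n" for b
    using that by (simp add: r_def poly_sum L Lval if_distrib[of "\<lambda>x. _ * x"] cong: if_cong)
  hence "(of_nat :: nat \<Rightarrow> complex) ` {..n} \<subseteq> {x. poly (q - r) x = 0}" by auto
  hence "card {x. poly (q - r) x = 0} \<ge> Suc n" if "q - r \<noteq> 0"
    using card_mono[OF poly_roots_finite[OF that]] by (metis card_atMost card_image inj_of_nat inj_on_subset subset_UNIV)
  ultimately have "q - r = 0"
    using card_poly_roots_bound[of "q - r"] by fastforce
  hence "poly q x = poly r x" by simp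
  thus ?thesis by (simp add: r_def poly_sum L)
qed

definition grid_interpolation :: "nat \<Rightarrow> (complex^'n \<Rightarrow> complex) \<Rightarrow> complex^'n \<Rightarrow> complex" where
  "grid_interpolation n p z =
     (\<Sum>a\<in>PiE UNIV (\<lambda>_. {..n}). p (\<chi> i. of_nat (a i)) * (\<Prod>i\<in>UNIV. lagrange_basis n (a i) (z $ i)))"

lemma polynomial_fun_grid_interpolation: "polynomial_fun (grid_interpolation n p)"
  unfolding grid_interpolation_def by (intro polynomial_fun_sum polynomial_fun_mult polynomial_fun_prod polynomial_fun_const polynomial_fun_lagrange_basis polynomial_fun_coord)

lemma grid_interpolation_eq:
  fixes p :: "complex^'n \<Rightarrow> complex"
  assumes "\<And>z i. \<exists>q. degree q \<le> n \<and> (\<forall>x. p (\<chi> j. if j = i then x else z $ j) = poly q x)"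
  shows "grid_interpolation n p z = p z"
proof -
  \<comment> \<open>Generalised to interpolation in the coordinates of \<open>A\<close> alone, the
    others keeping their values in \<open>z\<close>, so that the induction adds one variable at a
    time.\<close>
  have "p z = (\<Sum>a\<in>PiE A (\<lambda>_. {..n}). p (\<chi> i. if i \<in> A then of_nat (a i) else z $ i) *
          (\<Prod>i\<in>A. lagrange_basis n (a i) (z $ i)))" if "finite A" for A :: "'n set"
    using that
  proof (induction A rule: finite_induct)
    case empty thus ?case by simp
  next
    case (insert k A)
    have *: "p (\<chi> i. if i \<in> A then of_nat (a i) else z $ i) =
       (\<Sum>x\<le>n. p (\<chi> i. if i \<in> insert k A then of_nat ((a(k := x)) i) else z $ i) * lagrange_basis n x (z $ k))" for a
    proof -
      define y where "y = (\<chi> i. if i \<in> A then of_nat (a i) else z $ i)"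
      obtain q where q: "degree q \<le> n" "\<And>x. p (\<chi> j. if j = k then x else y $ j) = poly q x"
        using assms[of k y] by blast
      have "(\<chi> j. if j = k then z $ k else y $ j) = y" using insert(2) by (simp add: y_def vec_eq_iff)
      hence "p y = poly q (z $ k)" using q(2)[of "z $ k"] by simp
      also have "\<dots> = (\<Sum>x\<le>n. poly q (of_nat x) * lagrange_basis n x (z $ k))"
        by (rule lagrange_basis_interpolation[OF q(1)])
      also have "\<dots> = (\<Sum>x\<le>n. p (\<chi> i. if i \<in> insert k A then of_nat ((a(k := x)) i) else z $ i) * lagrange_basis n x (z $ k))"
        unfolding q(2)[symmetric] using insert(2)
        by (intro sum.cong arg_cong2[where f = "(*)"] arg_cong[where f = p]) (auto simp: vec_eq_iff y_def)
      finally show ?thesis by (simp add: y_def)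
    qed
    have "p z = (\<Sum>a\<in>PiE A (\<lambda>_. {..n}). \<Sum>x\<le>n. p (\<chi> i. if i \<in> insert k A then of_nat ((a(k := x)) i) else z $ i) *
           (lagrange_basis n x (z $ k) * (\<Prod>i\<in>A. lagrange_basis n (a i) (z $ i))))"
      unfolding insert.IH by (subst *) (simp add: sum_distrib_right sum_distrib_left mult_ac)
    also have "\<dots> = (\<Sum>(x, a)\<in>{..n} \<times> PiE A (\<lambda>_. {..n}). p (\<chi> i. if i \<in> insert k A then of_nat ((a(k := x)) i) else z $ i) *
           (lagrange_basis n x (z $ k) * (\<Prod>i\<in>A. lagrange_basis n (a i) (z $ i))))"
      by (subst sum.swap) (simp add: sum.cartesian_product)
    also have "\<dots> = (\<Sum>a\<in>PiE (insert k A) (\<lambda>_. {..n}). p (\<chi> i. if i \<in> insert k A then of_nat (a i) else z $ i) *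
          (\<Prod>i\<in>insert k A. lagrange_basis n (a i) (z $ i)))"
    proof (rule sym, rule sum.reindex_cong[where l = "\<lambda>(x, a). a(k := x)"])
      show "inj_on (\<lambda>(x, a). a(k := x)) ({..n} \<times> PiE A (\<lambda>_. {..n}))"
        using inj_combinator[OF insert(2), of "\<lambda>_. {..n}"] by simp
      show "PiE (insert k A) (\<lambda>_. {..n}) = (\<lambda>(x, a). a(k := x)) ` ({..n} \<times> PiE A (\<lambda>_. {..n}))"
        by (rule PiE_insert_eq)
      fix xa assume "xa \<in> {..n} \<times> PiE A (\<lambda>_. {..n})"
      have "(\<Prod>i\<in>A. lagrange_basis n (((snd xa)(k := fst xa)) i) (z $ i)) = (\<Prod>i\<in>A. lagrange_basis n (snd xa i) (z $ i))"
        using insert(2) by (intro prod.cong) auto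
      thus "p (\<chi> i. if i \<in> insert k A then of_nat ((case xa of (x, a) \<Rightarrow> a(k := x)) i) else z $ i) *
          (\<Prod>i\<in>insert k A. lagrange_basis n ((case xa of (x, a) \<Rightarrow> a(k := x)) i) (z $ i)) =
         (case xa of (x, a) \<Rightarrow> p (\<chi> i. if i \<in> insert k A then of_nat ((a(k := x)) i) else z $ i) *
           (lagrange_basis n x (z $ k) * (\<Prod>i\<in>A. lagrange_basis n (a i) (z $ i))))"
        using insert(1,2) by (cases xa) (auto simp: mult_ac)
    qed
    finally show ?case .
  qed
  from this[of UNIV] show ?thesis by (simp add: grid_interpolation_def)
qed

section \<open>Jacobians of polynomial maps\<close>

definition polynomial_map :: "(complex^'n \<Rightarrow> complex^'m) \<Rightarrow> bool" where
  "polynomial_map U \<longleftrightarrow> (\<forall>i. polynomial_fun (\<lambda>z. U z $ i))"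

lemma has_derivative_vec_componentwise:
  fixes f :: "'a::real_normed_vector \<Rightarrow> 'b::euclidean_space^'m"
  assumes "\<And>i. ((\<lambda>z. f z $ i) has_derivative (\<lambda>h. f' h $ i)) (at x within X)"
  shows "(f has_derivative f') (at x within X)"
  unfolding has_derivative_componentwise_within[of f]
  by (auto simp: Basis_vec_def inner_axis intro!: has_derivative_inner_left assms)

lemma polynomial_map_has_derivative:
  fixes U :: "complex^'n \<Rightarrow> complex^'n"
  assumes "polynomial_map U"
  shows "\<exists>D. (\<forall>i j. polynomial_fun (\<lambda>z. D z $ i $ j)) \<and> (\<forall>z. (U has_derivative (*v) (D z)) (at z))"
proof -
  have "\<forall>i. \<exists>p'. (\<forall>j. polynomial_fun (p' j)) \<and>
           (\<forall>z. ((\<lambda>z. U z $ i) has_derivative (\<lambda>h. \<Sum>j\<in>UNIV. p' j z * h $ j)) (at z))"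
    using assms polynomial_fun_has_derivative unfolding polynomial_map_def by blast
  then obtain p' where p': "\<And>i j. polynomial_fun (p' i j)"
    "\<And>i z. ((\<lambda>z. U z $ i) has_derivative (\<lambda>h. \<Sum>j\<in>UNIV. p' i j z * h $ j)) (at z)" by metis
  show ?thesis
  proof (intro exI[of _ "\<lambda>z. \<chi> i j. p' i j z"] conjI allI)
    fix z show "(U has_derivative (*v) (\<chi> i j. p' i j z)) (at z)"
      by (rule has_derivative_vec_componentwise) (use p'(2) in \<open>simp add: matrix_vector_mult_def\<close>)
  qed (use p' in auto)
qed

lemma complex_jacobian_eq_det:
  assumes "(U has_derivative (*v) A) (at z)"
  shows "complex_jacobian U z = det A"
  unfolding complex_jacobian_def frechet_derivative_at[OF assms, symmetric] by simp

lemma polynomial_fun_det: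
  assumes "\<And>i j. polynomial_fun (\<lambda>z. D z $ i $ j)"
  shows "polynomial_fun (\<lambda>z. det (D z :: complex^'n^'n))"
  unfolding det_def by (intro polynomial_fun_sum polynomial_fun_mult polynomial_fun_prod polynomial_fun_const assms)

lemma polynomial_fun_complex_jacobian:
  assumes "polynomial_map U" shows "polynomial_fun (complex_jacobian U)"
proof -
  obtain D where D: "\<And>i j. polynomial_fun (\<lambda>z. D z $ i $ j)" "\<And>z. (U has_derivative (*v) (D z)) (at z)"
    using polynomial_map_has_derivative[OF assms] by blast
  have "complex_jacobian U = (\<lambda>z. det (D z))" using complex_jacobian_eq_det[OF D(2)] by (simp add: fun_eq_iff)
  thus ?thesis using polynomial_fun_det[OF D(1)] by simp
qed

lemma complex_jacobian_compose:
  fixes U V :: "complex^'n \<Rightarrow> complex^'n"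
  assumes "polynomial_map U" "polynomial_map V"
  shows "complex_jacobian (\<lambda>z. V (U z)) z = complex_jacobian V (U z) * complex_jacobian U z"
proof -
  obtain D where D: "\<And>z. (U has_derivative (*v) (D z)) (at z)"
    using polynomial_map_has_derivative[OF assms(1)] by blast
  obtain E where E: "\<And>z. (V has_derivative (*v) (E z)) (at z)"
    using polynomial_map_has_derivative[OF assms(2)] by blast
  have "((\<lambda>z. V (U z)) has_derivative (\<lambda>h. E (U z) *v (D z *v h))) (at z)"
    by (rule has_derivative_compose[OF D E])
  hence "((\<lambda>z. V (U z)) has_derivative (*v) (E (U z) ** D z)) (at z)"
    by (simp add: matrix_vector_mul_assoc)
  from complex_jacobian_eq_det[OF this] show ?thesis
    by (simp add: det_mul complex_jacobian_eq_det[OF D] complex_jacobian_eq_det[OF E])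
qed

lemma polynomial_map_matrix [intro]: "polynomial_map ((*v) A)"
  unfolding polynomial_map_def by auto

lemma complex_jacobian_matrix: "complex_jacobian ((*v) A) z = det A"
  by (rule complex_jacobian_eq_det) (intro bounded_linear_imp_has_derivative matrix_vector_mul_bounded_linear)

text \<open>With \<open>Q\<close> the identity whose column \<open>k\<close> is replaced by
  \<open>n\<close>, the matrix is conjugate through \<open>Q\<close> to the identity with only row
  \<open>k\<close> changed. Both \<open>det Q\<close> and the determinant of that matrix are Cramer
  determinants, and \<open>n $ k \<noteq> 0\<close> makes \<open>Q\<close> cancellable.\<close>

lemma det_identity_plus_rank_one:
  fixes n b :: "complex^'n"
  shows "det (mat 1 + (\<chi> i j. n $ i * b $ j)) = 1 + (\<Sum>j\<in>UNIV. b $ j * n $ j)"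
proof (cases "n = 0")
  case True
  hence "(\<chi> i j. n $ i * b $ j) = (0 :: complex^'n^'n)" by (simp add: vec_eq_iff)
  thus ?thesis using True by simp
next
  case False
  then obtain k where k: "n $ k \<noteq> 0" by (auto simp: vec_eq_iff)
  define Q :: "complex^'n^'n" where "Q = (\<chi> i j. if j = k then (mat 1 *v n) $ i else (mat 1 :: complex^'n^'n) $ i $ j)"
  have detQ: "det Q = n $ k" unfolding Q_def cramer_lemma by simp
  define c where "c = (\<chi> j. \<Sum>i\<in>UNIV. b $ i * Q $ i $ j)"
  define B :: "complex^'n^'n" where "B = (\<chi> i. if i = k then (\<Sum>i\<in>UNIV. (axis k 1 + c) $ i *s row i (mat 1)) else row i (mat 1))"
  have detB: "det B = 1 + c $ k" unfolding B_def cramer_lemma_transpose by (simp add: axis_def)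
  have row1: "(\<Sum>i\<in>UNIV. x $ i *s row i (mat 1)) = x" for x :: "complex^'n"
    by (simp add: vec_eq_iff row_def mat_def if_distrib[of "\<lambda>y. _ * y"] cong: if_cong)
  have B: "B $ i $ j = (if i = j then 1 else 0) + (if i = k then c $ j else 0)" for i j
    unfolding B_def row1 by (auto simp: axis_def row_def mat_def)
  have "((mat 1 + (\<chi> i j. n $ i * b $ j)) ** Q) $ i $ j = (Q ** B) $ i $ j" for i j
  proof -
    have "((mat 1 + (\<chi> i j. n $ i * b $ j)) ** Q) $ i $ j = Q $ i $ j + n $ i * c $ j"
      by (simp add: matrix_matrix_mult_def mat_def c_def distrib_right sum.distrib sum_distrib_left mult.assoc mult.left_commute
          if_distrib[of "\<lambda>y. y * _"] cong: if_cong)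
    moreover have "(Q ** B) $ i $ j = Q $ i $ j + Q $ i $ k * c $ j"
      by (simp add: matrix_matrix_mult_def B distrib_left sum.distrib if_distrib[of "\<lambda>y. _ * y"] cong: if_cong)
    moreover have "Q $ i $ k = n $ i" by (simp add: Q_def)
    ultimately show ?thesis by simp
  qed
  hence "(mat 1 + (\<chi> i j. n $ i * b $ j)) ** Q = Q ** B" by (simp add: vec_eq_iff)
  hence "det (mat 1 + (\<chi> i j. n $ i * b $ j)) * det Q = det Q * det B"
    by (metis det_mul)
  hence "det (mat 1 + (\<chi> i j. n $ i * b $ j)) = 1 + c $ k"
    using k detQ detB by simp
  also have "c $ k = (\<Sum>j\<in>UNIV. b $ j * n $ j)" by (simp add: c_def Q_def)
  finally show ?thesis .
qed

section \<open>Functions of one variable vanishing to a given order\<close>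

text \<open>The estimate O(t^m) at 0, stated with one constant on the whole closed unit disc, so
  that factors continuous there can be absorbed by compactness.\<close>

definition vanish :: "nat \<Rightarrow> (complex \<Rightarrow> complex) \<Rightarrow> bool" where
  "vanish m f \<longleftrightarrow> (\<exists>C. \<forall>t. norm t \<le> 1 \<longrightarrow> norm (f t) \<le> C * norm t ^ m)"

lemma vanish_0 [simp]: "vanish m (\<lambda>_. 0)"
  unfolding vanish_def by (intro exI[of _ 0]) auto

lemma vanish_add: assumes "vanish m f" "vanish m g" shows "vanish m (\<lambda>t. f t + g t)"
proof -
  obtain C D where CD: "\<And>t. norm t \<le> 1 \<Longrightarrow> norm (f t) \<le> C * norm t ^ m" "\<And>t. norm t \<le> 1 \<Longrightarrow> norm (g t) \<le> D * norm t ^ m"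
    using assms unfolding vanish_def by blast
  have "norm (f t + g t) \<le> (C + D) * norm t ^ m" if "norm t \<le> 1" for t
    using norm_triangle_mono[OF CD(1)[OF that] CD(2)[OF that]] by (simp add: distrib_right)
  thus ?thesis unfolding vanish_def by blast
qed

lemma vanish_sum: "(\<And>x. x \<in> X \<Longrightarrow> vanish m (f x)) \<Longrightarrow> vanish m (\<lambda>t. \<Sum>x\<in>X. f x t)"
  by (induction X rule: infinite_finite_induct) (simp_all add: vanish_add)

lemma vanish_mult_left:
  assumes "vanish m f" "continuous_on (cball 0 1) g" shows "vanish m (\<lambda>t. g t * f t)"
proof -
  obtain C where C: "\<And>t. norm t \<le> 1 \<Longrightarrow> norm (f t) \<le> C * norm t ^ m"
    using assms unfolding vanish_def by blast
  have "compact (g ` cball 0 1)" using assms(2) compact_continuous_image compact_cball by blast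
  hence "bounded (g ` cball 0 1)" by (rule compact_imp_bounded)
  then obtain B where B: "\<And>t. norm t \<le> 1 \<Longrightarrow> norm (g t) \<le> B" unfolding bounded_iff by (metis dist_0_norm imageI mem_cball)
  have "norm (g t * f t) \<le> (B * C) * norm t ^ m" if "norm t \<le> 1" for t
  proof -
    have "norm (g t) * norm (f t) \<le> B * (C * norm t ^ m)"
      using B[OF that] C[OF that] by (intro mult_mono) (auto intro: order.trans[OF norm_ge_zero])
    thus ?thesis by (simp add: norm_mult mult_ac)
  qed
  thus ?thesis unfolding vanish_def by blast
qed

text \<open>Telescoping, one factor at a time; the remaining factors are continuous and therefore
  harmless.\<close>

lemma vanish_prod_diff:
  assumes "finite X" "\<And>x. x \<in> X \<Longrightarrow> continuous_on (cball 0 1) (f x)" "\<And>x. x \<in> X \<Longrightarrow> continuous_on (cball 0 1) (g x)"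
    "\<And>x. x \<in> X \<Longrightarrow> vanish m (\<lambda>t. f x t - g x t)"
  shows "vanish m (\<lambda>t. (\<Prod>x\<in>X. f x t) - (\<Prod>x\<in>X. g x t))"
  using assms
proof (induction X rule: finite_induct)
  case (insert y X)
  have "vanish m (\<lambda>t. f y t * ((\<Prod>x\<in>X. f x t) - (\<Prod>x\<in>X. g x t)) + (\<Prod>x\<in>X. g x t) * (f y t - g y t))"
    by (intro vanish_add vanish_mult_left continuous_on_prod insert) (use insert in auto)
  thus ?case using insert by (simp add: algebra_simps)
qed auto

lemma vanish_det_diff:
  fixes A B :: "complex \<Rightarrow> complex^'n^'n"
  assumes "\<And>i j. continuous_on (cball 0 1) (\<lambda>t. A t $ i $ j)" "\<And>i j. continuous_on (cball 0 1) (\<lambda>t. B t $ i $ j)"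
    "\<And>i j. vanish m (\<lambda>t. A t $ i $ j - B t $ i $ j)"
  shows "vanish m (\<lambda>t. det (A t) - det (B t))"
proof -
  have "vanish m (\<lambda>t. \<Sum>p\<in>{p. p permutes (UNIV::'n set)}. of_int (sign p) * ((\<Prod>i\<in>UNIV. A t $ i $ p i) - (\<Prod>i\<in>UNIV. B t $ i $ p i)))"
    by (intro vanish_sum vanish_mult_left vanish_prod_diff continuous_on_const assms finite)
  thus ?thesis by (simp add: det_def sum_subtractf right_diff_distrib)
qed

text \<open>After cancelling \<open>t ^ a\<close>, with \<open>a\<close> the exact order, the
  cofactor is still O(t) and would vanish at 0.\<close>

lemma vanish_poly:
  assumes "vanish (Suc m) (poly q)" shows "q = 0 \<or> Polynomial.order 0 q > m"
proof (rule ccontr)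
  assume a: "\<not> ?thesis"
  define a where "a = Polynomial.order 0 q"
  have "a \<le> m" "q \<noteq> 0" using a by (auto simp: a_def)
  obtain r where r: "q = [:- 0, 1:] ^ a * r" "\<not> [:- 0, 1:] dvd r"
    using order_decomp[OF \<open>q \<noteq> 0\<close>, of 0] a_def by blast
  obtain C where C: "\<And>t. norm t \<le> 1 \<Longrightarrow> norm (poly q t) \<le> C * norm t ^ Suc m"
    using assms unfolding vanish_def by blast
  have C0: "C \<ge> 0" using C[of 1] by (simp add: order.trans[OF norm_ge_zero])
  have *: "norm (poly r t) \<le> C * norm t" if "norm t \<le> 1" "t \<noteq> 0" for t
  proof -
    have "norm t ^ a * norm (poly r t) \<le> C * norm t ^ Suc m" using C[OF that(1)] by (simp add: r norm_mult norm_power)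
    also have "\<dots> \<le> C * norm t ^ Suc a"
      using \<open>a \<le> m\<close> that(1) C0 by (intro mult_left_mono power_decreasing) auto
    finally have "norm t ^ a * norm (poly r t) \<le> norm t ^ a * (C * norm t)" by (simp add: mult_ac)
    thus ?thesis using that(2) by (simp)
  qed
  have "((\<lambda>t. C * norm t) \<longlongrightarrow> 0) (at (0::complex))"
    by (intro tendsto_eq_intros refl) auto
  moreover have "\<forall>\<^sub>F t in at 0. norm (poly r t) \<le> C * norm t"
    unfolding eventually_at by (intro exI[of _ 1]) (auto intro!: *)
  ultimately have "(poly r \<longlongrightarrow> 0) (at 0)" by (rule Lim_null_comparison[rotated])
  moreover have "(poly r \<longlongrightarrow> poly r 0) (at 0)" using poly_isCont isContD by blast
  ultimately have "poly r 0 = 0" using tendsto_unique by (metis at_neq_bot)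
  thus False using r(2) by (simp add: poly_eq_0_iff_dvd)
qed

lemma vanish_along_line:
  assumes "polynomial_fun \<eta>" "\<eta> z = 0" shows "vanish m (\<lambda>t. \<eta> (z + t *s v) ^ m)"
proof -
  obtain q where q: "\<And>t. \<eta> (z + t *s v) = poly q t"
    using polynomial_fun_line_poly[OF assms(1)] by blast
  have "poly q 0 = 0" using q[of 0] assms(2) by simp
  then obtain r where r: "q = [:0, 1:] * r" using poly_eq_0_iff_dvd[of q 0] by (auto elim: dvdE)
  have "vanish m (\<lambda>t. poly r t ^ m * t ^ m)"
    by (intro vanish_mult_left continuous_intros) (auto simp: vanish_def norm_power intro: exI[of _ 1])
  thus ?thesis by (simp add: q r power_mult_distrib mult_ac)
qed

text \<open>Controls the gradient along the line rather than the function itself: two maps whose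
  components differ by flat functions have Jacobian determinants that agree to order
  \<open>m\<close> there.\<close>

definition flat :: "nat \<Rightarrow> complex^'n \<Rightarrow> complex^'n \<Rightarrow> (complex^'n \<Rightarrow> complex) \<Rightarrow> bool" where
  "flat m z0 v f \<longleftrightarrow> (\<exists>f'. (\<forall>z. (f has_derivative (\<lambda>h. \<Sum>i\<in>UNIV. f' i z * h $ i)) (at z)) \<and>
     (\<forall>i. vanish m (\<lambda>t. f' i (z0 + t *s v))))"

lemma flat_0 [simp]: "flat m z0 v (\<lambda>_. 0)"
  unfolding flat_def by (intro exI[of _ "\<lambda>_ _. 0"]) auto

lemma flat_add: assumes "flat m z0 v f" "flat m z0 v g" shows "flat m z0 v (\<lambda>z. f z + g z)"
proof -
  obtain f' g' where *: "\<And>z. (f has_derivative (\<lambda>h. \<Sum>i\<in>UNIV. f' i z * h $ i)) (at z)"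
    "\<And>z. (g has_derivative (\<lambda>h. \<Sum>i\<in>UNIV. g' i z * h $ i)) (at z)"
    "\<And>i. vanish m (\<lambda>t. f' i (z0 + t *s v))" "\<And>i. vanish m (\<lambda>t. g' i (z0 + t *s v))"
    using assms unfolding flat_def by blast
  show ?thesis unfolding flat_def
  proof (intro exI[of _ "\<lambda>i z. f' i z + g' i z"] conjI allI)
    fix z show "((\<lambda>z. f z + g z) has_derivative (\<lambda>h. \<Sum>i\<in>UNIV. (f' i z + g' i z) * h $ i)) (at z)"
      by (rule has_derivative_eq_rhs[OF has_derivative_add[OF *(1,2)]]) (simp add: fun_eq_iff sum.distrib distrib_right)
  qed (rule vanish_add[OF *(3,4)])
qed

lemma flat_sum: "(\<And>x. x \<in> X \<Longrightarrow> flat m z0 v (f x)) \<Longrightarrow> flat m z0 v (\<lambda>z. \<Sum>x\<in>X. f x z)"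
proof (induction X rule: infinite_finite_induct)
  case (insert x F)
  have "flat m z0 v (\<lambda>z. f x z + (\<Sum>x\<in>F. f x z))" by (intro flat_add insert) auto
  thus ?case using insert by simp
qed simp_all

text \<open>Differentiation costs one power, so every partial derivative still contains
  \<open>\<eta> ^ m\<close>, and \<eta> has a zero at parameter 0.\<close>

lemma flat_power_mult:
  assumes "polynomial_fun \<eta>" "\<eta> z0 = 0" "polynomial_fun r"
  shows "flat m z0 v (\<lambda>z. \<eta> z ^ Suc m * r z)"
proof -
  obtain \<eta>' where 1: "\<And>i. polynomial_fun (\<eta>' i)"
    "\<And>z. (\<eta> has_derivative (\<lambda>h. \<Sum>i\<in>UNIV. \<eta>' i z * h $ i)) (at z)"
    using polynomial_fun_has_derivative[OF assms(1)] by blast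
  obtain r' where 2: "\<And>i. polynomial_fun (r' i)"
    "\<And>z. (r has_derivative (\<lambda>h. \<Sum>i\<in>UNIV. r' i z * h $ i)) (at z)"
    using polynomial_fun_has_derivative[OF assms(3)] by blast
  note * = 1(1) 2(1) 1(2) 2(2)
  let ?g = "\<lambda>i z. of_nat (Suc m) * \<eta>' i z * r z + \<eta> z * r' i z"
  have g: "polynomial_fun (?g i)" for i
    by (intro polynomial_fun_add polynomial_fun_mult *(1,2) assms(1,3) polynomial_fun_const)
  show ?thesis unfolding flat_def
  proof (intro exI[of _ "\<lambda>i z. ?g i z * \<eta> z ^ m"] conjI allI)
    fix z
    have "((\<lambda>z. \<eta> z ^ Suc m) has_derivative (\<lambda>h. of_nat (Suc m) * (\<Sum>i\<in>UNIV. \<eta>' i z * h $ i) * \<eta> z ^ m)) (at z)"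
      using has_derivative_power[OF *(3), where n = "Suc m"] by (simp add: mult_ac)
    from has_derivative_mult[OF this *(4)]
    show "((\<lambda>z. \<eta> z ^ Suc m * r z) has_derivative (\<lambda>h. \<Sum>i\<in>UNIV. (?g i z * \<eta> z ^ m) * h $ i)) (at z)"
      by (rule has_derivative_eq_rhs)
        (simp add: fun_eq_iff sum_distrib_left sum_distrib_right sum.distrib[symmetric] algebra_simps)
  next
    fix i
    have "continuous_on (cball 0 1) (\<lambda>t. ?g i (z0 + t *s v))"
      by (rule continuous_on_compose2[OF polynomial_fun_continuous_on[OF g, of UNIV]]) (auto intro!: continuous_intros)
    thus "vanish m (\<lambda>t. ?g i (z0 + t *s v) * \<eta> (z0 + t *s v) ^ m)"
      by (intro vanish_mult_left vanish_along_line assms)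
  qed
qed

text \<open>For each point to be avoided, one coordinate in which it differs from \<open>y0\<close>
  yields an affine factor, normalised to 1 at \<open>y0\<close>.\<close>

lemma polynomial_fun_separation:
  fixes y0 :: "complex^'n"
  assumes "finite Y" "y0 \<notin> Y"
  shows "\<exists>q. polynomial_fun q \<and> q y0 = 1 \<and> (\<forall>y\<in>Y. q y = 0)"
proof -
  have "\<forall>y\<in>Y. \<exists>i. y0 $ i \<noteq> y $ i" using assms(2) by (metis vec_eq_iff)
  then obtain k where k: "\<And>y. y \<in> Y \<Longrightarrow> y0 $ k y \<noteq> y $ k y" by metis
  define q where "q z = (\<Prod>y\<in>Y. (z $ k y - y $ k y) * inverse (y0 $ k y - y $ k y))" for z
  have "polynomial_fun q" unfolding q_def
    by (intro polynomial_fun_prod polynomial_fun_mult polynomial_fun_diff polynomial_fun_const polynomial_fun_coord)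
  moreover have "q y0 = 1" unfolding q_def using k by (intro prod.neutral) auto
  moreover have "q y = 0" if "y \<in> Y" for y unfolding q_def using assms(1) that by (intro prod_zero) auto
  ultimately show ?thesis by blast
qed

section \<open>Relative invariants are divisible by the Jacobian\<close>

text \<open>Over the complex numbers a common root can be split off from both polynomials until the
  divisor is constant.\<close>

lemma poly_dvd_if_order_le:
  fixes p q :: "complex poly"
  assumes "p \<noteq> 0" "\<And>x. q = 0 \<or> Polynomial.order x p \<le> Polynomial.order x q" shows "p dvd q"
  using assms
proof (induction "degree p" arbitrary: p q)
  case 0
  then obtain c where "p = [:c:]" "c \<noteq> 0" using degree_eq_zeroE by (metis pCons_eq_0_iff)
  thus ?case by (simp add: const_poly_dvd_iff dvd_field_iff)
next
  case (Suc n)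
  show ?case
  proof (cases "q = 0")
    case False
    obtain x where x: "poly p x = 0"
      using fundamental_theorem_of_algebra_alt[of p] Suc(2) by (metis degree_pCons_0 nat.distinct(1))
    then obtain p1 where p1: "p = [:-x, 1:] * p1" using poly_eq_0_iff_dvd by (meson dvdE)
    have "Polynomial.order x p \<noteq> 0" using x Suc(3) order_root by blast
    hence "Polynomial.order x q \<noteq> 0" using Suc(4)[of x] False by simp
    hence "[:-x, 1:] dvd q" using order_root poly_eq_0_iff_dvd by blast
    then obtain q1 where q1: "q = [:-x, 1:] * q1" by (rule dvdE)
    have nz: "p1 \<noteq> 0" "q1 \<noteq> 0" using False Suc(3) p1 q1 by auto
    have "degree p = degree [:-x, 1:] + degree p1" unfolding p1 by (rule degree_mult_eq) (use nz(1) in auto)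
    hence "n = degree p1" using Suc(2) by simp
    moreover have "Polynomial.order y p1 \<le> Polynomial.order y q1" for y
    proof -
      have "Polynomial.order y p = Polynomial.order y [:-x, 1:] + Polynomial.order y p1"
        using order_mult[of "[:-x, 1:]" p1 y] Suc(3) p1 by metis
      moreover have "Polynomial.order y q = Polynomial.order y [:-x, 1:] + Polynomial.order y q1"
        using order_mult[of "[:-x, 1:]" q1 y] False q1 by metis
      ultimately show ?thesis using Suc(4)[of y] False by simp
    qed
    ultimately have "p1 dvd q1" using Suc(1) nz by blast
    thus ?thesis unfolding p1 q1 by (rule mult_dvd_mono[OF dvd_refl])
  qed auto
qed

lemma order_pcompose_shift:
  fixes p :: "complex poly"
  assumes "p \<noteq> 0" shows "Polynomial.order 0 (pcompose p [:x, 1:]) = Polynomial.order x p"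
proof -
  define k where "k = Polynomial.order x p"
  obtain r where r: "p = [:-x, 1:] ^ k * r" "\<not> [:-x, 1:] dvd r"
    using order_decomp[OF assms, of x] k_def by blast
  have "pcompose (a ^ k) b = pcompose a b ^ k" for a b :: "complex poly"
    by (induction k) (simp_all add: pcompose_mult pcompose_1)
  hence "pcompose ([:-x, 1:] ^ k) [:x, 1:] = [:0, 1:] ^ k" by (simp add: pcompose_pCons)
  hence e: "pcompose p [:x, 1:] = [:-0, 1:] ^ k * pcompose r [:x, 1:]"
    unfolding r(1) by (simp add: pcompose_mult)
  have nz: "poly (pcompose r [:x, 1:]) 0 \<noteq> 0" using r(2) by (simp add: poly_pcompose poly_eq_0_iff_dvd)
  show ?thesis unfolding k_def[symmetric]
  proof (rule order_unique_lemma)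
    show "[:- 0, 1:] ^ k dvd pcompose p [:x, 1:]" unfolding e by simp
    show "\<not> [:- 0, 1:] ^ Suc k dvd pcompose p [:x, 1:]"
    proof
      assume "[:- 0, 1:] ^ Suc k dvd pcompose p [:x, 1:]"
      hence "[:- 0, 1:] ^ k * [:- 0, 1:] dvd [:- 0, 1:] ^ k * pcompose r [:x, 1:]"
        unfolding e by (simp add: mult_ac)
      hence "[:- 0, 1:] dvd pcompose r [:x, 1:]" by (subst (asm) dvd_mult_cancel_left) auto
      thus False using nz poly_eq_0_iff_dvd by blast
    qed
  qed
qed

text \<open>Long division divides only by the leading coefficient of the divisor. As that is the
  constant \<beta>, the coefficients of the quotient remain polynomial in the parameter
  \<open>z\<close>.\<close>

lemma polynomial_fun_coeff_div:
  fixes q b :: "complex^'n \<Rightarrow> complex poly"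
  assumes "\<And>z i. i \<ge> m \<Longrightarrow> coeff (q z) i = 0"
    and "\<And>i. polynomial_fun (\<lambda>z. coeff (q z) i)" "\<And>i. polynomial_fun (\<lambda>z. coeff (b z) i)"
    and "\<And>z. degree (b z) = N" "\<And>z. coeff (b z) N = \<beta>" "\<beta> \<noteq> 0"
  shows "polynomial_fun (\<lambda>z. coeff (q z div b z) i)"
  using assms(1,2)
proof (induction m arbitrary: q i)
  case 0
  hence "q z = 0" for z by (simp add: poly_eq_iff)
  thus ?case by simp
next
  case (Suc m)
  have bnz: "b z \<noteq> 0" for z using assms(5,6) by (metis coeff_0)
  show ?case
  proof (cases "m < N")
    case True
    have "q z div b z = 0" for z
    proof (rule div_poly_less)
      have "degree (q z) \<le> m" by (rule degree_le) (use Suc(2) in auto)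
      thus "degree (q z) < degree (b z)" using True assms(4) by simp
    qed
    thus ?thesis by simp
  next
    case False
    \<comment> \<open>One step of long division: the coefficient of index \<open>m\<close> cancels,
      so the induction hypothesis applies to \<open>q1\<close>.\<close>
    define q1 where "q1 z = q z - monom (coeff (q z) m / \<beta>) (m - N) * b z" for z
    have q1: "q z div b z = monom (coeff (q z) m / \<beta>) (m - N) + q1 z div b z" for z
      using div_mult_self3[OF bnz, of "monom (coeff (q z) m / \<beta>) (m - N)" z "q1 z"]
      by (simp add: q1_def)
    have c: "coeff (monom (coeff (q z) m / \<beta>) (m - N) * b z) j
       = (if j \<ge> m - N then (coeff (q z) m / \<beta>) * coeff (b z) (j - (m - N)) else 0)" for z j
      by (simp add: coeff_monom_mult)
    have pf: "polynomial_fun (\<lambda>z. coeff (monom (coeff (q z) m / \<beta>) (m - N) * b z) j)" for j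
      unfolding c
      by (cases "j \<ge> m - N") (auto simp: divide_inverse intro!: polynomial_fun_mult Suc(3) assms(3))
    have "polynomial_fun (\<lambda>z. coeff (q1 z div b z) i)"
    proof (rule Suc.IH)
      fix z j assume j: "m \<le> j"
      show "coeff (q1 z) j = 0"
      proof (cases "j = m")
        case True
        thus ?thesis using False assms(5,6) by (simp add: q1_def c)
      next
        case neq: False
        have "coeff (b z) (j - (m - N)) = 0"
          by (rule coeff_eq_0) (use neq j False assms(4) in simp)
        thus ?thesis using Suc(2)[of j z] j neq by (simp add: q1_def c)
      qed
    next
      fix j show "polynomial_fun (\<lambda>z. coeff (q1 z) j)"
        unfolding q1_def coeff_diff by (intro polynomial_fun_diff Suc(3) pf)
    qed
    moreover have "polynomial_fun (\<lambda>z. coeff (monom (coeff (q z) m / \<beta>) (m - N)) i)"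
      unfolding coeff_monom
      by (cases "m - N = i") (auto simp: divide_inverse intro!: polynomial_fun_mult Suc(3))
    ultimately show ?thesis unfolding q1 coeff_add by (rule polynomial_fun_add[rotated])
  qed
qed

section \<open>The group action and the Jacobian of the basic invariants\<close>

locale invariant_quotient =
  fixes G :: "(complex^'n^'n) set" and \<theta> :: "complex^'n \<Rightarrow> complex^'n" and k :: "'n \<Rightarrow> nat"
  assumes finite_G: "finite G" and one_mem: "mat 1 \<in> G"
    and mult_mem: "g \<in> G \<Longrightarrow> h \<in> G \<Longrightarrow> g ** h \<in> G"
    and invertible_mem: "g \<in> G \<Longrightarrow> invertible g"
    and theta_map: "polynomial_map \<theta>"
    and theta_homogeneous: "\<theta> (c *s z) $ j = c ^ k j * \<theta> z $ j"
    and theta_invariant: "g \<in> G \<Longrightarrow> \<theta> (g *v z) = \<theta> z"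
    and invariant_factor: "polynomial_fun p \<Longrightarrow> (\<And>g z. g \<in> G \<Longrightarrow> p (g *v z) = p z) \<Longrightarrow>
          \<exists>P. polynomial_fun P \<and> (\<forall>z. p z = P (\<theta> z))"
    and jacobian_nonzero: "\<exists>z. complex_jacobian \<theta> z \<noteq> 0"
begin

abbreviation J :: "complex^'n \<Rightarrow> complex" where "J \<equiv> complex_jacobian \<theta>"

lemma polynomial_fun_J: "polynomial_fun J"
  by (rule polynomial_fun_complex_jacobian[OF theta_map])

lemma inj_on_left_mult: assumes "g \<in> G" shows "inj ((**) g)"
proof -
  obtain h where h: "h ** g = mat 1" using invertible_mem[OF assms] unfolding invertible_def by blast
  show ?thesis by (rule injI) (metis h matrix_mul_assoc matrix_mul_lid)
qed

lemma inverse_mem: assumes "g \<in> G" shows "\<exists>h\<in>G. g ** h = mat 1 \<and> h ** g = mat 1"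
proof -
  have "(**) g ` G = G"
    by (rule endo_inj_surj) (use finite_G assms mult_mem inj_on_left_mult[OF assms] in \<open>auto intro: inj_on_subset\<close>)
  then obtain h where "h \<in> G" "mat 1 = g ** h" using one_mem by blast
  thus ?thesis by (metis matrix_left_right_inverse)
qed

lemma bij_betw_right_mult: assumes "g \<in> G" shows "bij_betw (\<lambda>h. h ** g) G G"
proof -
  obtain g' where g': "g' \<in> G" "g ** g' = mat 1" "g' ** g = mat 1" using inverse_mem[OF assms] by blast
  show ?thesis
    by (rule bij_betw_byWitness[where f' = "\<lambda>h. h ** g'"])
      (use g' assms mult_mem in \<open>auto simp flip: matrix_mul_assoc\<close>)
qed

lemma sum_group_right: "g \<in> G \<Longrightarrow> (\<Sum>h\<in>G. f (h ** g)) = (\<Sum>h\<in>G. f h)"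
  by (rule sum.reindex_bij_betw[OF bij_betw_right_mult])

lemma prod_group_right: "g \<in> G \<Longrightarrow> (\<Prod>h\<in>G. f (h ** g)) = (\<Prod>h\<in>G. f h)"
  by (rule prod.reindex_bij_betw[OF bij_betw_right_mult])

lemma det_nonzero: "g \<in> G \<Longrightarrow> det g \<noteq> 0"
  using invertible_mem invertible_det_nz by blast

text \<open>Chain rule for \<theta> composed with \<open>g\<close>, which is \<theta>. The relative
  invariants below are the polynomials with this same transformation law.\<close>

lemma J_skew: assumes "g \<in> G" shows "J (g *v z) * det g = J z"
proof -
  have "(\<lambda>z. \<theta> (g *v z)) = \<theta>" using theta_invariant[OF assms] by (simp add: fun_eq_iff)
  thus ?thesis
    using complex_jacobian_compose[OF polynomial_map_matrix theta_map, of g z] by (simp add: complex_jacobian_matrix)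
qed

text \<open>At a fixed point the chain rule reads \<open>D z ** g = D z\<close>; an invertible
  \<open>D z\<close> would force \<open>g\<close> to be the identity.\<close>

lemma J_zero_at_fixed_point:
  assumes "g \<in> G" "g \<noteq> mat 1" "g *v z = z" shows "J z = 0"
proof (rule ccontr)
  assume nz: "J z \<noteq> 0"
  obtain D where D: "\<And>z. (\<theta> has_derivative (*v) (D z)) (at z)"
    using polynomial_map_has_derivative[OF theta_map] by blast
  have "((*v) g has_derivative (*v) g) (at z)"
    by (intro bounded_linear_imp_has_derivative matrix_vector_mul_bounded_linear)
  from has_derivative_compose[OF this D]
  have "((\<lambda>z. \<theta> (g *v z)) has_derivative (\<lambda>h. D z *v (g *v h))) (at z)" using assms(3) by simp
  moreover have "(\<lambda>z. \<theta> (g *v z)) = \<theta>" using theta_invariant[OF assms(1)] by (simp add: fun_eq_iff)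
  ultimately have "(\<theta> has_derivative (\<lambda>h. D z *v (g *v h))) (at z)" by simp
  hence "(\<lambda>h. D z *v (g *v h)) = (*v) (D z)" using D has_derivative_unique by blast
  hence "D z *v (g *v h) = D z *v h" for h by (rule fun_cong)
  moreover have "invertible (D z)" using nz complex_jacobian_eq_det[OF D, of z] invertible_det_nz by metis
  then obtain E where "E ** D z = mat 1" unfolding invertible_def by blast
  ultimately have "g *v h = h" for h by (metis matrix_vector_mul_assoc matrix_vector_mul_lid)
  hence "g = mat 1" by (simp add: matrix_eq)
  thus False using assms(2) by simp
qed

text \<open>A cutoff polynomial that is nearly 1 at \<open>z0\<close> and nearly 0 at the other
  points of its orbit turns \<Phi> into a group average \<open>U\<close>. Being invariant,
  \<open>U\<close> factors through \<theta>, so its Jacobian is a multiple of \<open>J\<close>; near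
  \<open>z0\<close> only the stabiliser contributes, so \<open>U\<close> is close to \<Phi> times
  the size of the stabiliser. That factor occurs once per row of the determinant, whence the
  exponent.\<close>

lemma local_jacobian:
  assumes \<Phi>: "polynomial_map \<Phi>" and inv: "\<And>g z. g \<in> G \<Longrightarrow> g *v z0 = z0 \<Longrightarrow> \<Phi> (g *v z) = \<Phi> z"
  shows "\<exists>R. polynomial_fun R \<and> vanish m (\<lambda>t.
    of_nat (card {g\<in>G. g *v z0 = z0}) ^ CARD('n) * complex_jacobian \<Phi> (z0 + t *s v)
      - R (z0 + t *s v) * J (z0 + t *s v))"
proof -
  define \<Gamma> where "\<Gamma> = {g\<in>G. g *v z0 = z0}"
  have \<Gamma>: "finite \<Gamma>" "\<Gamma> \<subseteq> G" using finite_G by (auto simp: \<Gamma>_def)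
  have "finite ((\<lambda>g. g *v z0) ` (G - \<Gamma>))" "z0 \<notin> (\<lambda>g. g *v z0) ` (G - \<Gamma>)"
    using finite_G by (auto simp: \<Gamma>_def)
  from polynomial_fun_separation[OF this]
  obtain q where q: "polynomial_fun q" "q z0 = 1" "\<And>g. g \<in> G \<Longrightarrow> g \<notin> \<Gamma> \<Longrightarrow> q (g *v z0) = 0" by blast
  define n where "n = Suc m"
  \<comment> \<open>Divisible by \<open>q ^ n\<close>, while \<open>1 - p\<close> is the
    \<open>n\<close>-th power of a polynomial vanishing where \<open>q = 1\<close>: this gives
    contact of order \<open>n = m + 1\<close> with both values of the cutoff, one order being lost
    to differentiation.\<close>
  define p where "p z = 1 - (1 - q z ^ n) ^ n" for z
  have pp: "polynomial_fun p" unfolding p_def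
    by (intro polynomial_fun_diff polynomial_fun_power q(1) polynomial_fun_const)
  define U where "U z = (\<chi> j. \<Sum>g\<in>G. p (g *v z) * \<Phi> (g *v z) $ j)" for z
  have \<Phi>j: "polynomial_fun (\<lambda>z. \<Phi> z $ j)" for j using \<Phi> unfolding polynomial_map_def by blast
  have Uj: "polynomial_fun (\<lambda>z. U z $ j)" for j
    unfolding U_def vec_lambda_beta
    by (intro polynomial_fun_sum polynomial_fun_mult polynomial_fun_linear_compose[OF pp] polynomial_fun_linear_compose[OF \<Phi>j])
  have "\<exists>P. polynomial_fun P \<and> (\<forall>z. U z $ j = P (\<theta> z))" for j
  proof (rule invariant_factor[OF Uj])
    fix g z assume "g \<in> G"
    show "U (g *v z) $ j = U z $ j"
      using sum_group_right[OF \<open>g \<in> G\<close>, of "\<lambda>h. p (h *v z) * \<Phi> (h *v z) $ j"]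
      by (simp add: U_def matrix_vector_mul_assoc)
  qed
  then obtain P where P: "\<And>j. polynomial_fun (P j)" "\<And>j z. U z $ j = P j (\<theta> z)" by metis
  define V where "V \<zeta> = (\<chi> j. P j \<zeta>)" for \<zeta>
  have V: "polynomial_map V" using P(1) by (simp add: polynomial_map_def V_def)
  have U: "U = (\<lambda>z. V (\<theta> z))" by (simp add: V_def P(2) fun_eq_iff vec_eq_iff)
  have jU: "complex_jacobian U z = complex_jacobian V (\<theta> z) * J z" for z
    unfolding U by (rule complex_jacobian_compose[OF theta_map V])
  define R where "R z = complex_jacobian V (\<theta> z)" for z
  have R: "polynomial_fun R" unfolding R_def
    by (rule polynomial_fun_compose[OF polynomial_fun_complex_jacobian[OF V]]) (use theta_map polynomial_map_def in blast)
  \<comment> \<open>The error consists of \<open>(p - 1)\<close> times \<Phi> for elements of the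
    stabiliser and of the full term for all other elements. Each contains the power
    \<open>m + 1\<close> of a polynomial that vanishes at \<open>z0\<close>.\<close>
  have flatE: "flat m z0 v (\<lambda>z. U z $ j - of_nat (card \<Gamma>) * \<Phi> z $ j)" for j
  proof -
    have 1: "flat m z0 v (\<lambda>z. (1 - q (g *v z) ^ n) ^ Suc m * - (\<Phi> z $ j))" if "g \<in> \<Gamma>" for g
      by (rule flat_power_mult)
        (use that q(2) in \<open>auto simp: \<Gamma>_def intro!: polynomial_fun_diff polynomial_fun_power polynomial_fun_minus \<Phi>j
           polynomial_fun_linear_compose[OF q(1)]\<close>)
    have 2: "flat m z0 v (\<lambda>z. q (g *v z) ^ Suc m * ((\<Sum>i<n. (1 - q (g *v z) ^ n) ^ i) * \<Phi> (g *v z) $ j))" if "g \<in> G - \<Gamma>" for g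
      by (rule flat_power_mult)
        (use that q(3) in \<open>auto intro!: polynomial_fun_diff polynomial_fun_power polynomial_fun_mult polynomial_fun_sum
          polynomial_fun_linear_compose[OF \<Phi>j] polynomial_fun_linear_compose[OF q(1)]\<close>)
    have "flat m z0 v (\<lambda>z. (\<Sum>g\<in>\<Gamma>. (1 - q (g *v z) ^ n) ^ Suc m * - (\<Phi> z $ j)) +
        (\<Sum>g\<in>G - \<Gamma>. q (g *v z) ^ Suc m * ((\<Sum>i<n. (1 - q (g *v z) ^ n) ^ i) * \<Phi> (g *v z) $ j)))"
      by (intro flat_add flat_sum 1 2)
    moreover have "(\<Sum>g\<in>\<Gamma>. (1 - q (g *v z) ^ n) ^ Suc m * - (\<Phi> z $ j)) +
        (\<Sum>g\<in>G - \<Gamma>. q (g *v z) ^ Suc m * ((\<Sum>i<n. (1 - q (g *v z) ^ n) ^ i) * \<Phi> (g *v z) $ j))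
        = U z $ j - of_nat (card \<Gamma>) * \<Phi> z $ j" for z
    proof -
      have "U z $ j = (\<Sum>g\<in>G - \<Gamma>. p (g *v z) * \<Phi> (g *v z) $ j) + (\<Sum>g\<in>\<Gamma>. p (g *v z) * \<Phi> (g *v z) $ j)"
        unfolding U_def using sum.subset_diff[OF \<Gamma>(2) finite_G] by simp
      moreover have "(\<Sum>g\<in>\<Gamma>. p (g *v z) * \<Phi> (g *v z) $ j) =
          (\<Sum>g\<in>\<Gamma>. (1 - q (g *v z) ^ n) ^ Suc m * - (\<Phi> z $ j)) + of_nat (card \<Gamma>) * \<Phi> z $ j"
      proof -
        have "(\<Sum>g\<in>\<Gamma>. p (g *v z) * \<Phi> (g *v z) $ j) = (\<Sum>g\<in>\<Gamma>. (1 - q (g *v z) ^ n) ^ Suc m * - (\<Phi> z $ j) + \<Phi> z $ j)"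
          by (intro sum.cong) (auto simp: \<Gamma>_def inv p_def n_def algebra_simps)
        thus ?thesis by (simp add: sum.distrib sum_subtractf sum_negf)
      qed
      moreover have "p (g *v z) = q (g *v z) ^ Suc m * (\<Sum>i<n. (1 - q (g *v z) ^ n) ^ i)" for g
        unfolding p_def n_def[symmetric] using one_diff_power_eq[of "1 - q (g *v z) ^ n" n] by simp
      ultimately show ?thesis by (simp add: mult_ac)
    qed
    ultimately show ?thesis by simp
  qed
  obtain D where D: "\<And>i j. polynomial_fun (\<lambda>z. D z $ i $ j)" "\<And>z. (\<Phi> has_derivative (*v) (D z)) (at z)"
    using polynomial_map_has_derivative[OF \<Phi>] by blast
  obtain DU where DU: "\<And>i j. polynomial_fun (\<lambda>z. DU z $ i $ j)" "\<And>z. (U has_derivative (*v) (DU z)) (at z)"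
    using polynomial_map_has_derivative[of U] Uj unfolding polynomial_map_def by blast
  define c where "c = (of_nat (card \<Gamma>) :: complex)"
  have ent: "vanish m (\<lambda>t. DU (z0 + t *s v) $ i $ j - c * D (z0 + t *s v) $ i $ j)" for i j
  proof -
    obtain e where e: "\<And>z. ((\<lambda>z. U z $ i - c * \<Phi> z $ i) has_derivative (\<lambda>h. \<Sum>j\<in>UNIV. e j z * h $ j)) (at z)"
      "\<And>j. vanish m (\<lambda>t. e j (z0 + t *s v))" using flatE[of i] unfolding flat_def c_def by blast
    have "DU z $ i $ j - c * D z $ i $ j = e j z" for z
    proof -
      have u: "((\<lambda>z. U z $ i) has_derivative (\<lambda>h. (DU z *v h) $ i)) (at z)"
        using bounded_linear.has_derivative[OF bounded_linear_vec_nth DU(2)] .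
      have f: "((\<lambda>z. \<Phi> z $ i) has_derivative (\<lambda>h. (D z *v h) $ i)) (at z)"
        using bounded_linear.has_derivative[OF bounded_linear_vec_nth D(2)] .
      have "((\<lambda>z. U z $ i - c * \<Phi> z $ i) has_derivative (\<lambda>h. (DU z *v h) $ i - c * (D z *v h) $ i)) (at z)"
        by (intro has_derivative_diff u has_derivative_mult_right f)
      hence "(\<lambda>h. (DU z *v h) $ i - c * (D z *v h) $ i) = (\<lambda>h. \<Sum>j\<in>UNIV. e j z * h $ j)"
        using e(1) has_derivative_unique by blast
      hence "(DU z *v axis j 1) $ i - c * (D z *v axis j 1) $ i = (\<Sum>l\<in>UNIV. e l z * axis j 1 $ l)" by meson
      moreover have "(\<Sum>l\<in>UNIV. e l z * axis j 1 $ l) = e j z"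
        by (simp add: axis_def if_distrib[of "\<lambda>y. _ * y"] cong: if_cong)
      moreover have "(A *v axis j 1) $ i = A $ i $ j" for A :: "complex^'n^'n"
        by (simp add: matrix_vector_mult_def axis_def if_distrib[of "\<lambda>y. _ * y"] cong: if_cong)
      ultimately show ?thesis by simp
    qed
    thus ?thesis using e(2) by simp
  qed
  have cont: "continuous_on (cball 0 1) (\<lambda>t. f (z0 + t *s v))" if "polynomial_fun f" for f
    by (rule continuous_on_compose2[OF polynomial_fun_continuous_on[OF that, of UNIV]]) (auto intro!: continuous_intros)
  have "vanish m (\<lambda>t. det (\<chi> i j. c * D (z0 + t *s v) $ i $ j) - det (DU (z0 + t *s v)))"
  proof (rule vanish_det_diff)
    fix i j
    have "vanish m (\<lambda>t. (-1) * (DU (z0 + t *s v) $ i $ j - c * D (z0 + t *s v) $ i $ j))"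
      by (intro vanish_mult_left ent) auto
    thus "vanish m (\<lambda>t. (\<chi> i j. c * D (z0 + t *s v) $ i $ j) $ i $ j - DU (z0 + t *s v) $ i $ j)" by simp
  qed (use D(1) DU(1) in \<open>auto intro!: continuous_on_mult cont continuous_on_const\<close>)
  moreover have "det (\<chi> i j. c * A $ i $ j) = c ^ CARD('n) * det A" for A :: "complex^'n^'n"
  proof -
    have "(\<chi> i j. c * A $ i $ j) = (\<chi> i. c *s (A $ i))" by (simp add: vec_eq_iff)
    thus ?thesis using det_rows_mul[of "\<lambda>_. c" "($) A"] by simp
  qed
  moreover have "det (DU z) = R z * J z" for z
    using complex_jacobian_eq_det[OF DU(2), of z] jU by (simp add: R_def)
  moreover have "det (D z) = complex_jacobian \<Phi> z" for z
    using complex_jacobian_eq_det[OF D(2), of z] by simp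
  ultimately show ?thesis using R unfolding c_def \<Gamma>_def by auto
qed

text \<open>Where the stabiliser of \<open>z0\<close> fixes a hyperplane complementary to \<open>v\<close> pointwise, integrating a
  relative invariant \<open>F\<close> in the direction of the common eigenvector \<open>n\<close> of the stabiliser produces
  a polynomial map with Jacobian \<open>F\<close> which is invariant under the stabiliser.\<close>

lemma skew_eq_jacobian:
  fixes z0 v :: "complex^'n"
  defines "\<Gamma> \<equiv> {g\<in>G. g *v z0 = z0}"
  assumes F: "polynomial_fun F" "\<And>g z. g \<in> G \<Longrightarrow> F (g *v z) * det g = F z"
    and v: "g0 \<in> \<Gamma>" "g0 *v v \<noteq> v"
    and split: "\<And>z. \<exists>y s. (\<forall>g\<in>\<Gamma>. g *v y = y) \<and> z = y + s *s v"
  shows "\<exists>\<Phi>. polynomial_map \<Phi> \<and> (\<forall>g\<in>\<Gamma>. \<forall>z. \<Phi> (g *v z) = \<Phi> z) \<and> (\<forall>z. complex_jacobian \<Phi> z = F z)"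
proof -
  have \<Gamma>: "finite \<Gamma>" "\<Gamma> \<subseteq> G" "mat 1 \<in> \<Gamma>" using finite_G one_mem by (auto simp: \<Gamma>_def)
  have \<Gamma>mult: "g ** h \<in> \<Gamma>" if "g \<in> \<Gamma>" "h \<in> \<Gamma>" for g h
    using that mult_mem by (auto simp: \<Gamma>_def simp flip: matrix_vector_mul_assoc)
  have card: "of_nat (card \<Gamma>) \<noteq> (0::complex)" using \<Gamma> by auto
  have right: "bij_betw (\<lambda>h. h ** g) \<Gamma> \<Gamma>" and left: "bij_betw ((**) g) \<Gamma> \<Gamma>" if "g \<in> \<Gamma>" for g
  proof -
    have "inj_on (\<lambda>h. h ** g) \<Gamma>"
      using bij_betw_right_mult[of g] that \<Gamma>(2) by (meson bij_betw_def inj_on_subset subsetD)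
    moreover have "inj_on ((**) g) \<Gamma>"
      using inj_on_left_mult[of g] that \<Gamma>(2) by (meson inj_on_subset subsetD top_greatest)
    ultimately show "bij_betw (\<lambda>h. h ** g) \<Gamma> \<Gamma>" "bij_betw ((**) g) \<Gamma> \<Gamma>"
      using endo_inj_surj[OF \<Gamma>(1)] \<Gamma>mult that by (simp_all add: bij_betw_def image_subset_iff)
  qed
  \<comment> \<open>Averaging over \<Gamma> is the projection onto its common fixed space.\<close>
  define \<pi> where "\<pi> z = inverse (of_nat (card \<Gamma>)) *s (\<Sum>g\<in>\<Gamma>. g *v z)" for z :: "complex^'n"
  have \<pi>add: "\<pi> (x + y) = \<pi> x + \<pi> y" for x y
    by (simp add: \<pi>_def matrix_vector_right_distrib sum.distrib vector_add_ldistrib)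
  have \<pi>scale: "\<pi> (c *s x) = c *s \<pi> x" for c x
    by (simp add: \<pi>_def vector_scalar_commute sum_distrib_left vec_eq_iff mult_ac)
  have \<pi>g: "\<pi> (g *v z) = \<pi> z" if "g \<in> \<Gamma>" for g z
    unfolding \<pi>_def matrix_vector_mul_assoc
    using sum.reindex_bij_betw[OF right[OF that], of "\<lambda>h. h *v z"] by simp
  have g\<pi>: "g *v \<pi> z = \<pi> z" if "g \<in> \<Gamma>" for g z
  proof -
    have "g *v \<pi> z = inverse (of_nat (card \<Gamma>)) *s (\<Sum>h\<in>\<Gamma>. g *v (h *v z))"
      by (simp add: \<pi>_def vector_scalar_commute vec.sum)
    also have "\<dots> = \<pi> z"
      unfolding \<pi>_def matrix_vector_mul_assoc
      using sum.reindex_bij_betw[OF left[OF that], of "\<lambda>h. h *v z"] by simp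
    finally show ?thesis .
  qed
  have \<pi>fix: "\<pi> y = y" if "\<And>g. g \<in> \<Gamma> \<Longrightarrow> g *v y = y" for y
    using that card by (simp add: \<pi>_def vec_eq_iff)
  \<comment> \<open>The part of \<open>v\<close> killed by the projection; it is nonzero because
    \<open>g0\<close> moves \<open>v\<close>. By \<open>split\<close> it spans the kernel of the
    projection, which makes it a common eigenvector of \<Gamma>.\<close>
  define n where "n = v - \<pi> v"
  have \<pi>n: "\<pi> n = 0"
  proof -
    have "\<pi> v = \<pi> n + \<pi> (\<pi> v)" unfolding n_def by (simp flip: \<pi>add)
    moreover have "\<pi> (\<pi> v) = \<pi> v" by (intro \<pi>fix g\<pi>)
    ultimately show ?thesis by simp
  qed
  have "n \<noteq> 0" using v g\<pi>[of g0 v] by (auto simp: n_def)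
  then obtain l where l: "n $ l \<noteq> 0" by (auto simp: vec_eq_iff)
  \<comment> \<open>The coordinate of \<open>z\<close> along \<open>n\<close>, read off from one
    component in which \<open>n\<close> does not vanish.\<close>
  define \<alpha> where "\<alpha> z = (z $ l - \<pi> z $ l) * inverse (n $ l)" for z
  have dec: "z = \<pi> z + \<alpha> z *s n" for z
  proof -
    obtain y s where y: "\<And>g. g \<in> \<Gamma> \<Longrightarrow> g *v y = y" "z = y + s *s v" using split[of z] by blast
    have "\<pi> z = y + s *s \<pi> v" using y \<pi>fix[of y] by (simp add: \<pi>add \<pi>scale)
    hence e: "z - \<pi> z = s *s n" using y(2) by (simp add: n_def vector_ssub_ldistrib)
    hence "z $ l - \<pi> z $ l = s * n $ l" by (metis vector_minus_component vector_smult_component)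
    hence "\<alpha> z = s" using l by (simp add: \<alpha>_def)
    thus ?thesis using e by (simp add: algebra_simps)
  qed
  have \<alpha>add: "\<alpha> (x + y) = \<alpha> x + \<alpha> y" for x y by (simp add: \<alpha>_def \<pi>add algebra_simps)
  have \<alpha>scale: "\<alpha> (c *s x) = c * \<alpha> x" for c x by (simp add: \<alpha>_def \<pi>scale algebra_simps)
  have \<alpha>n: "\<alpha> n = 1" using l by (simp add: \<alpha>_def \<pi>n)
  have \<alpha>0: "\<alpha> 0 = 0" using \<alpha>scale[of 0 0] by simp
  define a where "a j = \<alpha> (axis j 1)" for j
  have \<alpha>a: "\<alpha> x = (\<Sum>j\<in>UNIV. a j * x $ j)" for x
  proof -
    have "\<alpha> (\<Sum>j\<in>S. x $ j *s axis j 1) = (\<Sum>j\<in>S. a j * x $ j)" for S :: "'n set"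
      by (induction S rule: infinite_finite_induct) (simp_all add: \<alpha>0 \<alpha>add \<alpha>scale a_def)
    thus ?thesis by (metis basis_expansion)
  qed
  define \<kappa> where "\<kappa> g = \<alpha> (g *v n)" for g
  have gn: "g *v n = \<kappa> g *s n" if "g \<in> \<Gamma>" for g
    using dec[of "g *v n"] \<pi>g[OF that] \<pi>n by (simp add: \<kappa>_def)
  have gz: "g *v z = \<pi> z + (\<kappa> g * \<alpha> z) *s n" if "g \<in> \<Gamma>" for g z
  proof -
    have "g *v z = g *v (\<pi> z + \<alpha> z *s n)" using dec[of z] by simp
    also have "\<dots> = \<pi> z + \<alpha> z *s (g *v n)"
      using g\<pi>[OF that] by (simp add: matrix_vector_right_distrib vector_scalar_commute)
    finally show ?thesis using gn[OF that] by (simp add: vector_smult_assoc mult_ac)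
  qed
  have \<alpha>g: "\<alpha> (g *v z) = \<kappa> g * \<alpha> z" if "g \<in> \<Gamma>" for g z
  proof -
    have "\<alpha> (\<pi> z) = 0" using \<pi>fix[of "\<pi> z"] g\<pi> by (simp add: \<alpha>_def)
    thus ?thesis unfolding gz[OF that] by (simp add: \<alpha>add \<alpha>scale \<alpha>n)
  qed
  \<comment> \<open>An element of \<Gamma> fixes a hyperplane pointwise and scales \<open>n\<close>,
    so it is a rank one perturbation of the identity.\<close>
  have det: "det g = \<kappa> g" if "g \<in> \<Gamma>" for g
  proof -
    have "g *v x = (mat 1 + (\<chi> i j. n $ i * ((\<kappa> g - 1) * a j))) *v x" for x
    proof -
      have "(mat 1 + (\<chi> i j. n $ i * ((\<kappa> g - 1) * a j))) *v x = x + ((\<kappa> g - 1) * \<alpha> x) *s n"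
        unfolding \<alpha>a by (simp add: matrix_vector_mult_add_rdistrib)
          (simp add: matrix_vector_mult_def vec_eq_iff sum_distrib_left sum_distrib_right mult_ac)
      also have "\<dots> = g *v x"
        unfolding gz[OF that] by (subst (1) dec) (simp add: vec_eq_iff algebra_simps)
      finally show ?thesis by simp
    qed
    hence "g = mat 1 + (\<chi> i j. n $ i * (\<chi> j. (\<kappa> g - 1) * a j) $ j)" by (simp add: matrix_eq)
    hence "det g = det (mat 1 + (\<chi> i j. n $ i * (\<chi> j. (\<kappa> g - 1) * a j) $ j))" by (rule arg_cong)
    also have "\<dots> = 1 + (\<Sum>j\<in>UNIV. (\<chi> j. (\<kappa> g - 1) * a j) $ j * n $ j)"
      by (rule det_identity_plus_rank_one)
    also have "(\<Sum>j\<in>UNIV. (\<chi> j. (\<kappa> g - 1) * a j) $ j * n $ j) = (\<kappa> g - 1) * \<alpha> n"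
      unfolding \<alpha>a by (simp add: sum_distrib_left mult_ac)
    finally show ?thesis by (simp add: \<alpha>n)
  qed
  obtain q M where q: "\<And>i. polynomial_fun (\<lambda>z. coeff (q z) i)" "\<And>z. degree (q z) \<le> M"
    "\<And>z t. F (z + t *s n) = poly (q z) t"
    using polynomial_fun_along_line[OF F(1), of n] by blast
  \<comment> \<open>Relative invariance on the line through \<open>\<pi> z\<close>: the coefficient
    of index \<open>i\<close> can survive only if \<open>\<kappa> g ^ Suc i = 1\<close>. This
    shifted exponent is the one occurring in the antiderivative, which therefore becomes
    invariant.\<close>
  have qcoeff: "coeff (q (\<pi> z)) i * \<kappa> g ^ Suc i = coeff (q (\<pi> z)) i" if "g \<in> \<Gamma>" for g z i
  proof -
    have "poly (smult (\<kappa> g) (pcompose (q (\<pi> z)) [:0, \<kappa> g:])) t = poly (q (\<pi> z)) t" for t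
    proof -
      have "g *v (\<pi> z + t *s n) = \<pi> z + (\<kappa> g * t) *s n"
        using that by (simp add: matrix_vector_right_distrib vector_scalar_commute g\<pi> gn vector_smult_assoc mult_ac)
      hence "F (\<pi> z + (\<kappa> g * t) *s n) * \<kappa> g = F (\<pi> z + t *s n)"
        using F(2)[of g "\<pi> z + t *s n"] det[OF that] that \<Gamma>(2) by auto
      thus ?thesis by (simp add: q(3) poly_pcompose mult_ac)
    qed
    hence "smult (\<kappa> g) (pcompose (q (\<pi> z)) [:0, \<kappa> g:]) = q (\<pi> z)" by (simp add: poly_eq_poly_eq_iff[symmetric] fun_eq_iff)
    hence "coeff (smult (\<kappa> g) (pcompose (q (\<pi> z)) [:0, \<kappa> g:])) i = coeff (q (\<pi> z)) i" by simp
    thus ?thesis by (simp add: coeff_pcompose_linear mult_ac)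
  qed
  \<comment> \<open>The antiderivative of \<open>F\<close> in the direction \<open>n\<close> that
    vanishes on the fixed hyperplane.\<close>
  define u where "u z = (\<Sum>i\<le>M. coeff (q (\<pi> z)) i * \<alpha> z ^ Suc i * inverse (of_nat (Suc i)))" for z
  have \<pi>poly: "polynomial_fun (\<lambda>z. \<pi> z $ i)" for i
    by (auto simp: \<pi>_def intro!: polynomial_fun_mult polynomial_fun_sum)
  have \<alpha>poly: "polynomial_fun \<alpha>"
    unfolding \<alpha>_def by (intro polynomial_fun_mult polynomial_fun_diff polynomial_fun_coord \<pi>poly polynomial_fun_const)
  have upoly: "polynomial_fun u"
    unfolding u_def
    by (intro polynomial_fun_sum polynomial_fun_mult polynomial_fun_power \<alpha>poly polynomial_fun_const polynomial_fun_compose[OF q(1)] \<pi>poly)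
  have ug: "u (g *v z) = u z" if "g \<in> \<Gamma>" for g z
    unfolding u_def \<pi>g[OF that] \<alpha>g[OF that] power_mult_distrib
    using qcoeff[OF that, of z] by (intro sum.cong) (simp_all add: mult.assoc[symmetric])
  \<comment> \<open>Replaces the coordinate along \<open>n\<close> by \<open>u\<close> and keeps the
    fixed part; the Jacobian is then the derivative of \<open>u\<close> in the direction
    \<open>n\<close>, that is, \<open>F\<close>.\<close>
  define \<Phi> where "\<Phi> z = z + (u z - \<alpha> z) *s n" for z
  have "polynomial_map \<Phi>"
    unfolding polynomial_map_def \<Phi>_def
    by (auto intro!: polynomial_fun_add polynomial_fun_mult polynomial_fun_diff upoly \<alpha>poly)
  moreover have "\<Phi> (g *v z) = \<Phi> z" if "g \<in> \<Gamma>" for g z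
    unfolding \<Phi>_def ug[OF that] \<alpha>g[OF that]
    by (subst gz[OF that], subst (5) dec) (simp add: vec_eq_iff algebra_simps)
  moreover have "complex_jacobian \<Phi> z = F z" for z
  proof -
    obtain u' where u': "\<And>z. (u has_derivative (\<lambda>h. \<Sum>i\<in>UNIV. u' i z * h $ i)) (at z)"
      using polynomial_fun_has_derivative[OF upoly] by blast
    have d\<alpha>: "(\<alpha> has_derivative \<alpha>) (at z)"
    proof (rule bounded_linear_imp_has_derivative)
      have "\<alpha> = (\<lambda>x. \<Sum>j\<in>UNIV. a j * x $ j)" using \<alpha>a by blast
      thus "bounded_linear \<alpha>"
        by (auto intro!: bounded_linear_sum bounded_linear_const_mult bounded_linear_vec_nth)
    qed
    have "((\<lambda>z. \<Phi> z $ i) has_derivative (\<lambda>h. ((mat 1 + (\<chi> i j. n $ i * (\<chi> j. u' j z - a j) $ j)) *v h) $ i)) (at z)" for i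
    proof -
      have "((\<lambda>z. z $ i + (u z - \<alpha> z) * n $ i) has_derivative
          (\<lambda>h. h $ i + ((\<Sum>i\<in>UNIV. u' i z * h $ i) - \<alpha> h) * n $ i)) (at z)"
        by (intro has_derivative_add has_derivative_diff has_derivative_mult_left u' d\<alpha>
            bounded_linear_imp_has_derivative[OF bounded_linear_vec_nth])
      moreover have "h $ i + ((\<Sum>i\<in>UNIV. u' i z * h $ i) - \<alpha> h) * n $ i
          = ((mat 1 + (\<chi> i j. n $ i * (\<chi> j. u' j z - a j) $ j)) *v h) $ i" for h
        unfolding \<alpha>a matrix_vector_mult_add_rdistrib vector_add_component matrix_vector_mul_lid
        by (simp add: matrix_vector_mult_def sum_distrib_left sum_distrib_right sum_subtractf[symmetric] algebra_simps)
      ultimately show ?thesis unfolding \<Phi>_def vector_add_component vector_smult_component by simp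
    qed
    hence "(\<Phi> has_derivative (*v) (mat 1 + (\<chi> i j. n $ i * (\<chi> j. u' j z - a j) $ j))) (at z)"
      by (rule has_derivative_vec_componentwise)
    hence "complex_jacobian \<Phi> z = det (mat 1 + (\<chi> i j. n $ i * (\<chi> j. u' j z - a j) $ j))"
      by (rule complex_jacobian_eq_det)
    also have "\<dots> = 1 + (\<Sum>j\<in>UNIV. (\<chi> j. u' j z - a j) $ j * n $ j)"
      by (rule det_identity_plus_rank_one)
    also have "\<dots> = 1 + (\<Sum>j\<in>UNIV. u' j z * n $ j) - \<alpha> n"
      unfolding \<alpha>a by (simp add: left_diff_distrib sum_subtractf)
    finally have 1: "complex_jacobian \<Phi> z = (\<Sum>j\<in>UNIV. u' j z * n $ j)" by (simp add: \<alpha>n)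
    have line: "((\<lambda>s. z + s *s n) has_derivative (\<lambda>s. s *s n)) (at 0)"
    proof (rule has_derivative_vec_componentwise)
      fix i show "((\<lambda>s. (z + s *s n) $ i) has_derivative (\<lambda>s. (s *s n) $ i)) (at 0)"
        by (auto intro!: derivative_eq_intros)
    qed
    have "((\<lambda>s. u (z + s *s n)) has_derivative (\<lambda>s. \<Sum>i\<in>UNIV. u' i z * (s *s n) $ i)) (at 0)"
      using has_derivative_compose[OF line u'] by simp
    hence d1: "((\<lambda>s. u (z + s *s n)) has_field_derivative (\<Sum>j\<in>UNIV. u' j z * n $ j)) (at 0)"
      by (rule has_derivative_imp_has_field_derivative) (simp add: sum_distrib_left sum_distrib_right mult_ac)
    have us: "u (z + s *s n) = (\<Sum>i\<le>M. coeff (q (\<pi> z)) i * (\<alpha> z + s) ^ Suc i * inverse (of_nat (Suc i)))" for s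
      by (simp add: u_def \<pi>add \<pi>scale \<pi>n \<alpha>add \<alpha>scale \<alpha>n)
    have "((\<lambda>s. \<Sum>i\<le>M. coeff (q (\<pi> z)) i * (\<alpha> z + s) ^ Suc i * inverse (of_nat (Suc i))) has_field_derivative
       (\<Sum>i\<le>M. coeff (q (\<pi> z)) i * (of_nat (Suc i) * \<alpha> z ^ i) * inverse (of_nat (Suc i)))) (at 0)"
    proof (intro DERIV_sum DERIV_cmult_right DERIV_cmult)
      fix i
      show "((\<lambda>s. (\<alpha> z + s) ^ Suc i) has_field_derivative of_nat (Suc i) * \<alpha> z ^ i) (at 0)"
        using DERIV_power[OF DERIV_add[OF DERIV_const[of "\<alpha> z"] DERIV_ident], where n = "Suc i" and x = 0]
        by (simp del: power_Suc)
    qed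
    hence d2: "((\<lambda>s. u (z + s *s n)) has_field_derivative
       (\<Sum>i\<le>M. coeff (q (\<pi> z)) i * (of_nat (Suc i) * \<alpha> z ^ i) * inverse (of_nat (Suc i)))) (at 0)"
      unfolding us .
    have e: "coeff (q (\<pi> z)) i * (of_nat (Suc i) * \<alpha> z ^ i) * inverse (of_nat (Suc i)) = coeff (q (\<pi> z)) i * \<alpha> z ^ i" for i
      using of_nat_neq_0[of i, where 'a = complex] by (simp add: field_simps del: of_nat_Suc)
    have "(\<Sum>j\<in>UNIV. u' j z * n $ j) = (\<Sum>i\<le>M. coeff (q (\<pi> z)) i * \<alpha> z ^ i)"
      using DERIV_unique[OF d1 d2] unfolding e .
    also have "\<dots> = poly (q (\<pi> z)) (\<alpha> z)"
      unfolding poly_altdef by (rule sum.mono_neutral_right) (use q(2)[of "\<pi> z"] in \<open>auto simp: not_le coeff_eq_0\<close>)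
    also have "\<dots> = F z" using q(3)[of "\<pi> z" "\<alpha> z"] dec[of z] by simp
    finally show ?thesis using 1 by simp
  qed
  ultimately show ?thesis by blast
qed

text \<open>With \<Phi> of Jacobian \<open>F\<close>, a constant multiple of \<open>F\<close> agrees
  with a multiple of \<open>J\<close> on the line to one order more than the order of
  \<open>F\<close>. If \<open>J\<close> vanished to that higher order, so would \<open>F\<close>.
  For a trivial stabiliser the identity map plays the part of \<Phi> and shows that \<open>J\<close>
  does not vanish at \<open>z0\<close>.\<close>

lemma order_J_le_order_skew:
  assumes F: "polynomial_fun F" "\<And>g z. g \<in> G \<Longrightarrow> F (g *v z) * det g = F z" and v: "J v \<noteq> 0"
    and split: "\<And>z. \<exists>y s. (\<forall>g\<in>{g\<in>G. g *v z0 = z0}. g *v y = y) \<and> z = y + s *s v"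
    and pF: "\<And>t. F (z0 + t *s v) = poly pF t" "pF \<noteq> 0" and pJ: "\<And>t. J (z0 + t *s v) = poly pJ t"
  shows "Polynomial.order 0 pJ \<le> Polynomial.order 0 pF"
proof -
  define \<Gamma> where "\<Gamma> = {g\<in>G. g *v z0 = z0}"
  have \<Gamma>: "finite \<Gamma>" "mat 1 \<in> \<Gamma>" using finite_G one_mem by (auto simp: \<Gamma>_def)
  hence card: "of_nat (card \<Gamma>) \<noteq> (0::complex)" by auto
  define c where "c = (of_nat (card \<Gamma>) :: complex) ^ CARD('n)"
  have c: "c \<noteq> 0" using card by (simp add: c_def)
  show ?thesis
  proof (cases "\<Gamma> = {mat 1}")
    case True
    have "polynomial_map (\<lambda>z. z :: complex^'n)" by (auto simp: polynomial_map_def)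
    moreover have "g *v z = z" if "g \<in> G" "g *v z0 = z0" for g and z :: "complex^'n"
    proof -
      have "g \<in> \<Gamma>" using that by (simp add: \<Gamma>_def)
      thus ?thesis using True by simp
    qed
    ultimately have "\<exists>R. polynomial_fun R \<and> vanish 1 (\<lambda>t. c * complex_jacobian (\<lambda>z::complex^'n. z) (z0 + t *s v) - R (z0 + t *s v) * J (z0 + t *s v))"
      unfolding c_def \<Gamma>_def by (rule local_jacobian)
    then obtain R where R: "polynomial_fun R" "vanish 1 (\<lambda>t. c * complex_jacobian (\<lambda>z::complex^'n. z) (z0 + t *s v) - R (z0 + t *s v) * J (z0 + t *s v))"
      by blast
    have "complex_jacobian (\<lambda>z::complex^'n. z) z = 1" for z
    proof -
      have "(*v) (mat 1 :: complex^'n^'n) = (\<lambda>z. z)" by (simp add: fun_eq_iff)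
      thus ?thesis using complex_jacobian_matrix[of "mat 1 :: complex^'n^'n" z] by simp
    qed
    hence "\<exists>C. \<forall>t. norm t \<le> 1 \<longrightarrow> norm (c - R (z0 + t *s v) * J (z0 + t *s v)) \<le> C * norm t"
      using R(2) by (simp add: vanish_def)
    then obtain C where "\<And>t. norm t \<le> 1 \<Longrightarrow> norm (c - R (z0 + t *s v) * J (z0 + t *s v)) \<le> C * norm t" by blast
    from this[of 0] have "R z0 * J z0 = c" by simp
    hence "J z0 \<noteq> 0" using c by auto
    hence "poly pJ 0 \<noteq> 0" using pJ[of 0] by simp
    thus ?thesis using order_root[of pJ 0] by simp
  next
    case False
    then obtain g0 where g0: "g0 \<in> \<Gamma>" "g0 \<noteq> mat 1" using \<Gamma> by blast
    have "g0 *v v \<noteq> v" using J_zero_at_fixed_point[of g0 v] g0 v by (auto simp: \<Gamma>_def)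
    with skew_eq_jacobian[OF F, of g0 z0 v] g0(1) split
    obtain \<Phi> where \<Phi>: "polynomial_map \<Phi>" "\<And>g z. g \<in> G \<Longrightarrow> g *v z0 = z0 \<Longrightarrow> \<Phi> (g *v z) = \<Phi> z"
      "\<And>z. complex_jacobian \<Phi> z = F z" unfolding \<Gamma>_def by auto
    define m where "m = Suc (Polynomial.order 0 pF)"
    obtain R where R: "polynomial_fun R" "vanish m (\<lambda>t. c * F (z0 + t *s v) - R (z0 + t *s v) * J (z0 + t *s v))"
      using local_jacobian[OF \<Phi>(1,2), of z0 m v] unfolding \<Phi>(3) c_def \<Gamma>_def by auto
    obtain pR where pR: "\<And>t. R (z0 + t *s v) = poly pR t" using polynomial_fun_line_poly[OF R(1)] by blast
    show ?thesis
    proof (rule ccontr)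
      assume "\<not> ?thesis"
      hence "[:-0, 1:] ^ m dvd pJ" unfolding order_divides m_def by auto
      then obtain r where "pJ = [:-0, 1:] ^ m * r" by (rule dvdE)
      hence "poly pJ t = poly r t * t ^ m" for t by simp
      moreover have "vanish m (\<lambda>t. t ^ m)" by (auto simp: vanish_def norm_power intro: exI[of _ 1])
      ultimately have "vanish m (\<lambda>t. (poly pR t * poly r t) * t ^ m)"
        by (intro vanish_mult_left continuous_intros)
      hence "vanish m (\<lambda>t. R (z0 + t *s v) * J (z0 + t *s v))"
        by (simp add: pR pJ \<open>\<And>t. poly pJ t = poly r t * t ^ m\<close> mult_ac)
      from vanish_add[OF R(2) this] have "vanish m (\<lambda>t. c * poly pF t)" by (simp add: pF)
      hence "vanish m (\<lambda>t. inverse c * (c * poly pF t))" by (rule vanish_mult_left) auto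
      moreover have "(\<lambda>t. inverse c * (c * poly pF t)) = poly pF" using c by (simp add: fun_eq_iff)
      ultimately have vF: "vanish m (poly pF)" by (simp only:)
      from vanish_poly[OF vF[unfolded m_def]] pF(2) show False by simp
    qed
  qed
qed

text \<open>Each \<open>E \<Gamma>\<close> is a linear subspace and \<Gamma> ranges over finitely
  many sets, so the proper ones cover no open set. For a base point \<open>a\<close> outside them,
  the stabiliser of any point on the line through \<open>a\<close> in direction \<open>v\<close> has
  a fixed space that together with \<open>v\<close> spans everything.\<close>

lemma generic_base_points:
  fixes v :: "complex^'n"
  defines "E \<equiv> \<lambda>\<Gamma>. {z. \<exists>y s. (\<forall>g\<in>\<Gamma>. g *v y = y) \<and> z = y + s *s v}"
  shows "closure {a. \<forall>\<Gamma>\<subseteq>G. a \<in> E \<Gamma> \<longrightarrow> E \<Gamma> = UNIV} = UNIV"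
proof -
  have sub: "subspace (E \<Gamma>)" for \<Gamma>
  proof (rule subspaceI)
    show "0 \<in> E \<Gamma>" unfolding E_def by (auto intro!: exI[of _ 0])
    fix x y assume "x \<in> E \<Gamma>" "y \<in> E \<Gamma>"
    then obtain x' s y' t where "\<forall>g\<in>\<Gamma>. g *v x' = x'" "x = x' + s *s v" "\<forall>g\<in>\<Gamma>. g *v y' = y'" "y = y' + t *s v"
      unfolding E_def by blast
    thus "x + y \<in> E \<Gamma>" unfolding E_def
      by (intro CollectI exI[of _ "x' + y'"] exI[of _ "s + t"])
        (auto simp: matrix_vector_right_distrib vec_eq_iff algebra_simps)
  next
    fix c x assume "x \<in> E \<Gamma>"
    then obtain x' s where "\<forall>g\<in>\<Gamma>. g *v x' = x'" "x = x' + s *s v"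
      unfolding E_def by blast
    moreover have "c *\<^sub>R x = complex_of_real c *s x" by (simp add: vec_eq_iff complex_eq_iff)
    ultimately show "c *\<^sub>R x \<in> E \<Gamma>" unfolding E_def
      by (intro CollectI exI[of _ "complex_of_real c *s x'"] exI[of _ "complex_of_real c * s"])
        (simp add: vector_scalar_commute vector_add_ldistrib vector_smult_assoc)
  qed
  define B where "B = \<Union>(E ` {\<Gamma>. \<Gamma> \<subseteq> G \<and> E \<Gamma> \<noteq> UNIV})"
  have "finite X \<Longrightarrow> (\<And>\<Gamma>. \<Gamma> \<in> X \<Longrightarrow> E \<Gamma> \<noteq> UNIV) \<Longrightarrow> closed (\<Union>(E ` X)) \<and> interior (\<Union>(E ` X)) = {}" for X
  proof (induction X rule: finite_induct)
    case (insert \<Gamma> X)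
    have "dim (E \<Gamma>) < DIM(complex^'n)"
      using dim_eq_full[of "E \<Gamma>"] insert(4)[of \<Gamma>] dim_subset_UNIV[of "E \<Gamma>"] span_eq_iff[of "E \<Gamma>"] sub[of \<Gamma>]
      by (metis insertI1 le_neq_implies_less)
    hence "interior (E \<Gamma>) = {}" by (rule empty_interior_lowdim)
    moreover have "closed (E \<Gamma>)" using sub by (rule closed_subspace)
    ultimately show ?case using insert interior_closed_Un_empty_interior[of "E \<Gamma>" "\<Union>(E ` X)"] by auto
  qed auto
  moreover have "finite {\<Gamma>. \<Gamma> \<subseteq> G \<and> E \<Gamma> \<noteq> UNIV}" using finite_G by simp
  ultimately have "interior B = {}" unfolding B_def by blast
  moreover have "{a. \<forall>\<Gamma>\<subseteq>G. a \<in> E \<Gamma> \<longrightarrow> E \<Gamma> = UNIV} = - B" by (auto simp: B_def)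
  ultimately show ?thesis by (simp add: closure_complement)
qed

lemma J_scale: "c \<noteq> 0 \<Longrightarrow> c ^ CARD('n) * J (c *s z) = c ^ (\<Sum>j\<in>UNIV. k j) * J z"
proof -
  define A :: "complex^'n^'n" where "A = (\<chi> i j. if i = j then c else 0)"
  define B :: "complex^'n^'n" where "B = (\<chi> i j. if i = j then c ^ k j else 0)"
  have A: "A *v z = c *s z" for z
    by (simp add: A_def matrix_vector_mult_def vec_eq_iff if_distrib[of "\<lambda>y. y * _"] cong: if_cong)
  have B: "B *v z = (\<chi> j. c ^ k j * z $ j)" for z
    by (simp add: B_def matrix_vector_mult_def vec_eq_iff if_distrib[of "\<lambda>y. y * _"] cong: if_cong)
  have "(\<lambda>z. \<theta> (A *v z)) = (\<lambda>z. B *v \<theta> z)" by (simp add: A B fun_eq_iff vec_eq_iff theta_homogeneous)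
  hence "complex_jacobian (\<lambda>z. \<theta> (A *v z)) z = complex_jacobian (\<lambda>z. B *v \<theta> z) z" by simp
  hence "J (A *v z) * det A = det B * J z"
    by (simp add: complex_jacobian_compose[OF polynomial_map_matrix theta_map]
        complex_jacobian_compose[OF theta_map polynomial_map_matrix] complex_jacobian_matrix)
  moreover have "det A = c ^ CARD('n)" by (subst det_diagonal) (auto simp: A_def)
  moreover have "det B = c ^ (\<Sum>j\<in>UNIV. k j)" by (subst det_diagonal) (auto simp: B_def power_sum)
  ultimately show ?thesis by (simp add: A mult_ac)
qed

lemma degree_pos: "k j > 0"
proof (rule ccontr)
  assume "\<not> k j > 0"
  hence c: "\<theta> z $ j = \<theta> 0 $ j" for z using theta_homogeneous[of 0 z j] by simp
  obtain z where z: "J z \<noteq> 0" using jacobian_nonzero by blast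
  obtain D where D: "\<And>z. (\<theta> has_derivative (*v) (D z)) (at z)"
    using polynomial_map_has_derivative[OF theta_map] by blast
  have "((\<lambda>z. \<theta> z $ j) has_derivative (\<lambda>h. (D z *v h) $ j)) (at z)"
    using bounded_linear.has_derivative[OF bounded_linear_vec_nth D] .
  moreover have "(\<lambda>z. \<theta> z $ j) = (\<lambda>_. \<theta> 0 $ j)" by (rule ext) (rule c)
  hence "((\<lambda>z. \<theta> z $ j) has_derivative (\<lambda>h. 0)) (at z)" by simp
  ultimately have "(\<lambda>h. (D z *v h) $ j) = (\<lambda>h. 0)" by (rule has_derivative_unique)
  hence "(D z *v axis i 1) $ j = 0" for i by (rule fun_cong)
  moreover have "(D z *v axis i 1) $ j = D z $ j $ i" for i
    by (simp add: matrix_vector_mult_def axis_def if_distrib[of "\<lambda>y. _ * y"] cong: if_cong)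
  ultimately have "row j (D z) = 0" by (simp add: row_def vec_eq_iff)
  hence "det (D z) = 0" by (rule det_zero_row(2))
  thus False using z complex_jacobian_eq_det[OF D, of z] by simp
qed

text \<open>The degree of \<open>J\<close>, whose column for the \<open>j\<close>-th invariant loses
  one degree; the truncated subtraction is exact since every \<open>k j\<close> is positive.\<close>

definition deg_J :: nat where "deg_J = (\<Sum>j\<in>UNIV. k j - 1)"

lemma J_homogeneous: "J (c *s z) = c ^ deg_J * J z"
proof -
  have "(\<Sum>j\<in>UNIV. k j) = (\<Sum>j\<in>UNIV. (k j - 1) + 1)" using degree_pos by (intro sum.cong) (auto simp: Suc_le_eq)
  hence k: "(\<Sum>j\<in>UNIV. k j) = deg_J + CARD('n)" unfolding deg_J_def sum.distrib by simp
  have nz: "J (c *s z) = c ^ deg_J * J z" if "c \<noteq> 0" for c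
    using J_scale[OF that, of z] that by (simp add: k power_add)
  obtain q where q: "\<And>t. J (0 + t *s z) = poly q t" using polynomial_fun_line_poly[OF polynomial_fun_J] by blast
  \<comment> \<open>For \<open>c = 0\<close> the scaling law for \<open>J\<close> cannot be divided
    by a power of \<open>c\<close>, so this value is reached by continuity.\<close>
  have "isCont (\<lambda>c. J (c *s z)) 0" using q by simp
  hence "((\<lambda>c. J (c *s z)) \<longlongrightarrow> J (0 *s z)) (at 0)" by (simp add: isCont_def)
  moreover have "((\<lambda>c. c ^ deg_J * J z) \<longlongrightarrow> 0 ^ deg_J * J z) (at 0)" by (intro tendsto_intros)
  hence "((\<lambda>c. J (c *s z)) \<longlongrightarrow> 0 ^ deg_J * J z) (at 0)"
    by (rule Lim_transform_eventually) (auto simp: eventually_at nz intro!: exI[of _ 1])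
  ultimately have "J (0 *s z) = 0 ^ deg_J * J z" by (rule tendsto_unique[OF at_neq_bot])
  thus ?thesis using nz by (cases "c = 0") auto
qed

text \<open>Division takes place on all lines parallel to \<open>v\<close> simultaneously. There
  \<open>J\<close> has the constant leading coefficient \<open>J v\<close>, so quotient and
  remainder depend polynomially on the base point. The comparison of orders kills the remainder at
  generic base points, hence everywhere; the quotient at parameter 0 is the cofactor, and it is
  invariant.\<close>

theorem skew_factor:
  assumes F: "polynomial_fun F" "\<And>g z. g \<in> G \<Longrightarrow> F (g *v z) * det g = F z"
  shows "\<exists>P. polynomial_fun P \<and> (\<forall>z. F z = J z * P (\<theta> z))"
proof -
  obtain v where v: "J v \<noteq> 0" using jacobian_nonzero by blast
  obtain q m where q: "\<And>i. polynomial_fun (\<lambda>z. coeff (q z) i)" "\<And>z. degree (q z) \<le> m" "\<And>z t. F (z + t *s v) = poly (q z) t"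
    using polynomial_fun_along_line[OF F(1), of v] by blast
  obtain b n where b: "\<And>i. polynomial_fun (\<lambda>z. coeff (b z) i)" "\<And>z. degree (b z) \<le> n" "\<And>z t. J (z + t *s v) = poly (b z) t"
    using polynomial_fun_along_line[OF polynomial_fun_J, of v] by blast
  \<comment> \<open>By homogeneity \<open>J (z + t *s v)\<close> is \<open>t ^ deg_J\<close> times
    \<open>J (v + (1 / t) *s z)\<close>; clearing denominators with the reversed polynomial
    \<open>r'\<close> exhibits the leading coefficient \<open>J v\<close>.\<close>
  have top: "coeff (b z) i = (if i = deg_J then J v else 0)" if "i \<ge> deg_J" for z i
  proof -
    obtain r where r: "\<And>s. J (v + s *s z) = poly r s" using polynomial_fun_line_poly[OF polynomial_fun_J] by blast
    define l where "l = degree r"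
    define r' where "r' = (\<Sum>j\<le>l. monom (coeff r j) (l - j))"
    have "poly (monom 1 l * b z) t = poly (monom 1 deg_J * r') t" if "t \<noteq> 0" for t
    proof -
      have "z + t *s v = t *s (v + (1 / t) *s z)" using that by (simp add: vec_eq_iff field_simps)
      hence "poly (b z) t = t ^ deg_J * poly r (1 / t)" by (metis b(3) r J_homogeneous)
      moreover have "t ^ l * poly r (1 / t) = poly r' t"
        unfolding r'_def poly_sum poly_monom poly_altdef[of r] l_def sum_distrib_left
        by (intro sum.cong) (use that in \<open>auto simp: power_diff power_one_over field_simps\<close>)
      ultimately show ?thesis by (simp add: poly_monom mult_ac)
    qed
    hence "poly (monom 1 l * b z - monom 1 deg_J * r') t = 0" if "t \<noteq> 0" for t using that by simp
    hence "- {0} \<subseteq> {t. poly (monom 1 l * b z - monom 1 deg_J * r') t = 0}" by auto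
    moreover have "infinite (- {0::complex})" by (simp add: infinite_UNIV_char_0)
    ultimately have "monom 1 l * b z - monom 1 deg_J * r' = 0"
      using poly_roots_finite finite_subset by blast
    hence eq: "coeff (monom 1 l * b z) (l + i) = coeff (monom 1 deg_J * r') (l + i)" by simp
    have "coeff r' (l + i - deg_J) = (\<Sum>j\<le>l. if l - j = l + i - deg_J then coeff r j else 0)"
      by (simp add: r'_def coeff_sum)
    also have "\<dots> = (\<Sum>j\<le>l. if j = 0 \<and> i = deg_J then coeff r j else 0)"
      using that by (intro sum.cong refl) auto
    also have "\<dots> = (if i = deg_J then coeff r 0 else 0)" by (simp add: sum.delta')
    finally have "coeff (b z) i = (if i = deg_J then coeff r 0 else 0)"
      using eq that by (simp add: coeff_monom_mult)
    moreover have "coeff r 0 = J v" using r[of 0] by (simp add: poly_0_coeff_0)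
    ultimately show ?thesis by simp
  qed
  have degb: "degree (b z) = deg_J" for z
  proof (rule antisym)
    show "degree (b z) \<le> deg_J" by (rule degree_le) (use top in auto)
    show "deg_J \<le> degree (b z)" by (rule le_degree) (use top v in auto)
  qed
  have lead: "coeff (b z) deg_J = J v" for z using top by simp
  have q0: "coeff (q z) i = 0" if "Suc m \<le> i" for z i
    by (rule coeff_eq_0) (use that q(2)[of z] in linarith)
  have div: "polynomial_fun (\<lambda>z. coeff (q z div b z) i)" for i
    by (rule polynomial_fun_coeff_div[where m = "Suc m" and N = deg_J and \<beta> = "J v"])
      (use q0 q(1) b(1) degb lead v in auto)
  have md: "polynomial_fun (\<lambda>z. coeff (q z mod b z) i)" for i
    unfolding minus_div_mult_eq_mod[symmetric] coeff_diff coeff_mult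
    by (intro polynomial_fun_diff polynomial_fun_sum polynomial_fun_mult q div b)
  define E where "E \<Gamma> = {z. \<exists>y s. (\<forall>g\<in>\<Gamma>. g *v y = y) \<and> z = y + s *s v}" for \<Gamma> :: "(complex^'n^'n) set"
  \<comment> \<open>For generic \<open>a\<close> the order comparison is available at every point of
    the line, so all roots of \<open>b a\<close> are matched with multiplicity.\<close>
  have "q a mod b a = 0" if a: "\<forall>\<Gamma>\<subseteq>G. a \<in> E \<Gamma> \<longrightarrow> E \<Gamma> = UNIV" for a
  proof -
    have ba: "b a \<noteq> 0" using lead v by (metis coeff_0)
    have "b a dvd q a"
    proof (rule poly_dvd_if_order_le[OF ba])
      fix x
      define z0 where "z0 = a + x *s v"
      define \<Gamma> where "\<Gamma> = {g\<in>G. g *v z0 = z0}"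
      have "a \<in> E \<Gamma>" unfolding E_def
        by (intro CollectI exI[of _ z0] exI[of _ "-x"]) (auto simp: \<Gamma>_def z0_def)
      hence "E \<Gamma> = UNIV" using a by (auto simp: \<Gamma>_def)
      hence split: "\<exists>y s. (\<forall>g\<in>{g\<in>G. g *v z0 = z0}. g *v y = y) \<and> z = y + s *s v" for z
        unfolding E_def \<Gamma>_def by blast
      have line: "z0 + t *s v = a + (x + t) *s v" for t by (simp add: z0_def vector_sadd_rdistrib add.assoc)
      show "q a = 0 \<or> Polynomial.order x (b a) \<le> Polynomial.order x (q a)"
      proof (cases "q a = 0")
        case False
        have "Polynomial.order 0 (pcompose (b a) [:x, 1:]) \<le> Polynomial.order 0 (pcompose (q a) [:x, 1:])"
        proof (rule order_J_le_order_skew[OF F v split])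
          show "pcompose (q a) [:x, 1:] \<noteq> 0" using False by (simp add: pcompose_eq_0_iff)
          show "F (z0 + t *s v) = poly (pcompose (q a) [:x, 1:]) t" for t
            unfolding line q(3) by (simp add: poly_pcompose)
          show "J (z0 + t *s v) = poly (pcompose (b a) [:x, 1:]) t" for t
            unfolding line b(3) by (simp add: poly_pcompose)
        qed
        thus ?thesis using order_pcompose_shift False ba by simp
      qed simp
    qed
    thus ?thesis by simp
  qed
  hence "q z mod b z = 0" for z
    unfolding poly_eq_iff
    using continuous_eq_on_dense[OF generic_base_points polynomial_fun_continuous_on[OF md] continuous_on_const[of UNIV 0], of v]
    by (simp add: E_def)
  hence eq: "q z = (q z div b z) * b z" for z by (metis add.right_neutral div_mult_mod_eq)
  define p where "p z = coeff (q z div b z) 0" for z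
  have p: "polynomial_fun p" unfolding p_def by (rule div)
  have Fp: "F z = J z * p z" for z
  proof -
    have "F z = poly (q z) 0" using q(3)[of z 0] by simp
    also have "\<dots> = poly (q z div b z) 0 * poly (b z) 0" by (subst eq) simp
    also have "\<dots> = p z * J z" using b(3)[of z 0] by (simp add: p_def poly_0_coeff_0)
    finally show ?thesis by simp
  qed
  \<comment> \<open>Where \<open>J\<close> is nonzero it cancels from the two transformation laws;
    density of that set gives the rest.\<close>
  have "p (g *v z) = p z" if "g \<in> G" for g z
  proof (rule continuous_eq_on_dense[OF polynomial_fun_dense_nonzero[OF polynomial_fun_J v]])
    show "continuous_on UNIV (\<lambda>z. p (g *v z))" "continuous_on UNIV p"
      using polynomial_fun_continuous_on p polynomial_fun_linear_compose by blast+
    fix z assume z: "z \<in> {z. J z \<noteq> 0}"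
    have "J (g *v z) * det g * p (g *v z) = J z * p z" using F(2)[OF that, of z] by (simp add: Fp mult_ac)
    thus "p (g *v z) = p z" using J_skew[OF that] z by simp
  qed
  with invariant_factor[OF p] Fp show ?thesis by metis
qed

end

section \<open>Topology of the quotient map\<close>

context invariant_quotient
begin

lemma theta_continuous: "continuous_on X \<theta>"
proof -
  have "continuous_on X (\<lambda>z. \<chi> i. \<theta> z $ i)"
    using theta_map unfolding polynomial_map_def by (intro continuous_on_vec_lambda polynomial_fun_continuous_on) blast
  thus ?thesis by simp
qed

text \<open>The product over the group of \<open>1 - q (g *v x)\<close> is invariant, hence a
  function of \<open>\<theta> x\<close>; it equals 1 on the first orbit and 0 at a point outside
  that orbit.\<close>

lemma theta_eq_imp_orbit:
  assumes "\<theta> z = \<theta> z'" shows "\<exists>g\<in>G. z' = g *v z"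
proof (rule ccontr)
  assume "\<not> ?thesis"
  hence "z' \<notin> (\<lambda>g. g *v z) ` G" by blast
  moreover have "finite ((\<lambda>g. g *v z) ` G)" using finite_G by simp
  ultimately obtain q where q: "polynomial_fun q" "q z' = 1" "\<And>g. g \<in> G \<Longrightarrow> q (g *v z) = 0"
    using polynomial_fun_separation by (metis (no_types, lifting) imageI)
  define h where "h x = (\<Prod>g\<in>G. 1 - q (g *v x))" for x
  have "polynomial_fun h"
    unfolding h_def by (intro polynomial_fun_prod polynomial_fun_diff polynomial_fun_const polynomial_fun_linear_compose[OF q(1)])
  moreover have "h (g *v x) = h x" if "g \<in> G" for g x
    using prod_group_right[OF that, of "\<lambda>g. 1 - q (g *v x)"] by (simp add: h_def matrix_vector_mul_assoc)
  ultimately obtain P where "\<And>x. h x = P (\<theta> x)" using invariant_factor by blast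
  hence "h z = h z'" using assms by simp
  moreover have "h z = 1" unfolding h_def by (intro prod.neutral) (use q in auto)
  moreover have "h z' = 0" unfolding h_def
    by (rule prod_zero[OF finite_G]) (use one_mem q(2) in \<open>auto intro!: bexI[of _ "mat 1"]\<close>)
  ultimately show False by simp
qed

lemma theta_0: "\<theta> 0 = 0"
  unfolding vec_eq_iff using theta_homogeneous[of 0 0] degree_pos by (metis mult_zero_left vec.scale_zero_right zero_index zero_power)

lemma theta_eq_0: "\<theta> z = 0 \<Longrightarrow> z = 0"
  using theta_eq_imp_orbit[of 0 z] theta_0 by auto

text \<open>On the unit sphere \<theta> is bounded away from 0, and all degrees are positive, so
  outside the unit ball \<theta> grows at least linearly.\<close>

lemma theta_proper: "\<exists>R. \<forall>z. norm (\<theta> z) \<le> B \<longrightarrow> norm z \<le> R"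
proof -
  have "continuous_on (sphere 0 1) (\<lambda>z. norm (\<theta> z))" by (intro continuous_on_norm theta_continuous)
  moreover have "compact (sphere 0 1 :: (complex^'n) set)" by (rule compact_sphere)
  moreover have "sphere 0 1 \<noteq> ({} :: (complex^'n) set)" by simp
  ultimately obtain u where u: "u \<in> sphere 0 1" "\<And>z. z \<in> sphere 0 1 \<Longrightarrow> norm (\<theta> u) \<le> norm (\<theta> z)"
    using continuous_attains_inf[of "sphere 0 1 :: (complex^'n) set" "\<lambda>z. norm (\<theta> z)"] by metis
  define m where "m = norm (\<theta> u)"
  have m: "m > 0" using u(1) theta_eq_0[of u] unfolding m_def by auto
  have "norm z \<le> max 1 (B / m)" if z: "norm (\<theta> z) \<le> B" for z
  proof (cases "norm z \<le> 1")
    case False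
    define r where "r = norm z"
    have r: "r > 1" using False by (simp add: r_def)
    define y where "y = inverse r *\<^sub>R z"
    have "norm y = inverse r * r" using r by (simp add: y_def r_def)
    hence y: "y \<in> sphere 0 1" using r by simp
    have "z = complex_of_real r *s y"
      using r by (simp add: y_def vec_eq_iff complex_eq_iff)
    hence "\<theta> z $ j = of_real r ^ k j * \<theta> y $ j" for j using theta_homogeneous by simp
    hence "norm (\<theta> z $ j) = r ^ k j * norm (\<theta> y $ j)" for j using r by (simp add: norm_mult norm_power)
    moreover have "r ^ 1 \<le> r ^ k j" for j using degree_pos[of j] r by (intro power_increasing) auto
    ultimately have "norm (\<theta> z $ j) \<ge> norm ((r *\<^sub>R \<theta> y) $ j)" for j
      using r by (simp add: mult_right_mono)
    hence "norm (r *\<^sub>R \<theta> y) \<le> norm (\<theta> z)" by (rule norm_le_componentwise_cart)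
    hence "r * m \<le> B" using u(2)[OF y] z r unfolding m_def
      by (smt (verit) mult_left_mono norm_scaleR)
    hence "r \<le> B / m" using m by (simp add: pos_le_divide_eq)
    thus ?thesis by (simp add: r_def)
  qed auto
  thus ?thesis by blast
qed

text \<open>Near a limit point properness confines the preimages to a ball, where compactness closes
  the image.\<close>

lemma theta_closed_map:
  assumes "closed C" shows "closed (\<theta> ` C)"
proof -
  have "\<zeta> \<in> \<theta> ` C" if \<zeta>: "\<zeta> \<in> closure (\<theta> ` C)" for \<zeta>
  proof -
    obtain R where R: "\<And>z. norm (\<theta> z) \<le> norm \<zeta> + 1 \<Longrightarrow> norm z \<le> R" using theta_proper by blast
    have "ball \<zeta> 1 \<inter> \<theta> ` C \<subseteq> \<theta> ` (C \<inter> cball 0 R)"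
    proof
      fix y assume "y \<in> ball \<zeta> 1 \<inter> \<theta> ` C"
      then obtain z where z: "z \<in> C" "y = \<theta> z" "dist \<zeta> y < 1" by auto
      have "norm (\<theta> z) \<le> norm \<zeta> + 1" using z(2,3) norm_triangle_ineq2[of y \<zeta>] by (simp add: dist_norm norm_minus_commute)
      thus "y \<in> \<theta> ` (C \<inter> cball 0 R)" using R z by auto
    qed
    moreover have "closed (\<theta> ` (C \<inter> cball 0 R))"
      by (intro compact_imp_closed compact_continuous_image theta_continuous closed_Int_compact assms compact_cball)
    ultimately have "closure (ball \<zeta> 1 \<inter> \<theta> ` C) \<subseteq> \<theta> ` (C \<inter> cball 0 R)" by (rule closure_minimal)
    moreover have "\<zeta> \<in> closure (ball \<zeta> 1 \<inter> \<theta> ` C)"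
      using open_Int_closure_subset[of "ball \<zeta> 1" "\<theta> ` C"] \<zeta> by auto
    ultimately show ?thesis by blast
  qed
  thus ?thesis by (meson closed_closure closure_subset subsetI subset_antisym closure_eq)
qed

lemma theta_interior_image:
  assumes "J z \<noteq> 0" shows "\<theta> z \<in> interior (range \<theta>)"
proof -
  obtain D where D: "\<And>z. (\<theta> has_derivative (*v) (D z)) (at z)"
    using polynomial_map_has_derivative[OF theta_map] by blast
  have "det (D z) \<noteq> 0" using assms complex_jacobian_eq_det[OF D] by metis
  then obtain E where E: "D z ** E = mat 1" using invertible_det_nz unfolding invertible_def by blast
  show ?thesis
  proof (rule sussmann_open_mapping[of UNIV \<theta> z "(*v) (D z)" "(*v) E" UNIV])
    show "(*v) (D z) \<circ> (*v) E = id" using E by (simp add: fun_eq_iff matrix_vector_mul_assoc)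
  qed (use D theta_continuous in auto)
qed

text \<open>The norm of \<open>J\<close> over the group factors as \<open>\<Delta>\<close> composed
  with \<theta>, so the range is open wherever \<open>\<Delta>\<close> does not vanish, and closed
  by properness. A complex line minus the finitely many zeros of \<open>\<Delta>\<close> is still
  connected, which joins a known value to any \<zeta> with
  \<open>\<Delta> \<zeta> \<noteq> 0\<close>; such \<zeta> are dense.\<close>

lemma theta_surj: "range \<theta> = UNIV"
proof -
  define N where "N z = (\<Prod>g\<in>G. J (g *v z))" for z
  have "polynomial_fun N"
    unfolding N_def by (intro polynomial_fun_prod polynomial_fun_linear_compose polynomial_fun_J)
  moreover have "N (g *v x) = N x" if "g \<in> G" for g x
    using prod_group_right[OF that, of "\<lambda>g. J (g *v x)"] by (simp add: N_def matrix_vector_mul_assoc)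
  ultimately obtain \<Delta> where \<Delta>: "polynomial_fun \<Delta>" "\<And>x. N x = \<Delta> (\<theta> x)" using invariant_factor by blast
  have N: "N z \<noteq> 0 \<longleftrightarrow> J z \<noteq> 0" for z
  proof -
    have "J (g *v z) = 0 \<longleftrightarrow> J z = 0" if "g \<in> G" for g using J_skew[OF that, of z] det_nonzero[OF that] by auto
    thus ?thesis unfolding N_def using finite_G one_mem by (auto simp: prod_zero_iff)
  qed
  have closed: "closed (range \<theta>)" using theta_closed_map by blast
  obtain z0 where z0: "J z0 \<noteq> 0" using jacobian_nonzero by blast
  have "\<zeta> \<in> range \<theta>" if \<zeta>: "\<Delta> \<zeta> \<noteq> 0" for \<zeta>
  proof -
    define line where "line t = \<theta> z0 + t *s (\<zeta> - \<theta> z0)" for t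
    have cont: "continuous_on X line" for X unfolding line_def by (intro continuous_intros)
    obtain q where q: "\<And>t. \<Delta> (line t) = poly q t" using polynomial_fun_line_poly[OF \<Delta>(1)] unfolding line_def by blast
    have line0: "line 0 = \<theta> z0" and line1: "line 1 = \<zeta>" by (simp_all add: line_def)
    have q0: "poly q 0 \<noteq> 0" and q1: "poly q 1 \<noteq> 0" using z0 N \<Delta>(2) \<zeta> line0 line1 q by metis+
    define T where "T = - {t. poly q t = 0}"
    have fin: "finite {t. poly q t = 0}" using q0 by (intro poly_roots_finite) auto
    hence "path_connected T" unfolding T_def
      by (intro path_connected_complement_countable countable_finite) simp_all
    hence conn: "connected T" by (rule path_connected_imp_connected)
    have oT: "open T" unfolding T_def using fin by (simp add: finite_imp_closed open_Compl)
    define A where "A = T \<inter> line -` range \<theta>"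
    have "closedin (top_of_set T) A" unfolding A_def
      by (rule continuous_closedin_preimage[OF cont closed])
    moreover have "open A"
    proof (subst open_subopen, intro ballI)
      fix t assume t: "t \<in> A"
      then obtain z where z: "line t = \<theta> z" by (auto simp: A_def)
      have "\<Delta> (\<theta> z) \<noteq> 0" using t z q[of t] by (auto simp: A_def T_def)
      hence "J z \<noteq> 0" using N[of z] \<Delta>(2)[of z] by simp
      hence "line t \<in> interior (range \<theta>)" using theta_interior_image z by simp
      moreover have "open (line -` interior (range \<theta>))" using cont[of UNIV] by (intro open_vimage) auto
      ultimately show "\<exists>S. open S \<and> t \<in> S \<and> S \<subseteq> A"
        using t oT interior_subset[of "range \<theta>"] by (intro exI[of _ "T \<inter> line -` interior (range \<theta>)"]) (auto simp: A_def)
    qed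
    hence "openin (top_of_set T) A" using oT by (simp add: A_def openin_open_eq)
    moreover have "0 \<in> A" using q0 line0 by (simp add: A_def T_def)
    ultimately have "A = T" using conn unfolding connected_clopen by blast
    hence "1 \<in> A" using q1 by (simp add: T_def)
    thus ?thesis using line1 by (simp add: A_def)
  qed
  hence "closure {\<zeta>. \<Delta> \<zeta> \<noteq> 0} \<subseteq> range \<theta>" using closed by (intro closure_minimal) auto
  moreover have "\<Delta> (\<theta> z0) \<noteq> 0" using z0 N \<Delta>(2) by metis
  ultimately show ?thesis using polynomial_fun_dense_nonzero[OF \<Delta>(1)] by blast
qed

text \<open>Since \<theta> is onto and its fibres are orbits, the complement of the image is the
  image of the complement of the saturated set \<open>GU\<close>, and \<theta> is a closed
  map.\<close>

lemma theta_open_map: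
  assumes "open U" shows "open (\<theta> ` U)"
proof -
  define GU where "GU = (\<Union>g\<in>G. (*v) g -` U)"
  have "open GU" unfolding GU_def
    by (intro open_UN ballI open_vimage assms) (simp add: linear_continuous_on matrix_vector_mul_bounded_linear)
  hence "closed (\<theta> ` (- GU))" by (intro theta_closed_map closed_Compl)
  moreover have "\<theta> ` (- GU) = - (\<theta> ` U)"
  proof (intro equalityI subsetI)
    fix \<zeta> assume "\<zeta> \<in> \<theta> ` (- GU)"
    then obtain z where z: "\<zeta> = \<theta> z" "z \<notin> GU" by blast
    show "\<zeta> \<in> - (\<theta> ` U)"
    proof
      assume "\<zeta> \<in> \<theta> ` U"
      then obtain u where u: "u \<in> U" "\<theta> z = \<theta> u" using z by auto
      from theta_eq_imp_orbit[OF u(2)] show False using u(1) z(2) by (auto simp: GU_def)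
    qed
  next
    fix \<zeta> assume \<zeta>: "\<zeta> \<in> - (\<theta> ` U)"
    obtain z where z: "\<zeta> = \<theta> z" using theta_surj by (metis rangeE UNIV_I)
    have "z \<notin> GU"
    proof
      assume "z \<in> GU"
      then obtain g where "g \<in> G" "g *v z \<in> U" by (auto simp: GU_def)
      hence "\<theta> z \<in> \<theta> ` U" using theta_invariant by (metis imageI)
      thus False using \<zeta> z by simp
    qed
    thus "\<zeta> \<in> \<theta> ` (- GU)" using z by blast
  qed
  ultimately show ?thesis by (metis closed_def double_complement)
qed

end

section \<open>Homogeneous expansions\<close>

lemma norm_vector_smult [simp]: "norm (c *s z) = norm c * norm (z :: complex^'n)"
  by (simp add: norm_vec_def norm_mult L2_set_right_distrib)

lemma of_real_vector_smult: "complex_of_real r *s z = r *\<^sub>R (z :: complex^'n)"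
  by (simp add: vec_eq_iff complex_eq_iff)

lemma holo_has_derivative:
  assumes "holo f U" "open U" "z \<in> U"
  shows "\<exists>f'. (f has_derivative f') (at z) \<and> (\<forall>c v. f' (c *s v) = c * f' v)"
  using assms unfolding holo_def by (metis at_within_open)

lemma holo_continuous_on: "holo f U \<Longrightarrow> continuous_on U f"
  unfolding holo_def continuous_on_eq_continuous_within by (meson has_derivative_continuous)

lemma holo_const: "holo (\<lambda>_. c) U"
  unfolding holo_def by (intro ballI exI[of _ "\<lambda>_. 0"]) auto

lemma holo_add:
  assumes "holo f U" "holo g U" shows "holo (\<lambda>z. f z + g z) U"
  unfolding holo_def
proof
  fix z assume z: "z \<in> U"
  obtain f' where f: "(f has_derivative f') (at z within U)" "\<And>c v. f' (c *s v) = c * f' v"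
    using assms(1) z unfolding holo_def by blast
  obtain g' where g: "(g has_derivative g') (at z within U)" "\<And>c v. g' (c *s v) = c * g' v"
    using assms(2) z unfolding holo_def by blast
  show "\<exists>f'. ((\<lambda>z. f z + g z) has_derivative f') (at z within U) \<and> (\<forall>c v. f' (c *s v) = c * f' v)"
    using has_derivative_add[OF f(1) g(1)] by (intro exI[of _ "\<lambda>h. f' h + g' h"]) (simp add: f(2) g(2) distrib_left)
qed

lemma holo_mult:
  assumes "holo f U" "holo g U" shows "holo (\<lambda>z. f z * g z) U"
  unfolding holo_def
proof
  fix z assume z: "z \<in> U"
  obtain f' where f: "(f has_derivative f') (at z within U)" "\<And>c v. f' (c *s v) = c * f' v"
    using assms(1) z unfolding holo_def by blast
  obtain g' where g: "(g has_derivative g') (at z within U)" "\<And>c v. g' (c *s v) = c * g' v"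
    using assms(2) z unfolding holo_def by blast
  show "\<exists>f'. ((\<lambda>z. f z * g z) has_derivative f') (at z within U) \<and> (\<forall>c v. f' (c *s v) = c * f' v)"
    using has_derivative_mult[OF f(1) g(1)]
    by (intro exI[of _ "\<lambda>h. f z * g' h + f' h * g z"]) (simp add: f(2) g(2) distrib_left mult_ac)
qed

lemma holo_compose:
  assumes "holo f V" "q ` U \<subseteq> V"
    and "\<And>z. z \<in> U \<Longrightarrow> (q has_derivative (*v) (D z)) (at z within U)"
  shows "holo (\<lambda>z. f (q z)) U"
  unfolding holo_def
proof
  fix z assume z: "z \<in> U"
  obtain f' where f: "(f has_derivative f') (at (q z) within V)" "\<And>c v. f' (c *s v) = c * f' v"
    using assms z unfolding holo_def by blast
  have "(f has_derivative f') (at (q z) within q ` U)" using f(1) assms(2) by (rule has_derivative_subset)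
  from diff_chain_within[OF assms(3)[OF z] this]
  show "\<exists>f'. ((\<lambda>z. f (q z)) has_derivative f') (at z within U) \<and> (\<forall>c v. f' (c *s v) = c * f' v)"
    by (intro exI[of _ "\<lambda>h. f' (D z *v h)"]) (simp add: o_def f(2) vector_scalar_commute)
qed

lemma holo_matrix_compose:
  assumes "holo f V" "(*v) A ` U \<subseteq> V" shows "holo (\<lambda>z. f (A *v z)) U"
  using assms by (rule holo_compose[where D = "\<lambda>_. A"]) (intro bounded_linear_imp_has_derivative matrix_vector_mul_bounded_linear)

lemma matrix_scale: "(mat c :: complex^'n^'n) *v z = c *s z"
  by (simp add: matrix_vector_mult_def mat_def vec_eq_iff if_distrib[of "\<lambda>y. y * _"] cong: if_cong)

lemma has_field_derivative_on_line:
  fixes f :: "complex^'n \<Rightarrow> complex"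
  assumes f: "(f has_derivative f') (at (a + t *s b))" "\<And>c v. f' (c *s v) = c * f' v"
  shows "((\<lambda>s. f (a + s *s b)) has_field_derivative f' b) (at t)"
proof -
  have line: "((\<lambda>s. a + s *s b) has_derivative (\<lambda>s. s *s b)) (at t)"
  proof (rule has_derivative_vec_componentwise)
    fix i show "((\<lambda>s. (a + s *s b) $ i) has_derivative (\<lambda>s. (s *s b) $ i)) (at t)"
      by (auto intro!: derivative_eq_intros)
  qed
  have "((\<lambda>s. f (a + s *s b)) has_derivative (\<lambda>s. f' (s *s b))) (at t)"
    by (rule has_derivative_compose[OF line f(1)])
  thus ?thesis
    by (rule has_derivative_imp_has_field_derivative) (simp add: f(2) mult.commute)
qed

lemma holo_on_line:
  assumes "holo f U" "open U" shows "(\<lambda>t. f (a + t *s b)) holomorphic_on {t. a + t *s b \<in> U}"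
proof (rule holomorphic_onI)
  fix t assume "t \<in> {t. a + t *s b \<in> U}"
  then obtain f' where f: "(f has_derivative f') (at (a + t *s b))" "\<And>c v. f' (c *s v) = c * f' v"
    using holo_has_derivative[OF assms] by blast
  show "(\<lambda>t. f (a + t *s b)) field_differentiable at t within {t. a + t *s b \<in> U}"
    using has_field_derivative_on_line[OF f] field_differentiable_at_within field_differentiable_def by blast
qed

lemma open_line_preimage: "open U \<Longrightarrow> open {t. a + t *s (b :: complex^'n) \<in> U}"
  using open_vimage[of U "\<lambda>t. a + t *s b"] by (simp add: vimage_def continuous_intros)

text \<open>The \<open>n\<close>-th Taylor coefficient at 0 of the slice through \<open>z\<close>.
  The slice is needed only near parameter 0, so \<open>z\<close> may lie anywhere, even outside the
  domain of \<open>f\<close>.\<close>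

definition hom_part :: "nat \<Rightarrow> (complex^'n \<Rightarrow> complex) \<Rightarrow> complex^'n \<Rightarrow> complex" where
  "hom_part n f z = (deriv ^^ n) (\<lambda>t. f (t *s z)) 0 / fact n"

lemma hom_part_compose_matrix: "hom_part n (\<lambda>z. f (A *v z)) z = hom_part n f (A *v z)"
  by (simp add: hom_part_def vector_scalar_commute)

locale circled_domain =
  fixes \<Omega> :: "(complex^'n) set"
  assumes open_domain: "open \<Omega>" and bounded_domain: "bounded \<Omega>" and convex_domain: "convex \<Omega>"
    and zero_mem: "0 \<in> \<Omega>" and circled: "norm c = 1 \<Longrightarrow> z \<in> \<Omega> \<Longrightarrow> c *s z \<in> \<Omega>"
begin

lemma circled_closure:
  assumes "norm c = 1" "z \<in> closure \<Omega>" shows "c *s z \<in> closure \<Omega>"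
proof -
  have "(\<lambda>z. c *s z) ` closure \<Omega> \<subseteq> closure \<Omega>"
    using circled[OF assms(1)] closure_subset
    by (intro image_closure_subset continuous_intros) auto
  thus ?thesis using assms(2) by blast
qed

text \<open>Rotate so that the factor becomes a positive real below 1, then shrink towards 0, an
  interior point of the convex domain.\<close>

lemma scaled_closure_mem:
  assumes "norm c < 1" "z \<in> closure \<Omega>" shows "c *s z \<in> \<Omega>"
proof (cases "c = 0")
  case True thus ?thesis using zero_mem by simp
next
  case False
  define y where "y = (c / of_real (norm c)) *s z"
  have "y \<in> closure \<Omega>" unfolding y_def using False assms by (intro circled_closure) (auto simp: norm_divide)
  moreover have "0 \<in> interior \<Omega>" using open_domain zero_mem by (simp add: interior_open)
  ultimately have "y - (1 - norm c) *\<^sub>R (y - 0) \<in> interior \<Omega>"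
    using assms(1) by (intro mem_interior_closure_convex_shrink convex_domain) auto
  moreover have "y - (1 - norm c) *\<^sub>R (y - 0) = norm c *\<^sub>R y" by (simp add: algebra_simps)
  hence "y - (1 - norm c) *\<^sub>R (y - 0) = c *s z"
    using False by (simp add: y_def vector_smult_assoc flip: of_real_vector_smult)
  ultimately show ?thesis using open_domain by (simp add: interior_open)
qed

lemma scaled_mem: "norm c \<le> 1 \<Longrightarrow> z \<in> \<Omega> \<Longrightarrow> c *s z \<in> \<Omega>"
  using circled scaled_closure_mem closure_subset by (metis antisym_conv2 subsetD)

lemma compact_closure: "compact (closure \<Omega>)"
  using bounded_domain by (simp add: compact_closure)

lemma holomorphic_slice:
  assumes "holo f \<Omega>" shows "(\<lambda>t. f (t *s z)) holomorphic_on {t. t *s z \<in> \<Omega>}"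
  using holo_on_line[OF assms open_domain, of 0 z] by simp

lemma open_slice: "open {t. t *s z \<in> \<Omega>}"
  using open_line_preimage[OF open_domain, of 0 z] by simp

lemma holomorphic_slice_ball:
  assumes "holo f \<Omega>" "z \<in> closure \<Omega>" shows "(\<lambda>t. f (t *s z)) holomorphic_on ball 0 1"
  using holomorphic_slice[OF assms(1)] by (rule holomorphic_on_subset) (use assms(2) scaled_closure_mem in auto)

lemma hom_part_sums:
  assumes "holo f \<Omega>" "z \<in> closure \<Omega>" "norm t < 1"
  shows "(\<lambda>n. hom_part n f z * t ^ n) sums f (t *s z)"
  using holomorphic_power_series[OF holomorphic_slice_ball[OF assms(1,2)], of t] assms(3)
  by (simp add: hom_part_def)

lemma hom_part_scale:
  assumes "holo f \<Omega>" shows "hom_part n f (c *s z) = c ^ n * hom_part n f z"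
proof -
  have "(deriv ^^ n) (\<lambda>w. f ((c * w) *s z)) 0 = c ^ n * (deriv ^^ n) (\<lambda>t. f (t *s z)) (c * 0)"
    by (rule higher_deriv_compose_linear[OF holomorphic_slice[OF assms] open_slice[of "c *s z"] open_slice])
      (use zero_mem in \<open>auto simp: vector_smult_assoc mult_ac\<close>)
  thus ?thesis by (simp add: hom_part_def vector_smult_assoc mult_ac)
qed

lemma hom_part_bound:
  assumes "holo f \<Omega>" "r > 0" "\<And>t. norm t \<le> r \<Longrightarrow> t *s z \<in> \<Omega>" "\<And>t. norm t = r \<Longrightarrow> norm (f (t *s z)) \<le> B"
  shows "norm (hom_part n f z) \<le> B / r ^ n"
proof -
  have hol: "(\<lambda>t. f (t *s z)) holomorphic_on cball 0 r"
    using holomorphic_slice[OF assms(1)] by (rule holomorphic_on_subset) (use assms(3) in auto)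
  have "norm ((deriv ^^ n) (\<lambda>t. f (t *s z)) 0) \<le> fact n * B / r ^ n"
    by (rule Cauchy_inequality[OF holomorphic_on_subset[OF hol ball_subset_cball] holomorphic_on_imp_continuous_on[OF hol] assms(2)])
      (use assms(4) in auto)
  thus ?thesis by (simp add: hom_part_def norm_divide field_simps)
qed

text \<open>Cauchy estimates on a closed ball of radius \<open>e\<close> around 0 inside the domain,
  with \<open>C = 1 / e\<close>; unlike estimates on the domain they hold at every \<open>z\<close>,
  as needed for growth at infinity.\<close>

lemma hom_part_growth:
  assumes "holo f \<Omega>"
  shows "\<exists>B C. B \<ge> 0 \<and> C > 0 \<and> (\<forall>n z. norm (hom_part n f z) \<le> B * (C * norm z) ^ n) \<and>
     (\<forall>z. C * norm z \<le> 1 \<longrightarrow> z \<in> \<Omega>)"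
proof -
  obtain e where e: "e > 0" "cball 0 e \<subseteq> \<Omega>" using open_domain zero_mem open_contains_cball by blast
  have "compact (f ` cball 0 e)"
    using holo_continuous_on[OF assms] e(2) by (intro compact_continuous_image compact_cball) (rule continuous_on_subset)
  hence "bounded (f ` cball 0 e)" by (rule compact_imp_bounded)
  then obtain B where B: "\<And>z. norm z \<le> e \<Longrightarrow> norm (f z) \<le> B" unfolding bounded_iff by (metis imageI mem_cball_0)
  have B0: "B \<ge> 0" using order.trans[OF norm_ge_zero B[of 0]] e(1) by simp
  have "norm (hom_part n f z) \<le> B * (1 / e * norm z) ^ n" for n z
  proof (cases "z = 0")
    case True
    have "hom_part n f (0 *s z) = 0 ^ n * hom_part n f z" by (rule hom_part_scale[OF assms])
    moreover have "norm (hom_part 0 f z) \<le> B" using B[of 0] e(1) by (simp add: hom_part_def)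
    ultimately show ?thesis using True B0 by (cases n) auto
  next
    case False
    have "norm (hom_part n f z) \<le> B / (e / norm z) ^ n"
      by (rule hom_part_bound[OF assms]) (use e False B in \<open>auto simp: field_simps subset_iff\<close>)
    thus ?thesis by (simp add: power_divide power_mult_distrib field_simps)
  qed
  moreover have "z \<in> \<Omega>" if "1 / e * norm z \<le> 1" for z using that e by (auto simp: field_simps subset_iff)
  ultimately show ?thesis using B0 e(1) by (intro exI[of _ B] exI[of _ "1 / e"]) auto
qed

text \<open>\<open>hom_part (Suc n) f\<close> is the locally uniform limit, as \<open>t\<close> tends to \<open>0\<close>, of the \<open>n\<close>-th Taylor remainder of
  \<open>f (t z)\<close> divided by \<open>t ^ Suc n\<close>; so it is holomorphic in every variable.\<close>

lemma hom_part_coordinate_holomorphic: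
  assumes f: "holo f \<Omega>"
  shows "(\<lambda>x. hom_part n f (a + x *s b)) holomorphic_on UNIV"
proof (induction n rule: less_induct)
  case (less n)
  obtain B C where BC: "B \<ge> 0" "C > 0" "\<And>n z. norm (hom_part n f z) \<le> B * (C * norm z) ^ n"
     "\<And>z. C * norm z \<le> 1 \<Longrightarrow> z \<in> \<Omega>"
    using hom_part_growth[OF f] by metis
  have balls: "(\<lambda>x. hom_part n f (a + x *s b)) holomorphic_on ball 0 R" if "R > 0" for R
  proof -
    define M where "M = C * (norm a + R * norm b) + 1"
    have M: "M \<ge> 1" using BC(2) that by (simp add: M_def)
    have yM: "C * norm (a + x *s b) \<le> M" if "norm x \<le> R" for x
    proof -
      have "norm (a + x *s b) \<le> norm a + R * norm b"
        using that norm_triangle_le[of a "x *s b"] mult_right_mono[OF that, of "norm b"] by simp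
      thus ?thesis using BC(2) by (simp add: M_def) (smt (verit) mult_left_mono)
    qed
    \<comment> \<open>\<open>M\<close> bounds \<open>C * norm (a + x *s b)\<close> on the disc of
      radius \<open>R\<close>. These factors therefore keep the scaled points in the domain and
      bound the Taylor terms by a geometric series of ratio 1/2.\<close>
    define s where "s j = inverse (2 * M * of_nat (Suc j))" for j :: nat
    have s0: "s j > 0" for j using M by (simp add: s_def)
    have sM: "s j * M \<le> 1 / 2" for j
    proof -
      have "s j * M = 1 / 2 * inverse (real (Suc j))" using M by (simp add: s_def del: of_nat_Suc)
      moreover have "inverse (real (Suc j)) \<le> 1" by (simp add: inverse_le_1_iff)
      ultimately show ?thesis by linarith
    qed
    define F where "F j x = (f (of_real (s j) *s (a + x *s b)) - (\<Sum>m<n. hom_part m f (a + x *s b) * of_real (s j) ^ m)) / of_real (s j) ^ n" for j x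
    have in\<Omega>: "of_real (s j) *s (a + x *s b) \<in> \<Omega>" if "norm x \<le> R" for j x
    proof (rule BC(4))
      have "s j * (C * norm (a + x *s b)) \<le> s j * M" using yM[OF that] s0[of j] by (intro mult_left_mono) auto
      moreover have "C * norm (complex_of_real (s j) *s (a + x *s b)) = s j * (C * norm (a + x *s b))"
        unfolding norm_vector_smult using s0[of j] by simp
      ultimately show "C * norm (of_real (s j) *s (a + x *s b)) \<le> 1" using sM[of j] by linarith
    qed
    have est: "norm (F j x - hom_part n f (a + x *s b)) \<le> 2 * B * M ^ Suc n * s j" if x: "norm x \<le> R" for j x
    proof -
      define y where "y = a + x *s b"
      define t where "t = complex_of_real (s j)"
      have nt: "norm t = s j" "t \<noteq> 0" using s0[of j] by (simp_all add: t_def)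
      have "open {t. t *s y \<in> \<Omega>}" by (rule open_slice)
      have sub: "ball 0 (2 * s j) \<subseteq> {t. t *s y \<in> \<Omega>}"
      proof
        fix u :: complex assume "u \<in> ball 0 (2 * s j)"
        hence "norm u \<le> 2 * s j" by simp
        hence "norm u * (C * norm y) \<le> 2 * s j * M" using yM[OF x] BC(2) s0[of j] by (intro mult_mono) (auto simp: y_def)
        also have "\<dots> \<le> 1" using sM[of j] by simp
        finally show "u \<in> {t. t *s y \<in> \<Omega>}" using BC(4)[of "u *s y"] by (simp add: mult_ac)
      qed
      have "(\<lambda>m. (deriv ^^ m) (\<lambda>t. f (t *s y)) 0 / fact m * (t - 0) ^ m) sums f (t *s y)"
        by (rule holomorphic_power_series[OF holomorphic_on_subset[OF holomorphic_slice[OF f] sub]])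
          (use nt s0[of j] in auto)
      hence sums: "(\<lambda>m. hom_part m f y * t ^ m) sums f (t *s y)" by (simp add: hom_part_def)
      hence "(\<lambda>m. hom_part (m + Suc n) f y * t ^ (m + Suc n)) sums (f (t *s y) - (\<Sum>m<Suc n. hom_part m f y * t ^ m))"
        by (subst sums_iff_shift) simp
      hence tail: "(\<Sum>m. hom_part (m + Suc n) f y * t ^ (m + Suc n)) = f (t *s y) - (\<Sum>m<Suc n. hom_part m f y * t ^ m)"
        by (rule sums_unique[symmetric])
      have trm: "norm (hom_part (m + Suc n) f y * t ^ (m + Suc n)) \<le> (B * (M * s j) ^ Suc n) * (1 / 2) ^ m" for m
      proof -
        have "norm (hom_part (m + Suc n) f y * t ^ (m + Suc n)) \<le> (B * (C * norm y) ^ (m + Suc n)) * s j ^ (m + Suc n)"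
          unfolding norm_mult norm_power nt(1) by (intro mult_right_mono BC(3) zero_le_power less_imp_le[OF s0])
        also have "\<dots> \<le> (B * M ^ (m + Suc n)) * s j ^ (m + Suc n)"
          using yM[OF x] BC(1,2) s0[of j] by (intro mult_right_mono mult_left_mono power_mono) (auto simp: y_def)
        also have "\<dots> = B * (M * s j) ^ Suc n * (s j * M) ^ m"
          by (simp add: power_add power_mult_distrib mult_ac)
        also have "\<dots> \<le> B * (M * s j) ^ Suc n * (1 / 2) ^ m"
          using sM[of j] BC(1) M s0[of j] by (intro mult_left_mono power_mono) auto
        finally show ?thesis .
      qed
      have "norm (\<Sum>m. hom_part (m + Suc n) f y * t ^ (m + Suc n)) \<le> (\<Sum>m. (B * (M * s j) ^ Suc n) * (1 / 2) ^ m)"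
        by (rule norm_suminf_le[OF trm]) (intro summable_mult summable_geometric, simp)
      also have "\<dots> = 2 * (B * (M * s j) ^ Suc n)"
        using suminf_geometric[of "1 / 2 :: real"] by (subst suminf_mult) (auto intro: summable_geometric)
      finally have 1: "norm (f (t *s y) - (\<Sum>m<Suc n. hom_part m f y * t ^ m)) \<le> 2 * (B * (M * s j) ^ Suc n)"
        unfolding tail .
      have "F j x - hom_part n f y = (f (t *s y) - (\<Sum>m<Suc n. hom_part m f y * t ^ m)) / t ^ n"
        using nt(2) by (simp add: F_def y_def t_def field_simps)
      hence "norm (F j x - hom_part n f y) = norm (f (t *s y) - (\<Sum>m<Suc n. hom_part m f y * t ^ m)) / s j ^ n"
        by (simp add: norm_divide norm_power nt(1))
      also have "\<dots> \<le> 2 * (B * (M * s j) ^ Suc n) / s j ^ n"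
        using 1 s0[of j] by (intro divide_right_mono) auto
      also have "\<dots> = 2 * B * M ^ Suc n * s j" using s0[of j] by (simp add: power_mult_distrib field_simps)
      finally show ?thesis by (simp add: y_def)
    qed
    have slim: "s \<longlonglongrightarrow> 0"
    proof -
      have "(\<lambda>j. inverse (2 * M) * inverse (of_nat (Suc j))) \<longlonglongrightarrow> inverse (2 * M) * 0"
        by (intro tendsto_mult_left LIMSEQ_inverse_real_of_nat)
      moreover have "(\<lambda>j. inverse (2 * M) * inverse (of_nat (Suc j))) = s"
        by (rule ext) (simp only: s_def inverse_mult_distrib)
      ultimately show ?thesis by (simp only: mult_zero_right)
    qed
    show ?thesis
    proof (rule holomorphic_uniform_sequence[of _ F])
      fix j
      have sub: "ball 0 R \<subseteq> {x. of_real (s j) *s a + x *s (of_real (s j) *s b) \<in> \<Omega>}"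
        using in\<Omega>[of _ j] by (auto simp: vector_add_ldistrib vector_smult_assoc mult_ac)
      have "(\<lambda>x. f (of_real (s j) *s (a + x *s b))) holomorphic_on ball 0 R"
        using holomorphic_on_subset[OF holo_on_line[OF f open_domain] sub]
        by (simp add: vector_add_ldistrib vector_smult_assoc mult_ac)
      moreover have "(\<lambda>x. hom_part m f (a + x *s b)) holomorphic_on ball 0 R" if "m < n" for m
        using less[OF that] holomorphic_on_subset by blast
      ultimately show "F j holomorphic_on ball 0 R"
        unfolding F_def by (intro holomorphic_intros) (use s0[of j] in auto)
    next
      fix x :: complex assume "x \<in> ball 0 R"
      then obtain d where d: "d > 0" "cball x d \<subseteq> ball 0 R" using open_contains_cball by blast
      moreover have "uniform_limit (cball x d) F (\<lambda>x. hom_part n f (a + x *s b)) sequentially"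
      proof (rule metric_uniform_limit_imp_uniform_limit)
        show "uniform_limit (cball x d) (\<lambda>j x. 2 * B * M ^ Suc n * s j) (\<lambda>x. 0) sequentially"
        proof (rule uniform_limitI)
          fix e :: real assume "e > 0"
          have "(\<lambda>j. 2 * B * M ^ Suc n * s j) \<longlonglongrightarrow> 2 * B * M ^ Suc n * 0" by (intro tendsto_intros slim)
          hence "(\<lambda>j. 2 * B * M ^ Suc n * s j) \<longlonglongrightarrow> 0" by simp
          from tendstoD[OF this \<open>e > 0\<close>]
          show "\<forall>\<^sub>F j in sequentially. \<forall>x\<in>cball x d. dist (2 * B * M ^ Suc n * s j) 0 < e" by simp
        qed
        have "dist (F j y) (hom_part n f (a + y *s b)) \<le> dist (2 * B * M ^ Suc n * s j) 0" if "y \<in> cball x d" for j y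
        proof -
          have "norm y \<le> R" using that d(2) by (auto simp: subset_iff less_imp_le)
          thus ?thesis using est[of y j] by (simp add: dist_norm)
        qed
        thus "\<forall>\<^sub>F j in sequentially. \<forall>y\<in>cball x d. dist (F j y) (hom_part n f (a + y *s b)) \<le> dist (2 * B * M ^ Suc n * s j) 0"
          by simp
      qed
      ultimately show "\<exists>d>0. cball x d \<subseteq> ball 0 R \<and> uniform_limit (cball x d) F (\<lambda>x. hom_part n f (a + x *s b)) sequentially"
        by blast
    qed simp
  qed
  have "\<exists>f'. ((\<lambda>x. hom_part n f (a + x *s b)) has_field_derivative f') (at x)" for x
  proof -
    have "(\<lambda>x. hom_part n f (a + x *s b)) holomorphic_on ball 0 (norm x + 1)"
      by (rule balls) (simp add: add_nonneg_pos)
    thus ?thesis unfolding holomorphic_on_open[OF open_ball] by simp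
  qed
  thus ?case by (simp add: holomorphic_on_open)
qed

text \<open>In one coordinate the homogeneous part is entire and grows no faster than the
  \<open>n\<close>-th power, so Liouville's theorem applies.\<close>

lemma hom_part_coordinate_poly:
  assumes f: "holo f \<Omega>"
  shows "\<exists>q. degree q \<le> n \<and> (\<forall>x. hom_part n f (\<chi> j. if j = i then x else z $ j) = poly q x)"
proof -
  define a where "a = (\<chi> j. if j = i then 0 else z $ j)"
  have line: "(\<chi> j. if j = i then x else z $ j) = a + x *s axis i 1" for x
    by (simp add: a_def vec_eq_iff axis_def)
  obtain B C where BC: "B \<ge> 0" "C > 0" "\<And>n z. norm (hom_part n f z) \<le> B * (C * norm z) ^ n"
    using hom_part_growth[OF f] by metis
  define h where "h x = hom_part n f (a + x *s axis i 1)" for x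
  have hol: "h holomorphic_on UNIV" unfolding h_def by (rule hom_part_coordinate_holomorphic[OF f])
  have "norm (h x) \<le> (B * (C * (norm a + 1)) ^ n) * norm x ^ n" if x: "1 \<le> norm x" for x
  proof -
    have "norm (a + x *s axis i 1) \<le> norm a + norm x" using norm_triangle_ineq[of a "x *s axis i 1"] by (simp add: norm_axis_1)
    also have "\<dots> \<le> (norm a + 1) * norm x" using x mult_left_mono[OF x, of "norm a"] by (simp add: algebra_simps)
    finally have "C * norm (a + x *s axis i 1) \<le> C * (norm a + 1) * norm x" using BC(2) by (simp add: mult.assoc)
    hence "(C * norm (a + x *s axis i 1)) ^ n \<le> (C * (norm a + 1) * norm x) ^ n" using BC(2) by (intro power_mono) auto
    hence "B * (C * norm (a + x *s axis i 1)) ^ n \<le> B * (C * (norm a + 1) * norm x) ^ n" using BC(1) by (rule mult_left_mono)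
    thus ?thesis unfolding h_def using BC(3)[of n "a + x *s axis i 1"] by (simp add: power_mult_distrib mult_ac)
  qed
  from Liouville_polynomial[OF hol this]
  have eq: "h x = (\<Sum>k\<le>n. (deriv ^^ k) h 0 / fact k * x ^ k)" for x by blast
  define q where "q = (\<Sum>k\<le>n. monom ((deriv ^^ k) h 0 / fact k) k)"
  have "degree q \<le> n" unfolding q_def by (intro degree_sum_le) (auto intro: order.trans[OF degree_monom_le])
  moreover have "h x = poly q x" for x by (simp add: q_def poly_sum poly_monom eq[of x])
  ultimately show ?thesis unfolding line h_def by blast
qed

lemma polynomial_fun_hom_part:
  assumes "holo f \<Omega>" shows "polynomial_fun (hom_part n f)"
proof -
  have "grid_interpolation n (hom_part n f) = hom_part n f"
    using grid_interpolation_eq[of n "hom_part n f"] hom_part_coordinate_poly[OF assms] by blast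
  thus ?thesis using polynomial_fun_grid_interpolation by metis
qed

lemma hom_part_bound_uniform:
  assumes f: "holo f \<Omega>" and r: "0 < r" "r < 1"
  shows "\<exists>B\<ge>0. \<forall>n. \<forall>z\<in>closure \<Omega>. norm (hom_part n f z) \<le> B / r ^ n"
proof -
  define K where "K = (\<lambda>z. complex_of_real r *s z) ` closure \<Omega>"
  have "K \<subseteq> \<Omega>" unfolding K_def using r scaled_closure_mem by auto
  moreover have "compact K" unfolding K_def
    by (intro compact_continuous_image compact_closure continuous_intros)
  ultimately have "compact (f ` K)" using holo_continuous_on[OF f]
    by (intro compact_continuous_image) (auto intro: continuous_on_subset)
  hence "bounded (f ` K)" by (rule compact_imp_bounded)
  then obtain B where B: "\<And>z. z \<in> K \<Longrightarrow> norm (f z) \<le> B" unfolding bounded_iff by blast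
  have "norm (hom_part n f z) \<le> B / r ^ n" if z: "z \<in> closure \<Omega>" for n z
  proof (rule hom_part_bound[OF f r(1)])
    show "t *s z \<in> \<Omega>" if "norm t \<le> r" for t :: complex using that z r by (intro scaled_closure_mem) auto
    fix t :: complex assume t: "norm t = r"
    have "t *s z = of_real r *s ((t / of_real r) *s z)" using r by (simp add: vector_smult_assoc)
    moreover have "(t / of_real r) *s z \<in> closure \<Omega>" using t r z by (intro circled_closure) (auto simp: norm_divide)
    ultimately have "t *s z \<in> K" unfolding K_def by blast
    thus "norm (f (t *s z)) \<le> B" by (rule B)
  qed
  moreover have "B \<ge> 0"
  proof -
    have "0 \<in> closure \<Omega>" using zero_mem closure_subset by blast
    hence "(0 :: complex^'n) \<in> K" unfolding K_def by (metis image_iff vec.scale_zero_right)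
    thus ?thesis using B[of 0] norm_ge_zero[of "f 0"] by linarith
  qed
  ultimately show ?thesis by blast
qed

text \<open>An intermediate radius \<open>s\<close> between \<open>r\<close> and 1 makes the Taylor
  tail geometric of ratio \<open>r / s\<close>, uniformly up to the boundary.\<close>

lemma dilation_approximation:
  assumes f: "holo f \<Omega>" and r: "0 \<le> r" "r < 1" and e: "e > 0"
  shows "\<exists>N. \<forall>z\<in>closure \<Omega>. norm (f (of_real r *s z) - (\<Sum>n<N. hom_part n f z * of_real r ^ n)) \<le> e"
proof -
  obtain s where s: "r < s" "s < 1" using r dense by blast
  have s0: "0 < s" using r s by simp
  obtain B where B: "B \<ge> 0" "\<And>n z. z \<in> closure \<Omega> \<Longrightarrow> norm (hom_part n f z) \<le> B / s ^ n"
    using hom_part_bound_uniform[OF f s0 s(2)] by blast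
  have rs: "norm (r / s) < 1" "0 \<le> r / s" using r s by auto
  have lim: "(\<lambda>N. B * (r / s) ^ N * (1 / (1 - r / s))) \<longlonglongrightarrow> B * 0 * (1 / (1 - r / s))"
    by (intro tendsto_mult tendsto_const LIMSEQ_power_zero rs)
  then obtain N where N: "B * (r / s) ^ N * (1 / (1 - r / s)) < e"
    using order_tendstoD(2)[OF lim, of e] e unfolding eventually_sequentially by auto
  have "norm (f (of_real r *s z) - (\<Sum>n<N. hom_part n f z * of_real r ^ n)) \<le> e" if z: "z \<in> closure \<Omega>" for z
  proof -
    have "(\<lambda>n. hom_part n f z * of_real r ^ n) sums f (of_real r *s z)"
      using hom_part_sums[OF f z, of "of_real r"] r by simp
    hence "(\<lambda>n. hom_part (n + N) f z * of_real r ^ (n + N)) sums (f (of_real r *s z) - (\<Sum>n<N. hom_part n f z * of_real r ^ n))"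
      by (subst sums_iff_shift) simp
    hence eq: "f (of_real r *s z) - (\<Sum>n<N. hom_part n f z * of_real r ^ n) = (\<Sum>n. hom_part (n + N) f z * of_real r ^ (n + N))"
      by (rule sums_unique)
    have "norm (hom_part (n + N) f z * of_real r ^ (n + N)) \<le> B * (r / s) ^ N * (r / s) ^ n" for n
    proof -
      have "norm (hom_part (n + N) f z * of_real r ^ (n + N)) \<le> (B / s ^ (n + N)) * r ^ (n + N)"
        unfolding norm_mult norm_power using B(1) B(2)[OF z] r s0 by (intro mult_mono) auto
      thus ?thesis by (simp add: power_add power_divide mult_ac)
    qed
    hence "norm (\<Sum>n. hom_part (n + N) f z * of_real r ^ (n + N)) \<le> (\<Sum>n. B * (r / s) ^ N * (r / s) ^ n)"
      by (rule norm_suminf_le) (intro summable_mult summable_geometric rs)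
    also have "\<dots> = B * (r / s) ^ N * (1 / (1 - r / s))"
      using rs by (subst suminf_mult) (auto simp: suminf_geometric intro: summable_geometric)
    finally show ?thesis using N unfolding eq by simp
  qed
  thus ?thesis by blast
qed

end

section \<open>Square integrable functions\<close>

definition sq_norm :: "'a measure \<Rightarrow> ('a \<Rightarrow> complex) \<Rightarrow> real" where
  "sq_norm M f = (\<integral>x. (norm (f x))\<^sup>2 \<partial>M)"

lemma sq_norm_nonneg [simp]: "0 \<le> sq_norm M f"
  unfolding sq_norm_def by (rule integral_nonneg_AE) simp

lemma sq_norm_minus_commute: "sq_norm M (\<lambda>x. f x - g x) = sq_norm M (\<lambda>x. g x - f x)"
  by (simp add: sq_norm_def norm_minus_commute)

lemma sq_norm_cnj [simp]: "sq_norm M (\<lambda>x. cnj (f x)) = sq_norm M f"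
  by (simp add: sq_norm_def)

lemma sq_norm_scale: "sq_norm M (\<lambda>x. c * f x) = (norm c)\<^sup>2 * sq_norm M f"
  by (simp add: sq_norm_def norm_mult power_mult_distrib)

lemma borel_measurable_cnj [measurable (raw)]:
  "f \<in> borel_measurable M \<Longrightarrow> (\<lambda>x. cnj (f x)) \<in> borel_measurable M"
  by (rule measurable_compose[where N = borel], assumption) (intro borel_measurable_continuous_onI continuous_intros)

lemma LIMSEQ_norm_le:
  assumes "\<And>j. norm (f j) \<le> g j" "g \<longlonglongrightarrow> (0::real)" shows "f \<longlonglongrightarrow> 0"
  by (rule Lim_null_comparison[OF always_eventually assms(2)]) (use assms(1) in blast)

context prob_space
begin

lemma L2_measurable: "f \<in> L2 M \<Longrightarrow> f \<in> borel_measurable M"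
  by (simp add: L2_def)

lemma L2_integrable_sq: "f \<in> L2 M \<Longrightarrow> integrable M (\<lambda>x. (norm (f x))\<^sup>2)"
  by (simp add: L2_def)

lemma L2_I:
  assumes "f \<in> borel_measurable M" "integrable M g" "AE x in M. (norm (f x))\<^sup>2 \<le> g x" shows "f \<in> L2 M"
proof -
  have "integrable M (\<lambda>x. (norm (f x))\<^sup>2)"
    by (rule Bochner_Integration.integrable_bound[OF assms(2)]) (use assms(1,3) in auto)
  thus ?thesis using assms(1) by (simp add: L2_def)
qed

lemma L2_add: assumes "f \<in> L2 M" "g \<in> L2 M" shows "(\<lambda>x. f x + g x) \<in> L2 M"
proof (rule L2_I[of _ "\<lambda>x. 2 * (norm (f x))\<^sup>2 + 2 * (norm (g x))\<^sup>2"])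
  show "AE x in M. (norm (f x + g x))\<^sup>2 \<le> 2 * (norm (f x))\<^sup>2 + 2 * (norm (g x))\<^sup>2"
  proof (rule AE_I2)
    fix x
    have "(norm (f x + g x))\<^sup>2 \<le> (norm (f x) + norm (g x))\<^sup>2"
      by (intro power_mono norm_triangle_ineq) auto
    also have "\<dots> \<le> 2 * (norm (f x))\<^sup>2 + 2 * (norm (g x))\<^sup>2"
      using sum_squares_bound[of "norm (f x)" "norm (g x)"] by (simp add: power2_sum)
    finally show "(norm (f x + g x))\<^sup>2 \<le> 2 * (norm (f x))\<^sup>2 + 2 * (norm (g x))\<^sup>2" .
  qed
qed (use assms in \<open>auto simp: L2_def\<close>)

lemma L2_scale: "f \<in> L2 M \<Longrightarrow> (\<lambda>x. c * f x) \<in> L2 M"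
  by (auto simp: L2_def norm_mult power_mult_distrib)

lemma L2_diff: "f \<in> L2 M \<Longrightarrow> g \<in> L2 M \<Longrightarrow> (\<lambda>x. f x - g x) \<in> L2 M"
  using L2_add[OF _ L2_scale[of g "-1"], of f] by simp

lemma L2_cnj: "f \<in> L2 M \<Longrightarrow> (\<lambda>x. cnj (f x)) \<in> L2 M"
  by (auto simp: L2_def)

lemma L2_mult_bounded:
  assumes "f \<in> L2 M" "g \<in> borel_measurable M" "AE x in M. norm (g x) \<le> B" shows "(\<lambda>x. g x * f x) \<in> L2 M"
proof (rule L2_I[of _ "\<lambda>x. B\<^sup>2 * (norm (f x))\<^sup>2"])
  show "AE x in M. (norm (g x * f x))\<^sup>2 \<le> B\<^sup>2 * (norm (f x))\<^sup>2"
    using assms(3) by eventually_elim (auto simp: norm_mult power_mult_distrib intro!: mult_right_mono power_mono)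
qed (use assms in \<open>auto simp: L2_def\<close>)

lemma L2_const: "(\<lambda>_. c) \<in> L2 M"
  by (auto simp: L2_def)

lemma L2_bounded: "g \<in> borel_measurable M \<Longrightarrow> AE x in M. norm (g x) \<le> B \<Longrightarrow> g \<in> L2 M"
  using L2_mult_bounded[OF L2_const[of 1], of g B] by simp

lemma L2_sum: "(\<And>i. i \<in> I \<Longrightarrow> f i \<in> L2 M) \<Longrightarrow> (\<lambda>x. \<Sum>i\<in>I. f i x) \<in> L2 M"
proof (induction I rule: infinite_finite_induct)
  case (insert i I)
  have "(\<lambda>x. f i x + (\<Sum>i\<in>I. f i x)) \<in> L2 M" by (rule L2_add) (use insert in auto)
  thus ?case using insert by simp
qed (auto intro: L2_const)

lemma L2_integrable_mult: assumes "f \<in> L2 M" "g \<in> L2 M" shows "integrable M (\<lambda>x. f x * g x)"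
proof (rule Bochner_Integration.integrable_bound[of _ "\<lambda>x. (norm (f x))\<^sup>2 + (norm (g x))\<^sup>2"])
  show "AE x in M. norm (f x * g x) \<le> norm ((norm (f x))\<^sup>2 + (norm (g x))\<^sup>2)"
  proof (rule AE_I2)
    fix x
    have "2 * (norm (f x) * norm (g x)) \<le> (norm (f x))\<^sup>2 + (norm (g x))\<^sup>2"
      using sum_squares_bound[of "norm (f x)" "norm (g x)"] by (simp add: mult.assoc)
    moreover have "0 \<le> norm (f x) * norm (g x)" by simp
    ultimately have "norm (f x) * norm (g x) \<le> (norm (f x))\<^sup>2 + (norm (g x))\<^sup>2" by linarith
    thus "norm (f x * g x) \<le> norm ((norm (f x))\<^sup>2 + (norm (g x))\<^sup>2)"
      by (simp add: norm_mult)
  qed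
qed (use assms in \<open>auto simp: L2_def\<close>)

lemma L2_integrable_mult_cnj: "f \<in> L2 M \<Longrightarrow> g \<in> L2 M \<Longrightarrow> integrable M (\<lambda>x. f x * cnj (g x))"
  by (intro L2_integrable_mult L2_cnj)

lemma L2_integrable: "f \<in> L2 M \<Longrightarrow> integrable M f"
  using L2_integrable_mult[OF _ L2_const[of 1], of f] by simp

lemma sq_norm_add:
  assumes "f \<in> L2 M" "g \<in> L2 M"
  shows "sq_norm M (\<lambda>x. f x + g x) = sq_norm M f + sq_norm M g + 2 * Re (\<integral>x. f x * cnj (g x) \<partial>M)"
proof -
  have i: "integrable M (\<lambda>x. f x * cnj (g x))" by (rule L2_integrable_mult_cnj[OF assms])
  have "(norm (f x + g x))\<^sup>2 = (norm (f x))\<^sup>2 + (norm (g x))\<^sup>2 + 2 * Re (f x * cnj (g x))" for x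
    unfolding cmod_power2 by (simp add: power2_eq_square algebra_simps)
  hence "sq_norm M (\<lambda>x. f x + g x) = (\<integral>x. (norm (f x))\<^sup>2 + (norm (g x))\<^sup>2 + 2 * Re (f x * cnj (g x)) \<partial>M)"
    by (simp add: sq_norm_def)
  also have "\<dots> = sq_norm M f + sq_norm M g + 2 * (\<integral>x. Re (f x * cnj (g x)) \<partial>M)"
    unfolding sq_norm_def using i assms
    by (subst Bochner_Integration.integral_add) (auto simp: L2_integrable_sq simp del: times_complex.simps)
  also have "(\<integral>x. Re (f x * cnj (g x)) \<partial>M) = Re (\<integral>x. f x * cnj (g x) \<partial>M)"
    by (rule integral_Re[OF i])
  finally show ?thesis .
qed

lemma sq_norm_diff:
  assumes "f \<in> L2 M" "g \<in> L2 M"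
  shows "sq_norm M (\<lambda>x. f x - g x) = sq_norm M f + sq_norm M g - 2 * Re (\<integral>x. f x * cnj (g x) \<partial>M)"
  using sq_norm_add[OF assms(1) L2_scale[OF assms(2), of "-1"]] sq_norm_scale[of M "-1" g] by simp

lemma inner_self: "(\<integral>x. f x * cnj (f x) \<partial>M) = of_real (sq_norm M f)"
  unfolding sq_norm_def by (simp add: complex_norm_square[symmetric] flip: of_real_power)

lemma parallelogram:
  assumes "f \<in> L2 M" "g \<in> L2 M"
  shows "sq_norm M (\<lambda>x. f x - g x) = 2 * sq_norm M f + 2 * sq_norm M g - 4 * sq_norm M (\<lambda>x. (f x + g x) / 2)"
  using sq_norm_add[OF assms] sq_norm_diff[OF assms] sq_norm_scale[of M "1/2" "\<lambda>x. f x + g x"]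
  by (simp add: power2_eq_square norm_divide)

lemma cauchy_schwarz_real:
  assumes "f \<in> L2 M" "g \<in> L2 M"
  shows "(\<integral>x. norm (f x) * norm (g x) \<partial>M)\<^sup>2 \<le> sq_norm M f * sq_norm M g"
proof -
  define c where "c = (\<integral>x. norm (f x) * norm (g x) \<partial>M)"
  have i: "integrable M (\<lambda>x. norm (f x) * norm (g x))"
    using integrable_norm[OF L2_integrable_mult[OF assms]] by (simp add: norm_mult)
  have q: "0 \<le> sq_norm M f - 2 * t * c + t\<^sup>2 * sq_norm M g" for t
  proof -
    have "0 \<le> (\<integral>x. (norm (f x) - t * norm (g x))\<^sup>2 \<partial>M)" by (rule integral_nonneg_AE) simp
    also have "\<dots> = (\<integral>x. (norm (f x))\<^sup>2 - 2 * t * (norm (f x) * norm (g x)) + t\<^sup>2 * (norm (g x))\<^sup>2 \<partial>M)"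
      by (simp add: power2_eq_square algebra_simps)
    also have "\<dots> = sq_norm M f - 2 * t * c + t\<^sup>2 * sq_norm M g"
      unfolding sq_norm_def c_def using i assms
      by (simp add: L2_integrable_sq)
    finally show ?thesis .
  qed
  show ?thesis
  proof (cases "sq_norm M g = 0")
    case True
    have "c = 0"
    proof (rule ccontr)
      assume "c \<noteq> 0"
      have "0 \<le> sq_norm M f - 2 * ((sq_norm M f + 1) / c) * c" using q[of "(sq_norm M f + 1) / c"] True by simp
      hence "0 \<le> - sq_norm M f - 2" using \<open>c \<noteq> 0\<close> by simp
      thus False using sq_norm_nonneg[of M f] by linarith
    qed
    thus ?thesis using True by (simp add: c_def)
  next
    case False
    hence b: "sq_norm M g > 0" using sq_norm_nonneg[of M g] by linarith
    have "0 \<le> sq_norm M f - 2 * (c / sq_norm M g) * c + (c / sq_norm M g)\<^sup>2 * sq_norm M g" by (rule q)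
    also have "\<dots> = sq_norm M f - c\<^sup>2 / sq_norm M g" using b by (simp add: field_simps power2_eq_square)
    finally show ?thesis using b by (simp add: c_def field_simps)
  qed
qed

lemma cauchy_schwarz:
  assumes "f \<in> L2 M" "g \<in> L2 M"
  shows "norm (\<integral>x. f x * g x \<partial>M) \<le> sqrt (sq_norm M f) * sqrt (sq_norm M g)"
proof -
  have "norm (\<integral>x. f x * g x \<partial>M) \<le> (\<integral>x. norm (f x) * norm (g x) \<partial>M)"
    using integral_norm_bound[of M "\<lambda>x. f x * g x"] by (simp add: norm_mult)
  also have "\<dots> \<le> sqrt (sq_norm M f * sq_norm M g)"
    by (rule real_le_rsqrt[OF cauchy_schwarz_real[OF assms]])
  finally show ?thesis by (simp add: real_sqrt_mult)
qed

lemma L1_le_L2: assumes "f \<in> L2 M" shows "(\<integral>x. norm (f x) \<partial>M) \<le> sqrt (sq_norm M f)"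
proof -
  have "(\<integral>x. norm (f x) \<partial>M)\<^sup>2 \<le> sq_norm M f * sq_norm M (\<lambda>_. 1)"
    using cauchy_schwarz_real[OF assms L2_const[of 1]] by simp
  thus ?thesis by (intro real_le_rsqrt) (simp add: sq_norm_def prob_space)
qed

lemma sq_norm_triangle:
  assumes "f \<in> L2 M" "g \<in> L2 M"
  shows "sqrt (sq_norm M (\<lambda>x. f x + g x)) \<le> sqrt (sq_norm M f) + sqrt (sq_norm M g)"
proof -
  have "Re (\<integral>x. f x * cnj (g x) \<partial>M) \<le> sqrt (sq_norm M f) * sqrt (sq_norm M g)"
    using cauchy_schwarz[OF assms(1) L2_cnj[OF assms(2)]] complex_Re_le_cmod[of "\<integral>x. f x * cnj (g x) \<partial>M"] by simp
  hence "sq_norm M (\<lambda>x. f x + g x) \<le> (sqrt (sq_norm M f) + sqrt (sq_norm M g))\<^sup>2"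
    unfolding sq_norm_add[OF assms] by (simp add: power2_sum)
  thus ?thesis by (intro real_le_lsqrt) auto
qed

lemma sq_norm_add_le:
  assumes "f \<in> L2 M" "g \<in> L2 M"
  shows "sq_norm M (\<lambda>x. f x + g x) \<le> 2 * sq_norm M f + 2 * sq_norm M g"
  using parallelogram[OF assms(1) L2_scale[OF assms(2), of "-1"]] sq_norm_scale[of M "-1" g]
    sq_norm_nonneg[of M "\<lambda>x. (f x + - 1 * g x) / 2"] by simp

lemma sq_norm_0_AE: assumes "f \<in> L2 M" "sq_norm M f = 0" shows "AE x in M. f x = 0"
proof -
  have "AE x in M. (norm (f x))\<^sup>2 = 0"
    using integral_nonneg_eq_0_iff_AE[OF L2_integrable_sq[OF assms(1)]] assms(2) by (simp add: sq_norm_def)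
  thus ?thesis by simp
qed

lemma sq_norm_cong_AE:
  assumes "f \<in> borel_measurable M" "g \<in> borel_measurable M" "AE x in M. f x = g x"
  shows "sq_norm M f = sq_norm M g"
  unfolding sq_norm_def by (intro integral_cong_AE) (use assms in auto)

lemma tendsto_integral_mult:
  assumes "\<And>j. f j \<in> L2 M" "g \<in> L2 M" "h \<in> L2 M" "(\<lambda>j. sq_norm M (\<lambda>x. f j x - g x)) \<longlonglongrightarrow> 0"
  shows "(\<lambda>j. \<integral>x. f j x * h x \<partial>M) \<longlonglongrightarrow> (\<integral>x. g x * h x \<partial>M)"
proof -
  have "(\<lambda>j. sqrt (sq_norm M (\<lambda>x. f j x - g x)) * sqrt (sq_norm M h)) \<longlonglongrightarrow> sqrt 0 * sqrt (sq_norm M h)"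
    by (intro tendsto_intros assms)
  hence lim: "(\<lambda>j. sqrt (sq_norm M (\<lambda>x. f j x - g x)) * sqrt (sq_norm M h)) \<longlonglongrightarrow> 0" by simp
  have b: "norm ((\<integral>x. f j x * h x \<partial>M) - (\<integral>x. g x * h x \<partial>M)) \<le> sqrt (sq_norm M (\<lambda>x. f j x - g x)) * sqrt (sq_norm M h)" for j
  proof -
    have "(\<integral>x. f j x * h x \<partial>M) - (\<integral>x. g x * h x \<partial>M) = (\<integral>x. (f j x - g x) * h x \<partial>M)"
      using L2_integrable_mult[OF assms(1,3), of j] L2_integrable_mult[OF assms(2,3)]
      by (simp add: left_diff_distrib)
    thus ?thesis using cauchy_schwarz[OF L2_diff[OF assms(1,2)] assms(3), of j] by simp
  qed
  have "(\<lambda>j. (\<integral>x. f j x * h x \<partial>M) - (\<integral>x. g x * h x \<partial>M)) \<longlonglongrightarrow> 0"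
    by (rule LIMSEQ_norm_le[OF b lim])
  thus ?thesis by (simp add: LIM_zero_iff)
qed

lemma tendsto_sq_norm:
  assumes "\<And>j. f j \<in> L2 M" "g \<in> L2 M" "(\<lambda>j. sq_norm M (\<lambda>x. f j x - g x)) \<longlonglongrightarrow> 0"
  shows "(\<lambda>j. sq_norm M (f j)) \<longlonglongrightarrow> sq_norm M g"
proof -
  have b: "norm (sqrt (sq_norm M (f j)) - sqrt (sq_norm M g)) \<le> sqrt (sq_norm M (\<lambda>x. f j x - g x))" for j
  proof -
    have "sqrt (sq_norm M (f j)) \<le> sqrt (sq_norm M (\<lambda>x. f j x - g x)) + sqrt (sq_norm M g)"
      using sq_norm_triangle[OF L2_diff[OF assms(1,2)] assms(2), of j] by simp
    moreover have "sqrt (sq_norm M g) \<le> sqrt (sq_norm M (\<lambda>x. g x - f j x)) + sqrt (sq_norm M (f j))"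
      using sq_norm_triangle[OF L2_diff[OF assms(2,1)] assms(1), of j j] by simp
    ultimately show ?thesis using sq_norm_minus_commute[of M "f j" g] by simp
  qed
  have lim: "(\<lambda>j. sqrt (sq_norm M (\<lambda>x. f j x - g x))) \<longlonglongrightarrow> 0"
    using tendsto_real_sqrt[OF assms(3)] by simp
  have "(\<lambda>j. sqrt (sq_norm M (f j)) - sqrt (sq_norm M g)) \<longlonglongrightarrow> 0"
    by (rule LIMSEQ_norm_le[OF b lim])
  hence "(\<lambda>j. sqrt (sq_norm M (f j))) \<longlonglongrightarrow> sqrt (sq_norm M g)" by (simp add: LIM_zero_iff)
  hence "(\<lambda>j. (sqrt (sq_norm M (f j)))\<^sup>2) \<longlonglongrightarrow> (sqrt (sq_norm M g))\<^sup>2" by (rule tendsto_power)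
  thus ?thesis by simp
qed

lemma ennreal_sq_norm: "f \<in> L2 M \<Longrightarrow> ennreal (sq_norm M f) = (\<integral>\<^sup>+x. ennreal ((norm (f x))\<^sup>2) \<partial>M)"
  unfolding sq_norm_def by (rule nn_integral_eq_integral[symmetric]) (auto simp: L2_integrable_sq)

lemma L2_fatou:
  assumes "\<And>j::nat. f j \<in> L2 M" "g \<in> borel_measurable M" "AE x in M. (\<lambda>j. f j x) \<longlonglongrightarrow> g x"
    "\<And>j. sq_norm M (f j) \<le> B"
  shows "g \<in> L2 M" "sq_norm M g \<le> B"
proof -
  have "(\<integral>\<^sup>+x. ennreal ((norm (g x))\<^sup>2) \<partial>M) = (\<integral>\<^sup>+x. liminf (\<lambda>j. ennreal ((norm (f j x))\<^sup>2)) \<partial>M)"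
  proof (rule nn_integral_cong_AE)
    show "AE x in M. ennreal ((norm (g x))\<^sup>2) = liminf (\<lambda>j. ennreal ((norm (f j x))\<^sup>2))"
      using assms(3)
    proof eventually_elim
      case (elim x)
      hence "(\<lambda>j. ennreal ((norm (f j x))\<^sup>2)) \<longlonglongrightarrow> ennreal ((norm (g x))\<^sup>2)"
        by (intro tendsto_ennrealI tendsto_power tendsto_norm)
      thus ?case by (rule lim_imp_Liminf[OF sequentially_bot, symmetric])
    qed
  qed
  also have "\<dots> \<le> liminf (\<lambda>j. \<integral>\<^sup>+x. ennreal ((norm (f j x))\<^sup>2) \<partial>M)"
    by (rule nn_integral_liminf) (use assms(1) L2_measurable in auto)
  also have "\<dots> \<le> ennreal B"
    by (intro Liminf_le) (simp_all add: ennreal_sq_norm[OF assms(1), symmetric] assms(4) ennreal_leI)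
  finally have *: "(\<integral>\<^sup>+x. ennreal ((norm (g x))\<^sup>2) \<partial>M) \<le> ennreal B" .
  have "integrable M (\<lambda>x. (norm (g x))\<^sup>2)"
    by (rule integrableI_bounded) (use assms(2) le_less_trans[OF *] in auto)
  thus g: "g \<in> L2 M" using assms(2) by (simp add: L2_def)
  have "B \<ge> 0" using assms(4)[of 0] sq_norm_nonneg order.trans by blast
  thus "sq_norm M g \<le> B" using * unfolding ennreal_sq_norm[OF g, symmetric] by simp
qed

text \<open>Riesz--Fischer: a subsequence whose successive distances are summable converges almost everywhere.\<close>

lemma L2_complete:
  assumes f: "\<And>j::nat. f j \<in> L2 M"
    and Cauchy: "\<And>e. e > 0 \<Longrightarrow> \<exists>N. \<forall>i\<ge>N. \<forall>j\<ge>N. sq_norm M (\<lambda>x. f i x - f j x) < e"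
  shows "\<exists>g\<in>L2 M. (\<lambda>j. sq_norm M (\<lambda>x. f j x - g x)) \<longlonglongrightarrow> 0"
proof -
  have "\<exists>N. \<forall>i\<ge>N. \<forall>j\<ge>N. sq_norm M (\<lambda>x. f i x - f j x) < (1/4) ^ n" for n using Cauchy[of "(1/4)^n"] by simp
  then obtain N where N: "\<And>n i j. i \<ge> N n \<Longrightarrow> j \<ge> N n \<Longrightarrow> sq_norm M (\<lambda>x. f i x - f j x) < (1/4) ^ n" by metis
  \<comment> \<open>Partial sums make the indices nondecreasing and at least \<open>N n\<close>,
    without any monotonicity of \<open>N\<close>.\<close>
  define s where "s n = (\<Sum>m\<le>n. N m) + n" for n
  have sN: "s n \<ge> N n" for n unfolding s_def by (simp add: trans_le_add1 member_le_sum)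
  have ss: "s (Suc n) \<ge> s n" for n by (simp add: s_def)
  have sn: "s n \<ge> n" for n by (simp add: s_def)
  have step: "(\<integral>x. norm (f (s (Suc n)) x - f (s n) x) \<partial>M) \<le> (1/2) ^ n" for n
  proof -
    have "(\<integral>x. norm (f (s (Suc n)) x - f (s n) x) \<partial>M) \<le> sqrt (sq_norm M (\<lambda>x. f (s (Suc n)) x - f (s n) x))"
      by (intro L1_le_L2 L2_diff f)
    also have "\<dots> \<le> sqrt ((1/4) ^ n)"
      using N[of n "s (Suc n)" "s n"] sN[of n] ss[of n] by (intro real_sqrt_le_mono less_imp_le) linarith
    also have "\<dots> = (1/2) ^ n" by (simp add: real_sqrt_power real_sqrt_divide)
    finally show ?thesis .
  qed
  have meas: "f j \<in> borel_measurable M" for j using f L2_measurable by blast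
  have "(\<integral>\<^sup>+x. (\<Sum>n. ennreal (norm (f (s (Suc n)) x - f (s n) x))) \<partial>M) = (\<Sum>n. \<integral>\<^sup>+x. ennreal (norm (f (s (Suc n)) x - f (s n) x)) \<partial>M)"
    by (rule nn_integral_suminf) (use meas in auto)
  also have "\<dots> \<le> (\<Sum>n. ennreal ((1/2) ^ n))"
  proof (rule suminf_le)
    fix n
    have "(\<integral>\<^sup>+x. ennreal (norm (f (s (Suc n)) x - f (s n) x)) \<partial>M) = ennreal (\<integral>x. norm (f (s (Suc n)) x - f (s n) x) \<partial>M)"
      by (rule nn_integral_eq_integral) (auto intro!: integrable_norm L2_integrable L2_diff f)
    thus "(\<integral>\<^sup>+x. ennreal (norm (f (s (Suc n)) x - f (s n) x)) \<partial>M) \<le> ennreal ((1/2) ^ n)"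
      using step[of n] by (simp add: ennreal_leI)
  qed auto
  also have "\<dots> = ennreal (\<Sum>n. (1/2) ^ n)" by (intro suminf_ennreal2 summable_geometric) auto
  also have "\<dots> < \<infinity>" by simp
  finally have fin: "(\<integral>\<^sup>+x. (\<Sum>n. ennreal (norm (f (s (Suc n)) x - f (s n) x))) \<partial>M) \<noteq> \<infinity>" by simp
  have "AE x in M. (\<Sum>n. ennreal (norm (f (s (Suc n)) x - f (s n) x))) \<noteq> \<infinity>"
    by (rule nn_integral_PInf_AE[OF _ fin]) (use meas in measurable)
  hence conv: "AE x in M. convergent (\<lambda>n. f (s n) x)"
  proof eventually_elim
    case (elim x)
    hence "summable (\<lambda>n. norm (f (s (Suc n)) x - f (s n) x))" by (intro summable_suminf_not_top) auto
    hence "summable (\<lambda>n. f (s (Suc n)) x - f (s n) x)" by (rule summable_norm_cancel)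
    hence "convergent (\<lambda>n. \<Sum>i<n. f (s (Suc i)) x - f (s i) x)" by (simp add: summable_iff_convergent)
    hence "convergent (\<lambda>n. f (s n) x - f (s 0) x)" using sum_lessThan_telescope[of "\<lambda>i. f (s i) x"] by simp
    from convergent_add[OF this convergent_const[of "f (s 0) x"]] show ?case by simp
  qed
  define g where "g x = lim (\<lambda>n. f (s n) x)" for x
  have gm: "g \<in> borel_measurable M" unfolding g_def by (intro borel_measurable_lim_metric meas)
  have lim: "AE x in M. (\<lambda>n. f (s n) x) \<longlonglongrightarrow> g x"
    using conv unfolding g_def by eventually_elim (simp add: convergent_LIMSEQ_iff)
  \<comment> \<open>Fatou's lemma with \<open>f i\<close> held fixed passes the Cauchy bound to the
    limit of the subsequence, which gives convergence of the whole sequence.\<close>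
  have est: "(\<lambda>x. f i x - g x) \<in> L2 M \<and> sq_norm M (\<lambda>x. f i x - g x) \<le> (1/4) ^ n" if "i \<ge> N n" for i n
  proof -
    have 1: "AE x in M. (\<lambda>j. f i x - f (s (j + n)) x) \<longlonglongrightarrow> f i x - g x"
      using lim by eventually_elim (intro tendsto_diff tendsto_const LIMSEQ_ignore_initial_segment)
    have mono: "s (j + n) \<ge> s n" for j by (induction j) (use ss order.trans in auto)
    have 2: "sq_norm M (\<lambda>x. f i x - f (s (j + n)) x) \<le> (1/4) ^ n" for j
      by (rule less_imp_le[OF N]) (use that sN[of n] mono[of j] in auto)
    show ?thesis using L2_fatou[OF L2_diff[OF f f] _ 1 2] meas gm by auto
  qed
  have "(\<lambda>x. f (N 0) x - (f (N 0) x - g x)) \<in> L2 M" by (rule L2_diff[OF f]) (use est[of 0 "N 0"] in auto)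
  hence "g \<in> L2 M" by simp
  moreover have "(\<lambda>j. sq_norm M (\<lambda>x. f j x - g x)) \<longlonglongrightarrow> 0"
  proof (rule LIMSEQ_I)
    fix e :: real assume "e > 0"
    then obtain n where "(1/4) ^ n < e" using real_arch_pow_inv[of e "1/4"] by auto
    thus "\<exists>no. \<forall>j\<ge>no. norm (sq_norm M (\<lambda>x. f j x - g x) - 0) < e"
      using est by (intro exI[of _ "N n"]) (fastforce intro: le_less_trans)
  qed
  ultimately show ?thesis by blast
qed

text \<open>By the parallelogram law, nearly minimal elements form a Cauchy sequence.\<close>

lemma minimizing_sequence_converges:
  assumes X: "\<And>j. X j \<subseteq> L2 M" "\<And>j f g. f \<in> X j \<Longrightarrow> g \<in> X j \<Longrightarrow> (\<lambda>x. (f x + g x) / 2) \<in> X j"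
    "\<And>i j. i \<le> j \<Longrightarrow> X j \<subseteq> X i"
    and m: "\<And>j f. f \<in> X j \<Longrightarrow> m j \<le> sq_norm M f" "mono m" "\<And>j. m j \<le> B"
    and f: "\<And>j::nat. f j \<in> X j" "\<And>j. sq_norm M (f j) \<le> m j + inverse (of_nat (Suc j))"
  shows "\<exists>g\<in>L2 M. (\<lambda>j. sq_norm M (\<lambda>x. f j x - g x)) \<longlonglongrightarrow> 0"
proof (rule L2_complete)
  show "f j \<in> L2 M" for j using f(1) X(1) by blast
  fix e :: real assume e: "e > 0"
  obtain L where "m \<longlonglongrightarrow> L" using incseq_convergent[OF m(2), of B] m(3) by blast
  hence "convergent m" by (rule convergentI)
  hence "Cauchy m" by (simp add: Cauchy_convergent_iff)
  then obtain N1 where N1: "\<And>i j. i \<ge> N1 \<Longrightarrow> j \<ge> N1 \<Longrightarrow> norm (m i - m j) < e / 8" using CauchyD[of m "e / 8"] e by auto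
  obtain N2 where N2: "inverse (real (Suc N2)) < e / 8" using reals_Archimedean[of "e / 8"] e by auto
  have *: "sq_norm M (\<lambda>x. f i x - f j x) < e" if ij: "i \<le> j" "i \<ge> max N1 N2" for i j
  proof -
    \<comment> \<open>Nestedness puts both functions into \<open>X i\<close>, where the midpoint has
      squared norm at least \<open>m i\<close>; as \<open>m i\<close> and \<open>m j\<close> are
      close, the parallelogram law leaves little room for the difference.\<close>
    have "f j \<in> X i" using f(1)[of j] X(3)[OF ij(1)] by blast
    hence mid: "m i \<le> sq_norm M (\<lambda>x. (f i x + f j x) / 2)" by (intro m(1) X(2) f(1))
    have aux: "s \<le> 2 * A + 2 * B - 4 * d" if "d \<le> c" "s = 2 * a + 2 * b - 4 * c" "a \<le> A" "b \<le> B"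
      for a b c d s A B :: real using that by linarith
    have "sq_norm M (\<lambda>x. f i x - f j x) \<le> 2 * (m i + inverse (of_nat (Suc i))) + 2 * (m j + inverse (of_nat (Suc j))) - 4 * m i"
      by (rule aux[OF mid parallelogram[OF subsetD[OF X(1) f(1)] subsetD[OF X(1) f(1)]] f(2) f(2)])
    also have "\<dots> = 2 * (m j - m i) + 2 * inverse (of_nat (Suc i)) + 2 * inverse (of_nat (Suc j))" by simp
    also have "\<dots> < e"
    proof -
      have "m j - m i < e / 8" using N1[of j i] ij abs_ge_self[of "m j - m i"] by (simp only: real_norm_def) linarith
      moreover have "inverse (real (Suc i)) \<le> inverse (real (Suc N2))" "inverse (real (Suc j)) \<le> inverse (real (Suc N2))"
        using ij by (auto intro!: le_imp_inverse_le)
      moreover have "2 * x + 2 * a + 2 * c < e" if "x < e / 8" "a \<le> b" "c \<le> b" "b < e / 8" for x a b c :: real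
        using that e by linarith
      ultimately show ?thesis using N2 by blast
    qed
    finally show ?thesis .
  qed
  show "\<exists>N. \<forall>i\<ge>N. \<forall>j\<ge>N. sq_norm M (\<lambda>x. f i x - f j x) < e"
  proof (intro exI[of _ "max N1 N2"] allI impI)
    fix i j assume "i \<ge> max N1 N2" "j \<ge> max N1 N2"
    thus "sq_norm M (\<lambda>x. f i x - f j x) < e"
      using *[of i j] *[of j i] sq_norm_minus_commute[of M "f i" "f j"] by (cases "i \<le> j") auto
  qed
qed

lemma minimal_imp_orthogonal:
  assumes "y \<in> L2 M" "g \<in> L2 M" "\<And>t. sq_norm M y \<le> sq_norm M (\<lambda>x. y x - t * g x)"
  shows "(\<integral>x. y x * cnj (g x) \<partial>M) = 0"
proof -
  define c where "c = (\<integral>x. y x * cnj (g x) \<partial>M)"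
  show ?thesis
  proof (cases "sq_norm M g = 0")
    case True
    thus ?thesis using cauchy_schwarz[OF assms(1) L2_cnj[OF assms(2)]] by simp
  next
    case False
    hence b: "sq_norm M g > 0" using sq_norm_nonneg[of M g] by linarith
    \<comment> \<open>The minimiser of the quadratic in \<open>t\<close>: there the squared norm
      drops by \<open>(norm c)\<^sup>2 / sq_norm M g\<close>.\<close>
    define t where "t = c / of_real (sq_norm M g)"
    have "(\<integral>x. y x * cnj (t * g x) \<partial>M) = cnj t * c"
      by (simp add: c_def mult.left_commute[of "y _"])
    also have "\<dots> = (cnj c * c) / of_real (sq_norm M g)" by (simp add: t_def)
    also have "cnj c * c = of_real ((norm c)\<^sup>2)" by (simp only: complex_norm_square mult.commute)
    also have "of_real ((norm c)\<^sup>2) / of_real (sq_norm M g) = complex_of_real ((norm c)\<^sup>2 / sq_norm M g)" by simp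
    finally have r: "Re (\<integral>x. y x * cnj (t * g x) \<partial>M) = (norm c)\<^sup>2 / sq_norm M g" by (simp only: Re_complex_of_real)
    have "sq_norm M (\<lambda>x. t * g x) = (norm c)\<^sup>2 / sq_norm M g"
      unfolding sq_norm_scale using b by (simp add: t_def norm_divide power_divide power2_eq_square)
    hence "sq_norm M y \<le> sq_norm M y + (norm c)\<^sup>2 / sq_norm M g - 2 * ((norm c)\<^sup>2 / sq_norm M g)"
      using assms(3)[of t] sq_norm_diff[OF assms(1) L2_scale[OF assms(2), of t]] r by simp
    hence "(norm c)\<^sup>2 / sq_norm M g \<le> 0" by simp
    hence "(norm c)\<^sup>2 \<le> 0" using b by (simp add: divide_le_0_iff)
    thus ?thesis by (simp add: c_def)
  qed
qed

text \<open>\<open>W\<close> is not assumed closed, so the projection \<open>u - y\<close> is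
  delivered as the limit of a sequence in \<open>W\<close>.\<close>

lemma L2_projection:
  assumes W: "W \<subseteq> L2 M" "(\<lambda>_. 0) \<in> W" "\<And>f g. f \<in> W \<Longrightarrow> g \<in> W \<Longrightarrow> (\<lambda>x. f x + g x) \<in> W"
    "\<And>c f. f \<in> W \<Longrightarrow> (\<lambda>x. c * f x) \<in> W"
    and u: "u \<in> L2 M"
  shows "\<exists>f y. (\<forall>j::nat. f j \<in> W) \<and> y \<in> L2 M \<and> (\<lambda>j. sq_norm M (\<lambda>x. f j x - (u x - y x))) \<longlonglongrightarrow> 0 \<and>
    (\<forall>g\<in>W. (\<integral>x. y x * cnj (g x) \<partial>M) = 0)"
proof -
  define X where "X = {\<lambda>x. u x - f x | f. f \<in> W}"
  have XL: "X \<subseteq> L2 M" using W(1) u by (auto simp: X_def intro!: L2_diff)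
  define m where "m = Inf (sq_norm M ` X)"
  have bdd: "bdd_below (sq_norm M ` X)" by (intro bdd_belowI[of _ 0]) auto
  have ne: "X \<noteq> {}" using W(2) by (auto simp: X_def)
  have m: "m \<le> sq_norm M f" if "f \<in> X" for f unfolding m_def using that bdd by (intro cInf_lower) auto
  have "\<exists>f\<in>W. sq_norm M (\<lambda>x. u x - f x) \<le> m + inverse (of_nat (Suc j))" for j
  proof -
    have "Inf (sq_norm M ` X) < m + inverse (of_nat (Suc j))" by (simp add: m_def del: of_nat_Suc)
    then obtain h where "h \<in> X" "sq_norm M h < m + inverse (of_nat (Suc j))"
      using cInf_lessD[of "sq_norm M ` X"] ne by auto
    thus ?thesis by (auto simp: X_def intro!: less_imp_le)
  qed
  then obtain f where f: "\<And>j. f j \<in> W" "\<And>j. sq_norm M (\<lambda>x. u x - f j x) \<le> m + inverse (of_nat (Suc j))" by metis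
  have "\<exists>y\<in>L2 M. (\<lambda>j. sq_norm M (\<lambda>x. (u x - f j x) - y x)) \<longlonglongrightarrow> 0"
  proof (rule minimizing_sequence_converges[where X = "\<lambda>_. X" and m = "\<lambda>_. m" and B = m])
    fix g h assume "g \<in> X" "h \<in> X"
    then obtain g' h' where "g' \<in> W" "h' \<in> W" "g = (\<lambda>x. u x - g' x)" "h = (\<lambda>x. u x - h' x)" unfolding X_def by blast
    thus "(\<lambda>x. (g x + h x) / 2) \<in> X"
      unfolding X_def by (intro CollectI exI[of _ "\<lambda>x. (1/2) * (g' x + h' x)"] conjI W) (auto simp: field_simps)
  qed (use XL m f in \<open>auto simp: X_def mono_def\<close>)
  then obtain y where y: "y \<in> L2 M" "(\<lambda>j. sq_norm M (\<lambda>x. (u x - f j x) - y x)) \<longlonglongrightarrow> 0" by blast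
  have ufL: "(\<lambda>x. u x - f j x) \<in> L2 M" for j using f(1) W(1) u by (auto intro: L2_diff)
  have "sq_norm M y \<le> m"
  proof (rule LIMSEQ_le[OF tendsto_sq_norm[OF ufL y(1) y(2)]])
    show "(\<lambda>j. m + inverse (of_nat (Suc j))) \<longlonglongrightarrow> m"
      using tendsto_add[OF tendsto_const LIMSEQ_inverse_real_of_nat, of m] by simp
  qed (use f(2) in auto)
  moreover have "m \<le> sq_norm M (\<lambda>x. y x - t * g x)" if g: "g \<in> W" for g t
  proof (rule LIMSEQ_le_const)
    have gL: "g \<in> L2 M" using g W(1) by blast
    have "(\<lambda>x. (u x - f j x - t * g x) - (y x - t * g x)) = (\<lambda>x. (u x - f j x) - y x)" for j by auto
    thus "(\<lambda>j. sq_norm M (\<lambda>x. u x - f j x - t * g x)) \<longlonglongrightarrow> sq_norm M (\<lambda>x. y x - t * g x)"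
      using y by (intro tendsto_sq_norm L2_diff ufL L2_scale gL y(1)) simp
    have "m \<le> sq_norm M (\<lambda>x. u x - (f j x + t * g x))" for j
      by (rule m) (use W g f(1)[of j] in \<open>auto simp: X_def\<close>)
    thus "\<exists>N. \<forall>j\<ge>N. m \<le> sq_norm M (\<lambda>x. u x - f j x - t * g x)" by (simp add: diff_diff_eq)
  qed
  ultimately have "(\<integral>x. y x * cnj (g x) \<partial>M) = 0" if "g \<in> W" for g
    using that W(1) y(1) by (intro minimal_imp_orthogonal) (auto intro: order.trans)
  moreover have "sq_norm M (\<lambda>x. (u x - f j x) - y x) = sq_norm M (\<lambda>x. f j x - (u x - y x))" for j
    using sq_norm_minus_commute[of M "\<lambda>x. u x - y x" "f j"] by (simp add: algebra_simps)
  ultimately show ?thesis using f(1) y by (intro exI[of _ f] exI[of _ y]) auto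
qed

text \<open>The excess of \<open>norm (l x)\<close> over 1 is pointwise at most
  \<open>norm (k j x - l x)\<close>, so its L2 norm is 0.\<close>

lemma unit_ball_closed:
  assumes "\<And>j::nat. k j \<in> L2 M" "\<And>j. AE x in M. norm (k j x) \<le> 1" "l \<in> L2 M"
    "(\<lambda>j. sq_norm M (\<lambda>x. k j x - l x)) \<longlonglongrightarrow> 0"
  shows "AE x in M. norm (l x) \<le> 1"
proof -
  define p where "p x = complex_of_real (max (norm (l x) - 1) 0)" for x
  have pl: "norm (p x) \<le> norm (l x)" for x by (simp add: p_def)
  have pm: "p \<in> borel_measurable M" unfolding p_def using L2_measurable[OF assms(3)] by measurable
  have pL: "p \<in> L2 M"
    by (rule L2_I[OF pm L2_integrable_sq[OF assms(3)]]) (use pl in \<open>auto intro!: power_mono\<close>)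
  have "sq_norm M p \<le> sq_norm M (\<lambda>x. k j x - l x)" for j
    unfolding sq_norm_def
  proof (rule integral_mono_AE[OF L2_integrable_sq[OF pL] L2_integrable_sq[OF L2_diff[OF assms(1,3)]]])
    show "AE x in M. (norm (p x))\<^sup>2 \<le> (norm (k j x - l x))\<^sup>2"
      using assms(2)[of j]
    proof eventually_elim
      case (elim x)
      hence "norm (l x) - 1 \<le> norm (k j x - l x)" using norm_triangle_ineq2[of "l x" "k j x"] by (simp add: norm_minus_commute)
      thus ?case by (intro power_mono) (auto simp: p_def)
    qed
  qed
  hence "sq_norm M p \<le> 0" using assms(4) by (intro LIMSEQ_le_const) auto
  hence "AE x in M. p x = 0" using sq_norm_0_AE[OF pL] sq_norm_nonneg[of M p] by simp
  thus ?thesis by eventually_elim (auto simp: p_def max_def split: if_splits)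
qed

end

section \<open>Representing functionals that are contractive in the mean\<close>

context prob_space
begin

lemma sq_norm_midpoint:
  assumes "f \<in> L2 M" "g \<in> L2 M"
  shows "sq_norm M (\<lambda>x. (f x + g x) / 2) \<le> (sq_norm M f + sq_norm M g) / 2"
proof -
  have "c \<le> (a + b) / 2" if "s = 2 * a + 2 * b - 4 * c" "0 \<le> s" for a b c s :: real using that by simp
  thus ?thesis using parallelogram[OF assms] sq_norm_nonneg by blast
qed

lemma L2_half: "f \<in> L2 M \<Longrightarrow> (\<lambda>x. f x / 2) \<in> L2 M"
  using L2_scale[of f "1/2"] by simp

text \<open>Instead of extending the functional by the Hahn--Banach theorem, take a pair of
  minimal distance between the unit ball of \<open>L\<^sup>\<infinity>\<close> and the affine space of all representing functions; the
  difference separates the two sets, and contractivity forces it to vanish. Since the sum of the ball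
  and the space is not obviously closed, the pair is found by first nearly minimizing the distance and
  then the norm.\<close>

lemma contractive_functional_represented:
  assumes W: "W \<subseteq> L2 M" "(\<lambda>_. 0) \<in> W" "\<And>f g. f \<in> W \<Longrightarrow> g \<in> W \<Longrightarrow> (\<lambda>x. f x + g x) \<in> W"
    "\<And>c f. f \<in> W \<Longrightarrow> (\<lambda>x. c * f x) \<in> W"
    and \<psi>: "\<psi> \<in> L2 M"
    and contr: "\<And>f. f \<in> W \<Longrightarrow> norm (\<integral>x. \<psi> x * f x \<partial>M) \<le> (\<integral>x. norm (f x) \<partial>M)"
  shows "\<exists>\<phi>\<in>L2 M. (AE x in M. norm (\<phi> x) \<le> 1) \<and> (\<forall>f\<in>W. (\<integral>x. \<phi> x * f x \<partial>M) = (\<integral>x. \<psi> x * f x \<partial>M))"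
proof -
  define K where "K = {k \<in> L2 M. AE x in M. norm (k x) \<le> 1}"
  define A where "A = {a \<in> L2 M. \<forall>f\<in>W. (\<integral>x. a x * f x \<partial>M) = (\<integral>x. \<psi> x * f x \<partial>M)}"
  have KL: "k \<in> L2 M" if "k \<in> K" for k using that by (simp add: K_def)
  have AL: "a \<in> L2 M" if "a \<in> A" for a using that by (simp add: A_def)
  have Kconv: "(\<lambda>x. of_real (1 - s) * k x + of_real s * k' x) \<in> K" if "k \<in> K" "k' \<in> K" "0 \<le> s" "s \<le> 1" for k k' s
  proof -
    have "AE x in M. norm (k x) \<le> 1" "AE x in M. norm (k' x) \<le> 1" using that by (auto simp: K_def)
    hence "AE x in M. norm (of_real (1 - s) * k x + of_real s * k' x) \<le> 1"
    proof eventually_elim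
      case (elim x)
      have "norm (of_real (1 - s) * k x + of_real s * k' x) \<le> norm (of_real (1 - s) * k x) + norm (of_real s * k' x)"
        by (rule norm_triangle_ineq)
      also have "\<dots> = (1 - s) * norm (k x) + s * norm (k' x)"
        unfolding norm_mult norm_of_real using that by simp
      also have "\<dots> \<le> (1 - s) * 1 + s * 1" using elim that by (intro add_mono mult_left_mono) auto
      finally show ?case by simp
    qed
    thus ?thesis using that by (simp add: K_def L2_add L2_scale)
  qed
  have Kmid: "(\<lambda>x. (k x + k' x) / 2) \<in> K" if "k \<in> K" "k' \<in> K" for k k'
    using Kconv[OF that, of "1/2"] by (simp add: add_divide_distrib)
  have Amid: "(\<lambda>x. (a x + a' x) / 2) \<in> A" if "a \<in> A" "a' \<in> A" for a a'
  proof -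
    have "(\<integral>x. (a x + a' x) / 2 * f x \<partial>M) = (\<integral>x. \<psi> x * f x \<partial>M)" if f: "f \<in> W" for f
    proof -
      have i: "integrable M (\<lambda>x. a x * f x)" "integrable M (\<lambda>x. a' x * f x)"
        using L2_integrable_mult[OF AL[OF \<open>a \<in> A\<close>]] L2_integrable_mult[OF AL[OF \<open>a' \<in> A\<close>]] f W(1) by blast+
      have "(\<integral>x. (a x + a' x) / 2 * f x \<partial>M) = (\<integral>x. (1 / 2) * (a x * f x + a' x * f x) \<partial>M)"
        by (simp add: field_simps)
      also have "\<dots> = (1 / 2) * ((\<integral>x. a x * f x \<partial>M) + (\<integral>x. a' x * f x \<partial>M))"
        unfolding integral_mult_right_zero using i by simp
      finally show ?thesis using f \<open>a \<in> A\<close> \<open>a' \<in> A\<close> by (simp add: A_def)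
    qed
    thus ?thesis using L2_half[OF L2_add[OF AL AL], OF that] by (simp add: A_def)
  qed
  have Avar: "(\<lambda>x. a x - t * v x) \<in> A" if "a \<in> A" "v \<in> L2 M" "\<And>f. f \<in> W \<Longrightarrow> (\<integral>x. v x * f x \<partial>M) = 0" for a v t
  proof -
    have "(\<integral>x. (a x - t * v x) * f x \<partial>M) = (\<integral>x. \<psi> x * f x \<partial>M)" if f: "f \<in> W" for f
    proof -
      have "(\<integral>x. (a x - t * v x) * f x \<partial>M) = (\<integral>x. a x * f x - t * (v x * f x) \<partial>M)" by (simp add: algebra_simps)
      also have "\<dots> = (\<integral>x. a x * f x \<partial>M) - (\<integral>x. t * (v x * f x) \<partial>M)"
        by (intro Bochner_Integration.integral_diff integrable_mult_right L2_integrable_mult)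
          (use \<open>v \<in> L2 M\<close> f W(1) AL[OF \<open>a \<in> A\<close>] in blast)+
      also have "\<dots> = (\<integral>x. a x * f x \<partial>M)" using \<open>\<And>f. f \<in> W \<Longrightarrow> (\<integral>x. v x * f x \<partial>M) = 0\<close>[OF f] by simp
      finally show ?thesis using f \<open>a \<in> A\<close> by (simp add: A_def)
    qed
    thus ?thesis using L2_diff[OF AL[OF that(1)] L2_scale[OF that(2), of t]] by (simp add: A_def)
  qed
  have K1: "sq_norm M k \<le> 1" if "k \<in> K" for k
  proof -
    have "sq_norm M k \<le> (\<integral>x. 1 \<partial>M)" unfolding sq_norm_def
    proof (rule integral_mono_AE)
      show "integrable M (\<lambda>x. (norm (k x))\<^sup>2)" using that KL L2_integrable_sq by blast
      have "AE x in M. norm (k x) \<le> 1" using that by (simp add: K_def)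
      thus "AE x in M. (norm (k x))\<^sup>2 \<le> 1" by eventually_elim (simp add: power_le_one)
    qed simp
    thus ?thesis by (simp add: prob_space)
  qed
  have \<psi>A: "\<psi> \<in> A" using \<psi> by (simp add: A_def)
  have 0: "(\<lambda>_. 0) \<in> K" by (simp add: K_def L2_const)
  define X where "X = {\<lambda>x. k x - a x | k a. k \<in> K \<and> a \<in> A}"
  have XI: "(\<lambda>x. k x - a x) \<in> X" if "k \<in> K" "a \<in> A" for k a
    unfolding X_def by (intro CollectI exI[of _ k] exI[of _ a]) (simp add: that)
  define d where "d = Inf (sq_norm M ` X)"
  have XL: "X \<subseteq> L2 M" using KL AL by (auto simp: X_def intro!: L2_diff)
  have bddX: "bdd_below (sq_norm M ` X)" by (intro bdd_belowI[of _ 0]) auto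
  have Xne: "X \<noteq> {}" using 0 \<psi>A by (auto simp: X_def)
  have d: "d \<le> sq_norm M (\<lambda>x. k x - a x)" if "k \<in> K" "a \<in> A" for k a
    unfolding d_def using that bddX by (intro cInf_lower) (auto simp: X_def)
  \<comment> \<open>Nested and closed under midpoints, as the convergence of norm-minimising choices
    requires; the infima \<open>m j\<close> increase and stay below 1.\<close>
  define C where "C j = {k\<in>K. \<exists>a\<in>A. sq_norm M (\<lambda>x. k x - a x) < d + inverse (of_nat (Suc j))}" for j :: nat
  have Cne: "C j \<noteq> {}" for j
  proof -
    have "Inf (sq_norm M ` X) < d + inverse (of_nat (Suc j))" by (simp add: d_def del: of_nat_Suc)
    then obtain h where "h \<in> X" "sq_norm M h < d + inverse (of_nat (Suc j))"
      using cInf_lessD[of "sq_norm M ` X"] Xne by auto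
    thus ?thesis unfolding C_def X_def by blast
  qed
  define m where "m j = Inf (sq_norm M ` C j)" for j
  have bddC: "bdd_below (sq_norm M ` C j)" for j by (intro bdd_belowI[of _ 0]) auto
  have CK: "C j \<subseteq> K" for j by (auto simp: C_def)
  have Cdec: "C j \<subseteq> C i" if "i \<le> j" for i j
  proof -
    have "inverse (real (Suc j)) \<le> inverse (real (Suc i))" using that by (intro le_imp_inverse_le) auto
    thus ?thesis unfolding C_def by (fastforce intro: less_le_trans)
  qed
  have "\<exists>k\<in>C j. sq_norm M k \<le> m j + inverse (of_nat (Suc j))" for j
  proof -
    have "Inf (sq_norm M ` C j) < m j + inverse (of_nat (Suc j))" by (simp add: m_def del: of_nat_Suc)
    then obtain k where "k \<in> C j" "sq_norm M k < m j + inverse (of_nat (Suc j))"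
      using cInf_lessD[of "sq_norm M ` C j"] Cne by auto
    thus ?thesis by (auto intro!: less_imp_le)
  qed
  then obtain kk where kk: "\<And>j. kk j \<in> C j" "\<And>j. sq_norm M (kk j) \<le> m j + inverse (of_nat (Suc j))" by metis
  have kkK: "kk j \<in> K" for j using kk(1) CK by blast
  have "\<exists>k\<in>L2 M. (\<lambda>j. sq_norm M (\<lambda>x. kk j x - k x)) \<longlonglongrightarrow> 0"
  proof (rule minimizing_sequence_converges[where X = C and m = m and B = 1])
    show "C j \<subseteq> L2 M" for j using CK KL by blast
    show "(\<lambda>x. (f x + g x) / 2) \<in> C j" if fg: "f \<in> C j" "g \<in> C j" for f g j
    proof -
      obtain a b where ab: "a \<in> A" "b \<in> A" "sq_norm M (\<lambda>x. f x - a x) < d + inverse (of_nat (Suc j))"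
        "sq_norm M (\<lambda>x. g x - b x) < d + inverse (of_nat (Suc j))" using fg unfolding C_def by blast
      have "(\<lambda>x. (f x + g x) / 2 - (a x + b x) / 2) = (\<lambda>x. ((f x - a x) + (g x - b x)) / 2)" by (auto simp: field_simps)
      moreover have "f \<in> L2 M" "g \<in> L2 M" using fg CK KL by blast+
      ultimately have "sq_norm M (\<lambda>x. (f x + g x) / 2 - (a x + b x) / 2)
          \<le> (sq_norm M (\<lambda>x. f x - a x) + sq_norm M (\<lambda>x. g x - b x)) / 2"
        using sq_norm_midpoint[OF L2_diff[OF _ AL[OF ab(1)]] L2_diff[OF _ AL[OF ab(2)]], of f g] by simp
      moreover have "(p + q) / 2 < r" if "p < r" "q < r" for p q r :: real using that by simp
      from this[OF ab(3,4)] have "(sq_norm M (\<lambda>x. f x - a x) + sq_norm M (\<lambda>x. g x - b x)) / 2 < d + inverse (of_nat (Suc j))" .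
      ultimately have "sq_norm M (\<lambda>x. (f x + g x) / 2 - (a x + b x) / 2) < d + inverse (of_nat (Suc j))" by (rule le_less_trans)
      moreover have "(\<lambda>x. (f x + g x) / 2) \<in> K" by (rule Kmid) (use fg CK in blast)+
      ultimately show ?thesis unfolding C_def
        by (intro CollectI conjI bexI[OF _ Amid[OF ab(1,2)]])
    qed
    show "m j \<le> sq_norm M f" if "f \<in> C j" for j f
      unfolding m_def using that bddC by (intro cInf_lower) auto
    show "mono m"
    proof (rule monoI)
      fix i j :: nat assume "i \<le> j"
      thus "m i \<le> m j" unfolding m_def
        using Cdec[of i j] Cne[of j] bddC by (intro cInf_superset_mono) auto
    qed
    show "m j \<le> 1" for j
      using cInf_lower[OF _ bddC[of j], of "sq_norm M (kk j)"] kk(1)[of j] K1[OF kkK[of j]] unfolding m_def by force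
  qed (use Cdec kk in auto)
  then obtain k where k: "k \<in> L2 M" "(\<lambda>j. sq_norm M (\<lambda>x. kk j x - k x)) \<longlonglongrightarrow> 0" by blast
  have "AE x in M. norm (k x) \<le> 1"
    by (rule unit_ball_closed[OF KL[OF kkK] _ k]) (use kkK in \<open>simp add: K_def\<close>)
  hence kK: "k \<in> K" using k(1) by (simp add: K_def)
  have "\<forall>j. \<exists>a\<in>A. sq_norm M (\<lambda>x. kk j x - a x) < d + inverse (of_nat (Suc j))" using kk(1) unfolding C_def by blast
  then obtain aa where aa: "\<And>j. aa j \<in> A" "\<And>j. sq_norm M (\<lambda>x. kk j x - aa j x) < d + inverse (of_nat (Suc j))" by metis
  have "\<exists>v\<in>L2 M. (\<lambda>j. sq_norm M (\<lambda>x. (kk j x - aa j x) - v x)) \<longlonglongrightarrow> 0"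
  proof (rule minimizing_sequence_converges[where X = "\<lambda>_. X" and m = "\<lambda>_. d" and B = d])
    show "(\<lambda>x. (f x + g x) / 2) \<in> X" if fg: "f \<in> X" "g \<in> X" for f g
    proof -
      obtain p a q b where *: "p \<in> K" "a \<in> A" "q \<in> K" "b \<in> A" "f = (\<lambda>x. p x - a x)" "g = (\<lambda>x. q x - b x)"
        using fg unfolding X_def by blast
      have "(\<lambda>x. (f x + g x) / 2) = (\<lambda>x. (p x + q x) / 2 - (a x + b x) / 2)" by (auto simp: * field_simps)
      thus ?thesis using XI[OF Kmid[OF *(1,3)] Amid[OF *(2,4)]] by simp
    qed
    show "(\<lambda>x. kk j x - aa j x) \<in> X" for j by (rule XI[OF kkK aa(1)])
    show "sq_norm M (\<lambda>x. kk j x - aa j x) \<le> d + inverse (of_nat (Suc j))" for j using aa(2)[of j] by simp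
  qed (use XL bddX in \<open>auto simp: mono_def d_def intro!: cInf_lower\<close>)
  then obtain v where v: "v \<in> L2 M" "(\<lambda>j. sq_norm M (\<lambda>x. (kk j x - aa j x) - v x)) \<longlonglongrightarrow> 0" by blast
  have kaL: "(\<lambda>x. kk j x - aa j x) \<in> L2 M" for j by (rule L2_diff[OF KL[OF kkK] AL[OF aa(1)]])
  have vd: "sq_norm M v \<le> d"
  proof (rule LIMSEQ_le[OF tendsto_sq_norm[OF kaL v]])
    show "(\<lambda>j. d + inverse (of_nat (Suc j))) \<longlonglongrightarrow> d"
      using tendsto_add[OF tendsto_const LIMSEQ_inverse_real_of_nat, of d] by simp
  qed (use aa(2) less_imp_le in auto)
  define a where "a x = k x - v x" for x
  have aL: "a \<in> L2 M" unfolding a_def using k(1) v(1) by (rule L2_diff)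
  have alim: "(\<lambda>j. sq_norm M (\<lambda>x. aa j x - a x)) \<longlonglongrightarrow> 0"
  proof (rule LIMSEQ_norm_le)
    fix j
    have "sq_norm M (\<lambda>x. (kk j x - k x) + (v x - (kk j x - aa j x))) \<le>
       2 * sq_norm M (\<lambda>x. kk j x - k x) + 2 * sq_norm M (\<lambda>x. v x - (kk j x - aa j x))"
      by (rule sq_norm_add_le[OF L2_diff[OF KL[OF kkK] k(1)] L2_diff[OF v(1) kaL]])
    moreover have "(\<lambda>x. (kk j x - k x) + (v x - (kk j x - aa j x))) = (\<lambda>x. aa j x - a x)" by (auto simp: a_def)
    ultimately show "norm (sq_norm M (\<lambda>x. aa j x - a x)) \<le>
       2 * sq_norm M (\<lambda>x. kk j x - k x) + 2 * sq_norm M (\<lambda>x. (kk j x - aa j x) - v x)"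
      using sq_norm_minus_commute[of M v "\<lambda>x. kk j x - aa j x"] by simp
  next
    show "(\<lambda>j. 2 * sq_norm M (\<lambda>x. kk j x - k x) + 2 * sq_norm M (\<lambda>x. (kk j x - aa j x) - v x)) \<longlonglongrightarrow> 0"
      using tendsto_add[OF tendsto_mult_left[OF k(2), of 2] tendsto_mult_left[OF v(2), of 2]] by simp
  qed
  have aA: "a \<in> A"
  proof -
    have "(\<integral>x. a x * f x \<partial>M) = (\<integral>x. \<psi> x * f x \<partial>M)" if f: "f \<in> W" for f
    proof -
      have "(\<lambda>j. \<integral>x. aa j x * f x \<partial>M) \<longlonglongrightarrow> (\<integral>x. a x * f x \<partial>M)"
        by (rule tendsto_integral_mult[OF AL[OF aa(1)] aL subsetD[OF W(1) f] alim])
      moreover have "(\<lambda>j. \<integral>x. aa j x * f x \<partial>M) = (\<lambda>_. \<integral>x. \<psi> x * f x \<partial>M)"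
        using aa(1) f by (auto simp: A_def)
      ultimately show ?thesis by (simp add: LIMSEQ_const_iff)
    qed
    thus ?thesis using aL by (simp add: A_def)
  qed
  define u where "u x = a x - k x" for x
  have uL: "u \<in> L2 M" unfolding u_def using aL k(1) by (rule L2_diff)
  have "(\<lambda>x. k x - a x) = v" by (simp add: a_def)
  hence ud: "sq_norm M u \<le> d" using vd sq_norm_minus_commute[of M k a] by (simp add: u_def[abs_def])
  \<comment> \<open>Representing functions may be moved along any \<open>y\<close> that annihilates
    \<open>W\<close>, so minimality makes \<open>u\<close> orthogonal to all of these. This is what
    later puts the conjugate of \<open>u\<close> into the closure of \<open>W\<close>.\<close>
  have orth: "(\<integral>x. u x * cnj (y x) \<partial>M) = 0" if "y \<in> L2 M" "\<And>f. f \<in> W \<Longrightarrow> (\<integral>x. y x * f x \<partial>M) = 0" for y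
  proof (rule minimal_imp_orthogonal[OF uL that(1)])
    fix t
    have "d \<le> sq_norm M (\<lambda>x. k x - (a x - t * y x))" by (rule d[OF kK Avar[OF aA that]])
    also have "\<dots> = sq_norm M (\<lambda>x. (a x - t * y x) - k x)" by (rule sq_norm_minus_commute)
    finally show "sq_norm M u \<le> sq_norm M (\<lambda>x. u x - t * y x)" using ud by (simp add: u_def algebra_simps)
  qed
  \<comment> \<open>The variational inequality for the point \<open>k\<close> of the convex set
    \<open>K\<close> nearest to \<open>a\<close>.\<close>
  have Kvar: "Re (\<integral>x. u x * cnj (k' x - k x) \<partial>M) \<le> 0" if k': "k' \<in> K" for k'
  proof (rule ccontr)
    define h where "h x = k' x - k x" for x
    have hL: "h \<in> L2 M" unfolding h_def using KL[OF k'] k(1) by (rule L2_diff)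
    define c where "c = Re (\<integral>x. u x * cnj (h x) \<partial>M)"
    assume "\<not> ?thesis"
    hence c: "c > 0" by (simp add: c_def h_def)
    have ineq: "2 * c * s \<le> s\<^sup>2 * sq_norm M h" if s: "0 \<le> s" "s \<le> 1" for s
    proof -
      have "d \<le> sq_norm M (\<lambda>x. (of_real (1 - s) * k x + of_real s * k' x) - a x)"
        by (rule d[OF Kconv[OF kK k' s] aA])
      also have "(\<lambda>x. (of_real (1 - s) * k x + of_real s * k' x) - a x) = (\<lambda>x. complex_of_real s * h x - u x)"
        by (auto simp: h_def u_def algebra_simps)
      also have "sq_norm M (\<lambda>x. complex_of_real s * h x - u x) = sq_norm M (\<lambda>x. u x - complex_of_real s * h x)"
        by (rule sq_norm_minus_commute)
      also have "\<dots> = sq_norm M u + s\<^sup>2 * sq_norm M h - 2 * Re (\<integral>x. u x * cnj (complex_of_real s * h x) \<partial>M)"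
        using sq_norm_diff[OF uL L2_scale[OF hL]] by (simp add: sq_norm_scale)
      also have "(\<integral>x. u x * cnj (complex_of_real s * h x) \<partial>M) = of_real s * (\<integral>x. u x * cnj (h x) \<partial>M)"
        by (simp add: mult.left_commute[of "u _"])
      finally show ?thesis using ud by (simp add: c_def mult_ac)
    qed
    \<comment> \<open>So small that the quadratic term \<open>s * sq_norm M h\<close> stays below
      \<open>c\<close>, against the linear term \<open>2 * c\<close>.\<close>
    define s where "s = min 1 (c / (sq_norm M h + 1))"
    have s: "0 < s" "s \<le> 1" using c by (auto simp: s_def add_nonneg_pos)
    have "s * (2 * c) \<le> s * (s * sq_norm M h)" using ineq[of s] s by (simp add: power2_eq_square mult_ac)
    hence "2 * c \<le> s * sq_norm M h" using s(1) by (simp only: mult_le_cancel_left_pos)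
    also have "\<dots> \<le> s * (sq_norm M h + 1)" using s by (intro mult_left_mono) auto
    also have "\<dots> \<le> c / (sq_norm M h + 1) * (sq_norm M h + 1)" by (intro mult_right_mono) (auto simp: s_def)
    also have "\<dots> = c" using sq_norm_nonneg[of M h] by (simp add: add_nonneg_eq_0_iff)
    finally show False using c by simp
  qed
  obtain f y where f: "\<And>j::nat. f j \<in> W" and y: "y \<in> L2 M"
    and flim: "(\<lambda>j. sq_norm M (\<lambda>x. f j x - (cnj (u x) - y x))) \<longlonglongrightarrow> 0"
    and yorth: "\<And>g. g \<in> W \<Longrightarrow> (\<integral>x. y x * cnj (g x) \<partial>M) = 0"
    using L2_projection[OF W L2_cnj[OF uL]] by blast
  have fL: "f j \<in> L2 M" for j using f W(1) by blast
  \<comment> \<open>The part \<open>y\<close> of the conjugate of \<open>u\<close> orthogonal to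
    \<open>W\<close> has a conjugate that annihilates \<open>W\<close>; by \<open>orth\<close> this
    makes \<open>y\<close> orthogonal to itself.\<close>
  have y0: "sq_norm M y = 0"
  proof -
    have "(\<integral>x. u x * cnj (cnj (y x)) \<partial>M) = 0"
    proof (rule orth[OF L2_cnj[OF y]])
      fix g assume g: "g \<in> W"
      have "(\<integral>x. cnj (y x) * g x \<partial>M) = (\<integral>x. cnj (y x * cnj (g x)) \<partial>M)" by simp
      also have "\<dots> = cnj (\<integral>x. y x * cnj (g x) \<partial>M)"
        by (rule Bochner_Integration.integral_cnj)
      finally show "(\<integral>x. cnj (y x) * g x \<partial>M) = 0" using yorth[OF g] by simp
    qed
    hence 1: "(\<integral>x. cnj (u x) * cnj (y x) \<partial>M) = 0"
      using Bochner_Integration.integral_cnj[of M "\<lambda>x. u x * y x"] by simp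
    have "(\<lambda>j. \<integral>x. f j x * cnj (y x) \<partial>M) \<longlonglongrightarrow> (\<integral>x. (cnj (u x) - y x) * cnj (y x) \<partial>M)"
      by (rule tendsto_integral_mult[OF fL L2_diff[OF L2_cnj[OF uL] y] L2_cnj[OF y] flim])
    moreover have "(\<integral>x. f j x * cnj (y x) \<partial>M) = 0" for j
    proof -
      have "(\<integral>x. f j x * cnj (y x) \<partial>M) = (\<integral>x. cnj (y x * cnj (f j x)) \<partial>M)" by (simp add: mult.commute)
      also have "\<dots> = cnj (\<integral>x. y x * cnj (f j x) \<partial>M)" by (rule Bochner_Integration.integral_cnj)
      finally show ?thesis using yorth[OF f] by simp
    qed
    ultimately have "(\<integral>x. (cnj (u x) - y x) * cnj (y x) \<partial>M) = 0" by (simp add: LIMSEQ_const_iff)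
    moreover have "(\<integral>x. (cnj (u x) - y x) * cnj (y x) \<partial>M) = (\<integral>x. cnj (u x) * cnj (y x) \<partial>M) - (\<integral>x. y x * cnj (y x) \<partial>M)"
      unfolding left_diff_distrib
      by (rule Bochner_Integration.integral_diff[OF L2_integrable_mult[OF L2_cnj[OF uL] L2_cnj[OF y]] L2_integrable_mult[OF y L2_cnj[OF y]]])
    ultimately show ?thesis using 1 inner_self[of y] by simp
  qed
  hence "AE x in M. y x = 0" by (rule sq_norm_0_AE[OF y])
  hence "sq_norm M (\<lambda>x. f j x - (cnj (u x) - y x)) = sq_norm M (\<lambda>x. f j x - cnj (u x))" for j
    by (intro sq_norm_cong_AE L2_measurable L2_diff[OF fL] L2_diff[OF L2_cnj[OF uL] y] L2_cnj[OF uL]) auto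
  hence flim: "(\<lambda>j. sq_norm M (\<lambda>x. f j x - cnj (u x))) \<longlonglongrightarrow> 0" using flim by simp
  \<comment> \<open>Contractivity is given on \<open>W\<close> only; it passes to the limit since L2
    convergence implies L1 convergence for a probability measure.\<close>
  have "norm (\<integral>x. \<psi> x * cnj (u x) \<partial>M) \<le> (\<integral>x. norm (u x) \<partial>M)"
  proof (rule LIMSEQ_le)
    have "(\<lambda>j. \<integral>x. f j x * \<psi> x \<partial>M) \<longlonglongrightarrow> (\<integral>x. cnj (u x) * \<psi> x \<partial>M)"
      by (rule tendsto_integral_mult[OF fL L2_cnj[OF uL] \<psi> flim])
    thus "(\<lambda>j. norm (\<integral>x. \<psi> x * f j x \<partial>M)) \<longlonglongrightarrow> norm (\<integral>x. \<psi> x * cnj (u x) \<partial>M)"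
      by (intro tendsto_norm) (simp add: mult.commute)
    have "norm ((\<integral>x. norm (f j x) \<partial>M) - (\<integral>x. norm (u x) \<partial>M)) \<le> sqrt (sq_norm M (\<lambda>x. f j x - cnj (u x)))" for j
    proof -
      have i: "integrable M (\<lambda>x. norm (f j x))" "integrable M (\<lambda>x. norm (u x))" "integrable M (\<lambda>x. norm (f j x - cnj (u x)))"
        by (intro integrable_norm L2_integrable L2_diff[OF fL L2_cnj[OF uL]] fL uL)+
      have "norm ((\<integral>x. norm (f j x) \<partial>M) - (\<integral>x. norm (u x) \<partial>M)) = norm (\<integral>x. norm (f j x) - norm (u x) \<partial>M)"
        using i by simp
      also have "\<dots> \<le> (\<integral>x. norm (norm (f j x) - norm (u x)) \<partial>M)" by (rule integral_norm_bound)
      also have "\<dots> \<le> (\<integral>x. norm (f j x - cnj (u x)) \<partial>M)"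
      proof (rule integral_mono[OF integrable_norm[OF Bochner_Integration.integrable_diff[OF i(1,2)]] i(3)])
        fix x show "norm (norm (f j x) - norm (u x)) \<le> norm (f j x - cnj (u x))"
          using norm_triangle_ineq3[of "f j x" "cnj (u x)"] by simp
      qed
      also have "\<dots> \<le> sqrt (sq_norm M (\<lambda>x. f j x - cnj (u x)))" by (rule L1_le_L2[OF L2_diff[OF fL L2_cnj[OF uL]]])
      finally show ?thesis .
    qed
    moreover have "(\<lambda>j. sqrt (sq_norm M (\<lambda>x. f j x - cnj (u x)))) \<longlonglongrightarrow> 0" using tendsto_real_sqrt[OF flim] by simp
    ultimately have "(\<lambda>j. (\<integral>x. norm (f j x) \<partial>M) - (\<integral>x. norm (u x) \<partial>M)) \<longlonglongrightarrow> 0" by (rule LIMSEQ_norm_le)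
    thus "(\<lambda>j. \<integral>x. norm (f j x) \<partial>M) \<longlonglongrightarrow> (\<integral>x. norm (u x) \<partial>M)" by (simp add: LIM_zero_iff)
    show "\<exists>N. \<forall>j\<ge>N. norm (\<integral>x. \<psi> x * f j x \<partial>M) \<le> (\<integral>x. norm (f j x) \<partial>M)" using contr f by blast
  qed
  moreover have "(\<integral>x. \<psi> x * cnj (u x) \<partial>M) = (\<integral>x. a x * cnj (u x) \<partial>M)"
  proof -
    have "(\<lambda>j. \<integral>x. f j x * \<psi> x \<partial>M) \<longlonglongrightarrow> (\<integral>x. cnj (u x) * \<psi> x \<partial>M)"
      "(\<lambda>j. \<integral>x. f j x * a x \<partial>M) \<longlonglongrightarrow> (\<integral>x. cnj (u x) * a x \<partial>M)"
      by (rule tendsto_integral_mult[OF fL L2_cnj[OF uL] \<psi> flim] tendsto_integral_mult[OF fL L2_cnj[OF uL] aL flim])+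
    moreover have "(\<integral>x. f j x * \<psi> x \<partial>M) = (\<integral>x. f j x * a x \<partial>M)" for j
      using aA f[of j] by (auto simp: A_def mult.commute)
    ultimately have "(\<integral>x. cnj (u x) * \<psi> x \<partial>M) = (\<integral>x. cnj (u x) * a x \<partial>M)"
      using LIMSEQ_unique by simp
    thus ?thesis by (simp add: mult.commute)
  qed
  ultimately have 1: "Re (\<integral>x. a x * cnj (u x) \<partial>M) \<le> (\<integral>x. norm (u x) \<partial>M)"
    using complex_Re_le_cmod order.trans by metis
  have 2: "(\<integral>x. norm (u x) \<partial>M) \<le> Re (\<integral>x. u x * cnj (k x) \<partial>M)"
  proof -
    \<comment> \<open>The element of the unit ball whose pairing with \<open>u\<close> is the full
      L1 norm; inserted in the variational inequality it bounds the pairing with \<open>k\<close>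
      from below.\<close>
    define k' where "k' x = sgn (u x)" for x
    have "k' \<in> borel_measurable M" unfolding k'_def sgn_div_norm using L2_measurable[OF uL] by measurable
    moreover have n: "norm (k' x) \<le> 1" for x by (simp add: k'_def norm_sgn)
    ultimately have k'L: "k' \<in> L2 M" by (intro L2_bounded[of _ 1]) auto
    hence k'K: "k' \<in> K" using n by (simp add: K_def)
    have "u x * cnj (k' x) = of_real (norm (u x))" for x
      by (cases "u x = 0") (auto simp: k'_def sgn_div_norm scaleR_conv_of_real complex_norm_square[symmetric] power2_eq_square field_simps)
    hence "(\<integral>x. u x * cnj (k' x) \<partial>M) = of_real (\<integral>x. norm (u x) \<partial>M)" by simp
    moreover have "(\<integral>x. u x * cnj (k' x - k x) \<partial>M) = (\<integral>x. u x * cnj (k' x) \<partial>M) - (\<integral>x. u x * cnj (k x) \<partial>M)"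
      unfolding complex_cnj_diff right_diff_distrib
      by (rule Bochner_Integration.integral_diff[OF L2_integrable_mult[OF uL L2_cnj[OF k'L]] L2_integrable_mult[OF uL L2_cnj[OF k(1)]]])
    ultimately show ?thesis using Kvar[OF k'K] by simp
  qed
  have 3: "Re (\<integral>x. u x * cnj (k x) \<partial>M) = Re (\<integral>x. k x * cnj (u x) \<partial>M)"
  proof -
    have "(\<integral>x. k x * cnj (u x) \<partial>M) = (\<integral>x. cnj (u x * cnj (k x)) \<partial>M)" by (simp add: mult.commute)
    also have "\<dots> = cnj (\<integral>x. u x * cnj (k x) \<partial>M)" by (rule Bochner_Integration.integral_cnj)
    finally show ?thesis by simp
  qed
  \<comment> \<open>The pairing of \<open>u\<close> with \<open>a\<close> is at most the L1 norm of
    \<open>u\<close>, the pairing with \<open>k\<close> at least that norm, so the squared norm of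
    \<open>u\<close> is not positive.\<close>
  have "(\<integral>x. u x * cnj (u x) \<partial>M) = (\<integral>x. a x * cnj (u x) \<partial>M) - (\<integral>x. k x * cnj (u x) \<partial>M)"
  proof -
    have "(\<integral>x. u x * cnj (u x) \<partial>M) = (\<integral>x. a x * cnj (u x) - k x * cnj (u x) \<partial>M)"
      by (intro Bochner_Integration.integral_cong) (simp_all add: u_def algebra_simps)
    also have "\<dots> = (\<integral>x. a x * cnj (u x) \<partial>M) - (\<integral>x. k x * cnj (u x) \<partial>M)"
      by (rule Bochner_Integration.integral_diff[OF L2_integrable_mult[OF aL L2_cnj[OF uL]] L2_integrable_mult[OF k(1) L2_cnj[OF uL]]])
    finally show ?thesis .
  qed
  hence "sq_norm M u = Re (\<integral>x. a x * cnj (u x) \<partial>M) - Re (\<integral>x. k x * cnj (u x) \<partial>M)"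
    using inner_self[of u] by (metis Re_complex_of_real minus_complex.simps(1))
  hence "sq_norm M u = 0" using 1 2 3 sq_norm_nonneg[of M u] by linarith
  hence "AE x in M. u x = 0" by (rule sq_norm_0_AE[OF uL])
  hence "AE x in M. a x = k x" by eventually_elim (simp add: u_def)
  hence "AE x in M. norm (a x) \<le> 1" using kK unfolding K_def by (auto elim: AE_mp)
  thus ?thesis using aA aL by (auto simp: A_def)
qed

end

section \<open>Hardy spaces\<close>

lemma holo_cong: assumes "holo f U" "\<And>z. z \<in> U \<Longrightarrow> g z = f z" shows "holo g U"
  unfolding holo_def
proof
  fix z assume z: "z \<in> U"
  obtain f' where f': "(f has_derivative f') (at z within U)" "\<forall>c v. f' (c *s v) = c * f' v"
    using assms(1) z unfolding holo_def by blast
  have "(g has_derivative f') (at z within U)"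
    by (rule has_derivative_transform[OF z _ f'(1)]) (rule assms(2))
  thus "\<exists>f'. (g has_derivative f') (at z within U) \<and> (\<forall>c v. f' (c *s v) = c * f' v)" using f'(2) by blast
qed

lemma shilov_boundary_subset_closure: "shilov_boundary U \<subseteq> closure U"
  unfolding shilov_boundary_def by (intro Inter_lower) auto

lemma closed_shilov_boundary: "closed (shilov_boundary U)"
  unfolding shilov_boundary_def by (intro closed_Inter) auto

lemma continuous_on_matrix: "continuous_on X ((*v) (A :: complex^'n^'n))"
  by (simp add: linear_continuous_on matrix_vector_mul_bounded_linear)

lemma matrix_image_closure:
  fixes A :: "complex^'n^'n"
  assumes "(*v) A ` U \<subseteq> U" shows "(*v) A ` closure U \<subseteq> closure U"
  using assms closure_subset by (intro image_closure_subset continuous_on_matrix) auto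

text \<open>The preimage under \<open>A\<close> of a closed maximum-modulus set is again such a set,
  because composing with \<open>B\<close> preserves the disc algebra.\<close>

lemma shilov_boundary_matrix_invariant:
  fixes A B :: "complex^'n^'n"
  assumes AB: "A ** B = mat 1" "B ** A = mat 1" and U: "(*v) A ` U \<subseteq> U" "(*v) B ` U \<subseteq> U"
    and z: "z \<in> shilov_boundary U"
  shows "A *v z \<in> shilov_boundary U"
  unfolding shilov_boundary_def
proof (rule InterI)
  fix K assume "K \<in> {K. closed K \<and> K \<subseteq> closure U \<and>
     (\<forall>f\<in>disc_algebra U. \<forall>z\<in>closure U. \<exists>w\<in>K. norm (f z) \<le> norm (f w))}"
  hence K: "closed K" "K \<subseteq> closure U" "\<And>f z. f \<in> disc_algebra U \<Longrightarrow> z \<in> closure U \<Longrightarrow> \<exists>w\<in>K. norm (f z) \<le> norm (f w)"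
    by auto
  have AB': "A *v (B *v z) = z" "B *v (A *v z) = z" for z by (simp_all add: matrix_vector_mul_assoc AB)
  define K' where "K' = (*v) A -` K"
  have "closed K'" unfolding K'_def by (intro closed_vimage K(1) continuous_on_matrix)
  moreover have "K' \<subseteq> closure U"
  proof
    fix x assume "x \<in> K'"
    hence "B *v (A *v x) \<in> closure U" using K(2) matrix_image_closure[OF U(2)] unfolding K'_def by blast
    thus "x \<in> closure U" using AB' by simp
  qed
  moreover have "\<exists>w\<in>K'. norm (f x) \<le> norm (f w)" if f: "f \<in> disc_algebra U" and x: "x \<in> closure U" for f x
  proof -
    have "continuous_on (closure U) (\<lambda>z. f (B *v z))"
      by (rule continuous_on_compose2[OF _ continuous_on_matrix matrix_image_closure[OF U(2)]])
        (use f in \<open>simp add: disc_algebra_def\<close>)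
    hence "(\<lambda>z. f (B *v z)) \<in> disc_algebra U"
      using f holo_matrix_compose[OF _ U(2)] by (simp add: disc_algebra_def)
    moreover have "A *v x \<in> closure U" using x matrix_image_closure[OF U(1)] by blast
    ultimately obtain w where "w \<in> K" "norm (f (B *v (A *v x))) \<le> norm (f (B *v w))" using K(3) by blast
    thus ?thesis by (intro bexI[of _ "B *v w"]) (simp_all add: AB' K'_def)
  qed
  ultimately have "z \<in> K'" using z unfolding shilov_boundary_def by blast
  thus "A *v z \<in> K" by (simp add: K'_def)
qed

section \<open>Boundary measures, their symmetries and the change of variables\<close>

locale hardy_setting = invariant_quotient G \<theta> k + circled_domain \<Omega>
  for G :: "(complex^'n^'n) set" and \<theta> :: "complex^'n \<Rightarrow> complex^'n" and k :: "'n \<Rightarrow> nat"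
    and \<Omega> :: "(complex^'n) set" +
  fixes \<mu> M :: "(complex^'n) measure"
  assumes domain_invariant: "g \<in> G \<Longrightarrow> (*v) g ` \<Omega> = \<Omega>"
    and mu_invariant: "invariant_boundary_measure \<Omega> \<mu>"
    and theta_measure: "theta_boundary_measure \<Omega> \<theta> \<mu> M"
begin

sublocale mu: prob_space \<mu>
  using mu_invariant by (simp add: invariant_boundary_measure_def)

sublocale th: prob_space M
  using theta_measure by (simp add: theta_boundary_measure_def)

lemma sets_mu: "sets \<mu> = sets (restrict_space borel (shilov_boundary \<Omega>))"
  using mu_invariant by (simp add: invariant_boundary_measure_def)

lemma sets_M: "sets M = sets (restrict_space borel (shilov_boundary (\<theta> ` \<Omega>)))"
  using theta_measure by (simp add: theta_boundary_measure_def)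

lemma space_mu: "space \<mu> = shilov_boundary \<Omega>"
  using sets_eq_imp_space_eq[OF sets_mu] by (simp add: space_restrict_space)

lemma space_M: "space M = shilov_boundary (\<theta> ` \<Omega>)"
  using sets_eq_imp_space_eq[OF sets_M] by (simp add: space_restrict_space)

lemma space_mu_closure: "z \<in> space \<mu> \<Longrightarrow> z \<in> closure \<Omega>"
  using shilov_boundary_subset_closure space_mu by blast

lemma measurable_mu: "continuous_on (closure \<Omega>) f \<Longrightarrow> f \<in> borel_measurable \<mu>"
  unfolding measurable_cong_sets[OF sets_mu refl]
  by (intro borel_measurable_continuous_on_restrict) (rule continuous_on_subset[OF _ shilov_boundary_subset_closure])

lemma closure_theta_image: "closure (\<theta> ` \<Omega>) \<subseteq> \<theta> ` closure \<Omega>"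
  by (intro closure_minimal image_mono closure_subset compact_imp_closed compact_continuous_image theta_continuous compact_closure)

lemma space_M_subset: "space M \<subseteq> \<theta> ` closure \<Omega>"
  using shilov_boundary_subset_closure closure_theta_image unfolding space_M by blast

lemma measurable_M: "continuous_on (\<theta> ` closure \<Omega>) f \<Longrightarrow> f \<in> borel_measurable M"
  unfolding measurable_cong_sets[OF sets_M refl]
  by (intro borel_measurable_continuous_on_restrict continuous_on_subset[OF _ space_M_subset[unfolded space_M]])

lemma bounded_on_closure: "continuous_on (closure \<Omega>) f \<Longrightarrow> \<exists>B. \<forall>z\<in>closure \<Omega>. norm (f z) \<le> B"
  for f :: "complex^'n \<Rightarrow> complex"
proof -
  assume "continuous_on (closure \<Omega>) f"
  hence "bounded (f ` closure \<Omega>)" by (intro compact_imp_bounded compact_continuous_image compact_closure)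
  thus ?thesis unfolding bounded_iff by blast
qed

lemma L2_mu: "continuous_on (closure \<Omega>) f \<Longrightarrow> f \<in> L2 \<mu>"
proof -
  assume f: "continuous_on (closure \<Omega>) f"
  then obtain B where "\<And>z. z \<in> closure \<Omega> \<Longrightarrow> norm (f z) \<le> B" using bounded_on_closure by blast
  hence "AE z in \<mu>. norm (f z) \<le> B" by (intro AE_I2) (use space_mu_closure in blast)
  with measurable_mu[OF f] show ?thesis by (rule mu.L2_bounded)
qed

lemma L2_M: "continuous_on (\<theta> ` closure \<Omega>) f \<Longrightarrow> f \<in> L2 M"
proof -
  assume f: "continuous_on (\<theta> ` closure \<Omega>) f"
  hence "compact (f ` \<theta> ` closure \<Omega>)" by (intro compact_continuous_image theta_continuous compact_closure)
  hence "bounded (f ` \<theta> ` closure \<Omega>)" by (rule compact_imp_bounded)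
  then obtain B where "\<And>\<zeta>. \<zeta> \<in> \<theta> ` closure \<Omega> \<Longrightarrow> norm (f \<zeta>) \<le> B"
    unfolding bounded_iff by (metis imageI)
  hence "AE \<zeta> in M. norm (f \<zeta>) \<le> B" by (intro AE_I2) (use space_M_subset in blast)
  with measurable_M[OF f] show ?thesis by (rule th.L2_bounded)
qed

text \<open>A linear bijection of the domain is an automorphism fixing 0 and is its own continuous
  extension, so the defining invariance of \<mu> covers it. It is applied to rotations and to group
  elements.\<close>

lemma distr_mu_matrix:
  assumes AB: "A ** B = mat 1" "B ** A = mat 1" and U: "(*v) A ` \<Omega> \<subseteq> \<Omega>" "(*v) B ` \<Omega> \<subseteq> \<Omega>"
  shows "(*v) A \<in> measurable \<mu> \<mu>" "distr \<mu> \<mu> ((*v) A) = \<mu>"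
proof -
  have AB': "A *v (B *v z) = z" "B *v (A *v z) = z" for z by (simp_all add: matrix_vector_mul_assoc AB)
  have inj: "inj ((*v) A)" by (rule injI) (metis AB'(2))
  have img: "(*v) A ` \<Omega> = \<Omega>"
  proof
    show "\<Omega> \<subseteq> (*v) A ` \<Omega>" using U(2) AB'(1) by (metis image_eqI image_subset_iff subsetI)
  qed (rule U(1))
  have inv: "inv_into \<Omega> ((*v) A) z = B *v z" if "z \<in> \<Omega>" for z
    using that U(2) AB' inj by (intro inv_into_f_eq) (auto intro: inj_on_subset)
  have lin: "holo (\<lambda>z. (A *v z) $ i) \<Omega>" for A :: "complex^'n^'n" and i
    by (intro polynomial_fun_holo polynomial_fun_matrix_vector)
  have "automorphism \<Omega> ((*v) A)"
    unfolding automorphism_def holo_map_def bij_betw_def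
    using img inj lin holo_cong[OF lin[of B]] inv by (auto intro: inj_on_subset)
  moreover have "A *v 0 = 0" by simp
  ultimately have em: "emeasure \<mu> ((*v) A -` S \<inter> shilov_boundary \<Omega>) = emeasure \<mu> S" if "S \<in> sets \<mu>" for S
    using mu_invariant that continuous_on_matrix unfolding invariant_boundary_measure_def by blast
  have "(*v) A \<in> restrict_space borel (shilov_boundary \<Omega>) \<rightarrow>\<^sub>M restrict_space borel (shilov_boundary \<Omega>)"
    by (intro measurable_restrict_space2 borel_measurable_continuous_on_restrict continuous_on_matrix)
      (auto simp: space_restrict_space intro: shilov_boundary_matrix_invariant[OF AB U])
  thus m: "(*v) A \<in> measurable \<mu> \<mu>" unfolding measurable_cong_sets[OF sets_mu sets_mu] .
  show "distr \<mu> \<mu> ((*v) A) = \<mu>"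
    by (rule measure_eqI) (use m em space_mu in \<open>auto simp: emeasure_distr\<close>)
qed

lemma integral_mu_matrix:
  fixes f :: "complex^'n \<Rightarrow> 'b::{banach,second_countable_topology}"
  assumes "A ** B = mat 1" "B ** A = mat 1" "(*v) A ` \<Omega> \<subseteq> \<Omega>" "(*v) B ` \<Omega> \<subseteq> \<Omega>"
    and f: "f \<in> borel_measurable \<mu>"
  shows "(\<integral>z. f (A *v z) \<partial>\<mu>) = (\<integral>z. f z \<partial>\<mu>)"
  using integral_distr[OF distr_mu_matrix(1)[OF assms(1-4)] f] distr_mu_matrix(2)[OF assms(1-4)] by simp

lemma integral_mu_circle:
  fixes f :: "complex^'n \<Rightarrow> 'b::{banach,second_countable_topology}"
  assumes "norm c = 1" "f \<in> borel_measurable \<mu>"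
  shows "(\<integral>z. f (c *s z) \<partial>\<mu>) = (\<integral>z. f z \<partial>\<mu>)"
proof -
  have c: "c \<noteq> 0" using assms(1) by auto
  have m: "(mat a :: complex^'n^'n) ** mat b = mat (a * b)" for a b
    by (simp add: matrix_eq matrix_scale vector_smult_assoc flip: matrix_vector_mul_assoc)
  have "(\<integral>z. f ((mat c :: complex^'n^'n) *v z) \<partial>\<mu>) = (\<integral>z. f z \<partial>\<mu>)"
    by (rule integral_mu_matrix[of _ "mat (inverse c)"])
      (use assms c circled in \<open>auto simp: m matrix_scale norm_inverse\<close>)
  thus ?thesis by (simp add: matrix_scale)
qed

lemma integral_mu_group:
  fixes f :: "complex^'n \<Rightarrow> 'b::{banach,second_countable_topology}"
  assumes "g \<in> G" "f \<in> borel_measurable \<mu>"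
  shows "(\<integral>z. f (g *v z) \<partial>\<mu>) = (\<integral>z. f z \<partial>\<mu>)"
proof -
  obtain h where h: "h \<in> G" "g ** h = mat 1" "h ** g = mat 1" using inverse_mem[OF assms(1)] by blast
  show ?thesis using domain_invariant[OF assms(1)] domain_invariant[OF h(1)]
    by (intro integral_mu_matrix[OF h(2,3)] assms(2)) auto
qed

lemma measurable_mu_group: "g \<in> G \<Longrightarrow> (*v) g \<in> measurable \<mu> \<mu>"
  using inverse_mem[of g] distr_mu_matrix(1)[of g] domain_invariant by (metis order_refl)

abbreviation c\<theta> :: real where "c\<theta> \<equiv> c_theta \<theta> \<mu>"

lemma J_continuous: "continuous_on X J"
  by (rule polynomial_fun_continuous_on[OF polynomial_fun_J])

lemma nn_integral_M:
  "f \<in> borel_measurable borel \<Longrightarrow>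
    (\<integral>\<^sup>+ \<zeta>. f \<zeta> \<partial>M) = (\<integral>\<^sup>+ z. f (\<theta> z) * ennreal ((norm (J z))\<^sup>2) \<partial>\<mu>) / ennreal (c\<theta>\<^sup>2)"
  using theta_measure unfolding theta_boundary_measure_def by blast

lemma J_sq_norm: "ennreal (sq_norm \<mu> J) / ennreal (c\<theta>\<^sup>2) = 1"
proof -
  have "(1::ennreal) = (\<integral>\<^sup>+ \<zeta>. 1 \<partial>M)" by (simp add: th.emeasure_space_1)
  also have "\<dots> = (\<integral>\<^sup>+ z. ennreal ((norm (J z))\<^sup>2) \<partial>\<mu>) / ennreal (c\<theta>\<^sup>2)"
    by (subst nn_integral_M) simp_all
  also have "(\<integral>\<^sup>+ z. ennreal ((norm (J z))\<^sup>2) \<partial>\<mu>) = ennreal (sq_norm \<mu> J)"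
    by (rule mu.ennreal_sq_norm[symmetric, OF L2_mu[OF J_continuous]])
  finally show ?thesis by simp
qed

text \<open>Forced by the total mass 1 of \<open>M\<close>: in the extended reals a quotient by 0 is
  0 or infinite, never 1.\<close>

lemma c_theta_sq_pos: "c\<theta>\<^sup>2 > 0"
proof (rule ccontr)
  assume "\<not> ?thesis"
  hence c: "c\<theta>\<^sup>2 = 0" by simp
  show False
  proof (cases "sq_norm \<mu> J = 0")
    case True
    thus False using J_sq_norm c by simp
  next
    case False
    hence "sq_norm \<mu> J > 0" using sq_norm_nonneg[of \<mu> J] by (simp add: order_less_le)
    hence "ennreal (sq_norm \<mu> J) \<noteq> 0" by simp
    thus False using J_sq_norm c by (simp add: ennreal_divide_zero)
  qed
qed

lemma J_sq_norm_eq: "sq_norm \<mu> J = c\<theta>\<^sup>2"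
  using J_sq_norm c_theta_sq_pos by (simp add: divide_ennreal ennreal_eq_1)

text \<open>The density with respect to \<mu> of the measure that \<theta> pushes forward to
  \<open>M\<close>.\<close>

definition weight :: "complex^'n \<Rightarrow> real" where "weight z = (norm (J z))\<^sup>2 / c\<theta>\<^sup>2"

lemma weight_nonneg: "weight z \<ge> 0" by (simp add: weight_def)

lemma weight_continuous: "continuous_on X weight"
  unfolding weight_def by (intro continuous_intros J_continuous) (use c_theta_sq_pos in auto)

lemma measurable_weight: "weight \<in> borel_measurable \<mu>"
  by (rule measurable_mu[OF weight_continuous])

lemma measurable_theta: "\<theta> \<in> measurable \<mu> borel"
  by (rule measurable_mu[OF theta_continuous])

lemma measurable_id_M: "(\<lambda>x. x) \<in> measurable M borel"
  by (rule measurable_M) (rule continuous_on_id)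

text \<open>Both sides are compared on the full Borel algebra, because \<open>M\<close> lives on the
  trace algebra of its Shilov boundary and no pointwise inclusion of one Shilov boundary under
  \<theta> in the other is available here.\<close>

lemma distr_M: "distr M borel (\<lambda>x. x) = distr (density \<mu> (\<lambda>z. ennreal (weight z))) borel \<theta>"
proof (rule measure_eqI)
  fix A assume "A \<in> sets (distr M borel (\<lambda>x. x))"
  hence A: "A \<in> sets borel" by simp
  have "emeasure (distr M borel (\<lambda>x. x)) A = (\<integral>\<^sup>+ \<zeta>. indicator A \<zeta> \<partial>M)"
    using A by (subst nn_integral_distr[OF measurable_id_M, symmetric]) auto
  also have "\<dots> = (\<integral>\<^sup>+ z. indicator A (\<theta> z) * ennreal ((norm (J z))\<^sup>2) \<partial>\<mu>) / ennreal (c\<theta>\<^sup>2)"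
    using A by (intro nn_integral_M) auto
  also have "\<dots> = (\<integral>\<^sup>+ z. indicator A (\<theta> z) * ennreal ((norm (J z))\<^sup>2) / ennreal (c\<theta>\<^sup>2) \<partial>\<mu>)"
    by (rule nn_integral_divide[symmetric])
      (use A measurable_theta measurable_mu[OF J_continuous] in measurable)
  also have "\<dots> = (\<integral>\<^sup>+ z. ennreal (weight z) * indicator A (\<theta> z) \<partial>\<mu>)"
    using c_theta_sq_pos by (intro nn_integral_cong) (simp add: weight_def divide_ennreal[symmetric] ennreal_times_divide mult.commute split: split_indicator)
  also have "\<dots> = (\<integral>\<^sup>+ \<zeta>. indicator A \<zeta> \<partial>distr (density \<mu> (\<lambda>z. ennreal (weight z))) borel \<theta>)"
    using A measurable_theta measurable_weight by (subst nn_integral_distr) (auto simp: nn_integral_density)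
  finally show "emeasure (distr M borel (\<lambda>x. x)) A = emeasure (distr (density \<mu> (\<lambda>z. ennreal (weight z))) borel \<theta>) A"
    using A by simp
qed simp

lemma integral_M:
  fixes f :: "complex^'n \<Rightarrow> 'b::{banach,second_countable_topology}"
  assumes f: "f \<in> borel_measurable borel"
  shows "(\<integral>\<zeta>. f \<zeta> \<partial>M) = (\<integral>z. weight z *\<^sub>R f (\<theta> z) \<partial>\<mu>)"
proof -
  have ft: "(\<lambda>z. f (\<theta> z)) \<in> borel_measurable \<mu>" using f measurable_theta by measurable
  have "(\<integral>\<zeta>. f \<zeta> \<partial>M) = (\<integral>\<zeta>. f \<zeta> \<partial>distr M borel (\<lambda>x. x))"
    by (rule integral_distr[OF measurable_id_M f, symmetric])
  also have "\<dots> = (\<integral>z. f (\<theta> z) \<partial>density \<mu> (\<lambda>z. ennreal (weight z)))"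
    unfolding distr_M by (rule integral_distr) (use f measurable_theta in auto)
  also have "\<dots> = (\<integral>z. weight z *\<^sub>R f (\<theta> z) \<partial>\<mu>)"
    by (rule integral_density[OF ft measurable_weight]) (simp add: weight_nonneg)
  finally show ?thesis .
qed

lemma integrable_M_iff:
  fixes f :: "complex^'n \<Rightarrow> 'b::{banach,second_countable_topology}"
  assumes f: "f \<in> borel_measurable borel"
  shows "integrable M f \<longleftrightarrow> integrable \<mu> (\<lambda>z. weight z *\<^sub>R f (\<theta> z))"
proof -
  have ft: "(\<lambda>z. f (\<theta> z)) \<in> borel_measurable \<mu>" using f measurable_theta by measurable
  have "integrable M f \<longleftrightarrow> integrable (distr M borel (\<lambda>x. x)) f"
    by (rule integrable_distr_eq[OF measurable_id_M f, symmetric])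
  also have "\<dots> \<longleftrightarrow> integrable (density \<mu> (\<lambda>z. ennreal (weight z))) (\<lambda>z. f (\<theta> z))"
    unfolding distr_M by (rule integrable_distr_eq) (use f measurable_theta in auto)
  also have "\<dots> \<longleftrightarrow> integrable \<mu> (\<lambda>z. weight z *\<^sub>R f (\<theta> z))"
    by (rule integrable_density[OF ft measurable_weight]) (simp add: weight_nonneg)
  finally show ?thesis .
qed

text \<open>The almost everywhere form of the inclusion of boundaries under \<theta>. The condition
  on \<open>J\<close> is harmless: every lift vanishes where \<open>J\<close> does.\<close>

lemma AE_theta_mem: "AE z in \<mu>. J z \<noteq> 0 \<longrightarrow> \<theta> z \<in> space M"
proof -
  have B: "space M \<in> sets borel" unfolding space_M by (intro borel_closed closed_shilov_boundary)
  have "AE \<zeta> in distr M borel (\<lambda>x. x). \<zeta> \<in> space M"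
    by (subst AE_distr_iff[OF measurable_id_M]) (use B in auto)
  hence "AE z in density \<mu> (\<lambda>z. ennreal (weight z)). \<theta> z \<in> space M"
    unfolding distr_M by (subst (asm) AE_distr_iff) (use B measurable_theta in auto)
  hence "AE z in \<mu>. 0 < ennreal (weight z) \<longrightarrow> \<theta> z \<in> space M"
    by (subst (asm) AE_density) (use measurable_weight in auto)
  thus ?thesis by eventually_elim (use c_theta_sq_pos in \<open>auto simp: weight_def\<close>)
qed

lemma measurable_lift:
  assumes "u \<in> borel_measurable borel" shows "lift_J \<theta> u \<in> borel_measurable \<mu>"
  unfolding lift_J_def
  by (rule borel_measurable_times[OF measurable_mu[OF J_continuous]]) (use assms measurable_theta in measurable)

lemma weight_norm_eq: "weight z *\<^sub>R (norm (u (\<theta> z)))\<^sup>2 = (norm (lift_J \<theta> u z))\<^sup>2 / c\<theta>\<^sup>2"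
  by (simp add: weight_def lift_J_def norm_mult power_mult_distrib)

lemma sq_norm_lift:
  assumes "u \<in> borel_measurable borel" shows "sq_norm M u = sq_norm \<mu> (lift_J \<theta> u) / c\<theta>\<^sup>2"
  unfolding sq_norm_def
  by (subst integral_M) (use assms weight_norm_eq[of _ u] in \<open>auto\<close>)

lemma L2_lift:
  assumes "u \<in> borel_measurable borel" "u \<in> L2 M" shows "lift_J \<theta> u \<in> L2 \<mu>"
proof -
  have "integrable M (\<lambda>\<zeta>. (norm (u \<zeta>))\<^sup>2)" using assms(2) by (simp add: L2_def)
  hence "integrable \<mu> (\<lambda>z. (norm (lift_J \<theta> u z))\<^sup>2 / c\<theta>\<^sup>2)"
    using assms(1) weight_norm_eq[of _ u] by (subst (asm) integrable_M_iff) auto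
  from integrable_mult_right[OF this, of "c\<theta>\<^sup>2"]
  show ?thesis using c_theta_sq_pos measurable_lift[OF assms(1)] by (simp add: L2_def)
qed

section \<open>Orthogonality of homogeneous parts and the Hardy norm as a limit\<close>

lemma continuous_dilation:
  assumes "holo F \<Omega>" "norm a < 1" shows "continuous_on (closure \<Omega>) (\<lambda>z. F (a *s z))"
  by (rule continuous_on_compose2[OF holo_continuous_on[OF assms(1)]])
    (use scaled_closure_mem[OF assms(2)] in \<open>auto intro!: continuous_intros\<close>)

lemma hom_part_continuous: "holo F \<Omega> \<Longrightarrow> continuous_on X (hom_part n F)"
  by (intro polynomial_fun_continuous_on polynomial_fun_hom_part)

lemma hom_part_integral_sums:
  assumes F: "holo F \<Omega>" and a: "norm a < 1" and H: "continuous_on (closure \<Omega>) H"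
  shows "(\<lambda>n. a ^ n * (\<integral>z. hom_part n F z * H z \<partial>\<mu>)) sums (\<integral>z. F (a *s z) * H z \<partial>\<mu>)"
proof -
  obtain s where s: "norm a < s" "s < 1" using a dense by blast
  have s0: "0 < s" using s(1) norm_ge_zero le_less_trans by blast
  obtain B where B: "B \<ge> 0" "\<And>n z. z \<in> closure \<Omega> \<Longrightarrow> norm (hom_part n F z) \<le> B / s ^ n"
    using hom_part_bound_uniform[OF F s0 s(2)] by blast
  obtain C where C: "\<And>z. z \<in> closure \<Omega> \<Longrightarrow> norm (H z) \<le> C" using bounded_on_closure[OF H] by blast
  define f where "f n z = a ^ n * (hom_part n F z * H z)" for n z
  have bd: "norm (f n z) \<le> (B * C) * (norm a / s) ^ n" if z: "z \<in> space \<mu>" for n z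
  proof -
    have "norm (hom_part n F z) * norm (H z) \<le> (B / s ^ n) * C"
      using B C space_mu_closure[OF z] s0 by (intro mult_mono) auto
    hence "norm a ^ n * (norm (hom_part n F z) * norm (H z)) \<le> norm a ^ n * ((B / s ^ n) * C)" by (intro mult_left_mono) auto
    thus ?thesis by (simp add: f_def norm_mult norm_power power_divide mult_ac)
  qed
  have geo: "summable (\<lambda>n. (B * C) * (norm a / s) ^ n)"
    using s s0 by (intro summable_mult summable_geometric) auto
  have int: "integrable \<mu> (f n)" for n
    unfolding f_def by (intro integrable_mult_right mu.L2_integrable L2_mu continuous_on_mult hom_part_continuous[OF F] H)
  have "(\<lambda>n. \<integral>z. f n z \<partial>\<mu>) sums (\<integral>z. (\<Sum>n. f n z) \<partial>\<mu>)"
  proof (rule sums_integral[OF int])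
    show "AE z in \<mu>. summable (\<lambda>n. norm (f n z))"
      by (rule AE_I2) (rule summable_comparison_test'[OF geo], use bd in auto)
    show "summable (\<lambda>n. \<integral>z. norm (f n z) \<partial>\<mu>)"
    proof (rule summable_comparison_test'[OF geo])
      fix n
      have "(\<integral>z. norm (f n z) \<partial>\<mu>) \<le> (\<integral>z. (B * C) * (norm a / s) ^ n \<partial>\<mu>)"
        using int bd by (intro integral_mono) auto
      thus "norm (\<integral>z. norm (f n z) \<partial>\<mu>) \<le> (B * C) * (norm a / s) ^ n"
        by (simp add: mu.prob_space)
    qed
  qed
  moreover have "(\<integral>z. (\<Sum>n. f n z) \<partial>\<mu>) = (\<integral>z. F (a *s z) * H z \<partial>\<mu>)"
  proof (rule Bochner_Integration.integral_cong[OF refl])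
    fix z assume z: "z \<in> space \<mu>"
    have "(\<lambda>n. hom_part n F z * a ^ n * H z) sums (F (a *s z) * H z)"
      by (intro sums_mult2 hom_part_sums F space_mu_closure z a)
    thus "(\<Sum>n. f n z) = F (a *s z) * H z" by (simp add: f_def sums_iff mult_ac)
  qed
  moreover have "(\<integral>z. f n z \<partial>\<mu>) = a ^ n * (\<integral>z. hom_part n F z * H z \<partial>\<mu>)" for n
    unfolding f_def by simp
  ultimately show ?thesis by simp
qed

lemma exists_rotation: assumes "m \<noteq> n" obtains c :: complex where "norm c = 1" "c ^ m * cnj c ^ n \<noteq> 1"
proof -
  \<comment> \<open>Chosen so that the angle \<open>m * x - n * x\<close> is exactly 1, which is no
    multiple of a full turn.\<close>
  define x where "x = 1 / (real m - real n)"
  have "(cis x) ^ m * cnj (cis x) ^ n = cis (real m * x - real n * x)"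
    unfolding cis_cnj Complex.DeMoivre cis_mult by simp
  also have "real m * x - real n * x = 1" using assms by (simp add: x_def diff_divide_distrib[symmetric])
  finally have e: "(cis x) ^ m * cnj (cis x) ^ n = cis 1" .
  have "cis 1 \<noteq> 1"
  proof
    assume "cis 1 = 1"
    hence "sin (1::real) = 0" by (metis cis.simps(2) one_complex.simps(2))
    moreover have "sin (1::real) > 0" by (rule sin_gt_zero) (use pi_gt3 in auto)
    ultimately show False by simp
  qed
  thus thesis using that[of "cis x"] e by simp
qed

text \<open>Rotating by a suitable unimodular \<open>c\<close> multiplies the integral by a factor
  other than 1, while \<mu> is rotation invariant.\<close>

lemma hom_part_orthogonal:
  assumes "holo F \<Omega>" "holo H \<Omega>" "m \<noteq> n"
  shows "(\<integral>z. hom_part m F z * cnj (hom_part n H z) \<partial>\<mu>) = 0"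
proof -
  obtain c :: complex where c: "norm c = 1" "c ^ m * cnj c ^ n \<noteq> 1" using exists_rotation[OF assms(3)] by blast
  define I where "I = (\<integral>z. hom_part m F z * cnj (hom_part n H z) \<partial>\<mu>)"
  have "I = (\<integral>z. hom_part m F (c *s z) * cnj (hom_part n H (c *s z)) \<partial>\<mu>)"
    unfolding I_def by (rule integral_mu_circle[OF c(1), symmetric])
      (intro measurable_mu continuous_on_mult continuous_on_cnj hom_part_continuous assms)
  also have "\<dots> = (\<integral>z. (c ^ m * cnj c ^ n) * (hom_part m F z * cnj (hom_part n H z)) \<partial>\<mu>)"
    by (simp add: hom_part_scale assms mult_ac)
  also have "\<dots> = (c ^ m * cnj c ^ n) * I" by (simp add: I_def)
  finally have "(1 - c ^ m * cnj c ^ n) * I = 0" by (simp add: algebra_simps)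
  thus ?thesis using c(2) by (simp add: I_def)
qed

lemma dilated_inner_sums:
  assumes F: "holo F \<Omega>" and H: "holo H \<Omega>" and a: "norm a < 1" and b: "norm b < 1"
  shows "(\<lambda>n. (a * cnj b) ^ n * (\<integral>z. hom_part n F z * cnj (hom_part n H z) \<partial>\<mu>)) sums
           (\<integral>z. F (a *s z) * cnj (H (b *s z)) \<partial>\<mu>)"
proof -
  have cn: "(\<integral>z. f z * cnj (g z) \<partial>\<mu>) = cnj (\<integral>z. g z * cnj (f z) \<partial>\<mu>)" for f g :: "complex^'n \<Rightarrow> complex"
    by (simp add: Bochner_Integration.integral_cnj[symmetric] mult.commute)
  have inner: "(\<integral>z. hom_part n F z * cnj (H (b *s z)) \<partial>\<mu>) = cnj b ^ n * (\<integral>z. hom_part n F z * cnj (hom_part n H z) \<partial>\<mu>)" for n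
  proof -
    have "(\<lambda>m. b ^ m * (\<integral>z. hom_part m H z * cnj (hom_part n F z) \<partial>\<mu>)) sums (\<integral>z. H (b *s z) * cnj (hom_part n F z) \<partial>\<mu>)"
      by (intro hom_part_integral_sums H b continuous_on_cnj hom_part_continuous F)
    moreover have "(\<lambda>m. b ^ m * (\<integral>z. hom_part m H z * cnj (hom_part n F z) \<partial>\<mu>)) sums
        (\<Sum>m\<in>{n}. b ^ m * (\<integral>z. hom_part m H z * cnj (hom_part n F z) \<partial>\<mu>))"
      by (rule sums_finite) (use hom_part_orthogonal[OF H F] in auto)
    ultimately have "(\<integral>z. H (b *s z) * cnj (hom_part n F z) \<partial>\<mu>) = b ^ n * (\<integral>z. hom_part n H z * cnj (hom_part n F z) \<partial>\<mu>)"
      using sums_unique2 by fastforce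
    thus ?thesis using cn[of "hom_part n F" "\<lambda>z. H (b *s z)"] cn[of "hom_part n F" "hom_part n H"] by simp
  qed
  have "(\<lambda>n. a ^ n * (\<integral>z. hom_part n F z * cnj (H (b *s z)) \<partial>\<mu>)) sums (\<integral>z. F (a *s z) * cnj (H (b *s z)) \<partial>\<mu>)"
    by (intro hom_part_integral_sums F a continuous_on_cnj continuous_dilation H b)
  thus ?thesis unfolding inner by (simp add: power_mult_distrib mult_ac)
qed

text \<open>Only the product of one factor with the conjugate of the other enters the series. This
  gives both the self-adjointness of dilations and the Cauchy property of dilates.\<close>

lemma dilated_inner_shift:
  assumes "holo F \<Omega>" "holo H \<Omega>" "norm a < 1" "norm b < 1" "norm a' < 1" "norm b' < 1" "a * cnj b = a' * cnj b'"
  shows "(\<integral>z. F (a *s z) * cnj (H (b *s z)) \<partial>\<mu>) = (\<integral>z. F (a' *s z) * cnj (H (b' *s z)) \<partial>\<mu>)"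
  by (rule sums_unique2[OF dilated_inner_sums[OF assms(1-4), unfolded assms(7)] dilated_inner_sums[OF assms(1,2,5,6)]])

definition dil_norm :: "(complex^'n \<Rightarrow> complex) \<Rightarrow> real \<Rightarrow> real" where
  "dil_norm F r = sq_norm \<mu> (\<lambda>z. F (complex_of_real r *s z))"

lemma dil_norm_sums:
  assumes "holo F \<Omega>" "0 \<le> r" "r < 1"
  shows "(\<lambda>n. r ^ (2 * n) * sq_norm \<mu> (hom_part n F)) sums dil_norm F r"
proof -
  have "(\<lambda>n. (of_real r * cnj (of_real r)) ^ n * (\<integral>z. hom_part n F z * cnj (hom_part n F z) \<partial>\<mu>)) sums
      (\<integral>z. F (of_real r *s z) * cnj (F (of_real r *s z)) \<partial>\<mu>)"
    using assms by (intro dilated_inner_sums) auto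
  hence "(\<lambda>n. complex_of_real (r ^ (2 * n) * sq_norm \<mu> (hom_part n F))) sums of_real (dil_norm F r)"
    by (simp add: mu.inner_self dil_norm_def power_mult power2_eq_square)
  thus ?thesis by (simp only: sums_of_real_iff)
qed

lemma dil_norm_mono:
  assumes "holo F \<Omega>" "0 \<le> r" "r \<le> s" "s < 1" shows "dil_norm F r \<le> dil_norm F s"
proof (rule sums_le[OF _ dil_norm_sums dil_norm_sums])
  show "r ^ (2 * n) * sq_norm \<mu> (hom_part n F) \<le> s ^ (2 * n) * sq_norm \<mu> (hom_part n F)" for n
    using assms by (intro mult_right_mono power_mono) auto
qed (use assms in auto)

lemma dil_norm_L2: "holo F \<Omega> \<Longrightarrow> 0 \<le> r \<Longrightarrow> r < 1 \<Longrightarrow> (\<lambda>z. F (complex_of_real r *s z)) \<in> L2 \<mu>"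
  by (intro L2_mu continuous_dilation) auto

lemma hardy_sup_eq: assumes "holo F \<Omega>" shows "hardy_sup \<mu> F = (SUP r\<in>{0<..<1}. ennreal (dil_norm F r))"
  unfolding hardy_sup_def dil_norm_def
  by (intro SUP_cong refl)
    (simp add: mu.ennreal_sq_norm[OF dil_norm_L2[OF assms, unfolded of_real_vector_smult]] of_real_vector_smult)

lemma H2_I: assumes "holo F \<Omega>" "\<And>r. 0 < r \<Longrightarrow> r < 1 \<Longrightarrow> dil_norm F r \<le> B" shows "F \<in> H2 \<Omega> \<mu>"
proof -
  have "hardy_sup \<mu> F \<le> ennreal B" unfolding hardy_sup_eq[OF assms(1)]
    by (rule SUP_least) (use assms(2) in \<open>auto intro!: ennreal_leI\<close>)
  thus ?thesis using assms(1) by (simp add: H2_def le_less_trans[OF _ ennreal_less_top])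
qed

lemma H2_holo: "F \<in> H2 \<Omega> \<mu> \<Longrightarrow> holo F \<Omega>" by (simp add: H2_def)

lemma H2_dil_norm_le:
  assumes "F \<in> H2 \<Omega> \<mu>" "0 < r" "r < 1" shows "dil_norm F r \<le> (H2_norm \<mu> F)\<^sup>2"
proof -
  have "ennreal (dil_norm F r) \<le> hardy_sup \<mu> F"
    unfolding hardy_sup_eq[OF H2_holo[OF assms(1)]] using assms(2,3) by (intro SUP_upper) auto
  hence "enn2real (ennreal (dil_norm F r)) \<le> enn2real (hardy_sup \<mu> F)"
    by (rule enn2real_mono) (use assms(1) in \<open>simp add: H2_def\<close>)
  thus ?thesis by (simp add: H2_norm_def dil_norm_def)
qed

text \<open>The norms of dilates increase with the radius, so their supremum is a limit; inner
  products obtained by polarisation can then be computed as limits.\<close>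

lemma H2_norm_tendsto:
  assumes "F \<in> H2 \<Omega> \<mu>" shows "((\<lambda>r. dil_norm F r) \<longlongrightarrow> (H2_norm \<mu> F)\<^sup>2) (at_left 1)"
proof (rule order_tendstoI)
  have ev: "\<forall>\<^sub>F r in at_left (1::real). 0 < r \<and> r < 1" by (rule eventually_at_leftI[of 0]) auto
  fix a assume "a > (H2_norm \<mu> F)\<^sup>2"
  from ev show "\<forall>\<^sub>F r in at_left 1. dil_norm F r < a"
    by eventually_elim (use H2_dil_norm_le[OF assms] \<open>a > _\<close> in \<open>auto intro: le_less_trans\<close>)
next
  fix a assume a: "a < (H2_norm \<mu> F)\<^sup>2"
  have "\<exists>r\<in>{0<..<1}. dil_norm F r > a"
  proof (rule ccontr)
    assume "\<not> ?thesis"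
    hence le: "dil_norm F r \<le> a" if "0 < r" "r < 1" for r using that by force
    have "hardy_sup \<mu> F \<le> ennreal a" unfolding hardy_sup_eq[OF H2_holo[OF assms]]
      by (rule SUP_least) (use le in \<open>auto intro!: ennreal_leI\<close>)
    moreover have "0 \<le> dil_norm F (1/2)" by (simp add: dil_norm_def)
    hence "0 \<le> a" by (rule order.trans[OF _ le]) auto
    ultimately have "enn2real (hardy_sup \<mu> F) \<le> a" by (simp add: enn2real_leI)
    thus False using a by (simp add: H2_norm_def)
  qed
  then obtain r0 where r0: "0 < r0" "r0 < 1" "dil_norm F r0 > a" by auto
  show "\<forall>\<^sub>F r in at_left 1. a < dil_norm F r"
  proof (rule eventually_at_leftI[of r0])
    fix r assume "r \<in> {r0<..<1}"
    thus "a < dil_norm F r" using r0 dil_norm_mono[OF H2_holo[OF assms], of r0 r] by auto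
  qed (use r0 in simp)
qed

end

lemma (in prob_space) polarization:
  assumes "f \<in> L2 M" "g \<in> L2 M"
  shows "(\<Sum>m<4. \<i> ^ m * of_real (sq_norm M (\<lambda>x. f x + \<i> ^ m * g x))) / 4 = (\<integral>x. f x * cnj (g x) \<partial>M)"
proof -
  define I where "I = (\<integral>x. f x * cnj (g x) \<partial>M)"
  have "sq_norm M (\<lambda>x. f x + \<i> ^ m * g x) = sq_norm M f + sq_norm M g + 2 * Re (cnj (\<i> ^ m) * I)" for m
  proof -
    have "(\<integral>x. f x * cnj (\<i> ^ m * g x) \<partial>M) = cnj (\<i> ^ m) * I"
      unfolding I_def by (simp add: mult.left_commute[of "f _"] del: complex_cnj_power)
    thus ?thesis using sq_norm_add[OF assms(1) L2_scale[OF assms(2)], of "\<i> ^ m"]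
      by (simp add: sq_norm_scale norm_power del: complex_cnj_power)
  qed
  hence "(\<Sum>m<4. \<i> ^ m * of_real (sq_norm M (\<lambda>x. f x + \<i> ^ m * g x))) / 4 = I"
    by (simp add: numeral_eq_Suc complex_eq_iff)
  thus ?thesis by (simp add: I_def)
qed

section \<open>Inner product, dilations and functions continuous up to the boundary\<close>

context hardy_setting
begin

text \<open>Radii increasing to 1; the double successor keeps \<open>rr 0 = 1 / 2\<close>
  positive.\<close>

definition rr :: "nat \<Rightarrow> real" where "rr j = 1 - inverse (of_nat (Suc (Suc j)))"

lemma rr_pos: "0 < rr j" and rr_less: "rr j < 1"
  by (auto simp: rr_def field_simps)

lemma rr_tendsto: "rr \<longlonglongrightarrow> 1"
proof -
  have "(\<lambda>j. 1 - inverse (real (Suc (Suc j)))) \<longlonglongrightarrow> 1 - 0"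
    by (rule tendsto_diff[OF tendsto_const LIMSEQ_Suc[OF LIMSEQ_inverse_real_of_nat]])
  thus ?thesis by (simp add: rr_def[abs_def] del: of_nat_Suc)
qed

lemma rr_at_left: "filterlim rr (at_left 1) sequentially"
  by (rule filterlim_at_withinI[OF rr_tendsto]) (simp add: rr_less less_imp_neq)

lemma norm_of_rr: "norm (complex_of_real (rr j)) < 1"
  using rr_pos[of j] rr_less[of j] by simp

lemma scaled_closure_mem': "norm c \<le> 1 \<Longrightarrow> z \<in> closure \<Omega> \<Longrightarrow> c *s z \<in> closure \<Omega>"
  using circled_closure scaled_closure_mem closure_subset by (metis antisym_conv2 subsetD)

lemma radial_tendsto:
  assumes "continuous_on (closure \<Omega>) f" "z \<in> closure \<Omega>"
  shows "((\<lambda>r. f (complex_of_real r *s z)) \<longlongrightarrow> f z) (at_left 1)"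
proof -
  have "((\<lambda>r. complex_of_real r *s z) \<longlongrightarrow> complex_of_real 1 *s z) (at_left 1)"
    unfolding of_real_vector_smult by (intro tendsto_intros)
  hence t: "((\<lambda>r. complex_of_real r *s z) \<longlongrightarrow> z) (at_left 1)" by simp
  have "\<forall>\<^sub>F r in at_left 1. complex_of_real r *s z \<in> closure \<Omega>"
    by (rule eventually_at_leftI[of 0]) (auto intro!: scaled_closure_mem' assms(2))
  thus ?thesis using continuous_on_tendsto_compose[OF assms(1) t assms(2)] by blast
qed

lemma radial_sequence:
  assumes "continuous_on (closure \<Omega>) f" "z \<in> closure \<Omega>"
  shows "(\<lambda>j. f (complex_of_real (rr j) *s z)) \<longlonglongrightarrow> f z"
  by (rule filterlim_compose[OF radial_tendsto[OF assms] rr_at_left])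

lemma bounded_convergence:
  fixes f :: "nat \<Rightarrow> complex^'n \<Rightarrow> complex"
  assumes "\<And>j. continuous_on (closure \<Omega>) (f j)" "continuous_on (closure \<Omega>) g"
    "\<And>j z. z \<in> closure \<Omega> \<Longrightarrow> norm (f j z) \<le> B" "\<And>z. z \<in> closure \<Omega> \<Longrightarrow> (\<lambda>j. f j z) \<longlonglongrightarrow> g z"
  shows "(\<lambda>j. \<integral>z. f j z \<partial>\<mu>) \<longlonglongrightarrow> (\<integral>z. g z \<partial>\<mu>)"
proof (rule integral_dominated_convergence[where w = "\<lambda>_. B"])
  show "f j \<in> borel_measurable \<mu>" for j using assms(1) by (rule measurable_mu)
  show "g \<in> borel_measurable \<mu>" using assms(2) by (rule measurable_mu)
  show "AE z in \<mu>. (\<lambda>j. f j z) \<longlonglongrightarrow> g z" by (intro AE_I2 assms(4) space_mu_closure)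
  show "AE z in \<mu>. norm (f j z) \<le> B" for j by (intro AE_I2 assms(3) space_mu_closure)
qed simp

lemma theta_compose_continuous:
  "continuous_on (\<theta> ` closure \<Omega>) f \<Longrightarrow> continuous_on (closure \<Omega>) (\<lambda>z. f (\<theta> z))"
  by (rule continuous_on_compose2[OF _ theta_continuous]) auto

lemma lift_continuous: "continuous_on (\<theta> ` closure \<Omega>) f \<Longrightarrow> continuous_on (closure \<Omega>) (lift_J \<theta> f)"
  unfolding lift_J_def by (intro continuous_on_mult J_continuous theta_compose_continuous)

lemma theta_compose_holo: assumes "holo f (\<theta> ` \<Omega>)" shows "holo (\<lambda>z. f (\<theta> z)) \<Omega>"
proof -
  obtain D where D: "\<And>z. (\<theta> has_derivative (*v) (D z)) (at z)"
    using polynomial_map_has_derivative[OF theta_map] by blast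
  show ?thesis by (rule holo_compose[OF assms order_refl has_derivative_at_withinI[OF D]])
qed

lemma lift_holo: "holo f (\<theta> ` \<Omega>) \<Longrightarrow> holo (lift_J \<theta> f) \<Omega>"
  unfolding lift_J_def by (rule holo_mult[OF polynomial_fun_holo[OF polynomial_fun_J] theta_compose_holo])

lemma integral_M_continuous:
  fixes f :: "complex^'n \<Rightarrow> complex"
  assumes "continuous_on (\<theta> ` closure \<Omega>) f"
  shows "(\<integral>\<zeta>. f \<zeta> \<partial>M) = (\<integral>z. weight z *\<^sub>R f (\<theta> z) \<partial>\<mu>)"
proof -
  \<comment> \<open>Cut off to a Borel function on the whole space, as the change of variables
    demands; neither integral sees the difference.\<close>
  define f' where "f' \<zeta> = indicator (\<theta> ` closure \<Omega>) \<zeta> *\<^sub>R f \<zeta>" for \<zeta>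
  have "compact (\<theta> ` closure \<Omega>)" by (intro compact_continuous_image theta_continuous compact_closure)
  hence "f' \<in> borel_measurable borel" unfolding f'_def
    by (intro borel_measurable_continuous_on_indicator assms borel_closed compact_imp_closed)
  hence "(\<integral>\<zeta>. f' \<zeta> \<partial>M) = (\<integral>z. weight z *\<^sub>R f' (\<theta> z) \<partial>\<mu>)" by (rule integral_M)
  moreover have "(\<integral>\<zeta>. f' \<zeta> \<partial>M) = (\<integral>\<zeta>. f \<zeta> \<partial>M)"
    by (intro Bochner_Integration.integral_cong refl) (use space_M_subset in \<open>auto simp: f'_def\<close>)
  moreover have "(\<integral>z. weight z *\<^sub>R f' (\<theta> z) \<partial>\<mu>) = (\<integral>z. weight z *\<^sub>R f (\<theta> z) \<partial>\<mu>)"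
    by (intro Bochner_Integration.integral_cong refl) (use space_mu_closure in \<open>auto simp: f'_def\<close>)
  ultimately show ?thesis by simp
qed

lemma H2_theta_add_scale:
  assumes "f \<in> H2_theta \<Omega> \<theta> \<mu>" "g \<in> H2_theta \<Omega> \<theta> \<mu>" shows "(\<lambda>z. f z + a * g z) \<in> H2_theta \<Omega> \<theta> \<mu>"
proof -
  have h: "holo f (\<theta> ` \<Omega>)" "holo g (\<theta> ` \<Omega>)" "lift_J \<theta> f \<in> H2 \<Omega> \<mu>" "lift_J \<theta> g \<in> H2 \<Omega> \<mu>"
    using assms by (auto simp: H2_theta_def)
  have hs: "holo (\<lambda>z. f z + a * g z) (\<theta> ` \<Omega>)" by (intro holo_add holo_mult holo_const h)
  have "lift_J \<theta> (\<lambda>z. f z + a * g z) \<in> H2 \<Omega> \<mu>"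
  proof (rule H2_I[OF lift_holo[OF hs]])
    fix r :: real assume r: "0 < r" "r < 1"
    let ?F = "\<lambda>z. lift_J \<theta> f (of_real r *s z)" and ?G = "\<lambda>z. lift_J \<theta> g (of_real r *s z)"
    have L: "?F \<in> L2 \<mu>" "?G \<in> L2 \<mu>" using r h(3,4) by (auto intro!: dil_norm_L2 H2_holo)
    have "dil_norm (lift_J \<theta> (\<lambda>z. f z + a * g z)) r = sq_norm \<mu> (\<lambda>z. ?F z + a * ?G z)"
      by (simp add: dil_norm_def lift_J_def algebra_simps)
    also have "\<dots> \<le> 2 * sq_norm \<mu> ?F + 2 * sq_norm \<mu> (\<lambda>z. a * ?G z)"
      by (rule mu.sq_norm_add_le[OF L(1) mu.L2_scale[OF L(2)]])
    also have "\<dots> = 2 * dil_norm (lift_J \<theta> f) r + 2 * ((norm a)\<^sup>2 * dil_norm (lift_J \<theta> g) r)"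
      by (simp add: dil_norm_def sq_norm_scale)
    also have "\<dots> \<le> 2 * (H2_norm \<mu> (lift_J \<theta> f))\<^sup>2 + 2 * ((norm a)\<^sup>2 * (H2_norm \<mu> (lift_J \<theta> g))\<^sup>2)"
      using r by (intro add_mono mult_left_mono H2_dil_norm_le h) auto
    finally show "dil_norm (lift_J \<theta> (\<lambda>z. f z + a * g z)) r \<le> 2 * (H2_norm \<mu> (lift_J \<theta> f))\<^sup>2 + 2 * ((norm a)\<^sup>2 * (H2_norm \<mu> (lift_J \<theta> g))\<^sup>2)" .
  qed
  thus ?thesis using hs by (simp add: H2_theta_def)
qed

definition dil_inner :: "(complex^'n \<Rightarrow> complex) \<Rightarrow> (complex^'n \<Rightarrow> complex) \<Rightarrow> real \<Rightarrow> complex" where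
  "dil_inner f g r = (\<integral>z. lift_J \<theta> f (complex_of_real r *s z) * cnj (lift_J \<theta> g (complex_of_real r *s z)) \<partial>\<mu>) / of_real (c\<theta>\<^sup>2)"

text \<open>The inner product is polarised from norms that are suprema, from which sesquilinear
  identities are not visible. As a limit of integrals it inherits them.\<close>

lemma H2_theta_inner_tendsto:
  assumes "f \<in> H2_theta \<Omega> \<theta> \<mu>" "g \<in> H2_theta \<Omega> \<theta> \<mu>"
  shows "(dil_inner f g \<longlongrightarrow> H2_theta_inner \<theta> \<mu> f g) (at_left 1)"
proof -
  have h: "lift_J \<theta> (\<lambda>z. f z + a * g z) \<in> H2 \<Omega> \<mu>" for a
    using H2_theta_add_scale[OF assms] by (simp add: H2_theta_def)
  have "((\<lambda>r. (\<Sum>m<4. \<i> ^ m * of_real (dil_norm (lift_J \<theta> (\<lambda>z. f z + \<i> ^ m * g z)) r / c\<theta>\<^sup>2)) / 4)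
     \<longlongrightarrow> (\<Sum>m<4. \<i> ^ m * of_real ((H2_norm \<mu> (lift_J \<theta> (\<lambda>z. f z + \<i> ^ m * g z)))\<^sup>2 / c\<theta>\<^sup>2)) / 4) (at_left 1)"
    by (intro tendsto_intros H2_norm_tendsto h) (use c_theta_sq_pos in auto)
  moreover have "(\<Sum>m<4. \<i> ^ m * of_real ((H2_norm \<mu> (lift_J \<theta> (\<lambda>z. f z + \<i> ^ m * g z)))\<^sup>2 / c\<theta>\<^sup>2)) / 4 = H2_theta_inner \<theta> \<mu> f g"
    by (simp add: H2_theta_inner_def H2_theta_norm_def power_divide)
  moreover have "\<forall>\<^sub>F r in at_left 1. (\<Sum>m<4. \<i> ^ m * of_real (dil_norm (lift_J \<theta> (\<lambda>z. f z + \<i> ^ m * g z)) r / c\<theta>\<^sup>2)) / 4 = dil_inner f g r"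
  proof (rule eventually_at_leftI[of 0])
    fix r :: real assume "r \<in> {0<..<1}"
    hence r: "0 < r" "r < 1" by auto
    let ?F = "\<lambda>z. lift_J \<theta> f (of_real r *s z)" and ?G = "\<lambda>z. lift_J \<theta> g (of_real r *s z)"
    have L: "?F \<in> L2 \<mu>" "?G \<in> L2 \<mu>" using r assms by (auto simp: H2_theta_def intro!: dil_norm_L2 H2_holo)
    have e: "dil_norm (lift_J \<theta> (\<lambda>z. f z + a * g z)) r = sq_norm \<mu> (\<lambda>z. ?F z + a * ?G z)" for a
      by (simp add: dil_norm_def lift_J_def algebra_simps)
    have "(\<Sum>m<4. \<i> ^ m * of_real (dil_norm (lift_J \<theta> (\<lambda>z. f z + \<i> ^ m * g z)) r / c\<theta>\<^sup>2))
        = (\<Sum>m<4. \<i> ^ m * of_real (sq_norm \<mu> (\<lambda>z. ?F z + \<i> ^ m * ?G z))) / of_real (c\<theta>\<^sup>2)"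
      by (simp add: e sum_divide_distrib)
    moreover have "dil_inner f g r = (\<Sum>m<4. \<i> ^ m * of_real (sq_norm \<mu> (\<lambda>z. ?F z + \<i> ^ m * ?G z))) / 4 / of_real (c\<theta>\<^sup>2)"
      by (simp only: dil_inner_def mu.polarization[OF L])
    ultimately show "(\<Sum>m<4. \<i> ^ m * of_real (dil_norm (lift_J \<theta> (\<lambda>z. f z + \<i> ^ m * g z)) r / c\<theta>\<^sup>2)) / 4 = dil_inner f g r"
      by (simp only: divide_divide_eq_left mult.commute)
  qed simp
  ultimately show ?thesis by (simp add: tendsto_cong)
qed

lemma dil_inner_cnj: "dil_inner g f r = cnj (dil_inner f g r)"
proof -
  have "(\<integral>z. lift_J \<theta> g (complex_of_real r *s z) * cnj (lift_J \<theta> f (complex_of_real r *s z)) \<partial>\<mu>) =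
     (\<integral>z. cnj (lift_J \<theta> f (complex_of_real r *s z) * cnj (lift_J \<theta> g (complex_of_real r *s z))) \<partial>\<mu>)"
    by (simp add: mult.commute)
  also have "\<dots> = cnj (\<integral>z. lift_J \<theta> f (complex_of_real r *s z) * cnj (lift_J \<theta> g (complex_of_real r *s z)) \<partial>\<mu>)"
    by (rule Bochner_Integration.integral_cnj)
  finally show ?thesis by (simp add: dil_inner_def)
qed

lemma H2_theta_inner_cnj:
  assumes "f \<in> H2_theta \<Omega> \<theta> \<mu>" "g \<in> H2_theta \<Omega> \<theta> \<mu>"
  shows "H2_theta_inner \<theta> \<mu> g f = cnj (H2_theta_inner \<theta> \<mu> f g)"
proof (rule tendsto_unique[OF trivial_limit_at_left_real H2_theta_inner_tendsto[OF assms(2,1)]])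
  show "(dil_inner g f \<longlongrightarrow> cnj (H2_theta_inner \<theta> \<mu> f g)) (at_left 1)"
    using tendsto_cnj[OF H2_theta_inner_tendsto[OF assms]] by (simp add: dil_inner_cnj[of g f, abs_def])
qed

lemma weighted_dilation_theta: "weighted_dilation k r (\<theta> z) = \<theta> (complex_of_real r *s z)"
  by (simp add: weighted_dilation_def vec_eq_iff theta_homogeneous)

lemma lift_dilation:
  assumes "0 < r"
  shows "lift_J \<theta> (\<lambda>\<zeta>. f (weighted_dilation k r \<zeta>)) z = inverse (of_real r ^ deg_J) * lift_J \<theta> f (complex_of_real r *s z)"
  using assms by (simp add: lift_J_def weighted_dilation_theta J_homogeneous)

lemma weighted_dilation_matrix:
  "weighted_dilation k r \<zeta> = (\<chi> i j. if i = j then of_real (r ^ k i) else 0) *v \<zeta>"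
  by (simp add: weighted_dilation_def matrix_vector_mult_def vec_eq_iff if_distrib[of "\<lambda>y. y * _"] cong: if_cong)

lemma weighted_dilation_continuous: "continuous_on X (weighted_dilation k r)"
  unfolding weighted_dilation_matrix[abs_def] by (rule continuous_on_matrix)

lemma weighted_dilation_image:
  assumes "0 \<le> r" "r < 1" "\<zeta> \<in> \<theta> ` closure \<Omega>" shows "weighted_dilation k r \<zeta> \<in> \<theta> ` \<Omega>"
  using assms scaled_closure_mem[of "complex_of_real r"] by (auto simp: weighted_dilation_theta)

lemma dilation_holo:
  assumes "holo f (\<theta> ` \<Omega>)" "0 \<le> r" "r < 1" shows "holo (\<lambda>\<zeta>. f (weighted_dilation k r \<zeta>)) (\<theta> ` \<Omega>)"
proof -
  have "weighted_dilation k r ` \<theta> ` \<Omega> \<subseteq> \<theta> ` \<Omega>"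
    using weighted_dilation_image[OF assms(2,3)] closure_subset by blast
  thus ?thesis using assms(1) unfolding weighted_dilation_matrix by (intro holo_matrix_compose) (auto simp: weighted_dilation_matrix[abs_def])
qed

lemma H2_theta_dilation:
  assumes f: "f \<in> H2_theta \<Omega> \<theta> \<mu>" and r: "0 < r" "r < 1"
  shows "(\<lambda>\<zeta>. f (weighted_dilation k r \<zeta>)) \<in> H2_theta \<Omega> \<theta> \<mu>"
proof -
  have h: "holo f (\<theta> ` \<Omega>)" "lift_J \<theta> f \<in> H2 \<Omega> \<mu>" using f by (auto simp: H2_theta_def)
  have hd: "holo (\<lambda>\<zeta>. f (weighted_dilation k r \<zeta>)) (\<theta> ` \<Omega>)" using r by (intro dilation_holo h) auto
  have "lift_J \<theta> (\<lambda>\<zeta>. f (weighted_dilation k r \<zeta>)) \<in> H2 \<Omega> \<mu>"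
  proof (rule H2_I[OF lift_holo[OF hd]])
    fix s :: real assume s: "0 < s" "s < 1"
    have rs: "0 < r * s" "r * s < 1" using r s by (auto intro: mult_strict_mono[of r 1 s 1, simplified])
    have "dil_norm (lift_J \<theta> (\<lambda>\<zeta>. f (weighted_dilation k r \<zeta>))) s =
        (norm (inverse (complex_of_real r ^ deg_J)))\<^sup>2 * dil_norm (lift_J \<theta> f) (r * s)"
      unfolding dil_norm_def lift_dilation[OF r(1)] sq_norm_scale by (simp add: vector_smult_assoc)
    also have "\<dots> \<le> (norm (inverse (complex_of_real r ^ deg_J)))\<^sup>2 * (H2_norm \<mu> (lift_J \<theta> f))\<^sup>2"
      using rs by (intro mult_left_mono H2_dil_norm_le h) auto
    finally show "dil_norm (lift_J \<theta> (\<lambda>\<zeta>. f (weighted_dilation k r \<zeta>))) s \<le> \<dots>" .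
  qed
  thus ?thesis using hd by (simp add: H2_theta_def)
qed

text \<open>After lifting, the dilation moves from one radius to the other, from
  \<open>(r * s, s)\<close> to \<open>(s, r * s)\<close>, with the same product of radii; the
  factors \<open>r ^ deg_J\<close> coming from \<open>J\<close> agree on both sides.\<close>

lemma H2_theta_inner_dilation:
  assumes f: "f \<in> H2_theta \<Omega> \<theta> \<mu>" and g: "g \<in> H2_theta \<Omega> \<theta> \<mu>" and r: "0 < r" "r < 1"
  shows "H2_theta_inner \<theta> \<mu> (\<lambda>\<zeta>. f (weighted_dilation k r \<zeta>)) g = H2_theta_inner \<theta> \<mu> f (\<lambda>\<zeta>. g (weighted_dilation k r \<zeta>))"
proof -
  have eq: "dil_inner (\<lambda>\<zeta>. f (weighted_dilation k r \<zeta>)) g s = dil_inner f (\<lambda>\<zeta>. g (weighted_dilation k r \<zeta>)) s"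
    if s: "s \<in> {0<..<1}" for s
  proof -
    have rs: "0 < r * s" "r * s < 1" using r s by (auto intro: mult_strict_mono[of r 1 s 1, simplified])
    have "(\<integral>z. lift_J \<theta> f (of_real (r * s) *s z) * cnj (lift_J \<theta> g (of_real s *s z)) \<partial>\<mu>) =
       (\<integral>z. lift_J \<theta> f (of_real s *s z) * cnj (lift_J \<theta> g (of_real (r * s) *s z)) \<partial>\<mu>)"
    proof (rule dilated_inner_shift)
      show "holo (lift_J \<theta> f) \<Omega>" "holo (lift_J \<theta> g) \<Omega>" using f g by (auto simp: H2_theta_def H2_def)
      show "norm (complex_of_real (r * s)) < 1" "norm (complex_of_real (r * s)) < 1"
        unfolding norm_of_real using rs by simp_all
      show "norm (complex_of_real s) < 1" "norm (complex_of_real s) < 1" using s by auto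
    qed simp
    thus ?thesis unfolding dil_inner_def lift_dilation[OF r(1)]
      by (simp add: vector_smult_assoc mult.assoc mult.left_commute[of "lift_J \<theta> f _"])
  qed
  show ?thesis
  proof (rule tendsto_unique[OF trivial_limit_at_left_real])
    show "(dil_inner (\<lambda>\<zeta>. f (weighted_dilation k r \<zeta>)) g \<longlongrightarrow> H2_theta_inner \<theta> \<mu> (\<lambda>\<zeta>. f (weighted_dilation k r \<zeta>)) g) (at_left 1)"
      by (intro H2_theta_inner_tendsto H2_theta_dilation f g r)
    have "(dil_inner f (\<lambda>\<zeta>. g (weighted_dilation k r \<zeta>)) \<longlongrightarrow> H2_theta_inner \<theta> \<mu> f (\<lambda>\<zeta>. g (weighted_dilation k r \<zeta>))) (at_left 1)"
      by (intro H2_theta_inner_tendsto H2_theta_dilation f g r)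
    thus "(dil_inner (\<lambda>\<zeta>. f (weighted_dilation k r \<zeta>)) g \<longlongrightarrow> H2_theta_inner \<theta> \<mu> f (\<lambda>\<zeta>. g (weighted_dilation k r \<zeta>))) (at_left 1)"
      by (rule Lim_transform_eventually) (rule eventually_at_leftI[of 0], use eq in auto)
  qed
qed

text \<open>Members of \<open>H2_theta\<close> are determined on the open image only, so the
  boundary integral uses the continuous extensions \<open>f'\<close> and \<open>g'\<close>; bounded
  convergence carries the integrals over dilates to it.\<close>

lemma H2_theta_inner_continuous:
  assumes f: "f \<in> H2_theta \<Omega> \<theta> \<mu>" and g: "g \<in> H2_theta \<Omega> \<theta> \<mu>"
    and c: "continuous_on (\<theta> ` closure \<Omega>) f'" "continuous_on (\<theta> ` closure \<Omega>) g'"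
    and eq: "\<And>\<zeta>. \<zeta> \<in> \<theta> ` \<Omega> \<Longrightarrow> f' \<zeta> = f \<zeta>" "\<And>\<zeta>. \<zeta> \<in> \<theta> ` \<Omega> \<Longrightarrow> g' \<zeta> = g \<zeta>"
  shows "H2_theta_inner \<theta> \<mu> f g = (\<integral>\<zeta>. f' \<zeta> * cnj (g' \<zeta>) \<partial>M)"
proof -
  define \<Phi> where "\<Phi> z = lift_J \<theta> f' z * cnj (lift_J \<theta> g' z)" for z
  have \<Phi>c: "continuous_on (closure \<Omega>) \<Phi>"
    unfolding \<Phi>_def by (intro continuous_on_mult continuous_on_cnj lift_continuous c)
  obtain B where B: "\<And>z. z \<in> closure \<Omega> \<Longrightarrow> norm (\<Phi> z) \<le> B" using bounded_on_closure[OF \<Phi>c] by blast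
  have mem: "complex_of_real (rr j) *s z \<in> \<Omega>" if "z \<in> closure \<Omega>" for j z
    by (rule scaled_closure_mem[OF norm_of_rr that])
  have "(\<lambda>j. \<integral>z. \<Phi> (of_real (rr j) *s z) \<partial>\<mu>) \<longlonglongrightarrow> (\<integral>z. \<Phi> z \<partial>\<mu>)"
  proof (rule bounded_convergence[where B = B])
    show "continuous_on (closure \<Omega>) (\<lambda>z. \<Phi> (of_real (rr j) *s z))" for j
      by (rule continuous_on_compose2[OF \<Phi>c]) (use mem closure_subset in \<open>auto intro!: continuous_intros\<close>)
    show "norm (\<Phi> (of_real (rr j) *s z)) \<le> B" if "z \<in> closure \<Omega>" for j z
      using B mem[OF that] closure_subset by blast
  qed (use \<Phi>c radial_sequence in auto)
  moreover have "(\<integral>z. \<Phi> (of_real (rr j) *s z) \<partial>\<mu>) = dil_inner f g (rr j) * of_real (c\<theta>\<^sup>2)" for j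
  proof -
    have "(\<integral>z. \<Phi> (of_real (rr j) *s z) \<partial>\<mu>) =
      (\<integral>z. lift_J \<theta> f (of_real (rr j) *s z) * cnj (lift_J \<theta> g (of_real (rr j) *s z)) \<partial>\<mu>)"
      by (intro Bochner_Integration.integral_cong refl) (use mem space_mu_closure eq in \<open>auto simp: \<Phi>_def lift_J_def\<close>)
    thus ?thesis using c_theta_sq_pos by (simp add: dil_inner_def)
  qed
  moreover have "(\<lambda>j. dil_inner f g (rr j) * of_real (c\<theta>\<^sup>2)) \<longlonglongrightarrow> H2_theta_inner \<theta> \<mu> f g * of_real (c\<theta>\<^sup>2)"
    by (intro tendsto_mult tendsto_const filterlim_compose[OF H2_theta_inner_tendsto[OF f g] rr_at_left])
  ultimately have "(\<integral>z. \<Phi> z \<partial>\<mu>) = H2_theta_inner \<theta> \<mu> f g * of_real (c\<theta>\<^sup>2)"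
    using LIMSEQ_unique by simp
  hence "H2_theta_inner \<theta> \<mu> f g = (\<integral>z. \<Phi> z / of_real (c\<theta>\<^sup>2) \<partial>\<mu>)" using c_theta_sq_pos by (simp add: field_simps)
  also have "\<dots> = (\<integral>z. weight z *\<^sub>R (f' (\<theta> z) * cnj (g' (\<theta> z))) \<partial>\<mu>)"
    by (simp add: \<Phi>_def lift_J_def weight_def scaleR_conv_of_real complex_norm_square mult_ac del: of_real_power)
  also have "\<dots> = (\<integral>\<zeta>. f' \<zeta> * cnj (g' \<zeta>) \<partial>M)"
    by (rule integral_M_continuous[symmetric]) (intro continuous_on_mult continuous_on_cnj c)
  finally show ?thesis .
qed

lemma H2_theta_continuous:
  assumes "holo f (\<theta> ` \<Omega>)" "continuous_on (\<theta> ` closure \<Omega>) f" shows "f \<in> H2_theta \<Omega> \<theta> \<mu>"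
proof -
  obtain B where B: "\<And>z. z \<in> closure \<Omega> \<Longrightarrow> norm (lift_J \<theta> f z) \<le> B"
    using bounded_on_closure[OF lift_continuous[OF assms(2)]] by blast
  have "lift_J \<theta> f \<in> H2 \<Omega> \<mu>"
  proof (rule H2_I[OF lift_holo[OF assms(1)]])
    fix r :: real assume r: "0 < r" "r < 1"
    have "dil_norm (lift_J \<theta> f) r \<le> (\<integral>z. B\<^sup>2 \<partial>\<mu>)" unfolding dil_norm_def sq_norm_def
    proof (rule integral_mono)
      show "integrable \<mu> (\<lambda>z. (norm (lift_J \<theta> f (of_real r *s z)))\<^sup>2)"
        using r by (intro mu.L2_integrable_sq dil_norm_L2 lift_holo assms) auto
      fix z assume "z \<in> space \<mu>"
      hence "of_real r *s z \<in> closure \<Omega>" using r by (intro scaled_closure_mem' space_mu_closure) auto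
      thus "(norm (lift_J \<theta> f (of_real r *s z)))\<^sup>2 \<le> B\<^sup>2" using B by (intro power_mono) auto
    qed simp
    thus "dil_norm (lift_J \<theta> f) r \<le> B\<^sup>2" by (simp add: mu.prob_space)
  qed
  thus ?thesis using assms(1) by (simp add: H2_theta_def)
qed

lemma H2_theta_boundary_continuous:
  assumes f: "f \<in> H2_theta \<Omega> \<theta> \<mu>" and c: "continuous_on (\<theta> ` closure \<Omega>) f'"
    and eq: "\<And>\<zeta>. \<zeta> \<in> \<theta> ` \<Omega> \<Longrightarrow> f' \<zeta> = f \<zeta>"
  shows "f' \<in> H2_theta_boundary \<Omega> \<theta> \<mu> M"
proof -
  have "((\<lambda>r. lift_J \<theta> f (r *\<^sub>R z)) \<longlongrightarrow> lift_J \<theta> f' z) (at_left 1)" if z: "z \<in> closure \<Omega>" for z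
  proof (rule Lim_transform_eventually[OF radial_tendsto[OF lift_continuous[OF c] z]])
    show "\<forall>\<^sub>F r in at_left 1. lift_J \<theta> f' (complex_of_real r *s z) = lift_J \<theta> f (r *\<^sub>R z)"
    proof (rule eventually_at_leftI[of 0])
      fix r :: real assume "r \<in> {0<..<1}"
      hence "complex_of_real r *s z \<in> \<Omega>" using z by (intro scaled_closure_mem) auto
      thus "lift_J \<theta> f' (complex_of_real r *s z) = lift_J \<theta> f (r *\<^sub>R z)"
        using eq by (simp add: lift_J_def of_real_vector_smult)
    qed simp
  qed
  hence "AE z in \<mu>. ((\<lambda>r. lift_J \<theta> f (r *\<^sub>R z)) \<longlongrightarrow> lift_J \<theta> f' z) (at_left 1)"
    by (intro AE_I2) (use space_mu_closure in blast)
  moreover have "lift_J \<theta> f \<in> H2 \<Omega> \<mu>" using f by (simp add: H2_theta_def)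
  ultimately have "lift_J \<theta> f' \<in> H2_boundary \<Omega> \<mu>" unfolding H2_boundary_def by blast
  thus ?thesis using L2_M[OF c] by (simp add: H2_theta_boundary_def)
qed

text \<open>The weight depends on the modulus of \<open>J\<close>, which homogeneity makes rotation
  invariant, so all homogeneous parts but the constant one integrate to 0.\<close>

lemma integral_M_mean_value:
  assumes f: "holo f (\<theta> ` \<Omega>)" "continuous_on (\<theta> ` closure \<Omega>) f"
  shows "(\<integral>\<zeta>. f \<zeta> \<partial>M) = f 0"
proof -
  define F where "F z = f (\<theta> z)" for z
  have F: "holo F \<Omega>" unfolding F_def by (rule theta_compose_holo[OF f(1)])
  have Fc: "continuous_on (closure \<Omega>) F" unfolding F_def by (rule theta_compose_continuous[OF f(2)])
  define W where "W z = complex_of_real (weight z)" for z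
  have Wc: "continuous_on X W" for X unfolding W_def by (intro continuous_on_of_real weight_continuous)
  have zero: "(\<integral>z. hom_part n F z * W z \<partial>\<mu>) = 0" if n: "n \<noteq> 0" for n
  proof -
    obtain c :: complex where c: "norm c = 1" "c ^ n * cnj c ^ 0 \<noteq> 1" using exists_rotation[OF n] by blast
    have Wi: "W (c *s z) = W z" for z using c(1) by (simp add: W_def weight_def J_homogeneous norm_mult norm_power)
    have "(\<integral>z. hom_part n F z * W z \<partial>\<mu>) = (\<integral>z. hom_part n F (c *s z) * W (c *s z) \<partial>\<mu>)"
      by (rule integral_mu_circle[OF c(1), symmetric]) (intro measurable_mu continuous_on_mult hom_part_continuous F Wc)
    also have "\<dots> = (\<integral>z. c ^ n * (hom_part n F z * W z) \<partial>\<mu>)" by (simp add: hom_part_scale[OF F] Wi mult_ac)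
    also have "\<dots> = c ^ n * (\<integral>z. hom_part n F z * W z \<partial>\<mu>)" by simp
    finally have "(1 - c ^ n) * (\<integral>z. hom_part n F z * W z \<partial>\<mu>) = 0" by (simp add: algebra_simps)
    thus ?thesis using c(2) by simp
  qed
  have "(\<integral>\<zeta>. 1 \<partial>M) = (\<integral>z. weight z *\<^sub>R (1::complex) \<partial>\<mu>)" by (rule integral_M) simp
  hence W1: "(\<integral>z. W z \<partial>\<mu>) = 1" by (simp add: th.prob_space W_def scaleR_conv_of_real)
  have "(\<integral>z. F (complex_of_real (rr j) *s z) * W z \<partial>\<mu>) = f 0" for j
  proof -
    have "(\<lambda>n. of_real (rr j) ^ n * (\<integral>z. hom_part n F z * W z \<partial>\<mu>)) sums (\<integral>z. F (complex_of_real (rr j) *s z) * W z \<partial>\<mu>)"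
      by (rule hom_part_integral_sums[OF F norm_of_rr Wc])
    moreover have "(\<lambda>n. of_real (rr j) ^ n * (\<integral>z. hom_part n F z * W z \<partial>\<mu>)) sums
       (\<Sum>n\<in>{0}. of_real (rr j) ^ n * (\<integral>z. hom_part n F z * W z \<partial>\<mu>))"
      by (rule sums_finite) (use zero in auto)
    ultimately have "(\<integral>z. F (complex_of_real (rr j) *s z) * W z \<partial>\<mu>) = (\<integral>z. hom_part 0 F z * W z \<partial>\<mu>)"
      using sums_unique2 by fastforce
    also have "\<dots> = f 0" using W1 by (simp add: hom_part_def F_def theta_0)
    finally show ?thesis .
  qed
  moreover obtain B where B: "\<And>z. z \<in> closure \<Omega> \<Longrightarrow> norm (F z) \<le> B" using bounded_on_closure[OF Fc] by blast
  moreover obtain C where C: "\<And>z. z \<in> closure \<Omega> \<Longrightarrow> norm (W z) \<le> C" using bounded_on_closure[OF Wc] by blast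
  have "(\<lambda>j. \<integral>z. F (complex_of_real (rr j) *s z) * W z \<partial>\<mu>) \<longlonglongrightarrow> (\<integral>z. F z * W z \<partial>\<mu>)"
  proof (rule bounded_convergence[where B = "B * C"])
    show "continuous_on (closure \<Omega>) (\<lambda>z. F (complex_of_real (rr j) *s z) * W z)" for j
      by (intro continuous_on_mult continuous_dilation F norm_of_rr Wc)
    show "continuous_on (closure \<Omega>) (\<lambda>z. F z * W z)" by (intro continuous_on_mult Fc Wc)
    show "norm (F (complex_of_real (rr j) *s z) * W z) \<le> B * C" if z: "z \<in> closure \<Omega>" for j z
    proof -
      have "complex_of_real (rr j) *s z \<in> closure \<Omega>" using scaled_closure_mem[OF norm_of_rr z] closure_subset by blast
      thus ?thesis unfolding norm_mult using B C z by (intro mult_mono) (auto intro: order.trans[OF norm_ge_zero B])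
    qed
    show "(\<lambda>j. F (complex_of_real (rr j) *s z) * W z) \<longlonglongrightarrow> F z * W z" if "z \<in> closure \<Omega>" for z
      by (intro tendsto_mult tendsto_const radial_sequence Fc that)
  qed
  ultimately have "(\<integral>z. F z * W z \<partial>\<mu>) = f 0" by (simp add: LIMSEQ_const_iff)
  moreover have "(\<integral>\<zeta>. f \<zeta> \<partial>M) = (\<integral>z. F z * W z \<partial>\<mu>)"
    unfolding integral_M_continuous[OF f(2)] by (simp add: F_def W_def scaleR_conv_of_real mult.commute)
  ultimately show ?thesis by simp
qed

text \<open>Dilates form an L2 Cauchy sequence, Fatou's lemma bounds their distance to the radial
  limit \<open>f\<close>, and a dilate is uniformly close to a Taylor polynomial. Two errors of
  \<open>e / 8\<close>, each doubled, add up to \<open>e / 2\<close>.\<close>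

lemma H2_boundary_approximation:
  assumes F: "F \<in> H2 \<Omega> \<mu>" and lim: "AE z in \<mu>. ((\<lambda>r::real. F (r *\<^sub>R z)) \<longlongrightarrow> f z) (at_left 1)"
    and f: "f \<in> L2 \<mu>" and e: "e > 0"
  shows "\<exists>Q. polynomial_fun Q \<and> sq_norm \<mu> (\<lambda>z. Q z - f z) < e"
proof -
  define Fr where "Fr j z = F (complex_of_real (rr j) *s z)" for j z
  have hF: "holo F \<Omega>" by (rule H2_holo[OF F])
  have FrL: "Fr j \<in> L2 \<mu>" for j
    unfolding Fr_def using rr_pos[of j] rr_less[of j] by (intro dil_norm_L2 hF) auto
  have cauchy: "\<exists>N. \<forall>i\<ge>N. \<forall>j\<ge>N. sq_norm \<mu> (\<lambda>x. Fr i x - Fr j x) < d" if d: "d > 0" for d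
  proof -
    define L where "L = (H2_norm \<mu> F)\<^sup>2"
    have dl: "(dil_norm F \<longlongrightarrow> L) (at_left 1)" unfolding L_def by (rule H2_norm_tendsto[OF F])
    have "\<forall>\<^sub>F r in at_left 1. dil_norm F r > L - d / 4" using order_tendstoD(1)[OF dl, of "L - d / 4"] d by simp
    then obtain b where b: "b < 1" "\<And>r. b < r \<Longrightarrow> r < 1 \<Longrightarrow> dil_norm F r > L - d / 4"
      unfolding eventually_at_left[of 0 "1::real", OF zero_less_one] by blast
    define b' where "b' = max b 0"
    have b': "0 \<le> b'" "b' < 1" using b(1) by (auto simp: b'_def)
    have "\<forall>\<^sub>F j in sequentially. rr j > sqrt ((1 + b'\<^sup>2) / 2)"
    proof (rule order_tendstoD(1)[OF rr_tendsto])
      have "b'\<^sup>2 < 1" using b' by (simp add: power_less_one_iff abs_square_less_1)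
      thus "sqrt ((1 + b'\<^sup>2) / 2) < 1" by simp
    qed
    then obtain N where N: "\<And>j. j \<ge> N \<Longrightarrow> rr j > sqrt ((1 + b'\<^sup>2) / 2)" unfolding eventually_sequentially by blast
    have "sq_norm \<mu> (\<lambda>x. Fr i x - Fr j x) < d" if ij: "i \<ge> N" "j \<ge> N" for i j
    proof -
      \<comment> \<open>At the geometric mean the product of radii is unchanged, so the inner
        product of two dilates equals the squared norm of the dilate at \<open>s\<close>. The
        squared norms at \<open>rr i\<close> and \<open>rr j\<close> are at most \<open>L\<close>,
        the one at \<open>s\<close> exceeds \<open>L - d / 4\<close>.\<close>
      define s where "s = sqrt (rr i * rr j)"
      have b2: "b'\<^sup>2 < 1" using b' by (simp add: power_less_one_iff abs_square_less_1)
      have rr2: "b' < rr i" if "i \<ge> N" for i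
      proof -
        have "b' = sqrt (b'\<^sup>2)" using b' by simp
        also have "\<dots> < sqrt ((1 + b'\<^sup>2) / 2)" using b2 by (intro real_sqrt_less_mono) simp
        finally show ?thesis using N[OF that] by simp
      qed
      have s: "b' < s" "s < 1" "0 < s"
      proof -
        have "b'\<^sup>2 < rr i * rr j" unfolding power2_eq_square using rr2[OF ij(1)] rr2[OF ij(2)] b' by (intro mult_strict_mono') auto
        hence "sqrt (b'\<^sup>2) < s" unfolding s_def by (rule real_sqrt_less_mono)
        thus "b' < s" using b' by simp
        have "rr i * rr j < 1 * 1" using rr_less rr_pos by (intro mult_strict_mono') (auto intro: less_imp_le)
        thus "s < 1" unfolding s_def by simp
        show "0 < s" unfolding s_def using rr_pos by simp
      qed
      have ss: "s * s = rr i * rr j" unfolding s_def using rr_pos[of i] rr_pos[of j] by simp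
      have "(\<integral>z. Fr i z * cnj (Fr j z) \<partial>\<mu>) = (\<integral>z. F (of_real s *s z) * cnj (F (of_real s *s z)) \<partial>\<mu>)"
        unfolding Fr_def
        by (rule dilated_inner_shift[OF hF hF norm_of_rr norm_of_rr])
          (use s ss in \<open>simp_all flip: of_real_mult\<close>)
      also have "\<dots> = of_real (dil_norm F s)" by (simp add: mu.inner_self dil_norm_def)
      finally have "sq_norm \<mu> (\<lambda>x. Fr i x - Fr j x) = dil_norm F (rr i) + dil_norm F (rr j) - 2 * dil_norm F s"
        using mu.sq_norm_diff[OF FrL FrL, of i j] by (simp add: dil_norm_def Fr_def[abs_def])
      moreover have "dil_norm F (rr i) \<le> L" "dil_norm F (rr j) \<le> L"
        unfolding L_def by (intro H2_dil_norm_le F rr_pos rr_less)+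
      moreover have "dil_norm F s > L - d / 4" using b(2) s by (simp add: b'_def)
      ultimately show ?thesis using d by simp
    qed
    thus ?thesis by blast
  qed
  obtain N where N: "\<And>i j. i \<ge> N \<Longrightarrow> j \<ge> N \<Longrightarrow> sq_norm \<mu> (\<lambda>x. Fr i x - Fr j x) < e / 8" using cauchy[of "e / 8"] e by auto
  have "sq_norm \<mu> (\<lambda>x. Fr N x - f x) \<le> e / 8"
  proof (rule mu.L2_fatou(2))
    show "(\<lambda>x. Fr N x - Fr (j + N) x) \<in> L2 \<mu>" for j by (rule mu.L2_diff[OF FrL FrL])
    show "(\<lambda>x. Fr N x - f x) \<in> borel_measurable \<mu>" using mu.L2_measurable[OF mu.L2_diff[OF FrL f]] .
    show "AE x in \<mu>. (\<lambda>j. Fr N x - Fr (j + N) x) \<longlonglongrightarrow> Fr N x - f x"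
      using lim
    proof eventually_elim
      case (elim x)
      have "(\<lambda>j. Fr j x) \<longlonglongrightarrow> f x"
        using filterlim_compose[OF elim rr_at_left] by (simp add: Fr_def of_real_vector_smult)
      thus ?case by (intro tendsto_diff tendsto_const LIMSEQ_ignore_initial_segment)
    qed
    show "sq_norm \<mu> (\<lambda>x. Fr N x - Fr (j + N) x) \<le> e / 8" for j using N[of N "j + N"] by simp
  qed
  moreover obtain n where n: "\<And>z. z \<in> closure \<Omega> \<Longrightarrow>
      norm (F (of_real (rr N) *s z) - (\<Sum>i<n. hom_part i F z * of_real (rr N) ^ i)) \<le> sqrt (e / 8)"
    using dilation_approximation[OF hF less_imp_le[OF rr_pos] rr_less, of "sqrt (e / 8)" N] e by auto
  define Q where "Q z = (\<Sum>i<n. hom_part i F z * of_real (rr N) ^ i)" for z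
  have Q: "polynomial_fun Q" unfolding Q_def
    by (intro polynomial_fun_sum polynomial_fun_mult polynomial_fun_const polynomial_fun_hom_part hF)
  have QL: "Q \<in> L2 \<mu>" by (intro L2_mu polynomial_fun_continuous_on Q)
  have "sq_norm \<mu> (\<lambda>z. Q z - Fr N z) \<le> (\<integral>z. e / 8 \<partial>\<mu>)" unfolding sq_norm_def
  proof (rule integral_mono)
    show "integrable \<mu> (\<lambda>z. (norm (Q z - Fr N z))\<^sup>2)" by (rule mu.L2_integrable_sq[OF mu.L2_diff[OF QL FrL]])
    fix z assume "z \<in> space \<mu>"
    hence "norm (Q z - Fr N z) \<le> sqrt (e / 8)"
      using n[OF space_mu_closure] by (simp add: Q_def Fr_def norm_minus_commute)
    hence "(norm (Q z - Fr N z))\<^sup>2 \<le> (sqrt (e / 8))\<^sup>2" by (intro power_mono) auto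
    thus "(norm (Q z - Fr N z))\<^sup>2 \<le> e / 8" using e by simp
  qed simp
  hence "sq_norm \<mu> (\<lambda>z. Q z - Fr N z) \<le> e / 8" by (simp add: mu.prob_space)
  moreover have "sq_norm \<mu> (\<lambda>z. (Q z - Fr N z) + (Fr N z - f z)) \<le> 2 * sq_norm \<mu> (\<lambda>z. Q z - Fr N z) + 2 * sq_norm \<mu> (\<lambda>z. Fr N z - f z)"
    by (rule mu.sq_norm_add_le[OF mu.L2_diff[OF QL FrL] mu.L2_diff[OF FrL f]])
  ultimately have "sq_norm \<mu> (\<lambda>z. Q z - f z) < e" using e by simp
  thus ?thesis using Q by blast
qed

end

lemma (in prob_space) sq_norm_triangle_sum:
  assumes "finite I" "\<And>i. i \<in> I \<Longrightarrow> f i \<in> L2 M"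
  shows "sqrt (sq_norm M (\<lambda>x. \<Sum>i\<in>I. f i x)) \<le> (\<Sum>i\<in>I. sqrt (sq_norm M (f i)))"
  using assms
proof (induction I rule: finite_induct)
  case empty
  show ?case by (simp add: sq_norm_def)
next
  case (insert a I)
  have L: "f a \<in> L2 M" "(\<lambda>x. \<Sum>i\<in>I. f i x) \<in> L2 M" using insert.prems by (auto intro: L2_sum)
  have "sqrt (sq_norm M (\<lambda>x. f a x + (\<Sum>i\<in>I. f i x))) \<le> sqrt (sq_norm M (f a)) + sqrt (sq_norm M (\<lambda>x. \<Sum>i\<in>I. f i x))"
    by (rule sq_norm_triangle[OF L])
  thus ?case using insert by simp
qed

section \<open>Density of polynomials on the boundary of the image and its consequences\<close>

context hardy_setting
begin

lemma L2_M_extension: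
  fixes h :: "complex^'n \<Rightarrow> complex"
  assumes h: "h \<in> L2 M"
  defines "h' \<equiv> \<lambda>\<zeta>. indicator (space M) \<zeta> *\<^sub>R h \<zeta>"
  shows "h' \<in> borel_measurable borel" "h' \<in> L2 M"
proof -
  have c: "shilov_boundary (\<theta> ` \<Omega>) \<inter> space borel \<in> sets borel" by (simp add: borel_closed closed_shilov_boundary)
  have hm: "h \<in> borel_measurable M" by (rule th.L2_measurable[OF h])
  hence "h \<in> borel_measurable (restrict_space borel (shilov_boundary (\<theta> ` \<Omega>)))"
    by (simp cong: measurable_cong_sets add: sets_M)
  thus b: "h' \<in> borel_measurable borel"
    unfolding h'_def borel_measurable_restrict_space_iff[OF c] space_M .
  have "h' \<in> borel_measurable M \<longleftrightarrow> h \<in> borel_measurable M" by (rule measurable_cong) (simp add: h'_def)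
  moreover have "integrable M (\<lambda>x. (norm (h' x))\<^sup>2) \<longleftrightarrow> integrable M (\<lambda>x. (norm (h x))\<^sup>2)"
    by (rule Bochner_Integration.integrable_cong) (simp_all add: h'_def)
  ultimately show "h' \<in> L2 M" using h by (simp add: L2_def)
qed

text \<open>The functions \<open>J\<close> and \<open>J\<close> composed with \<open>g\<close> have
  equal L2 norms by invariance of \<mu>, and they differ by the factor \<open>det g\<close>.\<close>

lemma norm_det: assumes "g \<in> G" shows "norm (det g) = 1"
proof -
  have "c\<theta>\<^sup>2 = (\<integral>z. (norm (J (g *v z) * det g))\<^sup>2 \<partial>\<mu>)"
    by (simp add: J_skew[OF assms] sq_norm_def flip: J_sq_norm_eq)
  also have "\<dots> = (norm (det g))\<^sup>2 * (\<integral>z. (norm (J (g *v z)))\<^sup>2 \<partial>\<mu>)"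
    by (simp add: norm_mult power_mult_distrib mult.commute)
  also have "(\<integral>z. (norm (J (g *v z)))\<^sup>2 \<partial>\<mu>) = c\<theta>\<^sup>2"
    unfolding J_sq_norm_eq[symmetric] sq_norm_def
    by (rule integral_mu_group[OF assms]) (intro borel_measurable_power measurable_mu continuous_on_norm J_continuous)
  finally have "(norm (det g))\<^sup>2 = 1" using c_theta_sq_pos by simp
  thus ?thesis by (simp add: power2_eq_1_iff) (metis norm_ge_zero not_one_le_zero neg_0_le_iff_le)
qed

text \<open>Approximate the lift by a polynomial, average it over the group into a relative invariant, and divide by
  the Jacobian.\<close>

lemma H2_theta_boundary_approximation:
  assumes h: "h \<in> H2_theta_boundary \<Omega> \<theta> \<mu> M" and e: "e > 0"
  shows "\<exists>P. polynomial_fun P \<and> sq_norm M (\<lambda>x. P x - h x) < e"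
proof -
  define h' where "h' = (\<lambda>\<zeta>. indicator (space M) \<zeta> *\<^sub>R h \<zeta>)"
  define f where "f = lift_J \<theta> h'"
  have hL: "h \<in> L2 M" using h by (simp add: H2_theta_boundary_def)
  have h': "h' \<in> borel_measurable borel" "h' \<in> L2 M" unfolding h'_def by (rule L2_M_extension[OF hL])+
  have fL: "f \<in> L2 \<mu>" unfolding f_def by (rule L2_lift[OF h'])
  have "lift_J \<theta> h \<in> H2_boundary \<Omega> \<mu>" using h by (simp add: H2_theta_boundary_def)
  then obtain F where F: "F \<in> H2 \<Omega> \<mu>" "AE z in \<mu>. ((\<lambda>r. F (r *\<^sub>R z)) \<longlongrightarrow> lift_J \<theta> h z) (at_left 1)"
    unfolding H2_boundary_def by blast
  have lim: "AE z in \<mu>. ((\<lambda>r. F (r *\<^sub>R z)) \<longlongrightarrow> f z) (at_left 1)"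
    using F(2) AE_theta_mem
  proof eventually_elim
    case (elim z)
    \<comment> \<open>The cutoff could only matter where \<open>\<theta> z\<close> leaves the
      boundary of the image; almost everywhere this happens only at zeros of \<open>J\<close>, where
      both lifts vanish.\<close>
    have "f z = lift_J \<theta> h z" using elim(2) by (cases "J z = 0") (auto simp: f_def h'_def lift_J_def)
    thus ?case using elim(1) by simp
  qed
  \<comment> \<open>A lift is already relatively invariant, so averaging leaves it fixed and only
    moves the approximating polynomial.\<close>
  have f_skew: "f (g *v z) * det g = f z" if "g \<in> G" for g z
    unfolding f_def lift_J_def theta_invariant[OF that] J_skew[OF that, of z, symmetric] by (simp add: mult_ac)
  have "e * c\<theta>\<^sup>2 > 0" using e c_theta_sq_pos by simp
  from H2_boundary_approximation[OF F(1) lim fL this]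
  obtain Q where Q: "polynomial_fun Q" "sq_norm \<mu> (\<lambda>z. Q z - f z) < e * c\<theta>\<^sup>2" by blast
  define n where "n = complex_of_nat (card G)"
  have n0: "card G > 0" using finite_G one_mem by (auto simp: card_gt_0_iff)
  define Q' where "Q' z = (\<Sum>g\<in>G. Q (g *v z) * det g) / n" for z
  have Q'p: "polynomial_fun Q'"
    unfolding Q'_def divide_inverse
    by (intro polynomial_fun_mult polynomial_fun_sum polynomial_fun_const polynomial_fun_linear_compose Q(1))
  have Q's: "Q' (h *v z) * det h = Q' z" if "h \<in> G" for h z
    using sum_group_right[OF that, of "\<lambda>g. Q (g *v z) * det g"]
    by (simp add: Q'_def sum_distrib_right matrix_vector_mul_assoc det_mul mult.assoc)
  from skew_factor[OF Q'p Q's] obtain P where P: "polynomial_fun P" "\<And>z. Q' z = J z * P (\<theta> z)" by blast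
  have QL: "(\<lambda>z. Q z - f z) \<in> L2 \<mu>"
    by (rule mu.L2_diff[OF L2_mu[OF polynomial_fun_continuous_on[OF Q(1)]] fL])
  define D where "D g z = (det g / n) * (Q (g *v z) - f (g *v z))" for g z
  have sqD: "sq_norm \<mu> (D g) = sq_norm \<mu> (\<lambda>z. Q z - f z) / (card G)\<^sup>2" if g: "g \<in> G" for g
  proof -
    have "sq_norm \<mu> (\<lambda>z. Q (g *v z) - f (g *v z)) = sq_norm \<mu> (\<lambda>z. Q z - f z)"
      unfolding sq_norm_def
      by (rule integral_mu_group[OF g]) (intro borel_measurable_power measurable_compose[OF mu.L2_measurable[OF QL] borel_measurable_norm])
    moreover have "(norm (det g / n))\<^sup>2 = 1 / (card G)\<^sup>2" by (simp add: norm_divide norm_det[OF g] n_def power_divide)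
    ultimately show ?thesis unfolding D_def[abs_def] sq_norm_scale by simp
  qed
  have DL: "D g \<in> L2 \<mu>" if g: "g \<in> G" for g
  proof -
    have "(\<lambda>z. Q (g *v z) - f (g *v z)) \<in> borel_measurable \<mu>"
      using measurable_compose[OF measurable_mu_group[OF g] mu.L2_measurable[OF QL]] .
    moreover have "integrable \<mu> (\<lambda>z. (norm (Q (g *v z) - f (g *v z)))\<^sup>2)"
    proof -
      have m: "(\<lambda>z. (norm (Q z - f z))\<^sup>2) \<in> borel_measurable \<mu>"
        by (intro borel_measurable_power measurable_compose[OF mu.L2_measurable[OF QL] borel_measurable_norm])
      obtain h where h: "h \<in> G" "g ** h = mat 1" "h ** g = mat 1" using inverse_mem[OF g] by blast
      have sub: "(*v) g ` \<Omega> \<subseteq> \<Omega>" "(*v) h ` \<Omega> \<subseteq> \<Omega>" using domain_invariant g h(1) by auto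
      have "integrable (distr \<mu> \<mu> ((*v) g)) (\<lambda>z. (norm (Q z - f z))\<^sup>2)"
        unfolding distr_mu_matrix(2)[OF h(2,3) sub] by (rule mu.L2_integrable_sq[OF QL])
      thus ?thesis unfolding integrable_distr_eq[OF measurable_mu_group[OF g] m] .
    qed
    ultimately have "(\<lambda>z. Q (g *v z) - f (g *v z)) \<in> L2 \<mu>" by (simp add: L2_def)
    thus ?thesis unfolding D_def by (rule mu.L2_scale)
  qed
  have "Q' z - f z = (\<Sum>g\<in>G. D g z)" for z
  proof -
    have "(\<Sum>g\<in>G. f (g *v z) * det g) = n * f z" by (simp add: f_skew n_def)
    hence "f z = (\<Sum>g\<in>G. f (g *v z) * det g) / n" using n0 by (simp add: n_def)
    hence "Q' z - f z = (\<Sum>g\<in>G. Q (g *v z) * det g - f (g *v z) * det g) / n"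
      by (simp add: Q'_def sum_subtractf diff_divide_distrib)
    also have "\<dots> = (\<Sum>g\<in>G. D g z)" unfolding sum_divide_distrib D_def
      by (intro sum.cong refl) (simp add: diff_divide_distrib right_diff_distrib mult.commute)
    finally show ?thesis .
  qed
  hence eq: "sq_norm \<mu> (\<lambda>z. Q' z - f z) = sq_norm \<mu> (\<lambda>z. \<Sum>g\<in>G. D g z)" by simp
  \<comment> \<open>The error is an average of rotated copies of the original error, each of the
    same norm because the determinants are unimodular.\<close>
  have "sqrt (sq_norm \<mu> (\<lambda>z. \<Sum>g\<in>G. D g z)) \<le> (\<Sum>g\<in>G. sqrt (sq_norm \<mu> (D g)))"
    by (rule mu.sq_norm_triangle_sum[OF finite_G DL])
  also have "\<dots> = (\<Sum>g\<in>G. sqrt (sq_norm \<mu> (\<lambda>z. Q z - f z)) / card G)"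
    by (intro sum.cong refl) (simp add: sqD real_sqrt_divide)
  also have "\<dots> = sqrt (sq_norm \<mu> (\<lambda>z. Q z - f z))" using n0 by simp
  finally have "sq_norm \<mu> (\<lambda>z. Q' z - f z) \<le> sq_norm \<mu> (\<lambda>z. Q z - f z)" unfolding eq by simp
  hence lt: "sq_norm \<mu> (\<lambda>z. Q' z - f z) < e * c\<theta>\<^sup>2" using Q(2) by simp
  have "sq_norm M (\<lambda>x. P x - h x) = sq_norm M (\<lambda>x. P x - h' x)"
    unfolding sq_norm_def by (rule Bochner_Integration.integral_cong) (simp_all add: h'_def)
  also have "\<dots> = sq_norm \<mu> (lift_J \<theta> (\<lambda>x. P x - h' x)) / c\<theta>\<^sup>2"
    by (rule sq_norm_lift) (intro borel_measurable_diff h' borel_measurable_continuous_onI polynomial_fun_continuous_on P(1))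
  also have "lift_J \<theta> (\<lambda>x. P x - h' x) = (\<lambda>z. Q' z - f z)"
    by (simp add: fun_eq_iff lift_J_def P(2) f_def algebra_simps)
  also have "sq_norm \<mu> \<dots> / c\<theta>\<^sup>2 < e" using lt c_theta_sq_pos by (simp add: field_simps)
  finally show ?thesis using P(1) by blast
qed

lemma H2_theta_boundary_sequence:
  assumes "h \<in> H2_theta_boundary \<Omega> \<theta> \<mu> M"
  shows "\<exists>p. (\<forall>j::nat. polynomial_fun (p j)) \<and> (\<lambda>j. sq_norm M (\<lambda>x. p j x - h x)) \<longlonglongrightarrow> 0"
proof -
  have "\<forall>j. \<exists>P. polynomial_fun P \<and> sq_norm M (\<lambda>x. P x - h x) < inverse (real (Suc j))"
    using H2_theta_boundary_approximation[OF assms] by simp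
  then obtain p where p: "\<And>j. polynomial_fun (p j)" "\<And>j. sq_norm M (\<lambda>x. p j x - h x) < inverse (real (Suc j))" by metis
  have "(\<lambda>j. sq_norm M (\<lambda>x. p j x - h x)) \<longlonglongrightarrow> 0"
  proof (rule LIMSEQ_norm_le[OF _ LIMSEQ_inverse_real_of_nat])
    show "norm (sq_norm M (\<lambda>x. p j x - h x)) \<le> inverse (real (Suc j))" for j using less_imp_le[OF p(2)] by simp
  qed
  thus ?thesis using p(1) by blast
qed

lemma polynomial_fun_L2_M: "polynomial_fun P \<Longrightarrow> P \<in> L2 M"
  by (intro L2_M polynomial_fun_continuous_on)

lemma integral_M_polynomial: "polynomial_fun P \<Longrightarrow> (\<integral>\<zeta>. P \<zeta> \<partial>M) = P 0"
  by (intro integral_M_mean_value polynomial_fun_holo polynomial_fun_continuous_on)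

lemma polynomial_fun_H2_theta_boundary: "polynomial_fun P \<Longrightarrow> P \<in> H2_theta_boundary \<Omega> \<theta> \<mu> M"
  by (rule H2_theta_boundary_continuous[OF H2_theta_continuous]) (auto intro: polynomial_fun_holo polynomial_fun_continuous_on)

lemma H2_theta_boundary_L2: "h \<in> H2_theta_boundary \<Omega> \<theta> \<mu> M \<Longrightarrow> h \<in> L2 M"
  by (simp add: H2_theta_boundary_def)

lemma integral_polynomial_mult:
  assumes P: "polynomial_fun P" and h: "h \<in> H2_theta_boundary \<Omega> \<theta> \<mu> M"
  shows "(\<integral>x. P x * h x \<partial>M) = P 0 * (\<integral>x. h x \<partial>M)"
proof -
  obtain p where p: "\<And>j::nat. polynomial_fun (p j)" "(\<lambda>j. sq_norm M (\<lambda>x. p j x - h x)) \<longlonglongrightarrow> 0"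
    using H2_theta_boundary_sequence[OF h] by blast
  have "(\<lambda>j. \<integral>x. p j x * P x \<partial>M) \<longlonglongrightarrow> (\<integral>x. h x * P x \<partial>M)"
    by (rule th.tendsto_integral_mult[OF polynomial_fun_L2_M[OF p(1)] H2_theta_boundary_L2[OF h] polynomial_fun_L2_M[OF P] p(2)])
  moreover have "(\<integral>x. p j x * P x \<partial>M) = (\<integral>x. p j x * P 0 \<partial>M)" for j
    using integral_M_polynomial[OF polynomial_fun_mult[OF p(1) P]] integral_M_polynomial[OF p(1)] by simp
  moreover have "(\<lambda>j. \<integral>x. p j x * P 0 \<partial>M) \<longlonglongrightarrow> (\<integral>x. h x * P 0 \<partial>M)"
    by (rule th.tendsto_integral_mult[OF polynomial_fun_L2_M[OF p(1)] H2_theta_boundary_L2[OF h] th.L2_const p(2)])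
  ultimately have "(\<integral>x. h x * P x \<partial>M) = (\<integral>x. h x * P 0 \<partial>M)" by (simp add: LIMSEQ_unique)
  thus ?thesis by (simp add: mult.commute)
qed

text \<open>For polynomials integration is evaluation at 0, hence multiplicative. The two factors
  are approximated one after the other, since a product of two L2 limits has no direct approximation
  in L2.\<close>

lemma integral_H2_theta_boundary_mult:
  assumes h1: "h1 \<in> H2_theta_boundary \<Omega> \<theta> \<mu> M" and h2: "h2 \<in> H2_theta_boundary \<Omega> \<theta> \<mu> M"
  shows "(\<integral>x. h1 x * h2 x \<partial>M) = (\<integral>x. h1 x \<partial>M) * (\<integral>x. h2 x \<partial>M)"
proof -
  define I where "I = (\<integral>x. h2 x \<partial>M)"
  obtain p where p: "\<And>j::nat. polynomial_fun (p j)" "(\<lambda>j. sq_norm M (\<lambda>x. p j x - h1 x)) \<longlonglongrightarrow> 0"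
    using H2_theta_boundary_sequence[OF h1] by blast
  note t = th.tendsto_integral_mult[OF polynomial_fun_L2_M[OF p(1)] H2_theta_boundary_L2[OF h1] _ p(2)]
  have "(\<lambda>j. \<integral>x. p j x * h2 x \<partial>M) \<longlonglongrightarrow> (\<integral>x. h1 x * h2 x \<partial>M)"
    by (rule t[OF H2_theta_boundary_L2[OF h2]])
  moreover have "(\<integral>x. p j x * h2 x \<partial>M) = (\<integral>x. p j x * I \<partial>M)" for j
    using integral_polynomial_mult[OF p(1) h2] integral_M_polynomial[OF p(1)] by (simp add: I_def)
  moreover have "(\<lambda>j. \<integral>x. p j x * I \<partial>M) \<longlonglongrightarrow> (\<integral>x. h1 x * I \<partial>M)" by (rule t[OF th.L2_const])
  ultimately have "(\<integral>x. h1 x * h2 x \<partial>M) = (\<integral>x. h1 x * I \<partial>M)" by (simp add: LIMSEQ_unique)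
  thus ?thesis by (simp add: I_def)
qed

text \<open>For these functions the boundary value is the plain restriction, so no radial limits or
  exceptional null sets intervene.\<close>

abbreviation regular :: "(complex^'n \<Rightarrow> complex) \<Rightarrow> bool" where
  "regular f \<equiv> holo f (\<theta> ` \<Omega>) \<and> continuous_on (\<theta> ` closure \<Omega>) f"

lemma regular_sum:
  assumes "\<And>i. i \<in> I \<Longrightarrow> regular (f i)" shows "regular (\<lambda>x. \<Sum>i\<in>I. a i * f i x)"
proof
  show "continuous_on (\<theta> ` closure \<Omega>) (\<lambda>x. \<Sum>i\<in>I. a i * f i x)"
    using assms by (intro continuous_on_sum continuous_on_mult continuous_on_const) auto
  show "holo (\<lambda>x. \<Sum>i\<in>I. a i * f i x) (\<theta> ` \<Omega>)" using assms
  proof (induction I rule: infinite_finite_induct)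
    case (insert i I)
    have "holo (\<lambda>x. a i * f i x + (\<Sum>i\<in>I. a i * f i x)) (\<theta> ` \<Omega>)"
      using insert by (intro holo_add holo_mult holo_const) auto
    thus ?case using insert by simp
  qed (simp_all add: holo_const)
qed

lemma polynomial_fun_regular: "polynomial_fun P \<Longrightarrow> regular P"
  by (simp add: polynomial_fun_holo polynomial_fun_continuous_on)

lemma regular_H2_theta: "regular f \<Longrightarrow> f \<in> H2_theta \<Omega> \<theta> \<mu>" by (simp add: H2_theta_continuous)

lemma regular_H2_theta_boundary: "regular f \<Longrightarrow> f \<in> H2_theta_boundary \<Omega> \<theta> \<mu> M"
  by (rule H2_theta_boundary_continuous[OF H2_theta_continuous]) auto

lemma regular_L2: "regular f \<Longrightarrow> f \<in> L2 M" by (simp add: L2_M)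

lemma scaled_preimage: assumes "z \<in> \<Omega>" obtains r y where "0 < r" "r < 1" "y \<in> \<Omega>" "z = complex_of_real r *s y"
proof -
  have "((\<lambda>t. complex_of_real t *s z) \<longlongrightarrow> complex_of_real 1 *s z) (at_right 1)"
    unfolding of_real_vector_smult by (intro tendsto_intros)
  hence "\<forall>\<^sub>F t in at_right 1. complex_of_real t *s z \<in> \<Omega>"
    using assms by (intro topological_tendstoD open_domain) auto
  then obtain b where b: "b > 1" "\<And>t. 1 < t \<Longrightarrow> t < b \<Longrightarrow> complex_of_real t *s z \<in> \<Omega>"
    unfolding eventually_at_right[of 1 "2::real", simplified] by blast
  define t where "t = (1 + b) / 2"
  have t: "1 < t" "t < b" using b(1) by (auto simp: t_def)
  have "z = complex_of_real (1 / t) *s (complex_of_real t *s z)" using t by (simp add: vector_smult_assoc)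
  thus ?thesis using that[of "1 / t" "complex_of_real t *s z"] t b(2)[OF t] by simp
qed

end

section \<open>Kernel functions up to the boundary\<close>

locale hardy_kernel = hardy_setting G \<theta> k \<Omega> \<mu> M
  for G :: "(complex^'n^'n) set" and \<theta> k \<Omega> \<mu> M +
  fixes S :: "complex^'n \<Rightarrow> complex^'n \<Rightarrow> complex"
  assumes kernel: "reproducing_kernel (\<theta> ` \<Omega>) (H2_theta \<Omega> \<theta> \<mu>) (H2_theta_inner \<theta> \<mu>) S"
begin

lemma kernel_mem: "w \<in> \<theta> ` \<Omega> \<Longrightarrow> (\<lambda>z. S z w) \<in> H2_theta \<Omega> \<theta> \<mu>"
  and kernel_reproduces: "w \<in> \<theta> ` \<Omega> \<Longrightarrow> f \<in> H2_theta \<Omega> \<theta> \<mu> \<Longrightarrow> H2_theta_inner \<theta> \<mu> f (\<lambda>z. S z w) = f w"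
  using kernel by (auto simp: reproducing_kernel_def)

text \<open>Dilations are self-adjoint, so \<open>S (\<cdot>, \<delta> w) = S (\<delta> \<cdot>, w)\<close>; hence every kernel function extends
  continuously to the closure.\<close>

lemma kernel_extension:
  assumes w: "w \<in> \<theta> ` \<Omega>"
  shows "\<exists>s. continuous_on (\<theta> ` closure \<Omega>) s \<and> (\<forall>v\<in>\<theta> ` \<Omega>. s v = S v w)"
proof -
  obtain z where z: "z \<in> \<Omega>" "w = \<theta> z" using w by blast
  obtain r y where r: "0 < r" "r < 1" and y: "y \<in> \<Omega>" "z = complex_of_real r *s y" using scaled_preimage[OF z(1)] by blast
  \<comment> \<open>Enlarging the preimage of \<open>w\<close> slightly leaves room for a genuine
    dilation, which carries the closed image into the open one, where \<open>S\<close> is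
    continuous.\<close>
  define w1 where "w1 = \<theta> y"
  have w1: "w1 \<in> \<theta> ` \<Omega>" "weighted_dilation k r w1 = w" using y z(2) by (auto simp: w1_def weighted_dilation_theta)
  have "continuous_on (\<theta> ` \<Omega>) (\<lambda>v. S v w1)"
    using kernel_mem[OF w1(1)] by (intro holo_continuous_on) (simp add: H2_theta_def)
  hence c: "continuous_on (\<theta> ` closure \<Omega>) (\<lambda>v. S (weighted_dilation k r v) w1)"
    by (rule continuous_on_compose2[OF _ weighted_dilation_continuous]) (use weighted_dilation_image r in auto)
  have "S (weighted_dilation k r v) w1 = S v w" if v: "v \<in> \<theta> ` \<Omega>" for v
  proof -
    note m = kernel_mem[OF v] kernel_mem[OF w] kernel_mem[OF w1(1)]
    have "S w v = H2_theta_inner \<theta> \<mu> (\<lambda>u. S (weighted_dilation k r u) v) (\<lambda>u. S u w1)"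
      using kernel_reproduces[OF w1(1) H2_theta_dilation[OF m(1) r]] w1(2) by simp
    also have "\<dots> = H2_theta_inner \<theta> \<mu> (\<lambda>u. S u v) (\<lambda>u. S (weighted_dilation k r u) w1)"
      by (rule H2_theta_inner_dilation[OF m(1) m(3) r])
    also have "\<dots> = cnj (H2_theta_inner \<theta> \<mu> (\<lambda>u. S (weighted_dilation k r u) w1) (\<lambda>u. S u v))"
      by (rule H2_theta_inner_cnj[OF H2_theta_dilation[OF m(3) r] m(1)])
    also have "\<dots> = cnj (S (weighted_dilation k r v) w1)"
      using kernel_reproduces[OF v H2_theta_dilation[OF m(3) r]] by simp
    finally have "S w v = cnj (S (weighted_dilation k r v) w1)" .
    moreover have "S w v = cnj (S v w)"
      using H2_theta_inner_cnj[OF m(2,1)] kernel_reproduces[OF v m(2)] kernel_reproduces[OF w m(1)] by simp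
    ultimately show ?thesis by simp
  qed
  thus ?thesis using c by blast
qed

text \<open>\<open>S\<close> is unconstrained off the open image, so its boundary values are carried
  by a separate, chosen extension.\<close>

definition boundary_kernel :: "complex^'n \<Rightarrow> complex^'n \<Rightarrow> complex" where
  "boundary_kernel w = (SOME s. continuous_on (\<theta> ` closure \<Omega>) s \<and> (\<forall>v\<in>\<theta> ` \<Omega>. s v = S v w))"

lemma boundary_kernel:
  assumes "w \<in> \<theta> ` \<Omega>"
  shows "continuous_on (\<theta> ` closure \<Omega>) (boundary_kernel w)" "v \<in> \<theta> ` \<Omega> \<Longrightarrow> boundary_kernel w v = S v w"
  using someI_ex[OF kernel_extension[OF assms]] by (auto simp: boundary_kernel_def)

lemma boundary_kernel_regular: assumes "w \<in> \<theta> ` \<Omega>" shows "regular (boundary_kernel w)"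
proof
  have "holo (\<lambda>v. S v w) (\<theta> ` \<Omega>)" using kernel_mem[OF assms] by (simp add: H2_theta_def)
  thus "holo (boundary_kernel w) (\<theta> ` \<Omega>)" by (rule holo_cong) (rule boundary_kernel(2)[OF assms])
  show "continuous_on (\<theta> ` closure \<Omega>) (boundary_kernel w)" by (rule boundary_kernel(1)[OF assms])
qed

lemma boundary_kernel_L2: "w \<in> \<theta> ` \<Omega> \<Longrightarrow> boundary_kernel w \<in> L2 M"
  by (rule regular_L2[OF boundary_kernel_regular])

lemma reproducing:
  assumes w: "w \<in> \<theta> ` \<Omega>" and f: "regular f"
  shows "(\<integral>x. f x * cnj (boundary_kernel w x) \<partial>M) = f w"
proof -
  have "H2_theta_inner \<theta> \<mu> f (\<lambda>z. S z w) = (\<integral>x. f x * cnj (boundary_kernel w x) \<partial>M)"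
    by (rule H2_theta_inner_continuous[OF regular_H2_theta[OF f] kernel_mem[OF w]])
       (use f boundary_kernel[OF w] in auto)
  thus ?thesis using kernel_reproduces[OF w regular_H2_theta[OF f]] by simp
qed

lemma boundary_kernel_limit:
  assumes w: "w \<in> \<theta> ` \<Omega>" and v: "v \<in> space M"
  shows "((\<lambda>r. S (weighted_dilation k r v) w) \<longlongrightarrow> boundary_kernel w v) (at_left 1)"
proof -
  obtain z where z: "z \<in> closure \<Omega>" "v = \<theta> z" using v space_M_subset by blast
  have "((\<lambda>r. boundary_kernel w (\<theta> (complex_of_real r *s z))) \<longlongrightarrow> boundary_kernel w (\<theta> z)) (at_left 1)"
    by (rule radial_tendsto[OF theta_compose_continuous[OF boundary_kernel(1)[OF w]] z(1)])
  moreover have "\<forall>\<^sub>F r in at_left 1. boundary_kernel w (\<theta> (complex_of_real r *s z)) = S (weighted_dilation k r v) w"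
  proof (rule eventually_at_leftI[of 0])
    fix r :: real assume "r \<in> {0<..<1}"
    hence "complex_of_real r *s z \<in> \<Omega>" using z(1) by (intro scaled_closure_mem) auto
    thus "boundary_kernel w (\<theta> (complex_of_real r *s z)) = S (weighted_dilation k r v) w"
      by (simp add: boundary_kernel(2)[OF w] z(2) weighted_dilation_theta)
  qed simp
  ultimately show ?thesis using z(2) by (auto intro: Lim_transform_eventually)
qed

end

section \<open>Combinations of kernel functions and the Gram matrix\<close>

locale interpolation_data = hardy_kernel G \<theta> k \<Omega> \<mu> M S
  for G :: "(complex^'n^'n) set" and \<theta> k \<Omega> \<mu> M S +
  fixes \<zeta> :: "'p::finite \<Rightarrow> complex^'n" and w :: "complex^'p"
  assumes points_inj: "inj \<zeta>" and points_mem: "\<zeta> i \<in> \<theta> ` \<Omega>"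
begin

abbreviation s :: "'p \<Rightarrow> complex^'n \<Rightarrow> complex" where "s i \<equiv> boundary_kernel (\<zeta> i)"

definition combination :: "('p \<Rightarrow> complex) \<Rightarrow> complex^'n \<Rightarrow> complex" where
  "combination a x = (\<Sum>i\<in>UNIV. a i * s i x)"

lemma combination_regular: "regular (combination a)"
  unfolding combination_def[abs_def] by (rule regular_sum) (rule boundary_kernel_regular[OF points_mem])

lemma integral_cnj_combination:
  assumes u: "u \<in> L2 M" and e: "\<And>i. (\<integral>x. u x * cnj (s i x) \<partial>M) = e i"
  shows "(\<integral>x. u x * cnj (combination a x) \<partial>M) = (\<Sum>i\<in>UNIV. cnj (a i) * e i)"
proof -
  have "(\<integral>x. u x * cnj (combination a x) \<partial>M) = (\<integral>x. (\<Sum>i\<in>UNIV. cnj (a i) * (u x * cnj (s i x))) \<partial>M)"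
    by (simp add: combination_def sum_distrib_left mult_ac)
  also have "\<dots> = (\<Sum>i\<in>UNIV. \<integral>x. cnj (a i) * (u x * cnj (s i x)) \<partial>M)"
    by (rule Bochner_Integration.integral_sum)
       (intro integrable_mult_right th.L2_integrable_mult_cnj u boundary_kernel_L2 points_mem)
  finally show ?thesis by (simp add: e)
qed

lemma integral_regular_cnj_combination:
  "regular u \<Longrightarrow> (\<integral>x. u x * cnj (combination a x) \<partial>M) = (\<Sum>i\<in>UNIV. cnj (a i) * u (\<zeta> i))"
  by (intro integral_cnj_combination regular_L2 reproducing points_mem)

abbreviation gram :: "complex^'p^'p" where "gram \<equiv> \<chi> i j. S (\<zeta> i) (\<zeta> j)"

lemma combination_at_points: "combination a (\<zeta> i) = (gram *v (\<chi> j. a j)) $ i"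
  by (simp add: combination_def matrix_vector_mult_def boundary_kernel(2)[OF points_mem points_mem] mult.commute)

text \<open>A combination with coefficients in the kernel of the matrix vanishes at all nodes, and
  reproduction turns this into vanishing norm. Pairing it with a polynomial that is 1 at one node
  and 0 at the others isolates each coefficient.\<close>

lemma gram_injective: assumes "gram *v x = 0" shows "x = 0"
proof -
  define g where "g = combination (\<lambda>j. x $ j)"
  have g: "regular g" unfolding g_def by (rule combination_regular)
  have gz: "g (\<zeta> i) = 0" for i using assms by (simp add: g_def combination_at_points)
  have "complex_of_real (sq_norm M g) = (\<integral>y. g y * cnj (g y) \<partial>M)" by (rule th.inner_self[symmetric])
  also have "\<dots> = (\<integral>y. g y * cnj (combination (\<lambda>j. x $ j) y) \<partial>M)" by (simp add: g_def)
  also have "\<dots> = (\<Sum>i\<in>UNIV. cnj (x $ i) * g (\<zeta> i))" by (rule integral_regular_cnj_combination[OF g])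
  finally have g0: "sq_norm M g = 0" by (simp add: gz)
  have "x $ i = 0" for i
  proof -
    have "\<zeta> i \<notin> \<zeta> ` (UNIV - {i})" using points_inj by (auto dest: injD)
    then obtain q where q: "polynomial_fun q" "q (\<zeta> i) = 1" "\<forall>y\<in>\<zeta> ` (UNIV - {i}). q y = 0"
      using polynomial_fun_separation[of "\<zeta> ` (UNIV - {i})" "\<zeta> i"] by auto
    have "(\<integral>y. q y * cnj (combination (\<lambda>j. x $ j) y) \<partial>M) = (\<Sum>j\<in>UNIV. cnj (x $ j) * q (\<zeta> j))"
      by (rule integral_regular_cnj_combination[OF polynomial_fun_regular[OF q(1)]])
    also have "\<dots> = (\<Sum>j\<in>{i}. cnj (x $ j) * q (\<zeta> j))"
      by (rule sum.mono_neutral_right) (use q(3) in auto)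
    also have "\<dots> = cnj (x $ i)" by (simp add: q(2))
    finally have e: "(\<integral>y. q y * cnj (g y) \<partial>M) = cnj (x $ i)" by (simp add: g_def)
    have "norm (\<integral>y. q y * cnj (g y) \<partial>M) \<le> sqrt (sq_norm M q) * sqrt (sq_norm M (\<lambda>y. cnj (g y)))"
      by (rule th.cauchy_schwarz[OF polynomial_fun_L2_M[OF q(1)] th.L2_cnj[OF regular_L2[OF g]]])
    thus ?thesis using e g0 by simp
  qed
  thus ?thesis by (simp add: vec_eq_iff)
qed

lemma gram_solution: "gram *v (matrix_inv gram *v w) = w"
proof -
  have "\<exists>B. B ** gram = mat 1" unfolding matrix_left_invertible_ker using gram_injective by blast
  hence "invertible gram" by (simp add: invertible_left_inverse)
  hence "gram ** matrix_inv gram = mat 1"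
    unfolding invertible_def matrix_inv_def by (rule someI2_ex) blast
  thus ?thesis by (simp add: matrix_vector_mul_assoc)
qed

abbreviation c :: "complex^'p" where "c \<equiv> matrix_inv gram *v w"

abbreviation \<psi> :: "complex^'n \<Rightarrow> complex" where "\<psi> \<equiv> combination (\<lambda>i. c $ i)"

lemma \<psi>_at_points: "\<psi> (\<zeta> i) = w $ i"
  using gram_solution by (simp add: combination_at_points)

lemma combination_limit:
  assumes "x \<in> space M"
  shows "((\<lambda>r. \<Sum>i\<in>UNIV. a i * S (weighted_dilation k r x) (\<zeta> i)) \<longlongrightarrow> combination a x) (at_left 1)"
  unfolding combination_def
  by (intro tendsto_sum tendsto_mult tendsto_const boundary_kernel_limit points_mem assms)

text \<open>The radial limit exists at every point of the space, so the unspecified value of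
  \<open>Lim\<close> never occurs and the functional is integration against a continuous
  function.\<close>

lemma X_functional_eq:
  "X_functional k M (\<lambda>z. \<Sum>i\<in>UNIV. c $ i * S z (\<zeta> i)) f = (\<integral>x. \<psi> x * f x \<partial>M)"
  unfolding X_functional_def
proof (intro Bochner_Integration.integral_cong refl)
  fix x assume "x \<in> space M"
  hence "boundary_value k (\<lambda>z. \<Sum>i\<in>UNIV. c $ i * S z (\<zeta> i)) x = \<psi> x"
    unfolding boundary_value_def by (intro tendsto_Lim trivial_limit_at_left_real combination_limit)
  thus "boundary_value k (\<lambda>z. \<Sum>i\<in>UNIV. c $ i * S z (\<zeta> i)) x * f x = \<psi> x * f x" by simp
qed

lemma combination_boundary_function: "combination a \<in> boundary_functions k M (kernel_span S \<zeta>)"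
proof -
  have "(\<lambda>z. \<Sum>i\<in>UNIV. a i * S z (\<zeta> i)) \<in> kernel_span S \<zeta>" unfolding kernel_span_def by blast
  moreover have "AE x in M. ((\<lambda>r. \<Sum>i\<in>UNIV. a i * S (weighted_dilation k r x) (\<zeta> i)) \<longlongrightarrow> combination a x) (at_left 1)"
    by (intro AE_I2 combination_limit)
  ultimately show ?thesis
    unfolding boundary_functions_def
    by (intro CollectI conjI regular_L2[OF combination_regular] bexI[of _ "\<lambda>z. \<Sum>i\<in>UNIV. a i * S z (\<zeta> i)"])
qed

lemma boundary_functionE:
  assumes "q \<in> boundary_functions k M (kernel_span S \<zeta>)"
  obtains a where "q \<in> L2 M" "AE x in M. q x = combination a x"
proof -
  obtain a where a: "q \<in> L2 M" "AE x in M. ((\<lambda>r. \<Sum>i\<in>UNIV. a i * S (weighted_dilation k r x) (\<zeta> i)) \<longlongrightarrow> q x) (at_left 1)"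
    using assms unfolding boundary_functions_def kernel_span_def by blast
  have "AE x in M. q x = combination a x"
    using a(2) AE_space
  proof eventually_elim
    case (elim x)
    show ?case by (rule tendsto_unique[OF trivial_limit_at_left_real elim(1) combination_limit[OF elim(2)]])
  qed
  thus ?thesis using that a(1) by blast
qed

end

section \<open>Interpolation\<close>

context hardy_setting
begin

lemma L2_integral_add3:
  assumes "u \<in> L2 M" "q \<in> L2 M" "m \<in> L2 M" "h \<in> L2 M"
  shows "(\<integral>x. u x * (q x + m x + h x) \<partial>M) = (\<integral>x. u x * q x \<partial>M) + (\<integral>x. u x * m x \<partial>M) + (\<integral>x. u x * h x \<partial>M)"
proof -
  note i = th.L2_integrable_mult[OF assms(1,2)] th.L2_integrable_mult[OF assms(1,3)] th.L2_integrable_mult[OF assms(1,4)]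
  show ?thesis
    by (simp add: distrib_left Bochner_Integration.integral_add[OF Bochner_Integration.integrable_add[OF i(1,2)] i(3)]
        Bochner_Integration.integral_add[OF i(1,2)])
qed

lemma M_theta_orthogonal:
  assumes m: "m \<in> M_theta \<Omega> \<theta> \<mu> M" and h: "h \<in> H2_theta_boundary \<Omega> \<theta> \<mu> M"
  shows "(\<integral>x. m x * cnj (h x) \<partial>M) = 0" "(\<integral>x. h x * m x \<partial>M) = 0"
proof -
  have z: "(\<lambda>_. 0) \<in> H2_theta_boundary \<Omega> \<theta> \<mu> M" by (rule polynomial_fun_H2_theta_boundary) simp
  have z': "(\<lambda>_. 0) \<in> conj_set (H2_theta_boundary \<Omega> \<theta> \<mu> M)"
    unfolding conj_set_def using z by (intro CollectI exI[of _ "\<lambda>_. 0"]) simp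
  have h': "(\<lambda>x. cnj (h x)) \<in> conj_set (H2_theta_boundary \<Omega> \<theta> \<mu> M)"
    unfolding conj_set_def using h by blast
  have o: "L2_inner M m (\<lambda>x. f x + g x) = 0"
    if "f \<in> H2_theta_boundary \<Omega> \<theta> \<mu> M" "g \<in> conj_set (H2_theta_boundary \<Omega> \<theta> \<mu> M)" for f g
    using m that unfolding M_theta_def by blast
  show "(\<integral>x. m x * cnj (h x) \<partial>M) = 0" using o[OF h z'] by (simp add: L2_inner_def)
  show "(\<integral>x. h x * m x \<partial>M) = 0" using o[OF z h'] by (simp add: L2_inner_def mult.commute)
qed

lemma M_theta_I:
  assumes m: "m \<in> L2 M"
    and o: "\<And>h. h \<in> H2_theta_boundary \<Omega> \<theta> \<mu> M \<Longrightarrow> (\<integral>x. m x * cnj (h x) \<partial>M) = 0"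
      "\<And>h. h \<in> H2_theta_boundary \<Omega> \<theta> \<mu> M \<Longrightarrow> (\<integral>x. m x * h x \<partial>M) = 0"
  shows "m \<in> M_theta \<Omega> \<theta> \<mu> M"
proof -
  have "L2_inner M m (\<lambda>x. f x + g x) = 0"
    if f: "f \<in> H2_theta_boundary \<Omega> \<theta> \<mu> M" and g: "g \<in> conj_set (H2_theta_boundary \<Omega> \<theta> \<mu> M)" for f g
  proof -
    obtain h where h: "h \<in> H2_theta_boundary \<Omega> \<theta> \<mu> M" "g = (\<lambda>x. cnj (h x))" using g unfolding conj_set_def by blast
    have "L2_inner M m (\<lambda>x. f x + g x) = (\<integral>x. m x * cnj (f x) + m x * h x \<partial>M)"
      by (simp add: L2_inner_def h(2) distrib_left)
    also have "\<dots> = (\<integral>x. m x * cnj (f x) \<partial>M) + (\<integral>x. m x * h x \<partial>M)"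
      by (intro Bochner_Integration.integral_add th.L2_integrable_mult_cnj th.L2_integrable_mult m H2_theta_boundary_L2 f h(1))
    finally show ?thesis using o f h(1) by simp
  qed
  thus ?thesis using m unfolding M_theta_def by blast
qed

text \<open>Truncate the homogeneous expansion of a dilation; the truncation is invariant, hence a polynomial in \<open>\<theta>\<close>.\<close>

lemma schur_class_polynomial_approximation:
  assumes \<phi>: "\<phi> \<in> schur_class (\<theta> ` \<Omega>)" and A: "finite A" "A \<subseteq> \<theta> ` \<Omega>" and e: "e > 0"
  shows "\<exists>Q. polynomial_fun Q \<and> (\<forall>x\<in>\<theta> ` closure \<Omega>. norm (Q x) \<le> 1 + e) \<and> (\<forall>a\<in>A. norm (Q a - \<phi> a) \<le> e)"
proof -
  have h: "holo \<phi> (\<theta> ` \<Omega>)" and b: "\<And>x. x \<in> \<theta> ` \<Omega> \<Longrightarrow> norm (\<phi> x) \<le> 1" using \<phi> by (auto simp: schur_class_def)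
  define g where "g z = \<phi> (\<theta> z)" for z
  have g: "holo g \<Omega>" unfolding g_def by (rule theta_compose_holo[OF h])
  have ev: "\<forall>\<^sub>F r in at_left 1. norm (g (complex_of_real r *s z) - g z) < e / 2" if z: "z \<in> \<Omega>" for z
  proof -
    have "((\<lambda>r. complex_of_real r *s z) \<longlongrightarrow> complex_of_real 1 *s z) (at_left 1)"
      unfolding of_real_vector_smult by (intro tendsto_intros)
    hence "((\<lambda>r. complex_of_real r *s z) \<longlongrightarrow> z) (at_left 1)" by simp
    moreover have "isCont g z" using holo_continuous_on[OF g] z open_domain by (simp add: continuous_on_eq_continuous_at)
    ultimately have "((\<lambda>r. g (complex_of_real r *s z)) \<longlongrightarrow> g z) (at_left 1)" by (rule isCont_tendsto_compose[rotated])
    from tendstoD[OF this, of "e / 2"] e show ?thesis by (simp add: dist_norm)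
  qed
  \<comment> \<open>One preimage per node: for finitely many of them a single radius close to 1
    keeps all values within \<open>e / 2\<close>.\<close>
  obtain Z where Z: "Z \<subseteq> \<Omega>" "finite Z" "A = \<theta> ` Z" using finite_subset_image[OF A] by blast
  have "\<forall>\<^sub>F r in at_left 1. \<forall>z\<in>Z. norm (g (complex_of_real r *s z) - g z) < e / 2"
    by (intro eventually_ball_finite Z(2) ballI ev) (use Z(1) in blast)
  moreover have "\<forall>\<^sub>F r in at_left (1::real). r \<in> {0<..<1}" by (rule eventually_at_leftI[of 0]) auto
  ultimately have "\<forall>\<^sub>F r in at_left 1. (\<forall>z\<in>Z. norm (g (complex_of_real r *s z) - g z) < e / 2) \<and> r \<in> {0<..<1}"
    by (rule eventually_conj)
  from eventually_happens[OF this] obtain r :: real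
    where r: "\<And>z. z \<in> Z \<Longrightarrow> norm (g (complex_of_real r *s z) - g z) < e / 2" "0 < r" "r < 1"
    by auto
  obtain N where N: "\<And>z. z \<in> closure \<Omega> \<Longrightarrow>
      norm (g (complex_of_real r *s z) - (\<Sum>n<N. hom_part n g z * of_real r ^ n)) \<le> e / 2"
    using dilation_approximation[OF g less_imp_le[OF r(2)] r(3), of "e / 2"] e by auto
  define q where "q z = (\<Sum>n<N. hom_part n g z * of_real r ^ n)" for z
  have "polynomial_fun q" unfolding q_def
    by (intro polynomial_fun_sum polynomial_fun_mult polynomial_fun_const polynomial_fun_hom_part g)
  moreover have "q (a *v z) = q z" if "a \<in> G" for a z
  proof -
    have "(\<lambda>y. g (a *v y)) = g" by (simp add: fun_eq_iff g_def theta_invariant[OF that])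
    hence "hom_part n g (a *v z) = hom_part n g z" for n using hom_part_compose_matrix[of n g a z] by simp
    thus ?thesis by (simp add: q_def)
  qed
  ultimately obtain Q where Q: "polynomial_fun Q" "\<And>z. q z = Q (\<theta> z)" using invariant_factor by blast
  have "norm (Q x) \<le> 1 + e" if "x \<in> \<theta> ` closure \<Omega>" for x
  proof -
    obtain z where z: "z \<in> closure \<Omega>" "x = \<theta> z" using \<open>x \<in> \<theta> ` closure \<Omega>\<close> by blast
    have "complex_of_real r *s z \<in> \<Omega>" using r by (intro scaled_closure_mem z) auto
    hence "norm (g (complex_of_real r *s z)) \<le> 1" unfolding g_def by (intro b) blast
    moreover have "norm (q z) \<le> norm (g (complex_of_real r *s z)) + norm (g (complex_of_real r *s z) - q z)"
      using norm_triangle_sub[of "q z" "g (complex_of_real r *s z)"] by (simp add: norm_minus_commute)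
    ultimately show ?thesis using N[OF z(1)] e by (simp add: z(2) Q(2)[symmetric] q_def)
  qed
  moreover have "norm (Q a - \<phi> a) \<le> e" if "a \<in> A" for a
  proof -
    obtain z where z: "z \<in> Z" "a = \<theta> z" using \<open>a \<in> A\<close> Z(3) by blast
    have "z \<in> closure \<Omega>" using z(1) Z(1) closure_subset by blast
    hence "norm (q z - g (complex_of_real r *s z)) \<le> e / 2" using N by (simp add: q_def norm_minus_commute)
    hence "norm (q z - g z) \<le> e"
      using norm_triangle_ineq[of "q z - g (complex_of_real r *s z)" "g (complex_of_real r *s z) - g z"] r(1)[OF z(1)] by simp
    thus ?thesis by (simp add: Q(2) g_def z(2))
  qed
  ultimately show ?thesis using Q(1) by blast
qed

end

section \<open>From interpolation to contractivity\<close>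

context interpolation_data
begin

text \<open>The second summand is orthogonal to \<open>u\<close>, and the third contributes a
  product with the vanishing mean of \<open>h\<close>. So the pairing depends on \<open>u\<close>
  only through its values at the nodes, which lets the kernel combination be exchanged for any
  regular function with nearly the same values there.\<close>

lemma integral_regular_M_Q:
  assumes f: "f = (\<lambda>x. cnj (q x) + m x + h x)" and q: "q \<in> L2 M" "AE x in M. q x = combination a x"
    and m: "m \<in> M_theta \<Omega> \<theta> \<mu> M" and h: "h \<in> H2_theta_boundary_0 \<Omega> \<theta> \<mu> M" and u: "regular u"
  shows "(\<integral>x. u x * f x \<partial>M) = (\<Sum>i\<in>UNIV. cnj (a i) * u (\<zeta> i))"
proof -
  have mL: "m \<in> L2 M" using m by (simp add: M_theta_def)
  have hH: "h \<in> H2_theta_boundary \<Omega> \<theta> \<mu> M" and h0: "(\<integral>x. h x \<partial>M) = 0"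
    using h by (auto simp: H2_theta_boundary_0_def L2_inner_def)
  note uH = regular_H2_theta_boundary[OF u]
  have "(\<integral>x. u x * f x \<partial>M) = (\<integral>x. u x * cnj (q x) \<partial>M) + (\<integral>x. u x * m x \<partial>M) + (\<integral>x. u x * h x \<partial>M)"
    unfolding f by (rule L2_integral_add3[OF regular_L2[OF u] th.L2_cnj[OF q(1)] mL H2_theta_boundary_L2[OF hH]])
  also have "(\<integral>x. u x * m x \<partial>M) = 0" by (rule M_theta_orthogonal(2)[OF m uH])
  also have "(\<integral>x. u x * h x \<partial>M) = 0" using integral_H2_theta_boundary_mult[OF uH hH] h0 by simp
  also have "(\<integral>x. u x * cnj (q x) \<partial>M) = (\<integral>x. u x * cnj (combination a x) \<partial>M)"
  proof (rule integral_cong_AE)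
    show "(\<lambda>x. u x * cnj (q x)) \<in> borel_measurable M"
      by (rule borel_measurable_integrable[OF th.L2_integrable_mult_cnj[OF regular_L2[OF u] q(1)]])
    show "(\<lambda>x. u x * cnj (combination a x)) \<in> borel_measurable M"
      by (rule borel_measurable_integrable[OF th.L2_integrable_mult_cnj[OF regular_L2[OF u] regular_L2[OF combination_regular]]])
    show "AE x in M. u x * cnj (q x) = u x * cnj (combination a x)" using q(2) by eventually_elim simp
  qed
  also have "\<dots> = (\<Sum>i\<in>UNIV. cnj (a i) * u (\<zeta> i))" by (rule integral_regular_cnj_combination[OF u])
  finally show ?thesis by simp
qed

lemma M_Q_E:
  assumes "f \<in> M_Q \<Omega> \<theta> k \<mu> M (kernel_span S \<zeta>)"
  obtains q a m h where "f = (\<lambda>x. cnj (q x) + m x + h x)" "q \<in> L2 M" "AE x in M. q x = combination a x"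
    "m \<in> M_theta \<Omega> \<theta> \<mu> M" "h \<in> H2_theta_boundary_0 \<Omega> \<theta> \<mu> M"
proof -
  obtain q' m h where f: "f = (\<lambda>x. q' x + m x + h x)" "q' \<in> conj_set (boundary_functions k M (kernel_span S \<zeta>))"
    "m \<in> M_theta \<Omega> \<theta> \<mu> M" "h \<in> H2_theta_boundary_0 \<Omega> \<theta> \<mu> M"
    using assms unfolding M_Q_def by blast
  obtain q where q: "q' = (\<lambda>x. cnj (q x))" "q \<in> boundary_functions k M (kernel_span S \<zeta>)"
    using f(2) unfolding conj_set_def by blast
  obtain a where a: "q \<in> L2 M" "AE x in M. q x = combination a x" by (rule boundary_functionE[OF q(2)])
  show ?thesis by (rule that[OF _ a f(3,4)]) (simp add: f(1) q(1))
qed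

theorem interpolation_imp_contractive:
  assumes \<phi>: "\<phi> \<in> schur_class (\<theta> ` \<Omega>)" "\<And>i. \<phi> (\<zeta> i) = w $ i"
    and f: "f \<in> M_Q \<Omega> \<theta> k \<mu> M (kernel_span S \<zeta>)"
  shows "norm (\<integral>x. \<psi> x * f x \<partial>M) \<le> (\<integral>x. norm (f x) \<partial>M)"
proof -
  obtain q a m h where d: "f = (\<lambda>x. cnj (q x) + m x + h x)" "q \<in> L2 M" "AE x in M. q x = combination a x"
    "m \<in> M_theta \<Omega> \<theta> \<mu> M" "h \<in> H2_theta_boundary_0 \<Omega> \<theta> \<mu> M" by (rule M_Q_E[OF f])
  note formula = integral_regular_M_Q[OF d]
  have "m \<in> L2 M" "h \<in> L2 M" using d(4,5) by (auto simp: M_theta_def H2_theta_boundary_0_def H2_theta_boundary_def)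
  hence fL: "f \<in> L2 M" unfolding d(1) by (intro th.L2_add th.L2_cnj d(2))
  define I where "I = (\<integral>x. norm (f x) \<partial>M)"
  define A where "A = (\<Sum>i\<in>UNIV. norm (a i))"
  have I: "I \<ge> 0" and A: "A \<ge> 0" by (auto simp: I_def A_def intro: sum_nonneg)
  \<comment> \<open>The term \<open>e * I\<close> comes from the sup norm \<open>1 + e\<close> of
    the polynomial, the term \<open>e * A\<close> from its errors at the nodes.\<close>
  have bound: "norm (\<integral>x. \<psi> x * f x \<partial>M) \<le> I + e * (I + A)" if e: "e > 0" for e
  proof -
    have sub: "range \<zeta> \<subseteq> \<theta> ` \<Omega>" using points_mem by blast
    obtain Q where Q: "polynomial_fun Q" "\<And>x. x \<in> \<theta> ` closure \<Omega> \<Longrightarrow> norm (Q x) \<le> 1 + e"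
      "\<And>i. norm (Q (\<zeta> i) - w $ i) \<le> e"
      using schur_class_polynomial_approximation[OF \<phi>(1) finite_imageI[OF finite] sub e] \<phi>(2) by auto
    have "norm (\<integral>x. Q x * f x \<partial>M) \<le> (\<integral>x. (1 + e) * norm (f x) \<partial>M)"
    proof (rule order.trans[OF integral_norm_bound integral_mono])
      show "integrable M (\<lambda>x. norm (Q x * f x))"
        by (rule integrable_norm[OF th.L2_integrable_mult[OF polynomial_fun_L2_M[OF Q(1)] fL]])
      show "integrable M (\<lambda>x. (1 + e) * norm (f x))"
        by (rule integrable_mult_right[OF integrable_norm[OF th.L2_integrable[OF fL]]])
      fix x assume "x \<in> space M"
      hence "norm (Q x) \<le> 1 + e" using space_M_subset Q(2) by blast
      thus "norm (Q x * f x) \<le> (1 + e) * norm (f x)" unfolding norm_mult by (rule mult_right_mono) simp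
    qed
    hence b1: "norm (\<integral>x. Q x * f x \<partial>M) \<le> (1 + e) * I" by (simp add: I_def)
    have "(\<integral>x. \<psi> x * f x \<partial>M) - (\<integral>x. Q x * f x \<partial>M) = (\<Sum>i\<in>UNIV. cnj (a i) * (w $ i - Q (\<zeta> i)))"
      unfolding formula[OF combination_regular] formula[OF polynomial_fun_regular[OF Q(1)]] \<psi>_at_points
      by (simp add: sum_subtractf right_diff_distrib)
    also have "norm \<dots> \<le> (\<Sum>i\<in>UNIV. norm (a i) * e)"
    proof (rule sum_norm_le)
      fix i show "norm (cnj (a i) * (w $ i - Q (\<zeta> i))) \<le> norm (a i) * e"
        using Q(3)[of i] by (simp add: norm_mult norm_minus_commute mult_left_mono)
    qed
    also have "\<dots> = e * A" by (simp add: A_def sum_distrib_left mult.commute)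
    finally have b2: "norm ((\<integral>x. \<psi> x * f x \<partial>M) - (\<integral>x. Q x * f x \<partial>M)) \<le> e * A" .
    have "norm (\<integral>x. \<psi> x * f x \<partial>M) \<le> (1 + e) * I + e * A"
      using norm_triangle_sub[of "\<integral>x. \<psi> x * f x \<partial>M" "\<integral>x. Q x * f x \<partial>M"] b1 b2 by simp
    thus ?thesis by (simp add: algebra_simps)
  qed
  have "norm (\<integral>x. \<psi> x * f x \<partial>M) \<le> I"
  proof (rule field_le_epsilon)
    fix e :: real assume e: "e > 0"
    \<comment> \<open>The summand 1 keeps the denominator positive when \<open>I\<close> and
      \<open>A\<close> both vanish.\<close>
    define d where "d = e / (I + A + 1)"
    have "d > 0" using e I A by (simp add: d_def)
    from bound[OF this] have "norm (\<integral>x. \<psi> x * f x \<partial>M) \<le> I + d * (I + A)" .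
    also have "d * (I + A) \<le> d * (I + A + 1)" using \<open>d > 0\<close> by (intro mult_left_mono) auto
    also have "d * (I + A + 1) = e" using I A by (simp add: d_def)
    finally show "norm (\<integral>x. \<psi> x * f x \<partial>M) \<le> I + e" by simp
  qed
  thus ?thesis by (simp add: I_def)
qed

end

text \<open>Weierstrass: the Cauchy estimate on lines bounds the derivatives of the terms.\<close>

lemma holo_series:
  fixes P :: "nat \<Rightarrow> complex^'n \<Rightarrow> complex"
  assumes P: "\<And>n. polynomial_fun (P n)" and U: "open U"
    and b: "\<And>n x. x \<in> U \<Longrightarrow> norm (P n x) \<le> b n" "summable b"
    and f: "\<And>x. x \<in> U \<Longrightarrow> (\<lambda>n. P n x) sums f x"
  shows "holo f U"
proof -
  have "\<exists>f'. (f has_derivative f') (at z) \<and> (\<forall>c v. f' (c *s v) = c * f' v)" if z: "z \<in> U" for z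
  proof -
    define D where "D n = (SOME p'. \<forall>z. (P n has_derivative (\<lambda>h. \<Sum>i\<in>UNIV. p' i z * h $ i)) (at z))" for n
    define L where "L n x h = (\<Sum>i\<in>UNIV. D n i x * h $ i)" for n x h
    have LD: "(P n has_derivative L n x) (at x)" for n x
    proof -
      have "\<exists>p'. \<forall>z. (P n has_derivative (\<lambda>h. \<Sum>i\<in>UNIV. p' i z * h $ i)) (at z)"
        using polynomial_fun_has_derivative[OF P[of n]] by blast
      from someI_ex[OF this] show ?thesis unfolding D_def[symmetric] L_def[abs_def] by blast
    qed
    have Ls: "L n x (c *s h) = c * L n x h" for n x c h by (simp add: L_def sum_distrib_left mult_ac)
    obtain e where e: "e > 0" "cball z e \<subseteq> U" using U z open_contains_cball by blast
    \<comment> \<open>Half the radius, so that vectors of length \<open>d\<close> attached anywhere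
      in the smaller ball still end in \<open>U\<close>.\<close>
    define d where "d = e / 2"
    have d: "d > 0" using e(1) by (simp add: d_def)
    have near: "x + y \<in> U" if "x \<in> ball z d" "norm y \<le> d" for x y
    proof -
      have "dist z (x + y) \<le> dist z x + norm y" using norm_triangle_ineq4[of "z - x" y] by (simp add: dist_norm algebra_simps)
      hence "x + y \<in> cball z e" using that by (simp add: d_def)
      thus ?thesis using e(2) by blast
    qed
    have Lb: "norm (L n x h) \<le> b n / d * norm h" if x: "x \<in> ball z d" for n x h
    proof (cases "h = 0")
      case True
      thus ?thesis by (simp add: L_def)
    next
      case False
      \<comment> \<open>The largest parameter radius on which \<open>t *s h\<close> has length at
        most \<open>d\<close>; the Cauchy estimate for the first derivative then gives
        \<open>b n / d * norm h\<close>.\<close>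
      define r where "r = d / norm h"
      have r: "r > 0" using d False by (simp add: r_def)
      have hol: "(\<lambda>t. P n (x + t *s h)) holomorphic_on UNIV"
        using holo_on_line[OF polynomial_fun_holo[OF P] open_UNIV] by simp
      have "norm ((deriv ^^ 1) (\<lambda>t. P n (x + t *s h)) 0) \<le> fact 1 * b n / r ^ 1"
      proof (rule Cauchy_inequality[OF _ _ r])
        show "(\<lambda>t. P n (x + t *s h)) holomorphic_on ball 0 r" using hol by (rule holomorphic_on_subset) simp
        show "continuous_on (cball 0 r) (\<lambda>t. P n (x + t *s h))"
          by (rule holomorphic_on_imp_continuous_on[OF holomorphic_on_subset[OF hol]]) simp
        fix t :: complex assume "norm (0 - t) = r"
        hence "norm (t *s h) \<le> d" using False by (simp add: r_def)
        thus "norm (P n (x + t *s h)) \<le> b n" by (intro b near x)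
      qed
      moreover have "deriv (\<lambda>t. P n (x + t *s h)) 0 = L n x h"
        by (rule DERIV_imp_deriv[OF has_field_derivative_on_line]) (use LD[of n x] Ls in simp_all)
      ultimately show ?thesis using False by (simp add: r_def)
    qed
    define L' where "L' x h = (\<Sum>n. L n x h)" for x h
    have bs: "summable (\<lambda>n. b n / d * norm h)" for h :: "complex^'n" by (intro summable_mult2 summable_divide b(2))
    have Lsum: "summable (\<lambda>n. L n x h)" if "x \<in> ball z d" for x h
      by (rule summable_comparison_test'[OF bs]) (rule Lb[OF that])
    have b0: "b n \<ge> 0" for n using b(1)[OF z] norm_ge_zero order.trans by blast
    have "\<exists>g. \<forall>x\<in>ball z d. (\<lambda>n. P n x) sums g x \<and> (g has_derivative L' x) (at x within ball z d)"
    proof (rule has_derivative_series)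
      show "convex (ball z d)" by simp
      show "(P n has_derivative L n x) (at x within ball z d)" for n x by (rule has_derivative_at_withinI[OF LD])
      show "z \<in> ball z d" using d by simp
      show "(\<lambda>n. P n z) sums f z" by (rule f[OF z])
      fix \<epsilon> :: real assume \<epsilon>: "\<epsilon> > 0"
      have sb: "summable (\<lambda>n. b n / d)" by (rule summable_divide[OF b(2)])
      obtain N where N: "\<And>n. n \<ge> N \<Longrightarrow> norm (\<Sum>i. b (i + n) / d) < \<epsilon>"
        using suminf_exist_split[OF \<epsilon> sb] by blast
      have "norm (sum (\<lambda>i. L i x h) {..<n} - L' x h) \<le> \<epsilon> * norm h" if n: "n \<ge> N" and x: "x \<in> ball z d" for n x h
      proof -
        have "L' x h = (\<Sum>i. L (i + n) x h) + sum (\<lambda>i. L i x h) {..<n}"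
          unfolding L'_def by (rule suminf_split_initial_segment[OF Lsum[OF x]])
        hence "norm (sum (\<lambda>i. L i x h) {..<n} - L' x h) = norm (\<Sum>i. L (i + n) x h)" by simp
        also have "\<dots> \<le> (\<Sum>i. b (i + n) / d * norm h)"
          by (rule norm_suminf_le[OF Lb[OF x] summable_ignore_initial_segment[OF bs]])
        also have "\<dots> = (\<Sum>i. b (i + n) / d) * norm h"
          by (rule suminf_mult2[symmetric, OF summable_ignore_initial_segment[OF sb]])
        also have "\<dots> \<le> \<epsilon> * norm h" using N[OF n] by (intro mult_right_mono) auto
        finally show ?thesis .
      qed
      thus "\<forall>\<^sub>F n in sequentially. \<forall>x\<in>ball z d. \<forall>h. norm (sum (\<lambda>i. L i x h) {..<n} - L' x h) \<le> \<epsilon> * norm h"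
        unfolding eventually_sequentially by blast
    qed
    then obtain g where g: "\<And>x. x \<in> ball z d \<Longrightarrow> (\<lambda>n. P n x) sums g x"
      "\<And>x. x \<in> ball z d \<Longrightarrow> (g has_derivative L' x) (at x within ball z d)" by blast
    have zb: "z \<in> ball z d" using d by simp
    have "(g has_derivative L' z) (at z)" using g(2)[OF zb] at_within_open[OF zb open_ball] by simp
    hence "(f has_derivative L' z) (at z)"
    proof (rule has_derivative_transform_within_open[OF _ open_ball zb])
      fix x assume x: "x \<in> ball z d"
      have "x \<in> U" using near[OF x, of 0] d by simp
      thus "g x = f x" by (rule sums_unique2[OF g(1)[OF x] f])
    qed
    moreover have "L' z (c *s v) = c * L' z v" for c v
      unfolding L'_def Ls by (rule suminf_mult[OF Lsum[OF zb]])
    ultimately show ?thesis by blast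
  qed
  thus ?thesis unfolding holo_def by (meson has_derivative_at_withinI)
qed

text \<open>Cauchy's estimate on circles of radius \<open>r\<close> with \<open>r\<close> tending to
  1, so that the constant \<open>B\<close> itself is kept.\<close>

lemma power_series_coefficient_bound:
  fixes a :: "nat \<Rightarrow> complex"
  assumes F: "\<And>t. norm t < 1 \<Longrightarrow> (\<lambda>n. a n * t ^ n) sums F t" and B: "\<And>t. norm t < 1 \<Longrightarrow> norm (F t) \<le> B"
  shows "norm (a n) \<le> B"
proof -
  have hol: "F holomorphic_on ball 0 1"
    by (rule power_series_holomorphic[of _ _ a]) (use F in auto)
  have "F has_fps_expansion Abs_fps a"
  proof (rule has_fps_expansionI)
    have "\<forall>\<^sub>F u in nhds (0::complex). u \<in> ball 0 1" by (intro eventually_nhds_in_open) auto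
    thus "\<forall>\<^sub>F u in nhds 0. (\<lambda>n. fps_nth (Abs_fps a) n * u ^ n) sums F u"
      by eventually_elim (use F in simp)
  qed
  from fps_nth_fps_expansion[OF this, of n] have an: "a n = (deriv ^^ n) F 0 / fact n" by simp
  have "norm (a n) \<le> B / r ^ n" if r: "0 < r" "r < 1" for r
  proof -
    have sub: "cball 0 r \<subseteq> ball (0::complex) 1" using r by auto
    have "norm ((deriv ^^ n) F 0) \<le> fact n * B / r ^ n"
      by (rule Cauchy_inequality[OF holomorphic_on_subset[OF hol order.trans[OF ball_subset_cball sub]]
            holomorphic_on_imp_continuous_on[OF holomorphic_on_subset[OF hol sub]] r(1)])
         (use B r in auto)
    thus ?thesis by (simp add: an norm_divide field_simps)
  qed
  hence "\<forall>\<^sub>F r in at_left 1. norm (a n) \<le> B / r ^ n" by (intro eventually_at_leftI[of 0]) auto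
  moreover have "((\<lambda>r. B / r ^ n) \<longlongrightarrow> B / 1 ^ n) (at_left 1)" by (intro tendsto_intros) auto
  ultimately show ?thesis using tendsto_lowerbound by (metis div_by_1 power_one trivial_limit_at_left_real)
qed

text \<open>The coefficient errors are bounded independently of \<open>n\<close>, so the sums differ
  by at most \<open>e j / (1 - norm t)\<close>.\<close>

lemma power_series_limit:
  fixes g :: "nat \<Rightarrow> complex"
  assumes h: "\<And>j. (\<lambda>n. h j n * t ^ n) sums F j" and e: "\<And>j n. norm (h j n - g n) \<le> e j" "e \<longlonglongrightarrow> (0::real)"
    and t: "norm t < 1" and L: "F \<longlonglongrightarrow> L"
  shows "(\<lambda>n. g n * t ^ n) sums L"
proof -
  have gs: "summable (\<lambda>n. e j * norm t ^ n)" for j using t by (intro summable_mult summable_geometric) simp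
  have le: "norm ((h j n - g n) * t ^ n) \<le> e j * norm t ^ n" for j n
    unfolding norm_mult norm_power by (intro mult_right_mono e(1)) simp
  have ds: "summable (\<lambda>n. (h j n - g n) * t ^ n)" for j
    by (rule summable_comparison_test'[OF gs]) (rule le)
  have "summable (\<lambda>n. h 0 n * t ^ n - (h 0 n - g n) * t ^ n)"
    by (rule summable_diff[OF sums_summable[OF h] ds])
  hence sg: "summable (\<lambda>n. g n * t ^ n)" by (simp add: algebra_simps)
  define s where "s = (\<Sum>n. g n * t ^ n)"
  have "norm (F j - s) \<le> e j * (1 / (1 - norm t))" for j
  proof -
    have "(\<lambda>n. h j n * t ^ n - g n * t ^ n) sums (F j - s)"
      unfolding s_def by (rule sums_diff[OF h summable_sums[OF sg]])
    hence "F j - s = (\<Sum>n. (h j n - g n) * t ^ n)" by (simp add: left_diff_distrib sums_iff)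
    also have "norm \<dots> \<le> (\<Sum>n. e j * norm t ^ n)" by (rule norm_suminf_le[OF le gs])
    also have "\<dots> = e j * (1 / (1 - norm t))"
      using suminf_mult[of "\<lambda>n. norm t ^ n" "e j"] t by (simp add: suminf_geometric)
    finally show ?thesis .
  qed
  moreover have "(\<lambda>j. e j * (1 / (1 - norm t))) \<longlonglongrightarrow> 0" by (rule tendsto_mult_left_zero[OF e(2)])
  ultimately have "(\<lambda>j. F j - s) \<longlonglongrightarrow> 0" by (rule LIMSEQ_norm_le)
  hence "F \<longlonglongrightarrow> s" by (simp add: LIM_zero_iff)
  hence "s = L" using L by (rule LIMSEQ_unique)
  thus ?thesis using sg by (simp add: s_def sums_iff)
qed

section \<open>The holomorphic function behind a bounded limit of polynomials\<close>

locale polynomial_limit = hardy_kernel G \<theta> k \<Omega> \<mu> M S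
  for G :: "(complex^'n^'n) set" and \<theta> k \<Omega> \<mu> M S +
  fixes \<phi> :: "complex^'n \<Rightarrow> complex" and p :: "nat \<Rightarrow> complex^'n \<Rightarrow> complex"
  assumes \<phi>_L2: "\<phi> \<in> L2 M" and \<phi>_bound: "AE x in M. norm (\<phi> x) \<le> 1"
    and p: "polynomial_fun (p j)" and p_limit: "(\<lambda>j. sq_norm M (\<lambda>x. p j x - \<phi> x)) \<longlonglongrightarrow> 0"
begin

definition f :: "complex^'n \<Rightarrow> complex" where "f w = (\<integral>x. \<phi> x * cnj (boundary_kernel w x) \<partial>M)"

lemma p_tendsto_f: assumes w: "w \<in> \<theta> ` \<Omega>" shows "(\<lambda>j. p j w) \<longlonglongrightarrow> f w"
proof -
  have "(\<lambda>j. \<integral>x. p j x * cnj (boundary_kernel w x) \<partial>M) \<longlonglongrightarrow> f w"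
    unfolding f_def
    by (rule th.tendsto_integral_mult[OF polynomial_fun_L2_M[OF p] \<phi>_L2 th.L2_cnj[OF boundary_kernel_L2[OF w]] p_limit])
  thus ?thesis by (simp add: reproducing[OF w polynomial_fun_regular[OF p]])
qed

text \<open>One factor \<phi> at a time is approximated by polynomials; the statement carries a
  polynomial \<open>q\<close> so that the approximant can be absorbed into it. Boundedness of \<phi>
  keeps the remaining factor in L2.\<close>

lemma evaluation_multiplicative:
  assumes w: "w \<in> \<theta> ` \<Omega>" and q: "polynomial_fun q"
  shows "(\<integral>x. q x * (\<phi> x ^ n * cnj (boundary_kernel w x)) \<partial>M) = q w * f w ^ n"
  using q
proof (induction n arbitrary: q)
  case 0
  show ?case using reproducing[OF w polynomial_fun_regular[OF 0]] by simp
next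
  case (Suc n)
  have qc: "continuous_on (\<theta> ` closure \<Omega>) q" by (rule polynomial_fun_continuous_on[OF Suc.prems])
  obtain B where B: "\<And>z. z \<in> closure \<Omega> \<Longrightarrow> norm (q (\<theta> z)) \<le> B"
    using bounded_on_closure[OF theta_compose_continuous[OF qc]] by blast
  have L: "(\<lambda>x. (q x * \<phi> x ^ n) * cnj (boundary_kernel w x)) \<in> L2 M"
  proof (rule th.L2_mult_bounded[OF th.L2_cnj[OF boundary_kernel_L2[OF w]]])
    show "(\<lambda>x. q x * \<phi> x ^ n) \<in> borel_measurable M"
      by (intro borel_measurable_times borel_measurable_power measurable_M qc th.L2_measurable \<phi>_L2)
    show "AE x in M. norm (q x * \<phi> x ^ n) \<le> B * 1"
      using \<phi>_bound AE_space
    proof eventually_elim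
      case (elim x)
      have "norm (q x) \<le> B" using elim(2) space_M_subset B by blast
      moreover have "norm (\<phi> x) ^ n \<le> 1" using elim(1) by (intro power_le_one) auto
      moreover have "0 \<le> B" using norm_ge_zero[of "q x"] \<open>norm (q x) \<le> B\<close> by linarith
      ultimately show ?case unfolding norm_mult norm_power by (intro mult_mono) auto
    qed
  qed
  have "(\<lambda>j. \<integral>x. p j x * ((q x * \<phi> x ^ n) * cnj (boundary_kernel w x)) \<partial>M) \<longlonglongrightarrow>
        (\<integral>x. \<phi> x * ((q x * \<phi> x ^ n) * cnj (boundary_kernel w x)) \<partial>M)"
    by (rule th.tendsto_integral_mult[OF polynomial_fun_L2_M[OF p] \<phi>_L2 L p_limit])
  moreover have "(\<integral>x. p j x * ((q x * \<phi> x ^ n) * cnj (boundary_kernel w x)) \<partial>M) = p j w * (q w * f w ^ n)" for j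
    using Suc.IH[OF polynomial_fun_mult[OF p[of j] Suc.prems]] by (simp add: mult.assoc)
  moreover have "(\<lambda>j. p j w * (q w * f w ^ n)) \<longlonglongrightarrow> f w * (q w * f w ^ n)"
    by (rule tendsto_mult[OF p_tendsto_f[OF w] tendsto_const])
  ultimately have "(\<integral>x. \<phi> x * ((q x * \<phi> x ^ n) * cnj (boundary_kernel w x)) \<partial>M) = f w * (q w * f w ^ n)"
    by (simp add: LIMSEQ_unique)
  thus ?case by (simp add: mult_ac)
qed

text \<open>All powers of \<open>norm (f w)\<close> are bounded by the L1 norm of one kernel
  function, a constant independent of the exponent.\<close>

lemma f_bound: assumes w: "w \<in> \<theta> ` \<Omega>" shows "norm (f w) \<le> 1"
proof (rule ccontr)
  assume "\<not> norm (f w) \<le> 1"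
  define C where "C = (\<integral>x. norm (boundary_kernel w x) \<partial>M)"
  have sL: "boundary_kernel w \<in> L2 M" by (rule boundary_kernel_L2[OF w])
  have "norm (f w) ^ n \<le> C" for n
  proof -
    have L: "(\<lambda>x. \<phi> x ^ n * cnj (boundary_kernel w x)) \<in> L2 M"
    proof (rule th.L2_mult_bounded[OF th.L2_cnj[OF sL]])
      show "(\<lambda>x. \<phi> x ^ n) \<in> borel_measurable M" by (intro borel_measurable_power th.L2_measurable \<phi>_L2)
      show "AE x in M. norm (\<phi> x ^ n) \<le> 1"
        using \<phi>_bound by eventually_elim (simp add: norm_power power_le_one)
    qed
    have "norm (f w ^ n) = norm (\<integral>x. \<phi> x ^ n * cnj (boundary_kernel w x) \<partial>M)"
      using evaluation_multiplicative[OF w polynomial_fun_const, of 1 n] by simp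
    also have "\<dots> \<le> (\<integral>x. norm (\<phi> x ^ n * cnj (boundary_kernel w x)) \<partial>M)" by (rule integral_norm_bound)
    also have "\<dots> \<le> C" unfolding C_def
    proof (rule integral_mono_AE)
      show "integrable M (\<lambda>x. norm (\<phi> x ^ n * cnj (boundary_kernel w x)))" by (rule integrable_norm[OF th.L2_integrable[OF L]])
      show "integrable M (\<lambda>x. norm (boundary_kernel w x))" by (rule integrable_norm[OF th.L2_integrable[OF sL]])
      show "AE x in M. norm (\<phi> x ^ n * cnj (boundary_kernel w x)) \<le> norm (boundary_kernel w x)"
        using \<phi>_bound by eventually_elim (simp add: norm_mult norm_power power_le_one mult_left_le_one_le)
    qed
    finally show ?thesis by (simp add: norm_power)
  qed
  moreover obtain n where "C < norm (f w) ^ n" using real_arch_pow[of "norm (f w)" C] \<open>\<not> norm (f w) \<le> 1\<close> by auto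
  ultimately show False by (meson not_le)
qed

text \<open>A rotation of \<open>z\<close> becomes a diagonal substitution on the image, which
  preserves the L2 norm of polynomials. The evaluation constant at \<open>z\<close> therefore serves
  the whole circle through \<open>z\<close>.\<close>

lemma circle_evaluation_bound:
  assumes P: "polynomial_fun P" and z: "z \<in> \<Omega>" and t: "norm t = 1"
  shows "norm (P (\<theta> (t *s z))) \<le> sqrt (sq_norm M P) * sqrt (sq_norm M (boundary_kernel (\<theta> z)))"
proof -
  define q where "q \<zeta> = P (\<chi> j. t ^ k j * \<zeta> $ j)" for \<zeta>
  have q: "polynomial_fun q" unfolding q_def by (rule polynomial_fun_compose[OF P]) (simp add: polynomial_fun_mult)
  have qt: "q (\<theta> y) = P (\<theta> (t *s y))" for y
    unfolding q_def by (rule arg_cong[of _ _ P]) (simp add: vec_eq_iff theta_homogeneous)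
  have bm: "polynomial_fun Q \<Longrightarrow> Q \<in> borel_measurable borel" for Q :: "complex^'n \<Rightarrow> complex"
    by (intro borel_measurable_continuous_onI polynomial_fun_continuous_on)
  have n: "norm (lift_J \<theta> q y) = norm (lift_J \<theta> P (t *s y))" for y
    by (simp add: lift_J_def qt J_homogeneous norm_mult norm_power t)
  have "sq_norm \<mu> (lift_J \<theta> q) = (\<integral>y. (norm (lift_J \<theta> P (t *s y)))\<^sup>2 \<partial>\<mu>)" by (simp add: sq_norm_def n)
  also have "\<dots> = sq_norm \<mu> (lift_J \<theta> P)" unfolding sq_norm_def
    by (rule integral_mu_circle[OF t])
       (intro borel_measurable_power measurable_compose[OF measurable_lift[OF bm[OF P]] borel_measurable_norm])
  finally have "sq_norm M q = sq_norm M P" by (simp add: sq_norm_lift bm P q)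
  moreover have w: "\<theta> z \<in> \<theta> ` \<Omega>" using z by simp
  have "q (\<theta> z) = (\<integral>x. q x * cnj (boundary_kernel (\<theta> z) x) \<partial>M)"
    by (rule reproducing[OF w polynomial_fun_regular[OF q], symmetric])
  moreover have "norm (\<integral>x. q x * cnj (boundary_kernel (\<theta> z) x) \<partial>M) \<le>
      sqrt (sq_norm M q) * sqrt (sq_norm M (\<lambda>x. cnj (boundary_kernel (\<theta> z) x)))"
    by (rule th.cauchy_schwarz[OF polynomial_fun_L2_M[OF q] th.L2_cnj[OF boundary_kernel_L2[OF w]]])
  ultimately show ?thesis by (simp add: qt)
qed

lemma polynomial_theta_holo: "polynomial_fun P \<Longrightarrow> holo (\<lambda>z. P (\<theta> z)) \<Omega>"
  by (intro theta_compose_holo polynomial_fun_holo)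

definition h :: "nat \<Rightarrow> nat \<Rightarrow> complex^'n \<Rightarrow> complex" where
  "h j n z = hom_part n (\<lambda>y. p j (\<theta> y)) z"

text \<open>The norm of the reproducing kernel at \<open>\<theta> z\<close>, which bounds evaluation
  there on polynomials.\<close>

definition K :: "complex^'n \<Rightarrow> real" where "K z = sqrt (sq_norm M (boundary_kernel (\<theta> z)))"

definition e :: "nat \<Rightarrow> real" where "e j = sqrt (sq_norm M (\<lambda>x. p j x - \<phi> x))"

lemma e_tendsto: "e \<longlonglongrightarrow> 0"
  unfolding e_def[abs_def] using tendsto_real_sqrt[OF p_limit] by simp

text \<open>Cauchy's estimate on the circle of radius exactly 1, which lies in the domain; the bound
  is thus free of \<open>n\<close>.\<close>

lemma h_diff: assumes z: "z \<in> \<Omega>" shows "norm (h i n z - h j n z) \<le> (e i + e j) * K z"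
proof -
  have d: "polynomial_fun (\<lambda>x. p i x - p j x)" by (intro polynomial_fun_diff p)
  have "(deriv ^^ n) (\<lambda>t. p i (\<theta> (t *s z)) - p j (\<theta> (t *s z))) 0 =
        (deriv ^^ n) (\<lambda>t. p i (\<theta> (t *s z))) 0 - (deriv ^^ n) (\<lambda>t. p j (\<theta> (t *s z))) 0"
    by (rule higher_deriv_diff[OF holomorphic_slice[OF polynomial_theta_holo[OF p]]
          holomorphic_slice[OF polynomial_theta_holo[OF p]] open_slice]) (simp add: zero_mem)
  hence "h i n z - h j n z = hom_part n (\<lambda>y. p i (\<theta> y) - p j (\<theta> y)) z"
    by (simp add: h_def hom_part_def diff_divide_distrib)
  also have "norm \<dots> \<le> (sqrt (sq_norm M (\<lambda>x. p i x - p j x)) * K z) / 1 ^ n"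
  proof (rule hom_part_bound[OF polynomial_theta_holo[OF d] zero_less_one])
    show "t *s z \<in> \<Omega>" if "norm t \<le> 1" for t by (rule scaled_mem[OF that z])
    show "norm (p i (\<theta> (t *s z)) - p j (\<theta> (t *s z))) \<le> sqrt (sq_norm M (\<lambda>x. p i x - p j x)) * K z" if "norm t = 1" for t
      unfolding K_def by (rule circle_evaluation_bound[OF d z that])
  qed
  also have "sqrt (sq_norm M (\<lambda>x. p i x - p j x)) \<le> e i + e j"
  proof -
    have L: "(\<lambda>x. p l x - \<phi> x) \<in> L2 M" for l by (rule th.L2_diff[OF polynomial_fun_L2_M[OF p] \<phi>_L2])
    have L': "(\<lambda>x. \<phi> x - p l x) \<in> L2 M" for l by (rule th.L2_diff[OF \<phi>_L2 polynomial_fun_L2_M[OF p]])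
    have "sqrt (sq_norm M (\<lambda>x. (p i x - \<phi> x) + (\<phi> x - p j x))) \<le> e i + sqrt (sq_norm M (\<lambda>x. \<phi> x - p j x))"
      unfolding e_def by (rule th.sq_norm_triangle[OF L L'])
    thus ?thesis by (simp add: e_def sq_norm_minus_commute[of M \<phi>])
  qed
  finally show ?thesis by (simp add: mult_right_mono K_def)
qed

lemma h_scale: "h j n (c *s z) = c ^ n * h j n z"
  unfolding h_def by (rule hom_part_scale[OF polynomial_theta_holo[OF p]])

text \<open>Inside the domain the Cauchy property follows from \<open>h_diff\<close>; homogeneity
  extends convergence to all \<open>z\<close>, which is needed at the grid points of the
  interpolation formula.\<close>

lemma h_convergent: "convergent (\<lambda>j. h j n z)"
proof -
  have in_domain: "convergent (\<lambda>j. h j n y)" if y: "y \<in> \<Omega>" for y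
  proof -
    have "Cauchy (\<lambda>j. h j n y)"
    proof (rule CauchyI)
      fix \<epsilon> :: real assume \<epsilon>: "\<epsilon> > 0"
      have K0: "K y \<ge> 0" by (simp add: K_def)
      have "\<forall>\<^sub>F j in sequentially. e j < \<epsilon> / (2 * (K y + 1))"
        by (rule order_tendstoD(2)[OF e_tendsto]) (use \<epsilon> K0 in simp)
      then obtain N where N: "\<And>j. j \<ge> N \<Longrightarrow> e j < \<epsilon> / (2 * (K y + 1))" unfolding eventually_sequentially by blast
      have "norm (h i n y - h j n y) < \<epsilon>" if ij: "i \<ge> N" "j \<ge> N" for i j
      proof -
        have s: "e i + e j < \<epsilon> / (K y + 1)" using N[OF ij(1)] N[OF ij(2)] K0 by (simp add: field_simps)
        have "norm (h i n y - h j n y) \<le> (e i + e j) * K y" by (rule h_diff[OF y])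
        also have "\<dots> \<le> (e i + e j) * (K y + 1)" by (intro mult_left_mono) (auto simp: e_def)
        also have "\<dots> < \<epsilon>" using s K0 by (simp add: field_simps)
        finally show ?thesis .
      qed
      thus "\<exists>N. \<forall>i\<ge>N. \<forall>j\<ge>N. norm (h i n y - h j n y) < \<epsilon>" by blast
    qed
    thus ?thesis by (rule Cauchy_convergent)
  qed
  obtain d where d: "d > 0" "ball 0 d \<subseteq> \<Omega>" using open_domain zero_mem open_contains_ball by blast
  define r where "r = d / (2 * (norm z + 1))"
  have r0: "norm z + 1 > 0" using norm_ge_zero[of z] by linarith
  have r: "r > 0" using d(1) r0 by (simp add: r_def)
  have "norm (complex_of_real r *s z) = r * norm z" using r by simp
  also have "\<dots> = d / 2 * (norm z / (norm z + 1))" by (simp add: r_def)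
  also have "\<dots> \<le> d / 2 * 1" using d(1) r0 by (intro mult_left_mono) auto
  also have "\<dots> < d" using d(1) by simp
  finally have "complex_of_real r *s z \<in> \<Omega>" using d(2) by auto
  from in_domain[OF this] obtain l where l: "(\<lambda>j. of_real r ^ n * h j n z) \<longlonglongrightarrow> l"
    unfolding h_scale convergent_def by blast
  have "(\<lambda>j. inverse (of_real r ^ n) * (of_real r ^ n * h j n z)) \<longlonglongrightarrow> inverse (of_real r ^ n) * l"
    by (rule tendsto_mult[OF tendsto_const l])
  hence "(\<lambda>j. h j n z) \<longlonglongrightarrow> inverse (of_real r ^ n) * l" using r by (simp add: mult.assoc[symmetric])
  thus ?thesis by (rule convergentI)
qed

definition g :: "nat \<Rightarrow> complex^'n \<Rightarrow> complex" where "g n z = lim (\<lambda>j. h j n z)"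

lemma h_tendsto_g: "(\<lambda>j. h j n z) \<longlonglongrightarrow> g n z"
  unfolding g_def using h_convergent by (simp add: convergent_LIMSEQ_iff)

lemma g_scale: "g n (c *s z) = c ^ n * g n z"
  using LIMSEQ_unique[OF h_tendsto_g[of n "c *s z"]] tendsto_mult[OF tendsto_const h_tendsto_g, of "c ^ n" n z]
  by (simp add: h_scale)

text \<open>The interpolation formula is a finite sum over values at fixed grid points, so it passes
  to the pointwise limit.\<close>

lemma polynomial_fun_g: "polynomial_fun (g n)"
proof -
  have "g n z = grid_interpolation n (g n) z" for z
  proof (rule LIMSEQ_unique[OF h_tendsto_g])
    have "grid_interpolation n (h j n) z = h j n z" for j
      unfolding h_def by (rule grid_interpolation_eq[OF hom_part_coordinate_poly[OF polynomial_theta_holo[OF p]]])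
    moreover have "(\<lambda>j. grid_interpolation n (h j n) z) \<longlonglongrightarrow> grid_interpolation n (g n) z"
      unfolding grid_interpolation_def by (intro tendsto_sum tendsto_mult tendsto_const h_tendsto_g)
    ultimately show "(\<lambda>j. h j n z) \<longlonglongrightarrow> grid_interpolation n (g n) z" by simp
  qed
  hence "g n = grid_interpolation n (g n)" by (simp add: fun_eq_iff)
  thus ?thesis using polynomial_fun_grid_interpolation[of n "g n"] by simp
qed

lemma g_factor: "\<exists>P. polynomial_fun P \<and> (\<forall>z. g n z = P (\<theta> z))"
proof (rule invariant_factor[OF polynomial_fun_g])
  fix a z assume a: "a \<in> G"
  have "h j n (a *v z) = h j n z" for j
    using hom_part_compose_matrix[of n "\<lambda>y. p j (\<theta> y)" a z] by (simp add: h_def theta_invariant[OF a])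
  thus "g n (a *v z) = g n z" by (simp add: g_def)
qed

lemma f_expansion:
  assumes z: "z \<in> \<Omega>" and t: "norm t < 1"
  shows "(\<lambda>n. g n z * t ^ n) sums f (\<theta> (t *s z))"
proof (rule power_series_limit[OF _ _ _ t])
  have zc: "z \<in> closure \<Omega>" using z closure_subset by blast
  show "(\<lambda>n. h j n z * t ^ n) sums p j (\<theta> (t *s z))" for j
    unfolding h_def by (rule hom_part_sums[OF polynomial_theta_holo[OF p] zc t])
  show "norm (h j n z - g n z) \<le> e j * K z" for j n
  proof (rule tendsto_le[OF sequentially_bot _ _ always_eventually[OF allI[OF h_diff[OF z]]]])
    show "(\<lambda>i. (e j + e i) * K z) \<longlonglongrightarrow> e j * K z"
      using tendsto_mult[OF tendsto_add[OF tendsto_const[of "e j"] e_tendsto] tendsto_const[of "K z"]] by simp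
    show "(\<lambda>i. norm (h j n z - h i n z)) \<longlonglongrightarrow> norm (h j n z - g n z)"
      by (intro tendsto_norm tendsto_diff tendsto_const h_tendsto_g)
  qed
  show "(\<lambda>j. e j * K z) \<longlonglongrightarrow> 0" by (rule tendsto_mult_left_zero[OF e_tendsto])
  have "\<theta> (t *s z) \<in> \<theta> ` \<Omega>" using scaled_mem[OF less_imp_le[OF t] z] by blast
  thus "(\<lambda>j. p j (\<theta> (t *s z))) \<longlonglongrightarrow> f (\<theta> (t *s z))" by (rule p_tendsto_f)
qed

lemma g_bound: assumes z: "z \<in> \<Omega>" shows "norm (g n z) \<le> 1"
proof (rule power_series_coefficient_bound[OF f_expansion[OF z]])
  show "norm (f (\<theta> (t *s z))) \<le> 1" if "norm t < 1" for t
    using scaled_mem[OF less_imp_le[OF that] z] by (intro f_bound) blast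
qed

text \<open>The homogeneous parts \<open>g n\<close> are invariant, hence polynomials
  \<open>P n\<close> in \<theta>, and \<open>f\<close> is the sum of these on the image. Near a
  given point convergence is geometric, so no local inverse of \<theta> is used.\<close>

theorem f_schur_class: "f \<in> schur_class (\<theta> ` \<Omega>)"
proof -
  have "\<exists>P. \<forall>n. polynomial_fun (P n) \<and> (\<forall>z. g n z = P n (\<theta> z))" by (intro choice allI g_factor)
  then obtain P where P: "\<And>n. polynomial_fun (P n)" "\<And>n z. g n z = P n (\<theta> z)" by blast
  have sums: "(\<lambda>n. P n (\<theta> z)) sums f (\<theta> z)" if z: "z \<in> \<Omega>" for z
  proof -
    obtain r y where r: "0 < r" "r < 1" and y: "y \<in> \<Omega>" "z = complex_of_real r *s y" by (rule scaled_preimage[OF z])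
    have "norm (complex_of_real r) < 1" using r by simp
    from f_expansion[OF y(1) this] show ?thesis by (simp add: P(2)[symmetric] y(2) g_scale mult.commute)
  qed
  have "\<exists>f'. (f has_derivative f') (at v) \<and> (\<forall>c u. f' (c *s u) = c * f' u)" if v: "v \<in> \<theta> ` \<Omega>" for v
  proof -
    obtain z where z: "z \<in> \<Omega>" "v = \<theta> z" using v by blast
    obtain r y where r: "0 < r" "r < 1" and y: "y \<in> \<Omega>" "z = complex_of_real r *s y" by (rule scaled_preimage[OF z(1)])
    \<comment> \<open>An open neighbourhood of \<open>v\<close>; on it homogeneity and the bound 1
      for \<open>g n\<close> give \<open>norm (P n x) \<le> r ^ n\<close>.\<close>
    define U where "U = \<theta> ` ((\<lambda>x. r *\<^sub>R x) ` \<Omega>)"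
    have U: "open U" unfolding U_def by (intro theta_open_map open_scaling open_domain) (use r in simp)
    have vU: "v \<in> U" using y z(2) by (auto simp: U_def of_real_vector_smult)
    have "holo f U"
    proof (rule holo_series[OF P(1) U])
      show "summable (\<lambda>n. r ^ n)" using r by (intro summable_geometric) simp
      fix x assume "x \<in> U"
      then obtain u where u: "u \<in> \<Omega>" "x = \<theta> (complex_of_real r *s u)" by (auto simp: U_def of_real_vector_smult)
      have ru: "complex_of_real r *s u \<in> \<Omega>" using r by (intro scaled_mem u) simp
      show "(\<lambda>n. P n x) sums f x" using sums[OF ru] u(2) by simp
      show "norm (P n x) \<le> r ^ n" for n
        using g_bound[OF u(1), of n] r by (simp add: u(2) P(2)[symmetric] g_scale norm_mult norm_power mult_left_le)
    qed
    from holo_has_derivative[OF this U vU] show ?thesis .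
  qed
  hence "holo f (\<theta> ` \<Omega>)" unfolding holo_def by (meson has_derivative_at_withinI)
  thus ?thesis using f_bound by (simp add: schur_class_def)
qed

end

section \<open>From contractivity to interpolation\<close>

context interpolation_data
begin

text \<open>Explicit representatives inside the given space: continuous kernel combinations, and
  polynomials vanishing at 0 for the third summand. Density of polynomials makes this smaller space
  strong enough for the representing function.\<close>

definition test_functions :: "(complex^'n \<Rightarrow> complex) set" where
  "test_functions = {\<lambda>x. cnj (combination a x) + m x + P x | a m P.
     m \<in> M_theta \<Omega> \<theta> \<mu> M \<and> polynomial_fun P \<and> P 0 = 0}"

lemma test_functionsI:
  "m \<in> M_theta \<Omega> \<theta> \<mu> M \<Longrightarrow> polynomial_fun P \<Longrightarrow> P 0 = 0 \<Longrightarrow>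
    (\<lambda>x. cnj (combination a x) + m x + P x) \<in> test_functions"
  unfolding test_functions_def by blast

lemma M_theta_L2: "m \<in> M_theta \<Omega> \<theta> \<mu> M \<Longrightarrow> m \<in> L2 M" by (simp add: M_theta_def)

lemma M_theta_zero: "(\<lambda>_. 0) \<in> M_theta \<Omega> \<theta> \<mu> M"
  by (rule M_theta_I[OF th.L2_const]) simp_all

lemma M_theta_add:
  assumes m: "m \<in> M_theta \<Omega> \<theta> \<mu> M" "m' \<in> M_theta \<Omega> \<theta> \<mu> M" shows "(\<lambda>x. m x + m' x) \<in> M_theta \<Omega> \<theta> \<mu> M"
proof (rule M_theta_I[OF th.L2_add[OF M_theta_L2[OF m(1)] M_theta_L2[OF m(2)]]])
  fix h assume h: "h \<in> H2_theta_boundary \<Omega> \<theta> \<mu> M"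
  note hL = H2_theta_boundary_L2[OF h] and mL = M_theta_L2[OF m(1)] M_theta_L2[OF m(2)]
  have "(\<integral>x. m x * cnj (h x) + m' x * cnj (h x) \<partial>M) = 0"
    unfolding Bochner_Integration.integral_add[OF th.L2_integrable_mult_cnj[OF mL(1) hL] th.L2_integrable_mult_cnj[OF mL(2) hL]]
    by (simp add: M_theta_orthogonal[OF m(1) h] M_theta_orthogonal[OF m(2) h])
  thus "(\<integral>x. (m x + m' x) * cnj (h x) \<partial>M) = 0" by (simp add: distrib_right)
  have "(\<integral>x. h x * m x + h x * m' x \<partial>M) = 0"
    unfolding Bochner_Integration.integral_add[OF th.L2_integrable_mult[OF hL mL(1)] th.L2_integrable_mult[OF hL mL(2)]]
    by (simp add: M_theta_orthogonal[OF m(1) h] M_theta_orthogonal[OF m(2) h])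
  thus "(\<integral>x. (m x + m' x) * h x \<partial>M) = 0" by (simp add: distrib_left mult.commute)
qed

lemma M_theta_scale:
  assumes m: "m \<in> M_theta \<Omega> \<theta> \<mu> M" shows "(\<lambda>x. b * m x) \<in> M_theta \<Omega> \<theta> \<mu> M"
proof (rule M_theta_I[OF th.L2_scale[OF M_theta_L2[OF m]]])
  fix h assume h: "h \<in> H2_theta_boundary \<Omega> \<theta> \<mu> M"
  show "(\<integral>x. b * m x * cnj (h x) \<partial>M) = 0" using M_theta_orthogonal(1)[OF m h] by (simp add: mult.assoc)
  show "(\<integral>x. b * m x * h x \<partial>M) = 0" using M_theta_orthogonal(2)[OF m h] by (simp add: mult.assoc mult.commute[of "h _"])
qed

lemma test_functions_subspace:
  shows "test_functions \<subseteq> L2 M" "(\<lambda>_. 0) \<in> test_functions"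
    and "u \<in> test_functions \<Longrightarrow> v \<in> test_functions \<Longrightarrow> (\<lambda>x. u x + v x) \<in> test_functions"
    and "u \<in> test_functions \<Longrightarrow> (\<lambda>x. b * u x) \<in> test_functions"
proof -
  show "test_functions \<subseteq> L2 M"
  proof
    fix u assume "u \<in> test_functions"
    then obtain a m P where u: "u = (\<lambda>x. cnj (combination a x) + m x + P x)"
      "m \<in> M_theta \<Omega> \<theta> \<mu> M" "polynomial_fun P" unfolding test_functions_def by blast
    show "u \<in> L2 M" unfolding u(1)
      by (rule th.L2_add[OF th.L2_add[OF th.L2_cnj[OF regular_L2[OF combination_regular]] M_theta_L2[OF u(2)]] polynomial_fun_L2_M[OF u(3)]])
  qed
  show "(\<lambda>_. 0) \<in> test_functions"
    using test_functionsI[OF M_theta_zero polynomial_fun_const, of 0 "\<lambda>_. 0"] by (simp add: combination_def)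
  show "(\<lambda>x. u x + v x) \<in> test_functions" if uv: "u \<in> test_functions" "v \<in> test_functions"
  proof -
    obtain a m P where u: "u = (\<lambda>x. cnj (combination a x) + m x + P x)"
      "m \<in> M_theta \<Omega> \<theta> \<mu> M" "polynomial_fun P" "P 0 = 0" using uv(1) unfolding test_functions_def by blast
    obtain a' m' P' where v: "v = (\<lambda>x. cnj (combination a' x) + m' x + P' x)"
      "m' \<in> M_theta \<Omega> \<theta> \<mu> M" "polynomial_fun P'" "P' 0 = 0" using uv(2) unfolding test_functions_def by blast
    have "(\<lambda>x. u x + v x) = (\<lambda>x. cnj (combination (\<lambda>i. a i + a' i) x) + (m x + m' x) + (P x + P' x))"
      by (simp add: fun_eq_iff u(1) v(1) combination_def distrib_right sum.distrib)
    thus ?thesis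
      using test_functionsI[OF M_theta_add[OF u(2) v(2)] polynomial_fun_add[OF u(3) v(3)], of "\<lambda>i. a i + a' i"] u(4) v(4)
      by simp
  qed
  show "(\<lambda>x. b * u x) \<in> test_functions" if u: "u \<in> test_functions"
  proof -
    obtain a m P where u: "u = (\<lambda>x. cnj (combination a x) + m x + P x)"
      "m \<in> M_theta \<Omega> \<theta> \<mu> M" "polynomial_fun P" "P 0 = 0" using u unfolding test_functions_def by blast
    have "(\<lambda>x. b * u x) = (\<lambda>x. cnj (combination (\<lambda>i. cnj b * a i) x) + b * m x + b * P x)"
      by (simp add: fun_eq_iff u(1) combination_def distrib_left sum_distrib_left mult.assoc)
    moreover have "polynomial_fun (\<lambda>x. b * P x)" by (rule polynomial_fun_mult[OF polynomial_fun_const u(3)])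
    ultimately show ?thesis
      using test_functionsI[OF M_theta_scale[OF u(2), of b], of "\<lambda>x. b * P x" "\<lambda>i. cnj b * a i"] u(4)
      by simp
  qed
qed

lemma test_functions_M_Q: "test_functions \<subseteq> M_Q \<Omega> \<theta> k \<mu> M (kernel_span S \<zeta>)"
proof
  fix u assume "u \<in> test_functions"
  then obtain a m P where u: "u = (\<lambda>x. cnj (combination a x) + m x + P x)"
    "m \<in> M_theta \<Omega> \<theta> \<mu> M" "polynomial_fun P" "P 0 = 0" unfolding test_functions_def by blast
  have "(\<lambda>x. cnj (combination a x)) \<in> conj_set (boundary_functions k M (kernel_span S \<zeta>))"
    unfolding conj_set_def using combination_boundary_function by blast
  moreover have "P \<in> H2_theta_boundary_0 \<Omega> \<theta> \<mu> M"
    using polynomial_fun_H2_theta_boundary[OF u(3)] integral_M_polynomial[OF u(3)] u(4)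
    by (simp add: H2_theta_boundary_0_def L2_inner_def)
  ultimately show "u \<in> M_Q \<Omega> \<theta> k \<mu> M (kernel_span S \<zeta>)" unfolding M_Q_def u(1) using u(2)
    by (intro CollectI exI[of _ "\<lambda>x. cnj (combination a x)"] exI[of _ m] exI[of _ P] conjI refl)
qed

text \<open>The component orthogonal to the polynomials lies, together with its conjugate, in \<open>M_theta\<close>, and hence is
  orthogonal to itself.\<close>

lemma annihilator_polynomial_limit:
  assumes \<phi>: "\<phi> \<in> L2 M"
    and m0: "\<And>m. m \<in> M_theta \<Omega> \<theta> \<mu> M \<Longrightarrow> (\<integral>x. \<phi> x * m x \<partial>M) = 0"
    and P0: "\<And>P. polynomial_fun P \<Longrightarrow> P 0 = 0 \<Longrightarrow> (\<integral>x. \<phi> x * P x \<partial>M) = 0"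
  shows "\<exists>p. (\<forall>j::nat. polynomial_fun (p j)) \<and> (\<lambda>j. sq_norm M (\<lambda>x. p j x - \<phi> x)) \<longlonglongrightarrow> 0"
proof -
  have "\<exists>p y. (\<forall>j::nat. p j \<in> Collect polynomial_fun) \<and> y \<in> L2 M \<and> (\<lambda>j. sq_norm M (\<lambda>x. p j x - (\<phi> x - y x))) \<longlonglongrightarrow> 0 \<and>
    (\<forall>g\<in>Collect polynomial_fun. (\<integral>x. y x * cnj (g x) \<partial>M) = 0)"
    by (rule th.L2_projection[OF _ _ _ _ \<phi>])
      (auto intro: polynomial_fun_L2_M polynomial_fun_add polynomial_fun_mult polynomial_fun_const)
  then obtain p y where p: "\<And>j::nat. polynomial_fun (p j)" and y: "y \<in> L2 M"
    and lim: "(\<lambda>j. sq_norm M (\<lambda>x. p j x - (\<phi> x - y x))) \<longlonglongrightarrow> 0"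
    and o: "\<And>P. polynomial_fun P \<Longrightarrow> (\<integral>x. y x * cnj (P x) \<partial>M) = 0" by blast
  have zL: "(\<lambda>x. \<phi> x - y x) \<in> L2 M" by (rule th.L2_diff[OF \<phi> y])
  have y0: "(\<integral>x. y x * P x \<partial>M) = 0" if P: "polynomial_fun P" for P
  proof -
    \<comment> \<open>The annihilation hypothesis covers only polynomials vanishing at 0; the
      constant is handled by orthogonality of \<open>y\<close> to 1.\<close>
    define P' where "P' x = P x - P 0" for x
    have P': "polynomial_fun P'" unfolding P'_def by (rule polynomial_fun_diff[OF P polynomial_fun_const])
    have "(\<lambda>j. \<integral>x. p j x * P' x \<partial>M) \<longlonglongrightarrow> (\<integral>x. (\<phi> x - y x) * P' x \<partial>M)"
      by (rule th.tendsto_integral_mult[OF polynomial_fun_L2_M[OF p] zL polynomial_fun_L2_M[OF P'] lim])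
    moreover have "(\<integral>x. p j x * P' x \<partial>M) = 0" for j
      using integral_M_polynomial[OF polynomial_fun_mult[OF p[of j] P']] by (simp add: P'_def)
    ultimately have "(\<integral>x. (\<phi> x - y x) * P' x \<partial>M) = 0" by (simp add: LIMSEQ_const_iff)
    moreover have "(\<integral>x. (\<phi> x - y x) * P' x \<partial>M) = (\<integral>x. \<phi> x * P' x \<partial>M) - (\<integral>x. y x * P' x \<partial>M)"
      unfolding left_diff_distrib
      by (rule Bochner_Integration.integral_diff[OF th.L2_integrable_mult[OF \<phi> polynomial_fun_L2_M[OF P']]
            th.L2_integrable_mult[OF y polynomial_fun_L2_M[OF P']]])
    moreover have "(\<integral>x. \<phi> x * P' x \<partial>M) = 0" by (rule P0[OF P']) (simp add: P'_def)
    ultimately have yP': "(\<integral>x. y x * P' x \<partial>M) = 0" by simp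
    have "(\<integral>x. y x \<partial>M) = 0" using o[OF polynomial_fun_const[of 1]] by simp
    hence yc: "(\<integral>x. y x * P 0 \<partial>M) = 0" by simp
    have "(\<integral>x. y x * P x \<partial>M) = (\<integral>x. y x * P' x + y x * P 0 \<partial>M)" by (simp add: P'_def algebra_simps)
    also have "\<dots> = 0"
      using Bochner_Integration.integral_add[OF th.L2_integrable_mult[OF y polynomial_fun_L2_M[OF P']] th.L2_integrable_mult[OF y th.L2_const[of "P 0"]]]
        yP' yc by simp
    finally show ?thesis .
  qed
  have yH: "(\<integral>x. y x * h x \<partial>M) = 0" and yHc: "(\<integral>x. y x * cnj (h x) \<partial>M) = 0"
    if h: "h \<in> H2_theta_boundary \<Omega> \<theta> \<mu> M" for h
  proof -
    obtain q where q: "\<And>j::nat. polynomial_fun (q j)" "(\<lambda>j. sq_norm M (\<lambda>x. q j x - h x)) \<longlonglongrightarrow> 0"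
      using H2_theta_boundary_sequence[OF h] by blast
    note hL = H2_theta_boundary_L2[OF h]
    have "(\<lambda>j. \<integral>x. q j x * y x \<partial>M) \<longlonglongrightarrow> (\<integral>x. h x * y x \<partial>M)"
      by (rule th.tendsto_integral_mult[OF polynomial_fun_L2_M[OF q(1)] hL y q(2)])
    thus "(\<integral>x. y x * h x \<partial>M) = 0" using y0[OF q(1)] by (simp add: mult.commute LIMSEQ_const_iff)
    have "(\<lambda>j. sq_norm M (\<lambda>x. cnj (q j x) - cnj (h x))) \<longlonglongrightarrow> 0"
      using q(2) by (simp flip: complex_cnj_diff)
    from th.tendsto_integral_mult[OF th.L2_cnj[OF polynomial_fun_L2_M[OF q(1)]] th.L2_cnj[OF hL] y this]
    have "(\<lambda>j. \<integral>x. cnj (q j x) * y x \<partial>M) \<longlonglongrightarrow> (\<integral>x. cnj (h x) * y x \<partial>M)" .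
    thus "(\<integral>x. y x * cnj (h x) \<partial>M) = 0" using o[OF q(1)] by (simp add: mult.commute LIMSEQ_const_iff)
  qed
  have cnj_int: "(\<integral>x. cnj (u x) \<partial>M) = cnj (\<integral>x. u x \<partial>M)" for u by (rule Bochner_Integration.integral_cnj)
  have "(\<lambda>x. cnj (y x)) \<in> M_theta \<Omega> \<theta> \<mu> M"
  proof (rule M_theta_I[OF th.L2_cnj[OF y]])
    fix h assume h: "h \<in> H2_theta_boundary \<Omega> \<theta> \<mu> M"
    show "(\<integral>x. cnj (y x) * cnj (h x) \<partial>M) = 0" using cnj_int[of "\<lambda>x. y x * h x"] yH[OF h] by simp
    show "(\<integral>x. cnj (y x) * h x \<partial>M) = 0" using cnj_int[of "\<lambda>x. y x * cnj (h x)"] yHc[OF h] by simp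
  qed
  from m0[OF this] have c1: "(\<integral>x. \<phi> x * cnj (y x) \<partial>M) = 0" .
  have "(\<lambda>j. \<integral>x. p j x * cnj (y x) \<partial>M) \<longlonglongrightarrow> (\<integral>x. (\<phi> x - y x) * cnj (y x) \<partial>M)"
    by (rule th.tendsto_integral_mult[OF polynomial_fun_L2_M[OF p] zL th.L2_cnj[OF y] lim])
  moreover have "(\<integral>x. p j x * cnj (y x) \<partial>M) = 0" for j
    using cnj_int[of "\<lambda>x. y x * cnj (p j x)"] o[OF p[of j]] by (simp add: mult.commute)
  ultimately have "(\<integral>x. (\<phi> x - y x) * cnj (y x) \<partial>M) = 0" by (simp add: LIMSEQ_const_iff)
  moreover have "(\<integral>x. (\<phi> x - y x) * cnj (y x) \<partial>M) = (\<integral>x. \<phi> x * cnj (y x) \<partial>M) - (\<integral>x. y x * cnj (y x) \<partial>M)"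
    unfolding left_diff_distrib
    by (rule Bochner_Integration.integral_diff[OF th.L2_integrable_mult_cnj[OF \<phi> y] th.L2_integrable_mult_cnj[OF y y]])
  ultimately have "sq_norm M y = 0" using c1 th.inner_self[of y] by simp
  have "(\<lambda>j. sq_norm M (\<lambda>x. p j x - \<phi> x)) \<longlonglongrightarrow> 0"
  proof (rule LIMSEQ_norm_le)
    show "(\<lambda>j. 2 * sq_norm M (\<lambda>x. p j x - (\<phi> x - y x))) \<longlonglongrightarrow> 0" by (rule tendsto_mult_right_zero[OF lim])
    show "norm (sq_norm M (\<lambda>x. p j x - \<phi> x)) \<le> 2 * sq_norm M (\<lambda>x. p j x - (\<phi> x - y x))" for j
    proof -
      have "sq_norm M (\<lambda>x. (p j x - (\<phi> x - y x)) + (- 1) * y x) \<le>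
          2 * sq_norm M (\<lambda>x. p j x - (\<phi> x - y x)) + 2 * sq_norm M (\<lambda>x. (- 1) * y x)"
        by (rule th.sq_norm_add_le[OF th.L2_diff[OF polynomial_fun_L2_M[OF p] zL] th.L2_scale[OF y]])
      also have "sq_norm M (\<lambda>x. (- 1) * y x) = 0" unfolding sq_norm_scale using \<open>sq_norm M y = 0\<close> by simp
      finally show ?thesis by simp
    qed
  qed
  thus ?thesis using p by blast
qed

theorem contractive_imp_interpolation:
  assumes contr: "\<And>f. f \<in> M_Q \<Omega> \<theta> k \<mu> M (kernel_span S \<zeta>) \<Longrightarrow> norm (\<integral>x. \<psi> x * f x \<partial>M) \<le> (\<integral>x. norm (f x) \<partial>M)"
  shows "\<exists>\<phi>\<in>schur_class (\<theta> ` \<Omega>). \<forall>i. \<phi> (\<zeta> i) = w $ i"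
proof -
  have "\<exists>\<phi>\<in>L2 M. (AE x in M. norm (\<phi> x) \<le> 1) \<and>
    (\<forall>f\<in>test_functions. (\<integral>x. \<phi> x * f x \<partial>M) = (\<integral>x. \<psi> x * f x \<partial>M))"
    by (rule th.contractive_functional_represented[OF test_functions_subspace regular_L2[OF combination_regular]])
       (assumption | rule contr[OF subsetD[OF test_functions_M_Q]])+
  then obtain \<phi> where \<phi>: "\<phi> \<in> L2 M" "AE x in M. norm (\<phi> x) \<le> 1"
    "\<And>f. f \<in> test_functions \<Longrightarrow> (\<integral>x. \<phi> x * f x \<partial>M) = (\<integral>x. \<psi> x * f x \<partial>M)" by blast
  have \<psi>H: "\<psi> \<in> H2_theta_boundary \<Omega> \<theta> \<mu> M" by (rule regular_H2_theta_boundary[OF combination_regular])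
  have m0: "(\<integral>x. \<phi> x * m x \<partial>M) = 0" if m: "m \<in> M_theta \<Omega> \<theta> \<mu> M" for m
  proof -
    have "m \<in> test_functions" using test_functionsI[OF m polynomial_fun_const, of 0 "\<lambda>_. 0"] by (simp add: combination_def)
    thus ?thesis using \<phi>(3) M_theta_orthogonal(2)[OF m \<psi>H] by simp
  qed
  have P0: "(\<integral>x. \<phi> x * P x \<partial>M) = 0" if P: "polynomial_fun P" "P 0 = 0" for P
  proof -
    have "P \<in> test_functions" using test_functionsI[OF M_theta_zero P, of "\<lambda>_. 0"] by (simp add: combination_def)
    thus ?thesis using \<phi>(3) integral_polynomial_mult[OF P(1) \<psi>H] P(2) by (simp add: mult.commute)
  qed
  \<comment> \<open>On the conjugate kernel of a node \<phi> and the combination \<psi> have equal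
    integrals, and the reproducing property evaluates the latter at the node.\<close>
  have interp: "(\<integral>x. \<phi> x * cnj (s i x) \<partial>M) = w $ i" for i
  proof -
    have "combination (\<lambda>j. if j = i then 1 else 0) = s i"
      by (simp add: fun_eq_iff combination_def if_distrib[of "\<lambda>y. y * _"] cong: if_cong)
    hence "(\<lambda>x. cnj (s i x)) \<in> test_functions"
      using test_functionsI[OF M_theta_zero polynomial_fun_const, of 0 "\<lambda>j. if j = i then 1 else 0"] by simp
    from \<phi>(3)[OF this] show ?thesis
      using reproducing[OF points_mem[of i] combination_regular[of "\<lambda>i. c $ i"]] \<psi>_at_points[of i] by simp
  qed
  obtain p where p: "\<And>j::nat. polynomial_fun (p j)" "(\<lambda>j. sq_norm M (\<lambda>x. p j x - \<phi> x)) \<longlonglongrightarrow> 0"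
    using annihilator_polynomial_limit[OF \<phi>(1) m0 P0] by blast
  interpret lim: polynomial_limit G \<theta> k \<Omega> \<mu> M S \<phi> p by unfold_locales (fact \<phi> p)+
  have "lim.f (\<zeta> i) = w $ i" for i unfolding lim.f_def by (rule interp)
  thus ?thesis by (intro bexI[OF _ lim.f_schur_class] allI)
qed

end

section \<open>From the stated hypotheses to the abstract settings\<close>

lemma finite_reflection_group_facts:
  assumes "finite_reflection_group G"
  shows "finite G" "mat 1 \<in> G" "\<And>g h. g \<in> G \<Longrightarrow> h \<in> G \<Longrightarrow> g ** h \<in> G" "\<And>g. g \<in> G \<Longrightarrow> invertible g"
proof -
  obtain R where R: "\<And>\<sigma>. \<sigma> \<in> R \<Longrightarrow> complex_reflection \<sigma>" "G = generate GL R" and fin: "finite G"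
    using assms unfolding finite_reflection_group_def by blast
  show "finite G" by (rule fin)
  show "mat 1 \<in> G" using generate.one[of GL R] by (simp add: R(2) GL_def)
  show "g ** h \<in> G" if "g \<in> G" "h \<in> G" for g h
    using generate.eng[of g GL R h] that by (simp add: R(2) GL_def)
  have inv: "invertible A" if "B ** A = mat 1" for A B :: "complex^'n^'n"
    using that invertible_left_inverse by blast
  \<comment> \<open>Finite order with positive exponent exhibits a power of the reflection as its
    inverse.\<close>
  have Rinv: "invertible \<sigma>" if \<sigma>: "\<sigma> \<in> R" for \<sigma>
  proof -
    obtain m where m: "m > 0" "(((**) \<sigma>) ^^ m) (mat 1) = mat 1"
      using R(1)[OF \<sigma>] unfolding complex_reflection_def by blast
    then obtain n where "m = Suc n" using gr0_conv_Suc by blast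
    hence "\<sigma> ** (((**) \<sigma>) ^^ n) (mat 1) = mat 1" using m(2) by simp
    thus ?thesis using inv matrix_left_right_inverse by blast
  qed
  interpret GL: group "GL :: (complex^'n^'n) monoid"
  proof (rule groupI)
    show "\<exists>y\<in>carrier GL. y \<otimes>\<^bsub>GL\<^esub> x = \<one>\<^bsub>GL\<^esub>" if "x \<in> carrier GL" for x :: "complex^'n^'n"
      using that by (auto simp: GL_def invertible_def)
  qed (auto simp: GL_def matrix_mul_assoc invertible_mult invertible_def[of "mat 1"])
  have "generate GL R \<subseteq> carrier GL" by (rule GL.generate_incl) (use Rinv in \<open>auto simp: GL_def\<close>)
  thus "invertible g" if "g \<in> G" for g using that by (auto simp: R(2) GL_def)
qed

lemma invariant_quotient_intro:
  assumes G: "finite_reflection_group G" and \<theta>: "basic_invariants G \<theta> k" and M: "theta_boundary_measure \<Omega> \<theta> \<mu> M"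
  shows "invariant_quotient G \<theta> k"
proof
  note G' = finite_reflection_group_facts[OF G]
  show "finite G" "mat 1 \<in> G" by (fact G'(1,2))+
  show "g ** h \<in> G" if "g \<in> G" "h \<in> G" for g h by (rule G'(3)[OF that])
  show "invertible g" if "g \<in> G" for g by (rule G'(4)[OF that])
  have hom: "homogeneous_polynomial (k j) (\<lambda>z. \<theta> z $ j)" for j
    using \<theta> unfolding basic_invariants_def by blast
  have ring: "invariant_polynomials G = {\<lambda>z. p (\<theta> z) | p. polynomial_fun p}"
    using \<theta> unfolding basic_invariants_def by blast
  show "polynomial_map \<theta>" unfolding polynomial_map_def using homogeneous_polynomial_imp_polynomial_fun[OF hom] by blast
  show "\<theta> (c *s z) $ j = c ^ k j * \<theta> z $ j" for c z j by (rule homogeneous_polynomial_scale[OF hom])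
  show "\<theta> (g *v z) = \<theta> z" if "g \<in> G" for g z
  proof -
    have "(\<lambda>z. \<theta> z $ j) \<in> invariant_polynomials G" for j
      unfolding ring by (intro CollectI exI[of _ "\<lambda>y. y $ j"] conjI refl polynomial_fun_coord)
    thus ?thesis using that by (auto simp: invariant_polynomials_def vec_eq_iff)
  qed
  show "\<exists>P. polynomial_fun P \<and> (\<forall>z. p z = P (\<theta> z))"
    if "polynomial_fun p" "\<And>g z. g \<in> G \<Longrightarrow> p (g *v z) = p z" for p
  proof -
    have "p \<in> invariant_polynomials G" using that by (simp add: invariant_polynomials_def)
    thus ?thesis unfolding ring by (auto simp: fun_eq_iff)
  qed
  \<comment> \<open>If the Jacobian vanished identically, the change of variables applied to the
    constant 1 would give \<open>M\<close> total mass 0.\<close>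
  show "\<exists>z. complex_jacobian \<theta> z \<noteq> 0"
  proof (rule ccontr)
    assume n: "\<not> (\<exists>z. complex_jacobian \<theta> z \<noteq> 0)"
    have "prob_space M" using M by (simp add: theta_boundary_measure_def)
    hence "(\<integral>\<^sup>+ \<zeta>. 1 \<partial>M) = 1" by (simp add: prob_space.emeasure_space_1)
    moreover have "\<forall>f. f \<in> borel_measurable borel \<longrightarrow> (\<integral>\<^sup>+ \<zeta>. f \<zeta> \<partial>M) =
        (\<integral>\<^sup>+ z. f (\<theta> z) * ennreal ((norm (complex_jacobian \<theta> z))\<^sup>2) \<partial>\<mu>) / ennreal ((c_theta \<theta> \<mu>)\<^sup>2)"
      using M unfolding theta_boundary_measure_def by (elim conjE)
    from spec[OF this, of "\<lambda>_. 1"] have "(\<integral>\<^sup>+ \<zeta>. 1 \<partial>M) = 0" using n by simp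
    ultimately show False by simp
  qed
qed

lemma circled_domain_intro:
  assumes "bounded_symmetric_domain \<Omega>" "standard_realization \<Omega>" shows "circled_domain \<Omega>"
  using assms by unfold_locales (auto simp: bounded_symmetric_domain_def standard_realization_def)

theorem theorem4p1:
  fixes \<Omega> :: "(complex^'n) set" and G :: "(complex^'n^'n) set"
    and \<theta> :: "complex^'n \<Rightarrow> complex^'n" and k :: "'n \<Rightarrow> nat"
    and \<mu> \<mu>\<theta> :: "(complex^'n) measure"
    and S :: "complex^'n \<Rightarrow> complex^'n \<Rightarrow> complex"
    and \<zeta> :: "'p::finite \<Rightarrow> complex^'n" and w c :: "complex^'p"
    and \<psi> :: "complex^'n \<Rightarrow> complex"
  assumes "bounded_symmetric_domain \<Omega>" and "standard_realization \<Omega>"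
    and "finite_reflection_group G" and "\<forall>g\<in>G. (*v) g ` \<Omega> = \<Omega>"
    and "basic_invariants G \<theta> k"
    and "invariant_boundary_measure \<Omega> \<mu>"
    and "theta_boundary_measure \<Omega> \<theta> \<mu> \<mu>\<theta>"
    and "reproducing_kernel (\<theta> ` \<Omega>) (H2_theta \<Omega> \<theta> \<mu>) (H2_theta_inner \<theta> \<mu>) S"
    and "inj \<zeta>" and "range \<zeta> \<subseteq> \<theta> ` \<Omega>" and "\<forall>i. w $ i \<in> ball 0 1"
    and "c = matrix_inv (\<chi> i j. S (\<zeta> i) (\<zeta> j)) *v w"
    and "\<psi> = (\<lambda>z. \<Sum>i\<in>UNIV. c $ i * S z (\<zeta> i))"
  shows "(\<exists>\<phi>\<in>schur_class (\<theta> ` \<Omega>). \<forall>i. \<phi> (\<zeta> i) = w $ i) \<longleftrightarrow>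
    (\<forall>f\<in>M_Q \<Omega> \<theta> k \<mu> \<mu>\<theta> (kernel_span S \<zeta>).
       norm (X_functional k \<mu>\<theta> \<psi> f) \<le> L1_norm \<mu>\<theta> f)"
proof -
  interpret invariant_quotient G \<theta> k by (rule invariant_quotient_intro[OF assms(3,5,7)])
  interpret circled_domain \<Omega> by (rule circled_domain_intro[OF assms(1,2)])
  interpret interpolation_data G \<theta> k \<Omega> \<mu> \<mu>\<theta> S \<zeta> w
    using assms(4,6-10) by unfold_locales auto
  have X: "X_functional k \<mu>\<theta> \<psi> f = (\<integral>x. combination (\<lambda>i. c $ i) x * f x \<partial>\<mu>\<theta>)" for f
    unfolding assms(12,13) by (rule X_functional_eq)
  show ?thesis
    unfolding X L1_norm_def unfolding assms(12)
    using interpolation_imp_contractive contractive_imp_interpolation by blast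
qed

end
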